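(* The local-global principle for the annihilation of local cohomology modules holds at level $2$ over any commutative Noetherian ring; that is, for every commutative Noetherian ring $R$, every choice of ideals $\mathfrak a,\mathfrak b$ of $R$ and every finitely generated $R$-module $M$, $$f_{\mathfrak{a}R_{\mathfrak p}}^{\mathfrak{b}R_{\mathfrak p}}(M_{\mathfrak p})>2 \ \text{ for all } \mathfrak{p}\in\operatorname{Spec}(R)\iff f_{\mathfrak a}^{\mathfrak b}(M)>2 .$$
   Context: Rings have non-zero identity; $H^i_{\mathfrak a}(M)=\varinjlim_{n\ge 1}\operatorname{Ext}^i_R(R/\mathfrak a^n,M)$ denotes the $i$th local cohomology module of $M$ with support in $V(\mathfrak a)=\{\mathfrak p\in\operatorname{Spec}(R):\mathfrak p\supseteq\mathfrak a\}$. For ideals $\mathfrak a,\mathfrak b$ of $R$, the $\mathfrak b$-finiteness dimension of $M$ relative to $\mathfrak a$ is $f_{\mathfrak a}^{\mathfrak b}(M):=\inf\{i\in\mathbb{N}_0 : \mathfrak b^kH^i_{\mathfrak a}(M)\ne 0\text{ for all }k\in\mathbb{N}\}$, with $\inf\emptyset=\infty$; $f_{\mathfrak{a}R_{\mathfrak p}}^{\mathfrak{b}R_{\mathfrak p}}(M_{\mathfrak p})$ is computed over $R_{\mathfrak p}$. *)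

theory Defs
  imports "HOL-Algebra.Module" "HOL-Algebra.QuotRing" "HOL-Algebra.Ideal_Product"
    "HOL-Algebra.Ring_Divisibility" "HOL-Library.Extended_Nat"
begin

section \<open>Modules over a commutative ring\<close>

text \<open>The record type of modules extends that of rings. The \<open>mult\<close> and \<open>one\<close> fields play no role
  in the locale \<open>module\<close>; they are \<open>undefined\<close> in the modules constructed here, except for
  the ring as a module over itself.\<close>

definition regular_module :: "('a, 'r) ring_scheme \<Rightarrow> ('a, 'a) module" where
  "regular_module R =
    \<lparr>carrier = carrier R, monoid.mult = monoid.mult R, one = \<one>\<^bsub>R\<^esub>,
     zero = \<zero>\<^bsub>R\<^esub>, add = add R, smult = monoid.mult R\<rparr>"

definition finitely_generated_module ::
    "('a, 'r) ring_scheme \<Rightarrow> ('a, 'm, 's) module_scheme \<Rightarrow> bool" where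
  "finitely_generated_module R M \<longleftrightarrow>
    (\<exists>S. finite S \<and> S \<subseteq> carrier M \<and>
      carrier M = {\<Oplus>\<^bsub>M\<^esub>x\<in>S. c x \<odot>\<^bsub>M\<^esub> x | c. c \<in> S \<rightarrow> carrier R})"

definition quotient_module :: "('a, 'm, 's) module_scheme \<Rightarrow> 'm set \<Rightarrow> ('a, 'm set) module" where
  "quotient_module M N =
    \<lparr>carrier = a_rcosets\<^bsub>M\<^esub> N, monoid.mult = undefined, one = undefined,
     zero = N, add = set_add M,
     smult = (\<lambda>r X. \<Union>x\<in>X. N +>\<^bsub>M\<^esub> (r \<odot>\<^bsub>M\<^esub> x))\<rparr>"

definition linear_maps ::
    "('a, 'r) ring_scheme \<Rightarrow> ('a, 'n, 's) module_scheme \<Rightarrow> ('a, 'm, 't) module_scheme \<Rightarrow> ('n \<Rightarrow> 'm) set"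
  where
  "linear_maps R N M =
    {f \<in> carrier N \<rightarrow>\<^sub>E carrier M.
      (\<forall>x\<in>carrier N. \<forall>y\<in>carrier N. f (x \<oplus>\<^bsub>N\<^esub> y) = f x \<oplus>\<^bsub>M\<^esub> f y) \<and>
      (\<forall>r\<in>carrier R. \<forall>x\<in>carrier N. f (r \<odot>\<^bsub>N\<^esub> x) = r \<odot>\<^bsub>M\<^esub> f x)}"

definition Hom_module ::
    "('a, 'r) ring_scheme \<Rightarrow> ('a, 'n, 's) module_scheme \<Rightarrow> ('a, 'm, 't) module_scheme
      \<Rightarrow> ('a, 'n \<Rightarrow> 'm) module" where
  "Hom_module R N M =
    \<lparr>carrier = linear_maps R N M, monoid.mult = undefined, one = undefined,
     zero = (\<lambda>x\<in>carrier N. \<zero>\<^bsub>M\<^esub>),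
     add = (\<lambda>f g. \<lambda>x\<in>carrier N. f x \<oplus>\<^bsub>M\<^esub> g x),
     smult = (\<lambda>r f. \<lambda>x\<in>carrier N. r \<odot>\<^bsub>M\<^esub> f x)\<rparr>"

definition ideal_power :: "('a, 'r) ring_scheme \<Rightarrow> 'a set \<Rightarrow> nat \<Rightarrow> 'a set" where
  "ideal_power R I n = I [^]\<^bsub>ideals_set R\<^esub> n"

definition ideal_smult :: "'a set \<Rightarrow> ('a, 'm, 's) module_scheme \<Rightarrow> 'm set" where
  "ideal_smult I M =
    {\<Oplus>\<^bsub>M\<^esub>j\<in>{..<n}. c j \<odot>\<^bsub>M\<^esub> x j | (n::nat) c x. c \<in> {..<n} \<rightarrow> I \<and> x \<in> {..<n} \<rightarrow> carrier M}"


section \<open>Localization\<close>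

text \<open>\<open>fraction R S M m s\<close> is the fraction \<open>m/s\<close>, as the class of the pair \<open>(m, s)\<close>. The operations on
  classes are unions over representatives, all of which contribute the same class.\<close>

definition fraction ::
    "('a, 'r) ring_scheme \<Rightarrow> 'a set \<Rightarrow> ('a, 'm, 's) module_scheme \<Rightarrow> 'm \<Rightarrow> 'a \<Rightarrow> ('m \<times> 'a) set" where
  "fraction R S M m s =
    {(m', s'). m' \<in> carrier M \<and> s' \<in> S \<and>
      (\<exists>u\<in>S. (u \<otimes>\<^bsub>R\<^esub> s') \<odot>\<^bsub>M\<^esub> m = (u \<otimes>\<^bsub>R\<^esub> s) \<odot>\<^bsub>M\<^esub> m')}"

definition localize_module ::
    "('a, 'r) ring_scheme \<Rightarrow> 'a set \<Rightarrow> ('a, 'm, 's) module_scheme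
      \<Rightarrow> (('a \<times> 'a) set, ('m \<times> 'a) set) module" where
  "localize_module R S M =
    \<lparr>carrier = {fraction R S M m s | m s. m \<in> carrier M \<and> s \<in> S}, monoid.mult = undefined, one = undefined,
     zero = fraction R S M \<zero>\<^bsub>M\<^esub> \<one>\<^bsub>R\<^esub>,
     add = (\<lambda>X Y. \<Union>(m, s)\<in>X. \<Union>(n, t)\<in>Y.
       fraction R S M (t \<odot>\<^bsub>M\<^esub> m \<oplus>\<^bsub>M\<^esub> s \<odot>\<^bsub>M\<^esub> n) (s \<otimes>\<^bsub>R\<^esub> t)),
     smult = (\<lambda>X Y. \<Union>(r, s)\<in>X. \<Union>(m, t)\<in>Y. fraction R S M (r \<odot>\<^bsub>M\<^esub> m) (s \<otimes>\<^bsub>R\<^esub> t))\<rparr>"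

definition localize_ring :: "('a, 'r) ring_scheme \<Rightarrow> 'a set \<Rightarrow> ('a \<times> 'a) set ring" where
  "localize_ring R S =
    (let L = localize_module R S (regular_module R) in
      \<lparr>carrier = carrier L, monoid.mult = smult L, one = fraction R S (regular_module R) \<one>\<^bsub>R\<^esub> \<one>\<^bsub>R\<^esub>,
       zero = \<zero>\<^bsub>L\<^esub>, add = add L\<rparr>)"

definition ring_at :: "('a, 'r) ring_scheme \<Rightarrow> 'a set \<Rightarrow> ('a \<times> 'a) set ring" where
  "ring_at R P = localize_ring R (carrier R - P)"

definition module_at ::
    "('a, 'r) ring_scheme \<Rightarrow> 'a set \<Rightarrow> ('a, 'm, 's) module_scheme
      \<Rightarrow> (('a \<times> 'a) set, ('m \<times> 'a) set) module" where
  "module_at R P M = localize_module R (carrier R - P) M"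

definition ideal_at :: "('a, 'r) ring_scheme \<Rightarrow> 'a set \<Rightarrow> 'a set \<Rightarrow> ('a \<times> 'a) set set" where
  "ideal_at R P I =
    Idl\<^bsub>ring_at R P\<^esub> ((\<lambda>x. fraction R (carrier R - P) (regular_module R) x \<one>\<^bsub>R\<^esub>) ` I)"


section \<open>A functorial free resolution\<close>

text \<open>For a set \<open>B\<close>, \<open>free_module R B\<close> is the module of finitely supported functions from \<open>B\<close> to
  \<open>R\<close>, extended by zero outside \<open>B\<close>.\<close>

definition free_module :: "('a, 'r) ring_scheme \<Rightarrow> 'b set \<Rightarrow> ('a, 'b \<Rightarrow> 'a) module" where
  "free_module R B =
    \<lparr>carrier = {f. (\<forall>x\<in>B. f x \<in> carrier R) \<and> (\<forall>x. x \<notin> B \<longrightarrow> f x = \<zero>\<^bsub>R\<^esub>) \<and> finite {x. f x \<noteq> \<zero>\<^bsub>R\<^esub>}},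
     monoid.mult = undefined, one = undefined,
     zero = (\<lambda>_. \<zero>\<^bsub>R\<^esub>), add = (\<lambda>f g x. f x \<oplus>\<^bsub>R\<^esub> g x), smult = (\<lambda>r f x. r \<otimes>\<^bsub>R\<^esub> f x)\<rparr>"

definition basis_vec :: "('a, 'r) ring_scheme \<Rightarrow> 'b \<Rightarrow> 'b \<Rightarrow> 'a" where
  "basis_vec R x = (\<lambda>y. if y = x then \<one>\<^bsub>R\<^esub> else \<zero>\<^bsub>R\<^esub>)"

text \<open>The linear extension to a free module of a map \<open>u\<close> defined on its basis.\<close>

definition lin_ext ::
    "('a, 'r) ring_scheme \<Rightarrow> ('a, 'm, 's) module_scheme \<Rightarrow> ('b \<Rightarrow> 'm) \<Rightarrow> ('b \<Rightarrow> 'a) \<Rightarrow> 'm" where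
  "lin_ext R M u f = (\<Oplus>\<^bsub>M\<^esub>x\<in>{x. f x \<noteq> \<zero>\<^bsub>R\<^esub>}. f x \<odot>\<^bsub>M\<^esub> u x)"

text \<open>The resolution of a module \<open>N\<close> starts with the free module on the set \<open>carrier N\<close>; the next
  term is always the free module on all relations among the basis elements so far. A relation
  is a list \<open>[(r\<^sub>1, x\<^sub>1), \<dots>, (r\<^sub>k, x\<^sub>k)]\<close> such that \<open>r\<^sub>1 x\<^sub>1 + \<dots> + r\<^sub>k x\<^sub>k\<close> is a cycle, and
  the differential sends the corresponding basis element to this cycle. Since every cycle is of
  this form, the resolution is exact. The recursive datatype only serves to place
  the bases of all terms in a single type.\<close>

datatype ('a, 'n) syz = Gen (gen_of: 'n) | Rel (relation_of: "('a \<times> ('a, 'n) syz) list")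

definition formal_sum :: "('a, 'r) ring_scheme \<Rightarrow> ('a \<times> 'b) list \<Rightarrow> 'b \<Rightarrow> 'a" where
  "formal_sum R ws =
    foldr (\<lambda>(r, x) v. r \<odot>\<^bsub>free_module R UNIV\<^esub> basis_vec R x \<oplus>\<^bsub>free_module R UNIV\<^esub> v)
      ws \<zero>\<^bsub>free_module R UNIV\<^esub>"

definition augmentation ::
    "('a, 'r) ring_scheme \<Rightarrow> ('a, 'n, 's) module_scheme \<Rightarrow> (('a, 'n) syz \<Rightarrow> 'a) \<Rightarrow> 'n" where
  "augmentation R N = lin_ext R N gen_of"

definition differential ::
    "('a, 'r) ring_scheme \<Rightarrow> (('a, 'n) syz \<Rightarrow> 'a) \<Rightarrow> ('a, 'n) syz \<Rightarrow> 'a" where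
  "differential R = lin_ext R (free_module R UNIV) (\<lambda>z. formal_sum R (relation_of z))"

primrec res_basis ::
    "('a, 'r) ring_scheme \<Rightarrow> ('a, 'n, 's) module_scheme \<Rightarrow> nat \<Rightarrow> ('a, 'n) syz set" where
  "res_basis R N 0 = Gen ` carrier N"
| "res_basis R N (Suc i) =
    {Rel ws | ws. set ws \<subseteq> carrier R \<times> res_basis R N i \<and>
      (if i = 0 then augmentation R N (formal_sum R ws) = \<zero>\<^bsub>N\<^esub>
       else differential R (formal_sum R ws) = \<zero>\<^bsub>free_module R UNIV\<^esub>)}"

definition resolution ::
    "('a, 'r) ring_scheme \<Rightarrow> ('a, 'n, 's) module_scheme \<Rightarrow> nat \<Rightarrow> ('a, ('a, 'n) syz \<Rightarrow> 'a) module" where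
  "resolution R N i = free_module R (res_basis R N i)"

text \<open>The chain map between the resolutions induced by a linear map \<open>\<phi>\<close>.\<close>

definition resolution_map ::
    "('a, 'r) ring_scheme \<Rightarrow> ('n \<Rightarrow> 'k) \<Rightarrow> (('a, 'n) syz \<Rightarrow> 'a) \<Rightarrow> ('a, 'k) syz \<Rightarrow> 'a" where
  "resolution_map R \<phi> = lin_ext R (free_module R UNIV) (\<lambda>z. basis_vec R (map_syz id \<phi> z))"


section \<open>Ext\<close>

definition Ext_cocycles ::
    "('a, 'r) ring_scheme \<Rightarrow> ('a, 'n, 's) module_scheme \<Rightarrow> ('a, 'm, 't) module_scheme \<Rightarrow> nat
      \<Rightarrow> ((('a, 'n) syz \<Rightarrow> 'a) \<Rightarrow> 'm) set" where
  "Ext_cocycles R N M i =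
    {f \<in> linear_maps R (resolution R N i) M.
      \<forall>v\<in>carrier (resolution R N (Suc i)). f (differential R v) = \<zero>\<^bsub>M\<^esub>}"

definition Ext_coboundaries ::
    "('a, 'r) ring_scheme \<Rightarrow> ('a, 'n, 's) module_scheme \<Rightarrow> ('a, 'm, 't) module_scheme \<Rightarrow> nat
      \<Rightarrow> ((('a, 'n) syz \<Rightarrow> 'a) \<Rightarrow> 'm) set" where
  "Ext_coboundaries R N M i =
    (case i of
      0 \<Rightarrow> {\<zero>\<^bsub>Hom_module R (resolution R N 0) M\<^esub>}
    | Suc j \<Rightarrow> {\<lambda>v\<in>carrier (resolution R N (Suc j)). g (differential R v) | g.
        g \<in> linear_maps R (resolution R N j) M})"

definition Ext ::
    "('a, 'r) ring_scheme \<Rightarrow> nat \<Rightarrow> ('a, 'n, 's) module_scheme \<Rightarrow> ('a, 'm, 't) module_scheme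
      \<Rightarrow> ('a, ((('a, 'n) syz \<Rightarrow> 'a) \<Rightarrow> 'm) set) module" where
  "Ext R i N M =
    quotient_module (Hom_module R (resolution R N i) M \<lparr>carrier := Ext_cocycles R N M i\<rparr>)
      (Ext_coboundaries R N M i)"

text \<open>The map from \<open>Ext R i N M\<close> to \<open>Ext R i N' M\<close> induced by a linear map \<open>\<phi>\<close> from \<open>N'\<close> to \<open>N\<close>.\<close>

definition Ext_map ::
    "('a, 'r) ring_scheme \<Rightarrow> nat \<Rightarrow> ('a, 'k, 's) module_scheme \<Rightarrow> ('k \<Rightarrow> 'n) \<Rightarrow>
      ('a, 'm, 't) module_scheme \<Rightarrow> ((('a, 'n) syz \<Rightarrow> 'a) \<Rightarrow> 'm) set
      \<Rightarrow> ((('a, 'k) syz \<Rightarrow> 'a) \<Rightarrow> 'm) set" where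
  "Ext_map R i N' \<phi> M X =
    (\<Union>f\<in>X. Ext_coboundaries R N' M i +>\<^bsub>Hom_module R (resolution R N' i) M\<^esub>
      (\<lambda>v\<in>carrier (resolution R N' i). f (resolution_map R \<phi> v)))"


section \<open>Direct limits of sequences\<close>

text \<open>A direct system of modules \<open>X 0, X 1, \<dots>\<close> with maps \<open>t n\<close> from \<open>X n\<close> to \<open>X (Suc n)\<close>.\<close>

definition transition :: "(nat \<Rightarrow> 'x \<Rightarrow> 'x) \<Rightarrow> nat \<Rightarrow> nat \<Rightarrow> 'x \<Rightarrow> 'x" where
  "transition t m k = fold t [m..<k]"

definition germ ::
    "(nat \<Rightarrow> ('a, 'x, 's) module_scheme) \<Rightarrow> (nat \<Rightarrow> 'x \<Rightarrow> 'x) \<Rightarrow> nat \<Rightarrow> 'x \<Rightarrow> (nat \<times> 'x) set" where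
  "germ X t m x =
    {(n, y). y \<in> carrier (X n) \<and> (\<exists>k\<ge>max m n. transition t m k x = transition t n k y)}"

definition direct_limit ::
    "(nat \<Rightarrow> ('a, 'x, 's) module_scheme) \<Rightarrow> (nat \<Rightarrow> 'x \<Rightarrow> 'x) \<Rightarrow> ('a, (nat \<times> 'x) set) module" where
  "direct_limit X t =
    \<lparr>carrier = {germ X t m x | m x. x \<in> carrier (X m)}, monoid.mult = undefined, one = undefined,
     zero = germ X t 0 \<zero>\<^bsub>X 0\<^esub>,
     add = (\<lambda>A B. \<Union>(m, x)\<in>A. \<Union>(n, y)\<in>B. let k = max m n in
       germ X t k (transition t m k x \<oplus>\<^bsub>X k\<^esub> transition t n k y)),
     smult = (\<lambda>r A. \<Union>(m, x)\<in>A. germ X t m (r \<odot>\<^bsub>X m\<^esub> x))\<rparr>"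


section \<open>Local cohomology and finiteness dimension\<close>

definition residue_module :: "('a, 'r) ring_scheme \<Rightarrow> 'a set \<Rightarrow> nat \<Rightarrow> ('a, 'a set) module" where
  "residue_module R I n = quotient_module (regular_module R) (ideal_power R I n)"

text \<open>The projection of \<open>R/I\<^sup>n\<^sup>+\<^sup>1\<close> onto \<open>R/I\<^sup>n\<close>.\<close>

definition residue_proj :: "('a, 'r) ring_scheme \<Rightarrow> 'a set \<Rightarrow> nat \<Rightarrow> 'a set \<Rightarrow> 'a set" where
  "residue_proj R I n X = (\<Union>x\<in>X. ideal_power R I n +>\<^bsub>R\<^esub> x)"

text \<open>The index \<open>n\<close> of the direct system corresponds to the power \<open>I\<^sup>n\<^sup>+\<^sup>1\<close>, so that the limit is over
  all positive powers of \<open>I\<close>.\<close>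

definition local_cohomology ::
    "('a, 'r) ring_scheme \<Rightarrow> 'a set \<Rightarrow> nat \<Rightarrow> ('a, 'm, 's) module_scheme
      \<Rightarrow> ('a, (nat \<times> ((('a, 'a set) syz \<Rightarrow> 'a) \<Rightarrow> 'm) set) set) module" where
  "local_cohomology R I i M =
    direct_limit (\<lambda>n. Ext R i (residue_module R I (Suc n)) M)
      (\<lambda>n. Ext_map R i (residue_module R I (Suc (Suc n))) (residue_proj R I (Suc n)) M)"

definition finiteness_dimension ::
    "('a, 'r) ring_scheme \<Rightarrow> 'a set \<Rightarrow> 'a set \<Rightarrow> ('a, 'm, 's) module_scheme \<Rightarrow> enat" where
  "finiteness_dimension R I J M =
    Inf {enat i | i. \<forall>k\<ge>1. ideal_smult (ideal_power R J k) (local_cohomology R I i M)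
      \<noteq> {\<zero>\<^bsub>local_cohomology R I i M\<^esub>}}"

end

theory Submission
  imports Defs
begin

text \<open>Let \<open>x\<^sub>i\<close> generate the first ideal. As only degrees at most \<open>2\<close> matter, \<open>y\<close> kills the \<open>i\<close>-th local
  cohomology iff it satisfies an elementary condition on tuples \<open>m\<close> and on linear maps on the
  relations among the powers \<open>x\<^sub>i\<^sup>n\<close>. In this form one compares \<open>R\<close> with its localizations, and it
  remains to find one power of \<open>y\<close> that kills all classes, given for each prime a power killing
  every class up to an element outside the prime.

  Call a set of ideals detected if there are finitely many primes such that a member contained in
  none of them is the unit ideal. The annihilators of the elements of a Noetherian module are
  detected. Since every class is killed by a power of each \<open>x\<^sub>i\<close>, finitely many primes, hence one
  power of \<open>y\<close>, suffice once the annihilators of the classes killed by all \<open>x\<^sub>i\<close> (and, in degree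
  \<open>2\<close>, by \<open>y\<close>) are detected; this follows by mapping such classes to a Noetherian module of
  tuples. In degree \<open>1\<close> the tuple is read off the diagonal of the equations \<open>x\<^sub>j m = 0\<close>.
  In degree \<open>2\<close> one first replaces \<open>M\<close> by \<open>y\<^sup>k M\<close> to make \<open>y\<close> regular; then the first cohomology, being
  killed by a power of \<open>y\<close>, is killed by a fixed power of the \<open>x\<^sub>i\<close>, and the class is again
  determined by a diagonal tuple.\<close>

section \<open>Linear maps and quotient modules\<close>

text \<open>The obstacle is that local cohomology is not finitely generated, so exponents valid for
  single classes need not be bounded. Detection replaces finiteness of the associated primes: for
  annihilators of elements it says that an element vanishes once it vanishes in finitely many
  localizations. It is wanted only for classes killed by a finite set \<open>A\<close>, because a
  nonzero class on which every element of \<open>A\<close> is nilpotent has a nonzero multiple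
  killed by all of \<open>A\<close>. Degree 2 imitates the sequence H^1(M) -> H^1(M/yM) -> H^2(M) of
  a regular \<open>y\<close>: a class killed by \<open>y\<close> comes from H^1(M/yM), which is
  again a matter of tuples, but only up to the image of H^1(M). The bound on the torsion of H^1(M)
  is what allows these classes to be read off tuples with one fixed denominator. The resolution that
  defines Ext has enormous bases and is not compatible with localization. It is traded for
  presentations with one generator and \<open>r\<close> relations. This is harmless because the
  ideals generated by the n-th powers of the generators are cofinal with the powers of the
  ideal.\<close>

definition lin ::
    "('a, 'r) ring_scheme \<Rightarrow> ('a, 'n, 's) module_scheme \<Rightarrow> ('a, 'm, 't) module_scheme \<Rightarrow> ('n \<Rightarrow> 'm) \<Rightarrow> bool"
  where
  "lin R N M f \<longleftrightarrow> f \<in> carrier N \<rightarrow> carrier M \<and>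
      (\<forall>x\<in>carrier N. \<forall>y\<in>carrier N. f (x \<oplus>\<^bsub>N\<^esub> y) = f x \<oplus>\<^bsub>M\<^esub> f y) \<and>
      (\<forall>r\<in>carrier R. \<forall>x\<in>carrier N. f (r \<odot>\<^bsub>N\<^esub> x) = r \<odot>\<^bsub>M\<^esub> f x)"

lemma linI:
  assumes "\<And>x. x \<in> carrier N \<Longrightarrow> f x \<in> carrier M"
    and "\<And>x y. x \<in> carrier N \<Longrightarrow> y \<in> carrier N \<Longrightarrow> f (x \<oplus>\<^bsub>N\<^esub> y) = f x \<oplus>\<^bsub>M\<^esub> f y"
    and "\<And>r x. r \<in> carrier R \<Longrightarrow> x \<in> carrier N \<Longrightarrow> f (r \<odot>\<^bsub>N\<^esub> x) = r \<odot>\<^bsub>M\<^esub> f x"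
  shows "lin R N M f"
  using assms by (auto simp: lin_def)

lemma lin_closed: "lin R N M f \<Longrightarrow> x \<in> carrier N \<Longrightarrow> f x \<in> carrier M"
  and lin_add: "lin R N M f \<Longrightarrow> x \<in> carrier N \<Longrightarrow> y \<in> carrier N \<Longrightarrow> f (x \<oplus>\<^bsub>N\<^esub> y) = f x \<oplus>\<^bsub>M\<^esub> f y"
  and lin_smult: "lin R N M f \<Longrightarrow> r \<in> carrier R \<Longrightarrow> x \<in> carrier N \<Longrightarrow> f (r \<odot>\<^bsub>N\<^esub> x) = r \<odot>\<^bsub>M\<^esub> f x"
  by (auto simp: lin_def)

text \<open>Elements of a Hom module must be extensional to be determined by their values. The
  predicate \<open>lin\<close> drops extensionality, so that compositions and restrictions of maps
  need no bookkeeping.\<close>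

lemma linear_maps_lin: "linear_maps R N M = {f. f \<in> extensional (carrier N) \<and> lin R N M f}"
  by (auto simp: linear_maps_def lin_def PiE_def)

lemma lin_zero:
  assumes "module R N" "module R M" "lin R N M f"
  shows "f \<zero>\<^bsub>N\<^esub> = \<zero>\<^bsub>M\<^esub>"
proof -
  interpret N: module R N by fact
  interpret M: module R M by fact
  have "f \<zero>\<^bsub>N\<^esub> = f (\<zero>\<^bsub>R\<^esub> \<odot>\<^bsub>N\<^esub> \<zero>\<^bsub>N\<^esub>)" by simp
  also have "\<dots> = \<zero>\<^bsub>R\<^esub> \<odot>\<^bsub>M\<^esub> f \<zero>\<^bsub>N\<^esub>"
    by (rule lin_smult[OF assms(3)]) auto
  finally show ?thesis using lin_closed[OF assms(3) N.M.zero_closed] by simp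
qed

lemma (in module) a_inv_smult: "x \<in> carrier M \<Longrightarrow> \<ominus>\<^bsub>M\<^esub> x = (\<ominus> \<one>) \<odot>\<^bsub>M\<^esub> x"
  by (simp add: smult_l_minus)

lemma lin_minus:
  assumes "module R N" "module R M" "lin R N M f" "x \<in> carrier N"
  shows "f (\<ominus>\<^bsub>N\<^esub> x) = \<ominus>\<^bsub>M\<^esub> f x"
proof -
  interpret N: module R N by fact
  interpret M: module R M by fact
  show ?thesis
    using assms lin_closed[OF assms(3)] by (simp add: M.a_inv_smult N.a_inv_smult lin_smult)
qed

lemma (in abelian_group) minus_eq_zero_iff:
  "x \<in> carrier G \<Longrightarrow> y \<in> carrier G \<Longrightarrow> x \<ominus> y = \<zero> \<longleftrightarrow> x = y"
  by (metis a_minus_def a_inv_closed minus_equality minus_minus r_neg)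

text \<open>Serves the comparison of two lifts of the same map of cyclic modules, where
  \<open>x\<close> is the common multiple of the generator.\<close>

lemma (in abelian_group) diff_cancel_common:
  assumes "x \<in> carrier G" "p \<in> carrier G" "k \<in> carrier G" "q \<in> carrier G" "l \<in> carrier G"
  shows "((x \<oplus> p) \<oplus> k) \<oplus> \<ominus> ((x \<oplus> q) \<oplus> l) = (p \<oplus> \<ominus> q) \<oplus> (k \<oplus> \<ominus> l)"
proof -
  have "((x \<oplus> p) \<oplus> k) \<oplus> ((\<ominus> x \<oplus> \<ominus> q) \<oplus> \<ominus> l) = (x \<oplus> \<ominus> x) \<oplus> ((p \<oplus> \<ominus> q) \<oplus> (k \<oplus> \<ominus> l))"
    using assms by (simp only: a_ac a_inv_closed a_closed)
  then show ?thesis using assms by (simp add: minus_add r_neg)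
qed

lemma lin_diff:
  assumes "module R N" "module R M" "lin R N M f" "x \<in> carrier N" "y \<in> carrier N"
  shows "f (x \<ominus>\<^bsub>N\<^esub> y) = f x \<ominus>\<^bsub>M\<^esub> f y"
proof -
  interpret N: module R N by fact
  interpret M: module R M by fact
  show ?thesis
    using assms by (simp add: a_minus_def lin_add lin_minus)
qed

lemma lin_comp: "lin R N M f \<Longrightarrow> lin R L N g \<Longrightarrow> lin R L M (\<lambda>x. f (g x))"
  by (auto simp: lin_def Pi_iff)

lemma lin_cong: "lin R N M f \<Longrightarrow> (\<And>x. x \<in> carrier N \<Longrightarrow> f x = g x) \<Longrightarrow>
    (\<And>x y. x \<in> carrier N \<Longrightarrow> y \<in> carrier N \<Longrightarrow> x \<oplus>\<^bsub>N\<^esub> y \<in> carrier N) \<Longrightarrow>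
    (\<And>r x. r \<in> carrier R \<Longrightarrow> x \<in> carrier N \<Longrightarrow> r \<odot>\<^bsub>N\<^esub> x \<in> carrier N) \<Longrightarrow> lin R N M g"
  by (auto simp: lin_def Pi_iff)

lemma lin_scale:
  assumes "module R M" "lin R N M f" "a \<in> carrier R"
  shows "lin R N M (\<lambda>x. a \<odot>\<^bsub>M\<^esub> f x)"
proof -
  interpret M: module R M by fact
  show ?thesis
    using assms(2,3) by (auto simp: lin_def Pi_iff M.smult_r_distr M.m_comm simp flip: M.smult_assoc1)
qed

lemma lin_plus:
  assumes "module R M" "lin R N M f" "lin R N M g"
  shows "lin R N M (\<lambda>x. f x \<oplus>\<^bsub>M\<^esub> g x)"
proof -
  interpret M: module R M by fact
  show ?thesis
    using assms(2,3) by (auto simp: lin_def Pi_iff M.smult_r_distr M.a_ac)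
qed

lemma lin_uminus:
  assumes "module R M" "lin R N M g"
  shows "lin R N M (\<lambda>x. \<ominus>\<^bsub>M\<^esub> g x)"
proof -
  interpret M: module R M by fact
  show ?thesis
    using assms(2) by (auto simp: lin_def Pi_iff M.smult_r_minus M.minus_add)
qed

lemma lin_sub:
  assumes "module R M" "lin R N M f" "lin R N M g"
  shows "lin R N M (\<lambda>x. f x \<ominus>\<^bsub>M\<^esub> g x)"
  using lin_plus[OF assms(1,2) lin_uminus[OF assms(1,3)]] by (simp add: a_minus_def)

lemma lin_restrict_dom: "lin R N M f \<Longrightarrow> Z \<subseteq> carrier N \<Longrightarrow> lin R (N\<lparr>carrier := Z\<rparr>) M f"
  by (auto simp: lin_def Pi_iff subset_iff)

lemma lin_restrict_cod:
  "lin R N M f \<Longrightarrow> (\<And>x. x \<in> carrier N \<Longrightarrow> f x \<in> Z) \<Longrightarrow> lin R N (M\<lparr>carrier := Z\<rparr>) f"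
  by (auto simp: lin_def)

section \<open>Submodules from linear maps: images, preimages, kernels\<close>

lemma submodule_image:
  assumes "module R N" "module R M" "lin R N M f"
  shows "submodule (f ` carrier N) R M"
proof -
  interpret N: module R N by fact
  interpret M: module R M by fact
  note l = lin_closed[OF assms(3)] lin_add[OF assms(3)] lin_smult[OF assms(3)] lin_zero[OF assms] lin_minus[OF assms]
  show ?thesis
  proof (rule M.submoduleI)
    show "\<zero>\<^bsub>M\<^esub> \<in> f ` carrier N" using l(4) by (metis N.zero_closed imageI)
    show "\<ominus>\<^bsub>M\<^esub> a \<in> f ` carrier N" if "a \<in> f ` carrier N" for a
      using that l(5) by (metis (no_types, lifting) N.a_inv_closed imageE imageI)
    show "a \<oplus>\<^bsub>M\<^esub> b \<in> f ` carrier N" if "a \<in> f ` carrier N" "b \<in> f ` carrier N" for a b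
      using that l(2) by (metis (no_types, lifting) N.a_closed imageE imageI)
    show "a \<odot>\<^bsub>M\<^esub> x \<in> f ` carrier N" if "a \<in> carrier R" "x \<in> f ` carrier N" for a x
      using that l(3) by (metis (no_types, lifting) N.smult_closed imageE imageI)
  qed (use l in auto)
qed

lemma (in module) submoduleI':
  assumes "H \<subseteq> carrier M" "\<zero>\<^bsub>M\<^esub> \<in> H"
    and add: "\<And>a b. a \<in> H \<Longrightarrow> b \<in> H \<Longrightarrow> a \<oplus>\<^bsub>M\<^esub> b \<in> H"
    and smult: "\<And>a x. a \<in> carrier R \<Longrightarrow> x \<in> H \<Longrightarrow> a \<odot>\<^bsub>M\<^esub> x \<in> H"
  shows "submodule H R M"
proof (rule submoduleI)
  fix a assume "a \<in> H"
  then show "\<ominus>\<^bsub>M\<^esub> a \<in> H" using smult[of "\<ominus> \<one>" a] assms(1) by (auto simp: smult_l_minus)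
qed (use assms in auto)

lemma (in module) submodule_zero: "submodule H R M \<Longrightarrow> \<zero>\<^bsub>M\<^esub> \<in> H"
  by (metis submoduleE(1,2,4) smult_l_null R.zero_closed ex_in_conv subset_iff)

lemma (in module) submodule_diff: "submodule H R M \<Longrightarrow> a \<in> H \<Longrightarrow> b \<in> H \<Longrightarrow> a \<ominus>\<^bsub>M\<^esub> b \<in> H"
  unfolding a_minus_def by (intro submoduleE(3,5))

lemma (in module) submodule_vimage:
  assumes "module R N" "lin R M N f" "submodule H R N"
  shows "submodule {x \<in> carrier M. f x \<in> H} R M"
proof -
  interpret N: module R N by fact
  show ?thesis
    using assms(2) lin_zero[OF module_axioms assms(1,2)] N.submodule_zero[OF assms(3)]
      N.submoduleE(4,5)[OF assms(3)]
    by (intro submoduleI') (auto simp: lin_add lin_smult)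
qed

lemma (in module) submodule_trivial: "submodule {\<zero>\<^bsub>M\<^esub>} R M"
  by (intro submoduleI') auto

lemma (in module) submodule_ker:
  assumes "module R N" "lin R M N f"
  shows "submodule {x \<in> carrier M. f x = \<zero>\<^bsub>N\<^esub>} R M"
proof -
  interpret N: module R N by fact
  show ?thesis using submodule_vimage[OF assms N.submodule_trivial] by simp
qed

text \<open>\<open>g\<close> takes the value of \<open>f\<close> at a chosen preimage; two preimages
  differ by an element of the kernel of \<open>d\<close>, on which \<open>f\<close> vanishes. This
  turns a cocycle into a map on the next lower syzygy.\<close>

lemma lin_factor:
  assumes "module R X" "module R Y" "module R M" and d: "lin R X Y d" and f: "lin R X M f"
    and ker: "\<And>x. x \<in> carrier X \<Longrightarrow> d x = \<zero>\<^bsub>Y\<^esub> \<Longrightarrow> f x = \<zero>\<^bsub>M\<^esub>"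
  obtains g where "lin R (Y\<lparr>carrier := d ` carrier X\<rparr>) M g" "\<And>x. x \<in> carrier X \<Longrightarrow> g (d x) = f x"
proof -
  interpret X: module R X by fact
  interpret Y: module R Y by fact
  interpret M: module R M by fact
  define g where "g y = f (SOME x. x \<in> carrier X \<and> d x = y)" for y
  have g: "g (d x) = f x" if x: "x \<in> carrier X" for x
  proof -
    let ?x = "SOME x'. x' \<in> carrier X \<and> d x' = d x"
    have 1: "?x \<in> carrier X \<and> d ?x = d x"
      by (rule someI[of _ x]) (use x in auto)
    then have "d (?x \<ominus>\<^bsub>X\<^esub> x) = \<zero>\<^bsub>Y\<^esub>"
      using lin_diff[OF assms(1,2) d] x lin_closed[OF d x] by (simp add: Y.r_neg a_minus_def)
    then have "f (?x \<ominus>\<^bsub>X\<^esub> x) = \<zero>\<^bsub>M\<^esub>" using 1 x by (intro ker) auto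
    then have "f ?x = f x"
      using lin_diff[OF assms(1,3) f, of ?x x] 1 x lin_closed[OF f] by (simp add: M.minus_eq_zero_iff)
    then show ?thesis by (simp add: g_def)
  qed
  have "lin R (Y\<lparr>carrier := d ` carrier X\<rparr>) M g"
    using d f by (intro linI) (auto simp: g lin_closed lin_add[OF d, symmetric] lin_add[OF f]
      lin_smult[OF d, symmetric] lin_smult[OF f])
  then show ?thesis using g that by blast
qed

section \<open>The ring as a module over itself\<close>

lemma regular_module_simps [simp]:
  "carrier (regular_module R) = carrier R" "add (regular_module R) = add R"
  "zero (regular_module R) = \<zero>\<^bsub>R\<^esub>" "smult (regular_module R) = monoid.mult R"
  by (simp_all add: regular_module_def)

lemma (in cring) module_regular: "module R (regular_module R)"
proof (rule moduleI)
  show "abelian_group (regular_module R)"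
    by (rule abelian_groupI) (auto simp: a_ac intro: l_neg add.inv_closed bexI[of _ "\<ominus> _"])
qed (auto simp: l_distr r_distr m_ac is_cring)

lemma ideal_imp_submodule_regular:
  assumes "cring R" "ideal I R"
  shows "submodule I R (regular_module R)"
proof -
  interpret cring R by fact
  interpret I: ideal I R by fact
  interpret M: module R "regular_module R" by (rule module_regular)
  show ?thesis by (rule M.submoduleI') (auto simp: I.I_l_closed)
qed

text \<open>Lets ideals such as annihilators be obtained as preimages of submodules under linear
  maps from the ring.\<close>

lemma submodule_regular_imp_ideal:
  assumes "cring R" "submodule I R (regular_module R)"
  shows "ideal I R"
proof -
  interpret cring R by fact
  interpret M: module R "regular_module R" by (rule module_regular)
  note s = M.submoduleE[OF assms(2)] M.submodule_zero[OF assms(2)]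
  have inv: "\<ominus>\<^bsub>R\<^esub> a \<in> I" if "a \<in> I" for a
    using s(4)[of "\<ominus>\<^bsub>R\<^esub> \<one>\<^bsub>R\<^esub>" a] that s(1) by (auto simp: l_minus)
  show ?thesis
  proof (rule idealI)
    show "subgroup I (add_monoid R)"
      by (rule subgroup.intro) (use s inv in \<open>auto simp flip: a_inv_def\<close>)
    show "x \<otimes>\<^bsub>R\<^esub> a \<in> I" "a \<otimes>\<^bsub>R\<^esub> x \<in> I" if "a \<in> I" "x \<in> carrier R" for a x
      using s(4)[of x a] that s(1) by (auto simp: m_comm subset_iff)
  qed (rule ring_axioms)
qed

subsection \<open>Quotient modules\<close>

lemma quotient_module_simps [simp]:
  "carrier (quotient_module M N) = a_rcosets\<^bsub>M\<^esub> N" "zero (quotient_module M N) = N"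
  "add (quotient_module M N) = set_add M"
  "smult (quotient_module M N) r X = (\<Union>x\<in>X. N +>\<^bsub>M\<^esub> (r \<odot>\<^bsub>M\<^esub> x))"
  by (simp_all add: quotient_module_def)

context module
begin

lemma abelian_subgroup_submodule: "submodule N R M \<Longrightarrow> abelian_subgroup N M"
  by (rule abelian_subgroupI3) (simp_all add: submodule_def additive_subgroup_def M.abelian_group_axioms)

context
  fixes N assumes N: "submodule N R M"
begin

interpretation N: abelian_subgroup N M by (rule abelian_subgroup_submodule[OF N])

lemma coset_self: "x \<in> carrier M \<Longrightarrow> x \<in> N +>\<^bsub>M\<^esub> x"
  by (rule N.a_rcos_self)

lemma coset_mem_iff: "x \<in> carrier M \<Longrightarrow> y \<in> N +>\<^bsub>M\<^esub> x \<longleftrightarrow> y \<in> carrier M \<and> y \<ominus>\<^bsub>M\<^esub> x \<in> N"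
  using N.a_rcos_module N.a_elemrcos_carrier unfolding a_minus_def by blast

lemma coset_eq_iff:
  assumes "x \<in> carrier M" "y \<in> carrier M"
  shows "N +>\<^bsub>M\<^esub> x = N +>\<^bsub>M\<^esub> y \<longleftrightarrow> x \<ominus>\<^bsub>M\<^esub> y \<in> N"
  using assms N.a_repr_independence' coset_self coset_mem_iff by metis

lemma coset_zero_iff: "x \<in> carrier M \<Longrightarrow> N +>\<^bsub>M\<^esub> x = N \<longleftrightarrow> x \<in> N"
  using N.a_rcos_const coset_self by blast

lemma quotient_carrierE:
  assumes "X \<in> carrier (quotient_module M N)"
  obtains x where "x \<in> carrier M" "X = N +>\<^bsub>M\<^esub> x"
  using assms by (auto simp: A_RCOSETS_def RCOSETS_def a_r_coset_def)

lemma quotient_carrierI: "x \<in> carrier M \<Longrightarrow> N +>\<^bsub>M\<^esub> x \<in> carrier (quotient_module M N)"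
  by (simp add: M.a_rcosetsI N.a_subset)

lemma quotient_add: "x \<in> carrier M \<Longrightarrow> y \<in> carrier M \<Longrightarrow>
    (N +>\<^bsub>M\<^esub> x) \<oplus>\<^bsub>quotient_module M N\<^esub> (N +>\<^bsub>M\<^esub> y) = N +>\<^bsub>M\<^esub> (x \<oplus>\<^bsub>M\<^esub> y)"
  by (simp add: N.a_rcos_sum)

text \<open>The scalar product of a coset is defined as a union over all representatives; two of
  them differ by an element of \<open>N\<close>, and so do their multiples, so the union is a single
  coset.\<close>

lemma quotient_smult:
  assumes "r \<in> carrier R" "x \<in> carrier M"
  shows "r \<odot>\<^bsub>quotient_module M N\<^esub> (N +>\<^bsub>M\<^esub> x) = N +>\<^bsub>M\<^esub> (r \<odot>\<^bsub>M\<^esub> x)"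
proof -
  have "N +>\<^bsub>M\<^esub> (r \<odot>\<^bsub>M\<^esub> y) = N +>\<^bsub>M\<^esub> (r \<odot>\<^bsub>M\<^esub> x)" if "y \<in> N +>\<^bsub>M\<^esub> x" for y
  proof -
    have y: "y \<in> carrier M" "y \<ominus>\<^bsub>M\<^esub> x \<in> N" using that assms by (auto simp: coset_mem_iff)
    have "r \<odot>\<^bsub>M\<^esub> y \<ominus>\<^bsub>M\<^esub> r \<odot>\<^bsub>M\<^esub> x = r \<odot>\<^bsub>M\<^esub> (y \<ominus>\<^bsub>M\<^esub> x)"
      using assms y by (simp add: a_minus_def smult_r_distr smult_r_minus)
    then show ?thesis using assms y submoduleE(4)[OF N] by (simp add: coset_eq_iff)
  qed
  then show ?thesis
    unfolding quotient_module_simps by (intro UN_constant_eq[OF coset_self[OF assms(2)]] ballI)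
qed

lemma quotient_is_module: "module R (quotient_module M N)"
proof -
  have z: "\<zero>\<^bsub>quotient_module M N\<^esub> = N +>\<^bsub>M\<^esub> \<zero>\<^bsub>M\<^esub>"
    using coset_zero_iff[of "\<zero>\<^bsub>M\<^esub>"] submodule_zero[OF N] by simp
  note q = quotient_add quotient_smult quotient_carrierI
  show ?thesis
  proof (rule moduleI[OF R.is_cring abelian_groupI])
    fix X assume "X \<in> carrier (quotient_module M N)"
    then obtain x where x: "x \<in> carrier M" "X = N +>\<^bsub>M\<^esub> x" by (rule quotient_carrierE)
    show "\<exists>Y\<in>carrier (quotient_module M N). Y \<oplus>\<^bsub>quotient_module M N\<^esub> X = \<zero>\<^bsub>quotient_module M N\<^esub>"
      by (rule bexI[of _ "N +>\<^bsub>M\<^esub> (\<ominus>\<^bsub>M\<^esub> x)"]) (use x in \<open>simp_all only: z q M.a_inv_closed M.l_neg\<close>)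
  qed (auto elim!: quotient_carrierE simp only: z q smult_closed M.a_closed M.zero_closed
        R.a_closed R.m_closed smult_one R.one_closed smult_l_distr smult_r_distr smult_assoc1 M.a_ac M.l_zero M.r_zero)
qed

end

end

lemma additive_coset_regular: "A +>\<^bsub>regular_module R\<^esub> x = A +>\<^bsub>R\<^esub> x"
  by (simp add: a_r_coset_def r_coset_def)

section \<open>Direct limits\<close>

locale direct_system =
  fixes R :: "('a, 'r) ring_scheme" and X :: "nat \<Rightarrow> ('a, 'x, 's) module_scheme" and t :: "nat \<Rightarrow> 'x \<Rightarrow> 'x"
  assumes modules: "module R (X n)" and lin_step: "lin R (X n) (X (Suc n)) (t n)"
begin

abbreviation "tr \<equiv> transition t"
abbreviation "L \<equiv> direct_limit X t"

lemma cring: "cring R"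
  using modules by (rule module.axioms)

lemma tr_self [simp]: "tr m m x = x"
  by (simp add: transition_def)

lemma tr_Suc: "m \<le> k \<Longrightarrow> tr m (Suc k) x = t k (tr m k x)"
  by (simp add: transition_def)

lemma tr_lin: "m \<le> k \<Longrightarrow> lin R (X m) (X k) (tr m k)"
proof (induction k rule: dec_induct)
  case base
  show ?case by (rule linI) auto
next
  case (step n)
  then show ?case using lin_comp[OF lin_step step.IH] by (simp add: tr_Suc lin_def)
qed

lemma tr_closed [simp]: "m \<le> k \<Longrightarrow> x \<in> carrier (X m) \<Longrightarrow> tr m k x \<in> carrier (X k)"
  using tr_lin lin_closed by metis

lemma tr_trans [simp]:
  assumes "m \<le> k" "k \<le> l"
  shows "tr k l (tr m k x) = tr m l x"
  using assms(2)
proof (induction l rule: dec_induct)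
  case (step n)
  then show ?case using assms(1) by (simp add: tr_Suc)
qed simp

lemma tr_eq_mono: "tr m k x = tr n k y \<Longrightarrow> m \<le> k \<Longrightarrow> n \<le> k \<Longrightarrow> k \<le> l \<Longrightarrow> tr m l x = tr n l y"
  using tr_trans by metis

lemma germ_memI: "y \<in> carrier (X n) \<Longrightarrow> m \<le> k \<Longrightarrow> n \<le> k \<Longrightarrow> tr m k x = tr n k y \<Longrightarrow> (n, y) \<in> germ X t m x"
  by (auto simp: germ_def)

lemma germ_memE:
  assumes "(n, y) \<in> germ X t m x"
  obtains k where "y \<in> carrier (X n)" "m \<le> k" "n \<le> k" "tr m k x = tr n k y"
  using assms by (auto simp: germ_def)

lemma germ_subset:
  assumes "m \<le> k" "n \<le> k" "tr m k x = tr n k y"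
  shows "germ X t m x \<subseteq> germ X t n y"
proof
  fix p assume "p \<in> germ X t m x"
  then obtain q z where p: "p = (q, z)" "(q, z) \<in> germ X t m x" by (cases p) auto
  from p(2) obtain l where l: "z \<in> carrier (X q)" "m \<le> l" "q \<le> l" "tr m l x = tr q l z"
    by (rule germ_memE)
  have "tr n (max k l) y = tr q (max k l) z"
    using tr_eq_mono[OF assms(3,1,2), of "max k l"] tr_eq_mono[OF l(4,2,3), of "max k l"] by simp
  then show "p \<in> germ X t n y"
    unfolding p(1) by (rule germ_memI[rotated -1]) (use l assms in auto)
qed

lemma germ_eqI: "m \<le> k \<Longrightarrow> n \<le> k \<Longrightarrow> tr m k x = tr n k y \<Longrightarrow> germ X t m x = germ X t n y"
  by (intro equalityI germ_subset) auto

lemma germ_self: "x \<in> carrier (X m) \<Longrightarrow> (m, x) \<in> germ X t m x"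
  by (auto simp: germ_def)

lemma germ_eqD:
  assumes "germ X t m x = germ X t n y" "y \<in> carrier (X n)"
  obtains k where "m \<le> k" "n \<le> k" "tr m k x = tr n k y"
  using germ_self[OF assms(2)] assms(1) germ_memE by metis

lemma germ_raise: "m \<le> k \<Longrightarrow> germ X t m x = germ X t k (tr m k x)"
  by (rule germ_eqI[of _ k]) auto

lemma limit_simps [simp]:
  "carrier L = {germ X t m x | m x. x \<in> carrier (X m)}" "\<zero>\<^bsub>L\<^esub> = germ X t 0 \<zero>\<^bsub>X 0\<^esub>"
  "r \<odot>\<^bsub>L\<^esub> A = (\<Union>(m, x)\<in>A. germ X t m (r \<odot>\<^bsub>X m\<^esub> x))"
  by (simp_all add: direct_limit_def)

lemma germ_in_limit [simp]: "x \<in> carrier (X m) \<Longrightarrow> germ X t m x \<in> carrier L"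
  by auto

lemma limit_zero: "\<zero>\<^bsub>L\<^esub> = germ X t k \<zero>\<^bsub>X k\<^esub>"
  using lin_zero[OF modules modules tr_lin, of 0 k] germ_raise[of 0 k "\<zero>\<^bsub>X 0\<^esub>"] by simp

text \<open>The definition takes a union over all pairs of representatives. Moved far enough along
  the system, every pair contributes the same germ. Two representatives at the same index are enough
  in view of \<open>limit_reps\<close>.\<close>

lemma limit_add:
  assumes "x \<in> carrier (X k)" "y \<in> carrier (X k)"
  shows "germ X t k x \<oplus>\<^bsub>L\<^esub> germ X t k y = germ X t k (x \<oplus>\<^bsub>X k\<^esub> y)"
proof -
  have "germ X t (max m n) (tr m (max m n) x' \<oplus>\<^bsub>X (max m n)\<^esub> tr n (max m n) y') =
      germ X t k (x \<oplus>\<^bsub>X k\<^esub> y)"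
    if x': "(m, x') \<in> germ X t k x" and y': "(n, y') \<in> germ X t k y" for m x' n y'
  proof -
    let ?K = "max m n"
    from x' obtain a where a: "x' \<in> carrier (X m)" "k \<le> a" "m \<le> a" "tr k a x = tr m a x'" by (rule germ_memE)
    from y' obtain b where b: "y' \<in> carrier (X n)" "k \<le> b" "n \<le> b" "tr k b y = tr n b y'" by (rule germ_memE)
    let ?l = "max a b"
    have l: "tr k ?l x = tr m ?l x'" "tr k ?l y = tr n ?l y'"
      using tr_eq_mono[OF a(4,2,3), of ?l] tr_eq_mono[OF b(4,2,3), of ?l] by auto
    have le: "?K \<le> ?l" "k \<le> ?l" "m \<le> ?K" "n \<le> ?K" using a b by auto
    have "tr ?K ?l (tr m ?K x' \<oplus>\<^bsub>X ?K\<^esub> tr n ?K y') = tr m ?l x' \<oplus>\<^bsub>X ?l\<^esub> tr n ?l y'"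
      using le a(1) b(1) by (subst lin_add[OF tr_lin[OF le(1)]]) auto
    also have "\<dots> = tr k ?l (x \<oplus>\<^bsub>X k\<^esub> y)"
      using le assms by (subst lin_add[OF tr_lin[OF le(2)]]) (auto simp: l)
    finally show ?thesis using le by (intro germ_eqI[of _ ?l]) auto
  qed
  then show ?thesis
    unfolding direct_limit_def
    apply (simp add: Let_def)
    apply (rule UN_constant_eq[OF germ_self[OF assms(1)]])
    apply (clarify, rule UN_constant_eq[OF germ_self[OF assms(2)]])
    apply auto
    done
qed

lemma limit_smult:
  assumes "r \<in> carrier R" "x \<in> carrier (X k)"
  shows "r \<odot>\<^bsub>L\<^esub> germ X t k x = germ X t k (r \<odot>\<^bsub>X k\<^esub> x)"
proof -
  have "germ X t m (r \<odot>\<^bsub>X m\<^esub> x') = germ X t k (r \<odot>\<^bsub>X k\<^esub> x)"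
    if x': "(m, x') \<in> germ X t k x" for m x'
  proof -
    from x' obtain a where a: "x' \<in> carrier (X m)" "k \<le> a" "m \<le> a" "tr k a x = tr m a x'" by (rule germ_memE)
    have "tr m a (r \<odot>\<^bsub>X m\<^esub> x') = tr k a (r \<odot>\<^bsub>X k\<^esub> x)"
      using a assms lin_smult[OF tr_lin[OF a(2)]] lin_smult[OF tr_lin[OF a(3)]] by simp
    then show ?thesis using a by (intro germ_eqI[of _ a]) auto
  qed
  then show ?thesis
    unfolding limit_simps by (intro UN_constant_eq[OF germ_self[OF assms(2)]]) auto
qed

text \<open>Three elements because the module axioms involve at most three; for fewer the rule is
  applied with repetitions.\<close>

lemma limit_reps:
  assumes "A \<in> carrier L" "B \<in> carrier L" "C \<in> carrier L"
  obtains k x y z where "x \<in> carrier (X k)" "y \<in> carrier (X k)" "z \<in> carrier (X k)"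
    "A = germ X t k x" "B = germ X t k y" "C = germ X t k z"
proof -
  obtain m x n y l z where A: "A = germ X t m x" "x \<in> carrier (X m)"
    and B: "B = germ X t n y" "y \<in> carrier (X n)" and C: "C = germ X t l z" "z \<in> carrier (X l)"
    using assms by (simp del: ) blast
  let ?k = "max m (max n l)"
  show ?thesis
    by (rule that[of "tr m ?k x" ?k "tr n ?k y" "tr l ?k z"])
      (use A B C in \<open>auto intro!: tr_closed germ_raise\<close>)
qed

lemma limit_module: "module R L"
proof -
  interpret X: module R "X n" for n by (rule modules)
  note q = limit_add limit_smult germ_in_limit X.M.a_closed X.smult_closed
  show ?thesis
  proof (rule moduleI[OF cring abelian_groupI], goal_cases)
    case (1 A B)
    from 1(1,2,2) show ?case by (rule limit_reps) (simp only: q)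
  next
    case 2
    show ?case unfolding limit_zero[of 0] by (simp del: limit_simps)
  next
    case (3 A B C)
    then show ?case by (rule limit_reps) (simp only: q X.M.a_assoc)
  next
    case (4 A B)
    from 4(1,2,2) show ?case by (rule limit_reps) (simp only: q X.M.a_comm)
  next
    case (5 A)
    from 5(1,1,1) obtain k x where x: "x \<in> carrier (X k)" "A = germ X t k x" by (rule limit_reps)
    show ?case using x by (simp only: q limit_zero[of k] X.M.zero_closed X.M.l_zero)
  next
    case (6 A)
    from 6(1,1,1) obtain k x where x: "x \<in> carrier (X k)" "A = germ X t k x" by (rule limit_reps)
    show ?case
      by (rule bexI[of _ "germ X t k (\<ominus>\<^bsub>X k\<^esub> x)"])
        (use x in \<open>simp_all only: q limit_zero[of k] X.M.a_inv_closed X.M.l_neg\<close>)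
  next
    case (7 a A)
    from 7(2,2,2) show ?case by (rule limit_reps) (use 7(1) in \<open>simp only: q\<close>)
  next
    case (8 a b A)
    from 8(3,3,3) show ?case
      by (rule limit_reps) (use 8(1,2) in \<open>simp only: q X.R.a_closed X.smult_l_distr\<close>)
  next
    case (9 a A B)
    from 9(2,3,3) show ?case by (rule limit_reps) (use 9(1) in \<open>simp only: q X.smult_r_distr\<close>)
  next
    case (10 a b A)
    from 10(3,3,3) show ?case
      by (rule limit_reps) (use 10(1,2) in \<open>simp only: q X.R.m_closed X.smult_assoc1\<close>)
  next
    case (11 A)
    from 11(1,1,1) show ?case by (rule limit_reps) (simp only: q X.R.one_closed X.smult_one)
  qed
qed

lemma germ_zero_iff:
  assumes "x \<in> carrier (X m)"
  shows "germ X t m x = \<zero>\<^bsub>L\<^esub> \<longleftrightarrow> (\<exists>k\<ge>m. tr m k x = \<zero>\<^bsub>X k\<^esub>)"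
proof -
  interpret X: module R "X n" for n by (rule modules)
  have z: "tr m k \<zero>\<^bsub>X m\<^esub> = \<zero>\<^bsub>X k\<^esub>" if "m \<le> k" for k
    using lin_zero[OF modules modules tr_lin] that by blast
  show ?thesis
  proof
    assume "germ X t m x = \<zero>\<^bsub>L\<^esub>"
    then have "germ X t m x = germ X t m \<zero>\<^bsub>X m\<^esub>" by (simp only: limit_zero[of m])
    then show "\<exists>k\<ge>m. tr m k x = \<zero>\<^bsub>X k\<^esub>"
      by (rule germ_eqD) (auto simp: z)
  next
    assume "\<exists>k\<ge>m. tr m k x = \<zero>\<^bsub>X k\<^esub>"
    then show "germ X t m x = \<zero>\<^bsub>L\<^esub>"
      unfolding limit_zero[of m] using germ_eqI z by metis
  qed
qed

text \<open>Here the limit itself disappears: its annihilation becomes a statement about the stages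
  and the transition maps.\<close>

lemma kills_limit_iff:
  assumes "r \<in> carrier R"
  shows "(\<forall>A\<in>carrier L. r \<odot>\<^bsub>L\<^esub> A = \<zero>\<^bsub>L\<^esub>) \<longleftrightarrow>
    (\<forall>m. \<forall>x\<in>carrier (X m). \<exists>k\<ge>m. tr m k (r \<odot>\<^bsub>X m\<^esub> x) = \<zero>\<^bsub>X k\<^esub>)"
proof -
  interpret X: module R "X n" for n by (rule modules)
  have "r \<odot>\<^bsub>L\<^esub> germ X t m x = \<zero>\<^bsub>L\<^esub> \<longleftrightarrow> (\<exists>k\<ge>m. tr m k (r \<odot>\<^bsub>X m\<^esub> x) = \<zero>\<^bsub>X k\<^esub>)"
    if "x \<in> carrier (X m)" for m x
    unfolding limit_smult[OF assms that] by (rule germ_zero_iff) (use that assms in auto)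
  then show ?thesis by (auto simp del: limit_simps(2,3)) blast
qed

end

text \<open>A single product is a sum of length one, and sums of zeros are zero; so only products
  have to be considered.\<close>

lemma ideal_smult_zero_iff:
  assumes "module R H" "I \<subseteq> carrier R" "\<zero>\<^bsub>R\<^esub> \<in> I"
  shows "ideal_smult I H = {\<zero>\<^bsub>H\<^esub>} \<longleftrightarrow> (\<forall>a\<in>I. \<forall>h\<in>carrier H. a \<odot>\<^bsub>H\<^esub> h = \<zero>\<^bsub>H\<^esub>)"
proof -
  interpret H: module R H by fact
  have 1: "a \<odot>\<^bsub>H\<^esub> h \<in> ideal_smult I H" if "a \<in> I" "h \<in> carrier H" for a h
  proof -
    have "a \<odot>\<^bsub>H\<^esub> h = (\<Oplus>\<^bsub>H\<^esub>j\<in>{..<1::nat}. a \<odot>\<^bsub>H\<^esub> h)"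
      using that assms(2) by (auto simp: lessThan_Suc)
    then show ?thesis
      unfolding ideal_smult_def using that
      by (intro CollectI exI[of _ 1] exI[of _ "\<lambda>_. a"] exI[of _ "\<lambda>_. h"]) auto
  qed
  show ?thesis
  proof
    assume "ideal_smult I H = {\<zero>\<^bsub>H\<^esub>}"
    then show "\<forall>a\<in>I. \<forall>h\<in>carrier H. a \<odot>\<^bsub>H\<^esub> h = \<zero>\<^bsub>H\<^esub>" using 1 by blast
  next
    assume k: "\<forall>a\<in>I. \<forall>h\<in>carrier H. a \<odot>\<^bsub>H\<^esub> h = \<zero>\<^bsub>H\<^esub>"
    have "(\<Oplus>\<^bsub>H\<^esub>j\<in>{..<n::nat}. c j \<odot>\<^bsub>H\<^esub> x j) = \<zero>\<^bsub>H\<^esub>"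
      if "c \<in> {..<n} \<rightarrow> I" "x \<in> {..<n} \<rightarrow> carrier H" for n c x
      by (rule H.M.add.finprod_one_eqI) (use k that in auto)
    moreover have "\<zero>\<^bsub>H\<^esub> \<in> ideal_smult I H"
      using 1[OF assms(3), of "\<zero>\<^bsub>H\<^esub>"] by simp
    ultimately show "ideal_smult I H = {\<zero>\<^bsub>H\<^esub>}"
      by (auto simp: ideal_smult_def)
  qed
qed

section \<open>Free modules\<close>

lemma free_carrier:
  "carrier (free_module R B) =
    {f. (\<forall>x\<in>B. f x \<in> carrier R) \<and> (\<forall>x. x \<notin> B \<longrightarrow> f x = \<zero>\<^bsub>R\<^esub>) \<and> finite {x. f x \<noteq> \<zero>\<^bsub>R\<^esub>}}"
  by (simp add: free_module_def)

lemma free_simps: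
  "\<zero>\<^bsub>free_module R B\<^esub> = (\<lambda>_. \<zero>\<^bsub>R\<^esub>)"
  "f \<oplus>\<^bsub>free_module R B\<^esub> g = (\<lambda>x. f x \<oplus>\<^bsub>R\<^esub> g x)"
  "r \<odot>\<^bsub>free_module R B\<^esub> f = (\<lambda>x. r \<otimes>\<^bsub>R\<^esub> f x)"
  by (simp_all add: free_module_def)

text \<open>\<open>formal_sum\<close> is computed in the free module on \<open>UNIV\<close>. Zero,
  sums and multiples are the same functions for every basis, so any \<open>B\<close> may be written
  here and in \<open>formal_sum_Cons\<close>.\<close>

lemma formal_sum_Nil: "formal_sum R [] = \<zero>\<^bsub>free_module R B\<^esub>"
  by (simp add: formal_sum_def free_simps)

lemma formal_sum_Cons:
  "formal_sum R ((r, x) # ws) = r \<odot>\<^bsub>free_module R B\<^esub> basis_vec R x \<oplus>\<^bsub>free_module R B\<^esub> formal_sum R ws"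
  by (simp add: formal_sum_def free_simps)

declare res_basis.simps(2) [simp del]

context cring
begin

lemma free_closed: "v \<in> carrier (free_module R B) \<Longrightarrow> v x \<in> carrier R"
  by (cases "x \<in> B") (auto simp: free_carrier)

lemma free_mono: "B \<subseteq> C \<Longrightarrow> carrier (free_module R B) \<subseteq> carrier (free_module R C)"
  by (force simp: free_carrier)

lemma basis_closed [simp]: "basis_vec R x y \<in> carrier R"
  by (simp add: basis_vec_def)

lemma basis_in_free: "x \<in> B \<Longrightarrow> basis_vec R x \<in> carrier (free_module R B)"
  by (auto simp: free_carrier basis_vec_def intro: finite_subset[of _ "{x}"])

lemma free_add_closed:
  assumes "v \<in> carrier (free_module R B)" "w \<in> carrier (free_module R B)"
  shows "(\<lambda>a. v a \<oplus> w a) \<in> carrier (free_module R B)"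
proof -
  have "finite {a. v a \<oplus> w a \<noteq> \<zero>}"
    by (rule finite_subset[of _ "{a. v a \<noteq> \<zero>} \<union> {a. w a \<noteq> \<zero>}"]) (use assms in \<open>auto simp: free_carrier\<close>)
  with assms show ?thesis by (auto simp: free_carrier)
qed

lemma free_smult_closed:
  assumes "r \<in> carrier R" "v \<in> carrier (free_module R B)"
  shows "(\<lambda>a. r \<otimes> v a) \<in> carrier (free_module R B)"
proof -
  have "finite {a. r \<otimes> v a \<noteq> \<zero>}"
    by (rule finite_subset[of _ "{a. v a \<noteq> \<zero>}"]) (use assms in \<open>auto simp: free_carrier\<close>)
  with assms show ?thesis by (auto simp: free_carrier)
qed

lemma free_is_module: "module R (free_module R B)"
proof (rule moduleI[OF is_cring abelian_groupI], goal_cases)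
  case (6 x)
  have "(\<lambda>a. \<ominus> \<one> \<otimes> x a) \<in> carrier (free_module R B)"
    by (rule free_smult_closed[OF _ 6]) simp
  moreover have "(\<lambda>a. \<ominus> \<one> \<otimes> x a) \<oplus>\<^bsub>free_module R B\<^esub> x = \<zero>\<^bsub>free_module R B\<^esub>"
    using free_closed[OF 6] by (simp add: free_simps l_minus l_neg)
  ultimately show ?case by (intro bexI)
qed (simp_all only: free_simps free_add_closed free_smult_closed fun_eq_iff
    a_assoc a_comm a_lcomm l_distr r_distr m_assoc l_one l_zero free_closed a_closed m_closed,
  auto simp: free_carrier a_comm)

lemma formal_sum_closed: "set ws \<subseteq> carrier R \<times> B \<Longrightarrow> formal_sum R ws \<in> carrier (free_module R B)"
proof (induction ws)
  case Nil
  interpret F: module R "free_module R B" by (rule free_is_module)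
  show ?case by (simp add: formal_sum_Nil[of _ B])
next
  case (Cons w ws)
  interpret F: module R "free_module R B" by (rule free_is_module)
  obtain r x where w: "w = (r, x)" by fastforce
  show ?case
    unfolding w formal_sum_Cons[of _ _ _ _ B]
    by (intro F.M.a_closed F.smult_closed basis_in_free) (use Cons w in auto)
qed

text \<open>Induction on a finite set containing the support; the value at one point is split off
  and becomes the head of the list. This is the reason why every cycle is the value of the
  differential at a basis element.\<close>

lemma free_rep:
  assumes "v \<in> carrier (free_module R B)"
  obtains ws where "set ws \<subseteq> carrier R \<times> B" "v = formal_sum R ws"
proof -
  have "\<exists>ws. set ws \<subseteq> carrier R \<times> B \<and> v = formal_sum R ws"
    if "finite F" "{x. v x \<noteq> \<zero>} \<subseteq> F" "v \<in> carrier (free_module R B)" for F v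
    using that
  proof (induction F arbitrary: v)
    case empty
    then show ?case by (intro exI[of _ "[]"]) (auto simp: formal_sum_Nil[of _ B] free_simps)
  next
    case (insert a F)
    let ?v = "v(a := \<zero>)"
    have "{x. ?v x \<noteq> \<zero>} \<subseteq> F" using insert.prems(1) by auto
    moreover have "?v \<in> carrier (free_module R B)"
      using insert.prems(2) by (auto simp: free_carrier intro: finite_subset[of _ "{x. v x \<noteq> \<zero>}"])
    ultimately obtain ws where ws: "set ws \<subseteq> carrier R \<times> B" "?v = formal_sum R ws"
      using insert.IH by blast
    show ?case
    proof (cases "a \<in> B")
      case True
      have "v = formal_sum R ((v a, a) # ws)"
        using free_closed[OF insert.prems(2)]
        by (auto simp: formal_sum_Cons[of _ _ _ _ B] free_simps ws(2)[symmetric] basis_vec_def fun_eq_iff)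
      then show ?thesis using ws(1) True free_closed[OF insert.prems(2)]
        by (intro exI[of _ "(v a, a) # ws"]) auto
    next
      case False
      then have "v = ?v" using insert.prems(2) by (auto simp: fun_eq_iff free_carrier)
      then show ?thesis using ws by metis
    qed
  qed
  then show ?thesis using that assms by (auto simp: free_carrier)
qed

lemma free_induct:
  assumes v: "v \<in> carrier (free_module R B)" and zero: "P \<zero>\<^bsub>free_module R B\<^esub>"
    and step: "\<And>r x v. r \<in> carrier R \<Longrightarrow> x \<in> B \<Longrightarrow> v \<in> carrier (free_module R B) \<Longrightarrow> P v \<Longrightarrow>
      P (r \<odot>\<^bsub>free_module R B\<^esub> basis_vec R x \<oplus>\<^bsub>free_module R B\<^esub> v)"
  shows "P v"
proof -
  obtain ws where ws: "set ws \<subseteq> carrier R \<times> B" "v = formal_sum R ws" by (rule free_rep[OF v])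
  from ws(1) have "P (formal_sum R ws)"
  proof (induction ws)
    case (Cons w ws)
    obtain r x where w: "w = (r, x)" by fastforce
    show ?case
      using step[of r x "formal_sum R ws"] Cons formal_sum_closed[of ws B] w by (simp add: formal_sum_Cons[of _ _ _ _ B])
  qed (simp add: zero formal_sum_Nil[of _ B])
  then show ?thesis using ws by simp
qed

lemma lin_free_mem:
  assumes "module R M" "lin R (free_module R B) M f" "submodule H R M"
    and "\<And>x. x \<in> B \<Longrightarrow> f (basis_vec R x) \<in> H" and v: "v \<in> carrier (free_module R B)"
  shows "f v \<in> H"
proof -
  interpret M: module R M by fact
  interpret F: module R "free_module R B" by (rule free_is_module)
  note H = M.submoduleE(4,5)[OF assms(3)]
  from v show ?thesis
  proof (rule free_induct)
    show "f \<zero>\<^bsub>free_module R B\<^esub> \<in> H"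
      using lin_zero[OF F.module_axioms assms(1,2)] M.submodule_zero[OF assms(3)] by simp
    fix r x v assume *: "r \<in> carrier R" "x \<in> B" "v \<in> carrier (free_module R B)" "f v \<in> H"
    show "f (r \<odot>\<^bsub>free_module R B\<^esub> basis_vec R x \<oplus>\<^bsub>free_module R B\<^esub> v) \<in> H"
      using * H assms(4) basis_in_free[of x B]
      by (simp add: lin_add[OF assms(2)] lin_smult[OF assms(2)])
  qed
qed

lemma lin_free_eq:
  assumes "module R M" "lin R (free_module R B) M f" "lin R (free_module R B) M g"
    and "\<And>x. x \<in> B \<Longrightarrow> f (basis_vec R x) = g (basis_vec R x)" and v: "v \<in> carrier (free_module R B)"
  shows "f v = g v"
proof -
  interpret M: module R M by fact
  have "f v \<ominus>\<^bsub>M\<^esub> g v \<in> {\<zero>\<^bsub>M\<^esub>}"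
  proof (rule lin_free_mem[OF assms(1) lin_sub[OF assms(1-3)] M.submodule_trivial _ v])
    fix x assume "x \<in> B"
    then show "f (basis_vec R x) \<ominus>\<^bsub>M\<^esub> g (basis_vec R x) \<in> {\<zero>\<^bsub>M\<^esub>}"
      using assms(4) lin_closed[OF assms(3) basis_in_free[of x B]] by (simp add: M.minus_eq_zero_iff)
  qed
  then show ?thesis
    using lin_closed[OF assms(2) v] lin_closed[OF assms(3) v] by (simp add: M.minus_eq_zero_iff)
qed

lemma submodule_free: "B \<subseteq> C \<Longrightarrow> submodule (carrier (free_module R B)) R (free_module R C)"
proof -
  assume "B \<subseteq> C"
  interpret F: module R "free_module R B" by (rule free_is_module)
  interpret G: module R "free_module R C" by (rule free_is_module)
  show ?thesis
    using free_mono[OF \<open>B \<subseteq> C\<close>] F.M.a_closed F.smult_closed F.M.zero_closed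
    unfolding free_simps[of R B] free_simps[of R C]
    by (intro G.submoduleI') (auto simp: free_simps)
qed

text \<open>The differential and the induced chain maps are defined with values in the free module
  on \<open>UNIV\<close>. Looking at basis vectors cuts the codomain down to the proper term of the
  resolution.\<close>

lemma lin_free_cod:
  assumes "lin R (free_module R B) (free_module R UNIV) f"
    and "\<And>x. x \<in> B \<Longrightarrow> f (basis_vec R x) \<in> carrier (free_module R C)"
  shows "lin R (free_module R B) (free_module R C) f"
  using lin_free_mem[OF free_is_module assms(1) submodule_free[of C UNIV] assms(2)] assms(1)
  unfolding lin_def by (auto simp: free_simps)

text \<open>The definition sums over the support of \<open>v\<close>; additivity needs a common
  index set for two vectors, so the sum is extended by zero terms.\<close>

lemma lin_ext_eq:
  assumes "module R M" "u \<in> B \<rightarrow> carrier M" "v \<in> carrier (free_module R B)"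
    and "finite A" "A \<subseteq> B" "{x. v x \<noteq> \<zero>} \<subseteq> A"
  shows "lin_ext R M u v = (\<Oplus>\<^bsub>M\<^esub>x\<in>A. v x \<odot>\<^bsub>M\<^esub> u x)"
proof -
  interpret M: module R M by fact
  show ?thesis
    unfolding lin_ext_def
    by (rule M.M.add.finprod_mono_neutral_cong_left)
      (use assms free_closed[OF assms(3)] in \<open>auto simp: Pi_iff subset_iff\<close>)
qed

lemma lin_lin_ext:
  assumes "module R M" "u \<in> B \<rightarrow> carrier M"
  shows "lin R (free_module R B) M (lin_ext R M u)"
proof -
  interpret M: module R M by fact
  interpret F: module R "free_module R B" by (rule free_is_module)
  have supp: "finite {x. v x \<noteq> \<zero>}" "{x. v x \<noteq> \<zero>} \<subseteq> B" if "v \<in> carrier (free_module R B)" for v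
    using that by (auto simp: free_carrier)
  have u: "u x \<in> carrier M" if "x \<in> B" for x using that assms(2) by auto
  show ?thesis
  proof (rule linI)
    fix v assume v: "v \<in> carrier (free_module R B)"
    show "lin_ext R M u v \<in> carrier M"
      using supp(2)[OF v] free_closed[OF v] u
      by (auto simp: lin_ext_def intro!: M.M.finsum_closed)
  next
    fix v w assume v: "v \<in> carrier (free_module R B)" and w: "w \<in> carrier (free_module R B)"
    let ?A = "{x. v x \<noteq> \<zero>} \<union> {x. w x \<noteq> \<zero>}"
    have A: "finite ?A" "?A \<subseteq> B" using supp[OF v] supp[OF w] by auto
    have vw: "v \<oplus>\<^bsub>free_module R B\<^esub> w \<in> carrier (free_module R B)" using v w by (rule F.M.a_closed)
    have "lin_ext R M u (v \<oplus>\<^bsub>free_module R B\<^esub> w) =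
        (\<Oplus>\<^bsub>M\<^esub>x\<in>?A. (v \<oplus>\<^bsub>free_module R B\<^esub> w) x \<odot>\<^bsub>M\<^esub> u x)"
      by (rule lin_ext_eq[OF assms vw A]) (auto simp: free_simps)
    also have "\<dots> = (\<Oplus>\<^bsub>M\<^esub>x\<in>?A. v x \<odot>\<^bsub>M\<^esub> u x \<oplus>\<^bsub>M\<^esub> w x \<odot>\<^bsub>M\<^esub> u x)"
      using A(2) u free_closed[OF v] free_closed[OF w]
      by (intro M.M.finsum_cong') (auto simp: free_simps intro!: M.smult_l_distr)
    also have "\<dots> = (\<Oplus>\<^bsub>M\<^esub>x\<in>?A. v x \<odot>\<^bsub>M\<^esub> u x) \<oplus>\<^bsub>M\<^esub> (\<Oplus>\<^bsub>M\<^esub>x\<in>?A. w x \<odot>\<^bsub>M\<^esub> u x)"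
      using A(2) u free_closed[OF v] free_closed[OF w] by (intro M.M.finsum_addf) auto
    also have "\<dots> = lin_ext R M u v \<oplus>\<^bsub>M\<^esub> lin_ext R M u w"
      using lin_ext_eq[OF assms v A] lin_ext_eq[OF assms w A] by simp
    finally show "lin_ext R M u (v \<oplus>\<^bsub>free_module R B\<^esub> w) = lin_ext R M u v \<oplus>\<^bsub>M\<^esub> lin_ext R M u w" .
  next
    fix r v assume r: "r \<in> carrier R" and v: "v \<in> carrier (free_module R B)"
    let ?A = "{x. v x \<noteq> \<zero>}"
    have A: "finite ?A" "?A \<subseteq> B" using supp[OF v] by auto
    have rv: "r \<odot>\<^bsub>free_module R B\<^esub> v \<in> carrier (free_module R B)" using r v by (rule F.smult_closed)
    have "lin_ext R M u (r \<odot>\<^bsub>free_module R B\<^esub> v) =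
        (\<Oplus>\<^bsub>M\<^esub>x\<in>?A. (r \<odot>\<^bsub>free_module R B\<^esub> v) x \<odot>\<^bsub>M\<^esub> u x)"
      by (rule lin_ext_eq[OF assms rv A]) (use r in \<open>auto simp: free_simps\<close>)
    also have "\<dots> = (\<Oplus>\<^bsub>M\<^esub>x\<in>?A. r \<odot>\<^bsub>M\<^esub> (v x \<odot>\<^bsub>M\<^esub> u x))"
      using A(2) u r free_closed[OF v]
      by (intro M.M.finsum_cong') (auto simp: free_simps intro!: M.smult_assoc1)
    also have "\<dots> = r \<odot>\<^bsub>M\<^esub> (\<Oplus>\<^bsub>M\<^esub>x\<in>?A. v x \<odot>\<^bsub>M\<^esub> u x)"
      using A u r free_closed[OF v] by (intro M.finsum_smult_ldistr[symmetric]) auto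
    finally show "lin_ext R M u (r \<odot>\<^bsub>free_module R B\<^esub> v) = r \<odot>\<^bsub>M\<^esub> lin_ext R M u v"
      by (simp add: lin_ext_def)
  qed
qed

lemma lin_ext_basis:
  assumes "module R M" "u \<in> B \<rightarrow> carrier M" "x \<in> B"
  shows "lin_ext R M u (basis_vec R x) = u x"
proof -
  interpret M: module R M by fact
  have "lin_ext R M u (basis_vec R x) = (\<Oplus>\<^bsub>M\<^esub>y\<in>{x}. basis_vec R x y \<odot>\<^bsub>M\<^esub> u y)"
    by (rule lin_ext_eq[OF assms(1,2) basis_in_free[OF assms(3)]])
      (use assms(3) in \<open>auto simp: basis_vec_def\<close>)
  also have "\<dots> = basis_vec R x x \<odot>\<^bsub>M\<^esub> u x"
    using assms(2,3) by (subst M.M.finsum_insert) (auto simp: basis_vec_def Pi_iff)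
  also have "\<dots> = u x" using assms(2,3) by (auto simp: basis_vec_def Pi_iff)
  finally show ?thesis .
qed

text \<open>Free modules are projective: preimages of the values at the basis are chosen and
  extended linearly.\<close>

lemma free_lift:
  assumes "module R X" "module R Y" and d: "lin R X Y d" and th: "lin R (free_module R B) Y \<theta>"
    and "\<And>b. b \<in> B \<Longrightarrow> \<theta> (basis_vec R b) \<in> d ` carrier X"
  obtains h where "lin R (free_module R B) X h"
    "\<And>v. v \<in> carrier (free_module R B) \<Longrightarrow> d (h v) = \<theta> v"
proof -
  have "\<forall>b\<in>B. \<exists>x. x \<in> carrier X \<and> d x = \<theta> (basis_vec R b)"
    using assms(5) by (metis imageE)
  then obtain u where u: "\<forall>b\<in>B. u b \<in> carrier X \<and> d (u b) = \<theta> (basis_vec R b)"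
    by (auto dest!: bchoice)
  then have u': "u \<in> B \<rightarrow> carrier X" by auto
  have l: "lin R (free_module R B) X (lin_ext R X u)" by (rule lin_lin_ext[OF assms(1) u'])
  show ?thesis
  proof (rule that[OF l])
    fix v assume v: "v \<in> carrier (free_module R B)"
    show "d (lin_ext R X u v) = \<theta> v"
      by (rule lin_free_eq[OF assms(2) lin_comp[OF d l] th _ v])
        (simp add: lin_ext_basis[OF assms(1) u'] u)
  qed
qed

end

section \<open>The functorial free resolution\<close>

context module
begin

abbreviation "F \<equiv> resolution R M"
abbreviation "d \<equiv> differential R"
abbreviation "aug \<equiv> augmentation R M"

lemma resolution_module: "module R (F i)"
  unfolding resolution_def by (rule free_is_module)

lemma aug_lin: "lin R (F 0) M aug"
  unfolding resolution_def augmentation_def by (rule lin_lin_ext[OF module_axioms]) auto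

lemma aug_basis: "x \<in> carrier M \<Longrightarrow> aug (basis_vec R (Gen x)) = x"
  unfolding augmentation_def
  by (subst lin_ext_basis[OF module_axioms, where B = "Gen ` carrier M"]) auto

lemma relation_in: "z \<in> res_basis R M (Suc i) \<Longrightarrow> formal_sum R (relation_of z) \<in> carrier (F i)"
  unfolding resolution_def by (intro formal_sum_closed) (auto simp: res_basis.simps(2))

lemma d_basis: "z \<in> res_basis R M (Suc i) \<Longrightarrow> d (basis_vec R z) = formal_sum R (relation_of z)"
  unfolding differential_def
  by (rule lin_ext_basis[OF free_is_module, where B = "res_basis R M (Suc i)"])
    (use relation_in free_mono[of "res_basis R M i" UNIV] in
      \<open>auto simp: resolution_def\<close>)

lemma d_lin: "lin R (F (Suc i)) (F i) d"
  unfolding resolution_def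
proof (rule lin_free_cod)
  show "lin R (free_module R (res_basis R M (Suc i))) (free_module R UNIV) d"
    unfolding differential_def
    by (rule lin_lin_ext[OF free_is_module])
     (use relation_in free_mono[of "res_basis R M i" UNIV] in
      \<open>auto simp: resolution_def\<close>)
qed (use d_basis relation_in in \<open>simp add: resolution_def\<close>)

text \<open>Consecutive maps compose to zero, with the augmentation in the place of the next
  differential when \<open>i = 0\<close>. It holds on basis elements by the very condition that
  makes them relations.\<close>

lemma image_d_subset:
  assumes "v \<in> carrier (F (Suc i))"
  shows "if i = 0 then aug (d v) = \<zero>\<^bsub>M\<^esub> else d (d v) = \<zero>\<^bsub>free_module R UNIV\<^esub>"
proof (cases i)
  case 0
  have l: "lin R (free_module R (res_basis R M (Suc 0))) M (\<lambda>v. aug (d v))"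
    using lin_comp[OF aug_lin d_lin[of 0]] by (simp add: resolution_def)
  have "aug (d v) \<in> {\<zero>\<^bsub>M\<^esub>}"
  proof (rule lin_free_mem[OF module_axioms l submodule_trivial _ assms[unfolded 0 resolution_def]])
    fix z assume "z \<in> res_basis R M (Suc 0)"
    then show "aug (d (basis_vec R z)) \<in> {\<zero>\<^bsub>M\<^esub>}" by (auto simp: d_basis[of _ 0] res_basis.simps(2))
  qed
  with 0 show ?thesis by simp
next
  case (Suc j)
  have l: "lin R (free_module R (res_basis R M (Suc i))) (F j) (\<lambda>v. d (d v))"
    using lin_comp[OF d_lin[of j] d_lin[of "Suc j"]] by (simp add: resolution_def Suc)
  interpret Fj: module R "F j" by (rule resolution_module)
  have "d (d v) \<in> {\<zero>\<^bsub>F j\<^esub>}"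
  proof (rule lin_free_mem[OF resolution_module l Fj.submodule_trivial _ assms[unfolded resolution_def]])
    fix z assume "z \<in> res_basis R M (Suc i)"
    moreover from this obtain ws where "z = Rel ws" "d (formal_sum R ws) = \<zero>\<^bsub>free_module R UNIV\<^esub>"
      using Suc by (auto simp: res_basis.simps(2)[of R M "Suc j"])
    ultimately show "d (d (basis_vec R z)) \<in> {\<zero>\<^bsub>F j\<^esub>}"
      by (simp add: d_basis resolution_def free_simps)
  qed
  with Suc show ?thesis by (simp add: resolution_def free_simps)
qed

text \<open>Exactness by construction: a cycle is a formal sum of some list, this list is then a
  relation, and the corresponding basis element one degree higher is mapped to the cycle.\<close>

lemma cycle_in_image:
  assumes v: "v \<in> carrier (F i)" and "if i = 0 then aug v = \<zero>\<^bsub>M\<^esub> else d v = \<zero>\<^bsub>free_module R UNIV\<^esub>"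
  shows "v \<in> d ` carrier (F (Suc i))"
proof -
  obtain ws where ws: "set ws \<subseteq> carrier R \<times> res_basis R M i" "v = formal_sum R ws"
    by (rule free_rep[OF v[unfolded resolution_def]])
  then have z: "Rel ws \<in> res_basis R M (Suc i)" using assms(2) by (auto simp: res_basis.simps(2) split: if_splits)
  have "d (basis_vec R (Rel ws)) = v" using d_basis[OF z] ws by simp
  then show ?thesis
    using basis_in_free[OF z] unfolding resolution_def by (metis imageI)
qed

lemma image_d0: "d ` carrier (F (Suc 0)) = {v \<in> carrier (F 0). aug v = \<zero>\<^bsub>M\<^esub>}"
  using image_d_subset[of _ 0] cycle_in_image[of _ 0] lin_closed[OF d_lin] by auto

lemma image_d_Suc: "d ` carrier (F (Suc (Suc i))) = {v \<in> carrier (F (Suc i)). d v = \<zero>\<^bsub>F i\<^esub>}"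
  using image_d_subset[of _ "Suc i"] cycle_in_image[of _ "Suc i"] lin_closed[OF d_lin]
  by (auto simp: resolution_def free_simps)

section \<open>Chain maps induced by linear maps\<close>

lemma resolution_map_basis:
  "resolution_map R \<phi> (basis_vec R z) = basis_vec R (map_syz id \<phi> z)"
  unfolding resolution_map_def
  by (rule lin_ext_basis[OF free_is_module, where B = UNIV]) (auto intro: basis_in_free)

lemma resolution_map_lin_UNIV:
  "lin R (free_module R UNIV) (free_module R UNIV) (resolution_map R \<phi>)"
  unfolding resolution_map_def
  by (rule lin_lin_ext[OF free_is_module]) (auto intro: basis_in_free)

lemma resolution_map_lin_free:
  assumes "\<And>z. z \<in> B \<Longrightarrow> map_syz id \<phi> z \<in> C"
  shows "lin R (free_module R B) (free_module R C) (resolution_map R \<phi>)"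
proof (rule lin_free_cod)
  show "lin R (free_module R B) (free_module R UNIV) (resolution_map R \<phi>)"
    using lin_restrict_dom[OF resolution_map_lin_UNIV free_mono[of B UNIV]]
    unfolding lin_def by (simp add: free_simps)
qed (use assms in \<open>simp add: resolution_map_basis basis_in_free\<close>)

lemma resolution_map_formal_sum:
  "set ws \<subseteq> carrier R \<times> UNIV \<Longrightarrow>
    resolution_map R \<phi> (formal_sum R ws) = formal_sum R (map (map_prod id (map_syz id \<phi>)) ws)"
proof (induction ws)
  case Nil
  show ?case
    using lin_zero[OF free_is_module free_is_module resolution_map_lin_UNIV]
    by (simp add: formal_sum_Nil[of _ UNIV])
next
  case (Cons w ws)
  obtain r x where w: "w = (r, x)" by fastforce
  interpret U: module R "free_module R UNIV" by (rule free_is_module)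
  let ?\<rho> = "resolution_map R \<phi>"
  let ?U = "free_module R UNIV"
  have "formal_sum R (w # ws) = r \<odot>\<^bsub>?U\<^esub> basis_vec R x \<oplus>\<^bsub>?U\<^esub> formal_sum R ws"
    by (simp add: w formal_sum_Cons[of _ _ _ _ UNIV])
  moreover have "?\<rho> (r \<odot>\<^bsub>?U\<^esub> basis_vec R x \<oplus>\<^bsub>?U\<^esub> formal_sum R ws) =
      ?\<rho> (r \<odot>\<^bsub>?U\<^esub> basis_vec R x) \<oplus>\<^bsub>?U\<^esub> ?\<rho> (formal_sum R ws)"
    by (rule lin_add[OF resolution_map_lin_UNIV])
      (use Cons.prems w formal_sum_closed[of ws UNIV] basis_in_free[of x UNIV] in auto)
  moreover have "?\<rho> (r \<odot>\<^bsub>?U\<^esub> basis_vec R x) = r \<odot>\<^bsub>?U\<^esub> ?\<rho> (basis_vec R x)"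
    by (rule lin_smult[OF resolution_map_lin_UNIV]) (use Cons.prems w basis_in_free[of x UNIV] in auto)
  ultimately show ?case using Cons w by (simp add: resolution_map_basis formal_sum_Cons[of _ _ _ _ UNIV] id_def)
qed

end

context
  fixes R :: "('a, 'r) ring_scheme" and N' :: "('a, 'k, 's) module_scheme"
    and N :: "('a, 'n, 't) module_scheme" and \<phi>
  assumes N': "module R N'" and N: "module R N" and \<phi>: "lin R N' N \<phi>"
begin

interpretation N': module R N' by (rule N')
interpretation N: module R N by (rule N)

lemma resolution_map_aug:
  assumes "v \<in> carrier (N'.F 0)"
  shows "N.aug (resolution_map R \<phi> v) = \<phi> (N'.aug v)"
proof -
  have "lin R (N'.F 0) (N.F 0) (resolution_map R \<phi>)"
    unfolding resolution_def by (rule N.resolution_map_lin_free) (auto simp: lin_closed[OF \<phi>])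
  from lin_comp[OF N.aug_lin this] have 1: "lin R (N'.F 0) N (\<lambda>v. N.aug (resolution_map R \<phi> v))" .
  have 2: "lin R (N'.F 0) N (\<lambda>v. \<phi> (N'.aug v))" by (rule lin_comp[OF \<phi> N'.aug_lin])
  show ?thesis
    by (rule N'.lin_free_eq[OF N 1[unfolded resolution_def] 2[unfolded resolution_def] _ assms[unfolded resolution_def]])
      (auto simp: N.resolution_map_basis N.aug_basis N'.aug_basis lin_closed[OF \<phi>])
qed

text \<open>That bases go to bases is a hypothesis here because its proof, in one degree, rests on
  this very compatibility one degree lower.\<close>

lemma resolution_map_d_aux:
  assumes "\<And>z. z \<in> res_basis R N' i \<Longrightarrow> map_syz id \<phi> z \<in> res_basis R N i"
    and "\<And>z. z \<in> res_basis R N' (Suc i) \<Longrightarrow> map_syz id \<phi> z \<in> res_basis R N (Suc i)"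
    and "v \<in> carrier (N'.F (Suc i))"
  shows "N.d (resolution_map R \<phi> v) = resolution_map R \<phi> (N'.d v)"
proof -
  have l: "lin R (N'.F j) (N.F j) (resolution_map R \<phi>)" if "j = i \<or> j = Suc i" for j
    unfolding resolution_def by (rule N.resolution_map_lin_free) (use assms that in blast)
  have 1: "lin R (N'.F (Suc i)) (N.F i) (\<lambda>v. N.d (resolution_map R \<phi> v))"
    by (rule lin_comp[OF N.d_lin l]) auto
  have 2: "lin R (N'.F (Suc i)) (N.F i) (\<lambda>v. resolution_map R \<phi> (N'.d v))"
    by (rule lin_comp[OF l N'.d_lin]) auto
  show ?thesis
  proof (rule N'.lin_free_eq[OF N.resolution_module 1[unfolded resolution_def[of _ _ "Suc i"]]
        2[unfolded resolution_def[of _ _ "Suc i"]] _ assms(3)[unfolded resolution_def]])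
    fix z assume z: "z \<in> res_basis R N' (Suc i)"
    then obtain ws where ws: "z = Rel ws" "set ws \<subseteq> carrier R \<times> res_basis R N' i"
      by (auto simp: res_basis.simps(2))
    show "N.d (resolution_map R \<phi> (basis_vec R z)) = resolution_map R \<phi> (N'.d (basis_vec R z))"
      using z ws assms(2)[OF z] N.resolution_map_formal_sum[of ws \<phi>]
      by (subst N.resolution_map_basis, subst N.d_basis[of _ i], simp, subst N'.d_basis[of _ i], simp) fastforce
  qed
qed

text \<open>Strong induction: the image of a relation in degree \<open>j + 1\<close> is a relation
  because the chain map commutes with the differential leaving degree \<open>j\<close>, and that
  uses the claim in degree \<open>j\<close> and the one below.\<close>

lemma map_syz_res_basis: "z \<in> res_basis R N' i \<Longrightarrow> map_syz id \<phi> z \<in> res_basis R N i"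
proof (induction i arbitrary: z rule: less_induct)
  case (less i)
  show ?case
  proof (cases i)
    case 0
    with less.prems lin_closed[OF \<phi>] show ?thesis by auto
  next
    case (Suc j)
    from less.prems Suc obtain ws where ws: "z = Rel ws" "set ws \<subseteq> carrier R \<times> res_basis R N' j"
        "if j = 0 then N'.aug (formal_sum R ws) = \<zero>\<^bsub>N'\<^esub> else N'.d (formal_sum R ws) = \<zero>\<^bsub>free_module R UNIV\<^esub>"
      by (auto simp: res_basis.simps(2))
    let ?ws = "map (map_prod id (map_syz id \<phi>)) ws"
    have m: "formal_sum R ?ws = resolution_map R \<phi> (formal_sum R ws)"
      using N.resolution_map_formal_sum[of ws \<phi>] ws(2) by fastforce
    have ws': "set ?ws \<subseteq> carrier R \<times> res_basis R N j"
      using ws(2) less.IH[of j] Suc by fastforce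
    have v: "formal_sum R ws \<in> carrier (N'.F j)"
      unfolding resolution_def by (rule N'.formal_sum_closed[OF ws(2)])
    have "if j = 0 then N.aug (formal_sum R ?ws) = \<zero>\<^bsub>N\<^esub> else N.d (formal_sum R ?ws) = \<zero>\<^bsub>free_module R UNIV\<^esub>"
    proof (cases j)
      case 0
      then show ?thesis using ws(3) v resolution_map_aug lin_zero[OF N' N \<phi>] by (simp add: m)
    next
      case (Suc k)
      have "N.d (resolution_map R \<phi> (formal_sum R ws)) = resolution_map R \<phi> (N'.d (formal_sum R ws))"
        by (rule resolution_map_d_aux[of k, OF less.IH less.IH]) (use v \<open>i = Suc j\<close> Suc in simp_all)
      then show ?thesis
        using Suc ws(3) lin_zero[OF N'.free_is_module N'.free_is_module N.resolution_map_lin_UNIV]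
        by (simp add: m)
    qed
    moreover have "map_syz id \<phi> z = Rel ?ws" by (simp only: ws(1) syz.map)
    ultimately show ?thesis using ws' unfolding Suc res_basis.simps(2) by blast
  qed
qed

lemma resolution_map_lin: "lin R (N'.F i) (N.F i) (resolution_map R \<phi>)"
  unfolding resolution_def by (rule N.resolution_map_lin_free) (rule map_syz_res_basis)

lemma resolution_map_d: "v \<in> carrier (N'.F (Suc i)) \<Longrightarrow> N.d (resolution_map R \<phi> v) = resolution_map R \<phi> (N'.d v)"
  by (rule resolution_map_d_aux[OF map_syz_res_basis map_syz_res_basis])

end

section \<open>Free presentations of cyclic modules\<close>

text \<open>A presentation consists of the first two terms of a free resolution of a cyclic module
  \<open>R/\<aa>\<close>, given by their bases, a lift of the generator of \<open>R/\<aa>\<close>, the kernel of the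
  augmentation and the differential. Only this much is needed for \<open>Ext\<^sup>i\<close> with \<open>i \<le> 2\<close>: for
  positive \<open>i\<close>, classes of \<open>Ext\<^sup>i\<close> are linear maps on the \<open>i\<close>-th syzygy, modulo those that extend
  to the free module containing it.\<close>

record ('a, 'b) pres =
  gens :: "'b set"
  rels :: "'b set"
  unit :: "'b \<Rightarrow> 'a"
  ker :: "('b \<Rightarrow> 'a) set"
  diff :: "('b \<Rightarrow> 'a) \<Rightarrow> 'b \<Rightarrow> 'a"

locale presentation = cring R for R (structure) +
  fixes A :: "('a, 'e) pres"
  assumes unit_closed: "unit A \<in> carrier (free_module R (gens A))"
    and ker_submodule: "submodule (ker A) R (free_module R (gens A))"
    and unit_spans: "v \<in> carrier (free_module R (gens A)) \<Longrightarrow>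
      \<exists>a\<in>carrier R. \<exists>k\<in>ker A. v = a \<odot>\<^bsub>free_module R (gens A)\<^esub> unit A \<oplus>\<^bsub>free_module R (gens A)\<^esub> k"
    and diff_lin: "lin R (free_module R (rels A)) (free_module R (gens A)) (diff A)"
    and diff_image: "diff A ` carrier (free_module R (rels A)) = ker A"

text \<open>The annihilator of the generator: the presented module is \<open>R\<close> modulo this
  ideal.\<close>

definition pres_ideal :: "('a, 'r) ring_scheme \<Rightarrow> ('a, 'b) pres \<Rightarrow> 'a set" where
  "pres_ideal R A = {a \<in> carrier R. a \<odot>\<^bsub>free_module R (gens A)\<^esub> unit A \<in> ker A}"

text \<open>A chain map lifting the map of cyclic modules that takes generator to generator; the
  last conjunct expresses this modulo the kernel of the augmentation.\<close>

definition unital_map ::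
    "('a, 'r) ring_scheme \<Rightarrow> ('a, 'b) pres \<Rightarrow> ('a, 'c) pres \<Rightarrow>
      (nat \<Rightarrow> ('b \<Rightarrow> 'a) \<Rightarrow> 'c \<Rightarrow> 'a) \<Rightarrow> bool" where
  "unital_map R A B \<phi> \<longleftrightarrow>
    lin R (free_module R (gens A)) (free_module R (gens B)) (\<phi> 0) \<and>
    lin R (free_module R (rels A)) (free_module R (rels B)) (\<phi> 1) \<and>
    (\<forall>v\<in>carrier (free_module R (rels A)). diff B (\<phi> 1 v) = \<phi> 0 (diff A v)) \<and>
    (\<exists>k\<in>ker B. \<phi> 0 (unit A) = unit B \<oplus>\<^bsub>free_module R (gens B)\<^esub> k)"

text \<open>The first syzygy lies in the free module on the generators, the second in that on the
  relations; in degree 0 the whole module counts as syzygy. \<open>degree_part\<close> selects the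
  component of a chain map in the same way.\<close>

definition ambient :: "('a, 'r) ring_scheme \<Rightarrow> ('a, 'b) pres \<Rightarrow> nat \<Rightarrow> ('a, 'b \<Rightarrow> 'a) module" where
  "ambient R A i = free_module R (if i \<le> 1 then gens A else rels A)"

definition syzygy :: "('a, 'r) ring_scheme \<Rightarrow> ('a, 'b) pres \<Rightarrow> nat \<Rightarrow> ('b \<Rightarrow> 'a) set" where
  "syzygy R A i =
    (if i = 0 then carrier (ambient R A 0) else if i = 1 then ker A
     else {v \<in> carrier (ambient R A 2). diff A v = \<zero>\<^bsub>free_module R (gens A)\<^esub>})"

definition ext_class ::
    "('a, 'r) ring_scheme \<Rightarrow> ('a, 'b) pres \<Rightarrow> ('a, 'm, 's) module_scheme \<Rightarrow> nat \<Rightarrow> (('b \<Rightarrow> 'a) \<Rightarrow> 'm) \<Rightarrow> bool"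
  where
  "ext_class R A M i g \<longleftrightarrow> lin R (ambient R A i\<lparr>carrier := syzygy R A i\<rparr>) M g \<and>
    (i = 0 \<longrightarrow> (\<forall>v\<in>ker A. g v = \<zero>\<^bsub>M\<^esub>))"

definition ext_null ::
    "('a, 'r) ring_scheme \<Rightarrow> ('a, 'b) pres \<Rightarrow> ('a, 'm, 's) module_scheme \<Rightarrow> nat \<Rightarrow> (('b \<Rightarrow> 'a) \<Rightarrow> 'm) \<Rightarrow> bool"
  where
  "ext_null R A M i g \<longleftrightarrow>
    (if i = 0 then \<forall>v\<in>syzygy R A 0. g v = \<zero>\<^bsub>M\<^esub>
     else \<exists>G. lin R (ambient R A i) M G \<and> (\<forall>v\<in>syzygy R A i. G v = g v))"

definition degree_part :: "(nat \<Rightarrow> 'x) \<Rightarrow> nat \<Rightarrow> 'x" where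
  "degree_part \<phi> i = \<phi> (if i \<le> 1 then 0 else 1)"

text \<open>Annihilation by \<open>y\<close> of the direct limit of the Ext modules of a sequence of
  presentations. No transition maps are fixed: by \<open>ext_null_indep\<close> all unital maps give
  the same answer.\<close>

definition kills ::
    "('a, 'r) ring_scheme \<Rightarrow> (nat \<Rightarrow> ('a, 'b) pres) \<Rightarrow> ('a, 'm, 's) module_scheme \<Rightarrow> nat \<Rightarrow> 'a \<Rightarrow> bool"
  where
  "kills R A M i y \<longleftrightarrow> (\<forall>n g. ext_class R (A n) M i g \<longrightarrow>
    (\<exists>m\<ge>n. \<exists>\<phi>. unital_map R (A m) (A n) \<phi> \<and>
      ext_null R (A m) M i (\<lambda>v. y \<odot>\<^bsub>M\<^esub> g (degree_part \<phi> i v))))"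

lemma ext_class_closed: "ext_class R A M i g \<Longrightarrow> v \<in> syzygy R A i \<Longrightarrow> g v \<in> carrier M"
  and ext_class_add: "ext_class R A M i g \<Longrightarrow> v \<in> syzygy R A i \<Longrightarrow> w \<in> syzygy R A i \<Longrightarrow>
      g (v \<oplus>\<^bsub>ambient R A i\<^esub> w) = g v \<oplus>\<^bsub>M\<^esub> g w"
  and ext_class_smult: "ext_class R A M i g \<Longrightarrow> r \<in> carrier R \<Longrightarrow> v \<in> syzygy R A i \<Longrightarrow>
      g (r \<odot>\<^bsub>ambient R A i\<^esub> v) = r \<odot>\<^bsub>M\<^esub> g v"
  by (auto simp: ext_class_def lin_def)

context presentation
begin

abbreviation "C0 \<equiv> free_module R (gens A)"
abbreviation "C1 \<equiv> free_module R (rels A)"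

sublocale C0: module R C0 by (rule free_is_module)
sublocale C1: module R C1 by (rule free_is_module)

lemma ker_subset: "ker A \<subseteq> carrier C0"
  by (rule C0.submoduleE(1)[OF ker_submodule])

lemmas ker_add = C0.submoduleE(5)[OF ker_submodule]
  and ker_smult = C0.submoduleE(4)[OF ker_submodule]

lemma ambient_module: "module R (ambient R A i)"
  unfolding ambient_def by (rule free_is_module)

lemma syzygy_submodule: "submodule (syzygy R A i) R (ambient R A i)"
proof -
  interpret amb: module R "ambient R A i" by (rule ambient_module)
  consider "i = 0" | "i = 1" | "i \<ge> 2" by linarith
  then show ?thesis
    by cases (use amb.carrier_is_submodule ker_submodule C1.submodule_ker[OF C0.module_axioms diff_lin]
      in \<open>auto simp: syzygy_def ambient_def\<close>)
qed

lemma syzygy_subset: "syzygy R A i \<subseteq> carrier (ambient R A i)"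
  using syzygy_submodule ambient_module module.submoduleE(1) by blast

end

section \<open>Chain maps between presentations\<close>

lemma unital_map_ker:
  assumes "presentation R A" "presentation R B" "unital_map R A B \<phi>" "k \<in> ker A"
  shows "\<phi> 0 k \<in> ker B"
proof -
  interpret A: presentation R A by fact
  interpret B: presentation R B by fact
  \<comment> \<open>The kernel of the augmentation is the image of \<open>diff A\<close>, so
    compatibility with the differentials decides where \<open>k\<close> goes.\<close>
  obtain w where "w \<in> carrier A.C1" "k = diff A w" using assms(4) A.diff_image by auto
  moreover from this have "\<phi> 1 w \<in> carrier B.C1" using assms(3) by (auto simp: unital_map_def lin_def)
  ultimately show ?thesis
    using assms(3) B.diff_image by (metis imageI unital_map_def)
qed

lemma unital_map_lin:
  assumes "unital_map R A B \<phi>"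
  shows "lin R (ambient R A i) (ambient R B i) (degree_part \<phi> i)"
  using assms by (auto simp: unital_map_def ambient_def degree_part_def)

lemma unital_map_syzygy:
  assumes "presentation R A" "presentation R B" "unital_map R A B \<phi>" "v \<in> syzygy R A i"
  shows "degree_part \<phi> i v \<in> syzygy R B i"
proof -
  interpret A: presentation R A by fact
  interpret B: presentation R B by fact
  consider "i = 0" | "i = 1" | "i \<ge> 2" by linarith
  then show ?thesis
  proof cases
    case 1
    then show ?thesis using assms(3,4) by (auto simp: syzygy_def ambient_def degree_part_def unital_map_def lin_def)
  next
    case 2
    then show ?thesis using unital_map_ker[OF assms(1-3)] assms(4) by (auto simp: syzygy_def degree_part_def)
  next
    case 3
    then have "v \<in> carrier A.C1" "diff A v = \<zero>\<^bsub>A.C0\<^esub>" using assms(4) by (auto simp: syzygy_def ambient_def)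
    moreover have "\<phi> 0 \<zero>\<^bsub>A.C0\<^esub> = \<zero>\<^bsub>B.C0\<^esub>"
      using lin_zero[OF A.C0.module_axioms B.C0.module_axioms] assms(3) by (auto simp: unital_map_def)
    ultimately show ?thesis
      using 3 assms(3) by (auto simp: syzygy_def degree_part_def ambient_def unital_map_def lin_def)
  qed
qed

lemma ext_class_pullback:
  assumes "presentation R A" "presentation R B" "unital_map R A B \<phi>" "ext_class R B M i g"
  shows "ext_class R A M i (\<lambda>v. g (degree_part \<phi> i v))"
proof -
  interpret A: presentation R A by fact
  have l: "lin R (ambient R A i\<lparr>carrier := syzygy R A i\<rparr>) (ambient R B i\<lparr>carrier := syzygy R B i\<rparr>) (degree_part \<phi> i)"
    by (rule lin_restrict_cod[OF lin_restrict_dom[OF unital_map_lin[OF assms(3)] A.syzygy_subset]])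
      (use unital_map_syzygy[OF assms(1-3)] in auto)
  show ?thesis
    using lin_comp[OF _ l] assms(4) unital_map_ker[OF assms(1-3)]
    by (auto simp: ext_class_def degree_part_def)
qed

lemma ext_null_pullback:
  assumes "presentation R A" "presentation R B" "unital_map R A B \<phi>" "ext_null R B M i g"
  shows "ext_null R A M i (\<lambda>v. g (degree_part \<phi> i v))"
proof (cases "i = 0")
  case True
  then show ?thesis
    using assms(4) unital_map_syzygy[OF assms(1-3), of _ 0] by (auto simp: ext_null_def)
next
  case False
  with assms(4) obtain G where "lin R (ambient R B i) M G" "\<forall>v\<in>syzygy R B i. G v = g v"
    by (auto simp: ext_null_def)
  then show ?thesis
    using False lin_comp[OF _ unital_map_lin[OF assms(3)]] unital_map_syzygy[OF assms(1-3), of _ i]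
    by (auto simp: ext_null_def intro!: exI[of _ "\<lambda>v. G (degree_part \<phi> i v)"])
qed

lemma ext_class_scale:
  assumes "module R M" "ext_class R B M i g" "y \<in> carrier R"
  shows "ext_class R B M i (\<lambda>v. y \<odot>\<^bsub>M\<^esub> g v)"
proof -
  interpret M: module R M by fact
  show ?thesis
    using assms lin_scale[OF assms(1) _ assms(3)] by (auto simp: ext_class_def)
qed

lemma unital_map_comp:
  assumes "presentation R A" "presentation R B" "presentation R C"
    and f: "unital_map R A B \<phi>" and g: "unital_map R B C \<psi>"
  shows "unital_map R A C (\<lambda>j v. \<psi> j (\<phi> j v))"
proof -
  interpret A: presentation R A by fact
  interpret B: presentation R B by fact
  interpret C: presentation R C by fact
  note f' = f[unfolded unital_map_def] and g' = g[unfolded unital_map_def]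
  obtain k where k: "k \<in> ker B" "\<phi> 0 (unit A) = unit B \<oplus>\<^bsub>B.C0\<^esub> k" using f' by blast
  obtain l where l: "l \<in> ker C" "\<psi> 0 (unit B) = unit C \<oplus>\<^bsub>C.C0\<^esub> l" using g' by blast
  have pk: "\<psi> 0 k \<in> ker C" by (rule unital_map_ker[OF assms(2,3) g k(1)])
  have "\<psi> 0 (\<phi> 0 (unit A)) = (unit C \<oplus>\<^bsub>C.C0\<^esub> l) \<oplus>\<^bsub>C.C0\<^esub> \<psi> 0 k"
    using g' k B.unit_closed B.ker_subset l by (auto simp: lin_def)
  also have "\<dots> = unit C \<oplus>\<^bsub>C.C0\<^esub> (l \<oplus>\<^bsub>C.C0\<^esub> \<psi> 0 k)"
    using l(1) pk C.ker_subset C.unit_closed by (intro C.C0.M.a_assoc) auto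
  finally have "\<exists>k\<in>ker C. \<psi> 0 (\<phi> 0 (unit A)) = unit C \<oplus>\<^bsub>C.C0\<^esub> k"
    using C.ker_add[OF l(1) pk] by blast
  then show ?thesis
    using f' g' lin_comp[of R B.C0 C.C0 "\<psi> 0"] lin_comp[of R B.C1 C.C1 "\<psi> 1"]
    by (auto simp: unital_map_def lin_closed)
qed

text \<open>The comparison theorem for projective resolutions. Modulo the kernel every basis vector
  is a multiple of the generator; sending it to the same multiple of \<open>unit B\<close> gives the
  map in degree 0, and projectivity lifts it to the relations.\<close>

lemma unital_map_exists:
  assumes "presentation R A" "presentation R B" and sub: "pres_ideal R A \<subseteq> pres_ideal R B"
  obtains \<phi> where "unital_map R A B \<phi>"
proof -
  interpret A: presentation R A by fact
  interpret B: presentation R B by fact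
  have "\<forall>b\<in>gens A. \<exists>a. a \<in> carrier R \<and> (\<exists>k\<in>ker A. basis_vec R b = a \<odot>\<^bsub>A.C0\<^esub> unit A \<oplus>\<^bsub>A.C0\<^esub> k)"
    using A.unit_spans[OF A.basis_in_free] by blast
  then obtain u where u: "\<forall>b\<in>gens A. u b \<in> carrier R \<and>
      (\<exists>k\<in>ker A. basis_vec R b = u b \<odot>\<^bsub>A.C0\<^esub> unit A \<oplus>\<^bsub>A.C0\<^esub> k)"
    by (auto dest!: bchoice)
  interpret Rm: module R "regular_module R" by (rule A.module_regular)
  let ?a = "lin_ext R (regular_module R) u"
  have u': "u \<in> gens A \<rightarrow> carrier (regular_module R)" using u by auto
  have a: "lin R A.C0 (regular_module R) ?a" by (rule A.lin_lin_ext[OF A.module_regular u'])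
  have ac: "?a v \<in> carrier R" if "v \<in> carrier A.C0" for v using lin_closed[OF a that] by simp
  have mult: "lin R A.C0 B' (\<lambda>v. ?a v \<odot>\<^bsub>B'\<^esub> x)" if "module R B'" "x \<in> carrier B'"
    for B' :: "('a, 'x) module" and x
  proof -
    interpret B': module R B' by fact
    show ?thesis
      using a that(2) by (intro linI) (auto simp: lin_def Pi_iff B'.smult_l_distr B'.smult_assoc1)
  qed
  \<comment> \<open>The part of \<open>v\<close> in the kernel: \<open>v\<close> minus its multiple
    of the generator.\<close>
  let ?e = "\<lambda>v. v \<ominus>\<^bsub>A.C0\<^esub> ?a v \<odot>\<^bsub>A.C0\<^esub> unit A"
  have e: "?e v \<in> ker A" if v: "v \<in> carrier A.C0" for v
  proof (rule A.lin_free_mem[OF A.C0.module_axioms lin_sub[OF A.C0.module_axioms _ mult[OF A.C0.module_axioms A.unit_closed]]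
        A.ker_submodule _ v])
    show "lin R A.C0 A.C0 (\<lambda>v. v)" by (rule linI) auto
    fix b assume b: "b \<in> gens A"
    then obtain k where k: "k \<in> ker A" "basis_vec R b = u b \<odot>\<^bsub>A.C0\<^esub> unit A \<oplus>\<^bsub>A.C0\<^esub> k" and ub: "u b \<in> carrier R"
      using u by blast
    have ab: "?a (basis_vec R b) = u b" by (rule A.lin_ext_basis[OF A.module_regular u' b])
    let ?x = "u b \<odot>\<^bsub>A.C0\<^esub> unit A"
    have x: "?x \<in> carrier A.C0" "k \<in> carrier A.C0" using ub A.unit_closed k A.ker_subset by auto
    have "(?x \<oplus>\<^bsub>A.C0\<^esub> k) \<ominus>\<^bsub>A.C0\<^esub> ?x = k"
      using x by (simp add: a_minus_def A.C0.M.a_comm[of "u b \<odot>\<^bsub>A.C0\<^esub> unit A" k] A.C0.M.a_assoc A.C0.M.r_neg)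
    then show "?e (basis_vec R b) \<in> ker A"
      unfolding ab using k by simp
  qed
  have split: "?a v \<odot>\<^bsub>A.C0\<^esub> unit A \<oplus>\<^bsub>A.C0\<^esub> ?e v = v" if v: "v \<in> carrier A.C0" for v
    using v ac[OF v] A.unit_closed
    by (simp add: a_minus_def A.C0.M.a_comm A.C0.M.a_lcomm A.C0.M.r_neg)
  define \<phi>0 where "\<phi>0 v = ?a v \<odot>\<^bsub>B.C0\<^esub> unit B" for v
  have l0: "lin R A.C0 B.C0 \<phi>0" unfolding \<phi>0_def by (rule mult[OF B.C0.module_axioms B.unit_closed])
  \<comment> \<open>For \<open>v\<close> in the kernel, the multiple of the generator, which is
    \<open>v\<close> minus \<open>?e v\<close>, is in the kernel too. So its coefficient annihilates
    the generator of the first module, hence by assumption that of the second.\<close>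
  have in_ker: "\<phi>0 v \<in> ker B" if "v \<in> ker A" for v
  proof -
    have v: "v \<in> carrier A.C0" using that A.ker_subset by auto
    have "v \<ominus>\<^bsub>A.C0\<^esub> ?e v \<in> ker A" by (rule A.C0.submodule_diff[OF A.ker_submodule that e[OF v]])
    moreover have "v \<ominus>\<^bsub>A.C0\<^esub> ?e v = ?a v \<odot>\<^bsub>A.C0\<^esub> unit A"
      using v ac[OF v] A.unit_closed by (simp add: a_minus_def A.C0.M.minus_add A.C0.M.r_neg1 A.C0.M.r_neg2 A.C0.M.a_ac)
    ultimately have "?a v \<in> pres_ideal R A" using ac[OF v] by (simp add: pres_ideal_def)
    then show ?thesis using sub by (auto simp: pres_ideal_def \<phi>0_def)
  qed
  have l1: "lin R A.C1 B.C0 (\<lambda>v. \<phi>0 (diff A v))" by (rule lin_comp[OF l0 A.diff_lin])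
  obtain \<phi>1 where \<phi>1: "lin R A.C1 B.C1 \<phi>1" "\<And>v. v \<in> carrier A.C1 \<Longrightarrow> diff B (\<phi>1 v) = \<phi>0 (diff A v)"
  proof (rule A.free_lift[OF B.C1.module_axioms B.C0.module_axioms B.diff_lin l1])
    fix b assume "b \<in> rels A"
    then show "\<phi>0 (diff A (basis_vec R b)) \<in> diff B ` carrier B.C1"
      using in_ker imageI[OF A.basis_in_free, of b "rels A" "diff A"] by (simp add: A.diff_image B.diff_image)
  qed blast
  \<comment> \<open>The coefficient assigned to \<open>unit A\<close> itself need not be
    \<open>\<one>\<close>, but it differs from \<open>\<one>\<close> by an element annihilating the
    generator; this difference provides the correction term \<open>?k\<close>.\<close>
  have "?e (unit A) \<in> ker A" using e A.unit_closed by blast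
  moreover have "?e (unit A) = (\<one>\<^bsub>R\<^esub> \<ominus>\<^bsub>R\<^esub> ?a (unit A)) \<odot>\<^bsub>A.C0\<^esub> unit A"
    using A.unit_closed ac[OF A.unit_closed] by (simp add: a_minus_def A.C0.smult_l_distr A.C0.smult_l_minus)
  moreover have "\<one>\<^bsub>R\<^esub> \<ominus>\<^bsub>R\<^esub> ?a (unit A) \<in> carrier R"
    using ac[OF A.unit_closed] by (simp add: a_minus_def)
  ultimately have "\<one>\<^bsub>R\<^esub> \<ominus>\<^bsub>R\<^esub> ?a (unit A) \<in> pres_ideal R B"
    using sub by (auto simp: pres_ideal_def)
  then have k: "(\<ominus>\<^bsub>R\<^esub> \<one>\<^bsub>R\<^esub>) \<odot>\<^bsub>B.C0\<^esub> ((\<one>\<^bsub>R\<^esub> \<ominus>\<^bsub>R\<^esub> ?a (unit A)) \<odot>\<^bsub>B.C0\<^esub> unit B) \<in> ker B" (is "?k \<in> _")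
    by - (rule B.ker_smult, auto simp: pres_ideal_def)
  have "\<phi>0 (unit A) = unit B \<oplus>\<^bsub>B.C0\<^esub> ?k"
    using ac[OF A.unit_closed] B.unit_closed
    by (simp add: \<phi>0_def a_minus_def B.C0.smult_l_distr B.C0.smult_l_minus B.C0.M.minus_add B.C0.M.r_neg2)
  then have "unital_map R A B (\<lambda>j. if j = 0 then \<phi>0 else \<phi>1)"
    using l0 \<phi>1 k by (auto simp: unital_map_def)
  then show ?thesis by (rule that)
qed

text \<open>Both maps induce the same map of cyclic modules: on \<open>a\<close> times the generator
  plus \<open>k\<close> the contributions of \<open>a \<odot> unit B\<close> cancel and only kernel
  elements remain.\<close>

lemma unital_map_diff:
  assumes "presentation R A" "presentation R B"
    and f: "unital_map R A B \<phi>" and g: "unital_map R A B \<psi>" and v: "v \<in> carrier (free_module R (gens A))"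
  shows "\<phi> 0 v \<oplus>\<^bsub>free_module R (gens B)\<^esub> (\<ominus>\<^bsub>R\<^esub> \<one>\<^bsub>R\<^esub>) \<odot>\<^bsub>free_module R (gens B)\<^esub> \<psi> 0 v \<in> ker B"
proof -
  interpret A: presentation R A by fact
  interpret B: presentation R B by fact
  note f' = f[unfolded unital_map_def] and g' = g[unfolded unital_map_def]
  obtain a k where a: "a \<in> carrier R" and k: "k \<in> ker A" "v = a \<odot>\<^bsub>A.C0\<^esub> unit A \<oplus>\<^bsub>A.C0\<^esub> k"
    using A.unit_spans[OF v] by blast
  obtain p where p: "p \<in> ker B" "\<phi> 0 (unit A) = unit B \<oplus>\<^bsub>B.C0\<^esub> p" using f' by blast
  obtain q where q: "q \<in> ker B" "\<psi> 0 (unit A) = unit B \<oplus>\<^bsub>B.C0\<^esub> q" using g' by blast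
  note pk = unital_map_ker[OF assms(1,2) f k(1)] and qk = unital_map_ker[OF assms(1,2) g k(1)]
  have lp: "lin R A.C0 B.C0 (\<phi> 0)" and lq: "lin R A.C0 B.C0 (\<psi> 0)" using f' g' by auto
  have kc: "k \<in> carrier A.C0" and c: "\<And>x. x \<in> ker B \<Longrightarrow> x \<in> carrier B.C0"
    using k(1) A.ker_subset B.ker_subset by auto
  have m: "\<ominus>\<^bsub>R\<^esub> \<one>\<^bsub>R\<^esub> \<in> carrier R" by simp
  let ?X = "a \<odot>\<^bsub>B.C0\<^esub> unit B"
  have X: "?X \<in> carrier B.C0" "a \<odot>\<^bsub>B.C0\<^esub> p \<in> carrier B.C0" "a \<odot>\<^bsub>B.C0\<^esub> q \<in> carrier B.C0"
    using a B.unit_closed c[OF p(1)] c[OF q(1)] by auto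
  have v': "\<phi> 0 v = (?X \<oplus>\<^bsub>B.C0\<^esub> a \<odot>\<^bsub>B.C0\<^esub> p) \<oplus>\<^bsub>B.C0\<^esub> \<phi> 0 k" "\<psi> 0 v = (?X \<oplus>\<^bsub>B.C0\<^esub> a \<odot>\<^bsub>B.C0\<^esub> q) \<oplus>\<^bsub>B.C0\<^esub> \<psi> 0 k"
    using a k A.unit_closed kc c[OF p(1)] c[OF q(1)] B.unit_closed p q
    by (simp_all add: lin_add[OF lp] lin_add[OF lq] lin_smult[OF lp] lin_smult[OF lq] B.C0.smult_r_distr)
  have "\<phi> 0 v \<oplus>\<^bsub>B.C0\<^esub> (\<ominus>\<^bsub>R\<^esub> \<one>\<^bsub>R\<^esub>) \<odot>\<^bsub>B.C0\<^esub> \<psi> 0 v =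
      (a \<odot>\<^bsub>B.C0\<^esub> p \<oplus>\<^bsub>B.C0\<^esub> (\<ominus>\<^bsub>R\<^esub> a) \<odot>\<^bsub>B.C0\<^esub> q) \<oplus>\<^bsub>B.C0\<^esub> (\<phi> 0 k \<oplus>\<^bsub>B.C0\<^esub> (\<ominus>\<^bsub>R\<^esub> \<one>\<^bsub>R\<^esub>) \<odot>\<^bsub>B.C0\<^esub> \<psi> 0 k)"
    unfolding v' using B.C0.M.diff_cancel_common[OF X(1,2) c[OF pk] X(3) c[OF qk]] X a c[OF pk] c[OF qk] c[OF q(1)]
    by (simp add: B.C0.smult_l_minus)
  also have "\<dots> \<in> ker B"
    using a p q pk qk by (intro B.ker_add B.ker_smult) auto
  finally show ?thesis .
qed

text \<open>The two maps are homotopic, and the homotopy provides the extension of the difference of the classes.\<close>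

lemma ext_null_indep:
  assumes "presentation R A" "presentation R B" "module R M"
    and f: "unital_map R A B \<phi>" and g: "unital_map R A B \<psi>"
    and c: "ext_class R B M i c" and null: "ext_null R A M i (\<lambda>v. c (degree_part \<phi> i v))"
  shows "ext_null R A M i (\<lambda>v. c (degree_part \<psi> i v))"
proof -
  interpret A: presentation R A by fact
  interpret B: presentation R B by fact
  interpret M: module R M by fact
  let ?m = "\<ominus>\<^bsub>R\<^esub> \<one>\<^bsub>R\<^esub>"
  have m: "?m \<in> carrier R" by simp
  note f' = f[unfolded unital_map_def] and g' = g[unfolded unital_map_def]
  note D = unital_map_diff[OF assms(1,2) f g]
  have neg: "x \<oplus>\<^bsub>M\<^esub> ?m \<odot>\<^bsub>M\<^esub> (x \<oplus>\<^bsub>M\<^esub> ?m \<odot>\<^bsub>M\<^esub> y) = y" if "x \<in> carrier M" "y \<in> carrier M" for x y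
    using that by (simp add: M.smult_l_minus M.smult_r_minus M.smult_r_distr M.minus_add M.M.r_neg2)
  consider "i = 0" | "i = 1" | "i \<ge> 2" by linarith
  then show ?thesis
  proof cases
    case 1
    have "c (\<psi> 0 v) = \<zero>\<^bsub>M\<^esub>" if v: "v \<in> carrier A.C0" for v
    proof -
      have s: "\<phi> 0 v \<in> syzygy R B 0" "\<psi> 0 v \<in> syzygy R B 0" "\<phi> 0 v \<in> carrier B.C0" "\<psi> 0 v \<in> carrier B.C0"
        using v f' g' by (auto simp: syzygy_def ambient_def lin_def)
      have "\<zero>\<^bsub>M\<^esub> = c (\<phi> 0 v \<oplus>\<^bsub>B.C0\<^esub> ?m \<odot>\<^bsub>B.C0\<^esub> \<psi> 0 v)"
        using c D[OF v] 1 by (auto simp: ext_class_def)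
      also have "\<dots> = c (\<phi> 0 v) \<oplus>\<^bsub>M\<^esub> ?m \<odot>\<^bsub>M\<^esub> c (\<psi> 0 v)"
        using ext_class_add[OF c[unfolded 1]] ext_class_smult[OF c[unfolded 1] m] s m
        by (simp add: ambient_def syzygy_def)
      also have "\<dots> = \<ominus>\<^bsub>M\<^esub> c (\<psi> 0 v)"
        using null v ext_class_closed[OF c[unfolded 1] s(2)] 1
        by (simp add: ext_null_def syzygy_def ambient_def degree_part_def M.smult_l_minus)
      finally show ?thesis
        using M.M.r_neg[OF ext_class_closed[OF c[unfolded 1] s(2)]] ext_class_closed[OF c[unfolded 1] s(2)]
        by simp
    qed
    then show ?thesis using 1 by (simp add: ext_null_def syzygy_def ambient_def degree_part_def)
  next
    case 2
    then obtain G where G: "lin R A.C0 M G" "\<And>v. v \<in> ker A \<Longrightarrow> G v = c (\<phi> 0 v)"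
      using null by (auto simp: ext_null_def syzygy_def ambient_def degree_part_def)
    have cl: "lin R (B.C0\<lparr>carrier := ker B\<rparr>) M c"
      using c 2 by (auto simp: ext_class_def syzygy_def ambient_def)
    \<comment> \<open>The difference of the two maps takes the whole free module into the kernel,
      where \<open>c\<close> is defined. Hence \<open>c\<close> composed with it is a map on the
      ambient module, and subtracting it from \<open>G\<close> yields the wanted extension.\<close>
    let ?D = "\<lambda>v. \<phi> 0 v \<oplus>\<^bsub>B.C0\<^esub> ?m \<odot>\<^bsub>B.C0\<^esub> \<psi> 0 v"
    have "lin R A.C0 B.C0 ?D"
      by (rule lin_plus[OF B.C0.module_axioms _ lin_scale[OF B.C0.module_axioms _ m]]) (use f' g' in auto)
    from lin_comp[OF cl lin_restrict_cod[OF this D]]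
    have l: "lin R A.C0 M (\<lambda>v. G v \<oplus>\<^bsub>M\<^esub> ?m \<odot>\<^bsub>M\<^esub> c (?D v))"
      by (intro lin_plus[OF assms(3) G(1)] lin_scale[OF assms(3) _ m])
    have "G v \<oplus>\<^bsub>M\<^esub> ?m \<odot>\<^bsub>M\<^esub> c (?D v) = c (\<psi> 0 v)" if v: "v \<in> ker A" for v
    proof -
      note k = unital_map_ker[OF assms(1,2) f v] unital_map_ker[OF assms(1,2) g v]
      have "c (?D v) = c (\<phi> 0 v) \<oplus>\<^bsub>M\<^esub> ?m \<odot>\<^bsub>M\<^esub> c (\<psi> 0 v)"
        using lin_add[OF cl, of "\<phi> 0 v" "?m \<odot>\<^bsub>B.C0\<^esub> \<psi> 0 v"] lin_smult[OF cl m, of "\<psi> 0 v"] k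
          B.ker_smult[OF m k(2)] by simp
      then show ?thesis using neg k lin_closed[OF cl] by (simp add: G(2)[OF v])
    qed
    then show ?thesis
      using 2 l by (auto simp: ext_null_def syzygy_def ambient_def degree_part_def)
  next
    case 3
    then obtain G where G: "lin R A.C1 M G"
        "\<And>v. v \<in> carrier A.C1 \<Longrightarrow> diff A v = \<zero>\<^bsub>A.C0\<^esub> \<Longrightarrow> G v = c (\<phi> 1 v)"
      using null by (auto simp: ext_null_def syzygy_def ambient_def degree_part_def)
    let ?Z = "{v \<in> carrier B.C1. diff B v = \<zero>\<^bsub>B.C0\<^esub>}"
    have cl: "lin R (B.C1\<lparr>carrier := ?Z\<rparr>) M c"
      using c 3 by (auto simp: ext_class_def syzygy_def ambient_def)
    let ?D = "\<lambda>v. \<phi> 0 v \<oplus>\<^bsub>B.C0\<^esub> ?m \<odot>\<^bsub>B.C0\<^esub> \<psi> 0 v"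
    have lD: "lin R A.C0 B.C0 ?D"
      by (rule lin_plus[OF B.C0.module_axioms _ lin_scale[OF B.C0.module_axioms _ m]]) (use f' g' in auto)
    \<comment> \<open>The homotopy: the difference of the maps in degree 0 has values in the image
      of \<open>diff B\<close> and therefore lifts.\<close>
    obtain h where h: "lin R A.C0 B.C1 h" "\<And>v. v \<in> carrier A.C0 \<Longrightarrow> diff B (h v) = ?D v"
      by (rule A.free_lift[OF B.C1.module_axioms B.C0.module_axioms B.diff_lin lD])
        (use D[OF A.basis_in_free] B.diff_image in auto)
    \<comment> \<open>The difference in degree 1 corrected by the homotopy takes all vectors to
      cycles, so \<open>c\<close> may be applied to it. On cycles the correction term
      vanishes.\<close>
    let ?E = "\<lambda>v. \<phi> 1 v \<oplus>\<^bsub>B.C1\<^esub> ?m \<odot>\<^bsub>B.C1\<^esub> (\<psi> 1 v \<oplus>\<^bsub>B.C1\<^esub> h (diff A v))"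
    have lE: "lin R A.C1 B.C1 ?E"
      by (intro lin_plus[OF B.C1.module_axioms] lin_scale[OF B.C1.module_axioms _ m] lin_comp[OF h(1)] A.diff_lin)
        (use f' g' in auto)
    have closed: "\<phi> 1 v \<in> carrier B.C1" "\<psi> 1 v \<in> carrier B.C1" "diff A v \<in> carrier A.C0"
        "\<phi> 0 (diff A v) \<in> carrier B.C0" "\<psi> 0 (diff A v) \<in> carrier B.C0"
      if "v \<in> carrier A.C1" for v
      using f' g' that lin_closed lin_closed[OF A.diff_lin that] by metis+
    have E: "?E v \<in> ?Z" if v: "v \<in> carrier A.C1" for v
    proof -
      have "diff B (?E v) = \<phi> 0 (diff A v) \<oplus>\<^bsub>B.C0\<^esub> ?m \<odot>\<^bsub>B.C0\<^esub> (\<psi> 0 (diff A v) \<oplus>\<^bsub>B.C0\<^esub> ?D (diff A v))"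
        using closed[OF v] v f' g' h lin_closed[OF h(1)] m
        by (simp add: lin_add[OF B.diff_lin] lin_smult[OF B.diff_lin])
      also have "\<dots> = \<zero>\<^bsub>B.C0\<^esub>"
        using closed[OF v]
        by (simp add: B.C0.smult_l_minus B.C0.M.minus_add B.C0.M.r_neg2 B.C0.M.r_neg1 B.C0.M.a_lcomm B.C0.M.r_neg B.C0.M.l_neg)
      finally show ?thesis using lin_closed[OF lE v] by simp
    qed
    from lin_comp[OF cl lin_restrict_cod[OF lE E]]
    have l: "lin R A.C1 M (\<lambda>v. G v \<oplus>\<^bsub>M\<^esub> ?m \<odot>\<^bsub>M\<^esub> c (?E v))"
      by (intro lin_plus[OF assms(3) G(1)] lin_scale[OF assms(3) _ m])
    have "G v \<oplus>\<^bsub>M\<^esub> ?m \<odot>\<^bsub>M\<^esub> c (?E v) = c (\<psi> 1 v)"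
      if v: "v \<in> carrier A.C1" "diff A v = \<zero>\<^bsub>A.C0\<^esub>" for v
    proof -
      have s: "v \<in> syzygy R A 2" using v by (simp add: syzygy_def ambient_def)
      have k: "\<phi> 1 v \<in> ?Z" "\<psi> 1 v \<in> ?Z"
        using unital_map_syzygy[OF assms(1,2) f s] unital_map_syzygy[OF assms(1,2) g s]
        by (auto simp: syzygy_def ambient_def degree_part_def)
      have ks: "?m \<odot>\<^bsub>B.C1\<^esub> \<psi> 1 v \<in> ?Z"
        by (rule B.C1.submoduleE(4)[OF B.C1.submodule_ker[OF B.C0.module_axioms B.diff_lin] m k(2)])
      have h0: "h \<zero>\<^bsub>A.C0\<^esub> = \<zero>\<^bsub>B.C1\<^esub>" by (rule lin_zero[OF A.C0.module_axioms B.C1.module_axioms h(1)])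
      have "?E v = \<phi> 1 v \<oplus>\<^bsub>B.C1\<^esub> ?m \<odot>\<^bsub>B.C1\<^esub> \<psi> 1 v"
        using v h0 k by simp
      then have "c (?E v) = c (\<phi> 1 v) \<oplus>\<^bsub>M\<^esub> ?m \<odot>\<^bsub>M\<^esub> c (\<psi> 1 v)"
        using lin_add[OF cl, of "\<phi> 1 v" "?m \<odot>\<^bsub>B.C1\<^esub> \<psi> 1 v"] lin_smult[OF cl m, of "\<psi> 1 v"] k ks by simp
      then show ?thesis using neg k lin_closed[OF cl] by (simp add: G(2)[OF v])
    qed
    then show ?thesis
      using 3 l by (auto simp: ext_null_def syzygy_def ambient_def degree_part_def)
  qed
qed

text \<open>Independence of the chain map allows the transition maps to be fixed, as they are in the
  direct limit.\<close>

lemma kills_specific: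
  assumes "\<And>n. presentation R (A n)" "module R M" "y \<in> carrier R"
    and "\<And>m n. n \<le> m \<Longrightarrow> unital_map R (A m) (A n) (\<tau> m n)"
  shows "kills R A M i y \<longleftrightarrow> (\<forall>n g. ext_class R (A n) M i g \<longrightarrow>
    (\<exists>m\<ge>n. ext_null R (A m) M i (\<lambda>v. y \<odot>\<^bsub>M\<^esub> g (degree_part (\<tau> m n) i v))))"
  unfolding kills_def
  using assms(4) ext_null_indep[OF assms(1,1,2) _ _ ext_class_scale[OF assms(2) _ assms(3)]] by metis

text \<open>Cofinal systems of ideals have the same limit. A class on \<open>A n\<close> is pulled
  back to some \<open>B m\<close>, becomes null there after multiplication by \<open>y\<close> at a
  later stage \<open>B m'\<close>, and stays null when pulled back to some \<open>A l\<close>. The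
  index types may differ, so the functorial resolution can be exchanged for a finite
  presentation.\<close>

lemma kills_transfer:
  fixes A :: "nat \<Rightarrow> ('a, 'b) pres" and B :: "nat \<Rightarrow> ('a, 'c) pres"
  assumes A: "\<And>n. presentation R (A n)" and B: "\<And>n. presentation R (B n)"
    and 1: "\<And>n. \<exists>m. pres_ideal R (B m) \<subseteq> pres_ideal R (A n)"
    and 2: "\<And>m n. \<exists>l\<ge>n. pres_ideal R (A l) \<subseteq> pres_ideal R (B m)"
    and kills: "kills R B M i y"
  shows "kills R A M i y"
  unfolding kills_def
proof (intro allI impI)
  fix n g assume g: "ext_class R (A n) M i g"
  obtain m where "pres_ideal R (B m) \<subseteq> pres_ideal R (A n)" using 1 by blast
  then obtain \<alpha> where \<alpha>: "unital_map R (B m) (A n) \<alpha>" by (rule unital_map_exists[OF B A])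
  obtain m' \<sigma> where \<sigma>: "unital_map R (B m') (B m) \<sigma>"
      "ext_null R (B m') M i (\<lambda>v. y \<odot>\<^bsub>M\<^esub> g (degree_part \<alpha> i (degree_part \<sigma> i v)))"
    using kills ext_class_pullback[OF B A \<alpha> g] unfolding kills_def by blast
  obtain l where l: "l \<ge> n" "pres_ideal R (A l) \<subseteq> pres_ideal R (B m')" using 2 by blast
  obtain \<beta> where \<beta>: "unital_map R (A l) (B m') \<beta>" by (rule unital_map_exists[OF A B l(2)])
  have "unital_map R (A l) (A n) (\<lambda>j v. \<alpha> j (\<sigma> j (\<beta> j v)))"
    by (rule unital_map_comp[OF A B A unital_map_comp[OF A B B \<beta> \<sigma>(1)] \<alpha>])
  moreover have "ext_null R (A l) M i (\<lambda>v. y \<odot>\<^bsub>M\<^esub> g (degree_part (\<lambda>j v. \<alpha> j (\<sigma> j (\<beta> j v))) i v))"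
    using ext_null_pullback[OF A B \<beta> \<sigma>(2)] by (simp add: degree_part_def)
  ultimately show "\<exists>m\<ge>n. \<exists>\<phi>. unital_map R (A m) (A n) \<phi> \<and>
      ext_null R (A m) M i (\<lambda>v. y \<odot>\<^bsub>M\<^esub> g (degree_part \<phi> i v))"
    using l(1) by blast
qed

section \<open>Local cohomology through presentations\<close>

lemma lin_restrict_iff:
  assumes "module R C"
  shows "lin R C M (restrict f (carrier C)) \<longleftrightarrow> lin R C M f"
proof -
  interpret C: module R C by fact
  show ?thesis by (auto simp: lin_def Pi_iff)
qed

section \<open>Ext as cocycles modulo coboundaries\<close>

lemma Hom_module_simps [simp]:
  "carrier (Hom_module R C M) = linear_maps R C M"
  "\<zero>\<^bsub>Hom_module R C M\<^esub> = (\<lambda>x\<in>carrier C. \<zero>\<^bsub>M\<^esub>)"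
  "f \<oplus>\<^bsub>Hom_module R C M\<^esub> g = (\<lambda>x\<in>carrier C. f x \<oplus>\<^bsub>M\<^esub> g x)"
  "r \<odot>\<^bsub>Hom_module R C M\<^esub> f = (\<lambda>x\<in>carrier C. r \<odot>\<^bsub>M\<^esub> f x)"
  by (simp_all add: Hom_module_def)

lemma Hom_is_module:
  assumes C: "module R C" and M: "module R M"
  shows "module R (Hom_module R C M)"
proof -
  interpret C: module R C by fact
  interpret M: module R M by fact
  have mem: "f x \<in> carrier M" if "f \<in> linear_maps R C M" "x \<in> carrier C" for f x
    using that by (auto simp: linear_maps_lin lin_def)
  have ext: "f = g" if "f \<in> linear_maps R C M" "g \<in> linear_maps R C M" "\<And>x. x \<in> carrier C \<Longrightarrow> f x = g x" for f g
    using that by (auto simp: linear_maps_lin intro: extensionalityI)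
  have z: "(\<lambda>x\<in>carrier C. \<zero>\<^bsub>M\<^esub>) \<in> linear_maps R C M"
    by (auto simp: linear_maps_lin lin_restrict_iff[OF C] intro!: linI)
  have p: "(\<lambda>x\<in>carrier C. f x \<oplus>\<^bsub>M\<^esub> g x) \<in> linear_maps R C M"
    if "f \<in> linear_maps R C M" "g \<in> linear_maps R C M" for f g
    using that by (auto simp: linear_maps_lin lin_restrict_iff[OF C] intro!: lin_plus[OF M])
  have s: "(\<lambda>x\<in>carrier C. r \<odot>\<^bsub>M\<^esub> f x) \<in> linear_maps R C M"
    if "f \<in> linear_maps R C M" "r \<in> carrier R" for f r
    using that by (auto simp: linear_maps_lin lin_restrict_iff[OF C] intro!: lin_scale[OF M])
  show ?thesis
  proof (rule moduleI[OF C.is_cring abelian_groupI], goal_cases)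
    case (5 f)
    show ?case unfolding Hom_module_simps
      by (rule ext[OF p[OF z] _]) (use 5 mem in auto)
  next
    case (6 f)
    have "(\<lambda>x\<in>carrier C. (\<ominus>\<^bsub>R\<^esub> \<one>\<^bsub>R\<^esub>) \<odot>\<^bsub>M\<^esub> f x) \<oplus>\<^bsub>Hom_module R C M\<^esub> f = \<zero>\<^bsub>Hom_module R C M\<^esub>"
      using 6 mem by (auto simp: M.smult_l_minus M.M.l_neg)
    then show ?case using s[of f "\<ominus>\<^bsub>R\<^esub> \<one>\<^bsub>R\<^esub>"] 6
      by (intro bexI[of _ "\<lambda>x\<in>carrier C. (\<ominus>\<^bsub>R\<^esub> \<one>\<^bsub>R\<^esub>) \<odot>\<^bsub>M\<^esub> f x"]) auto
  next
    case (11 f)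
    then show ?case using s[of f "\<one>\<^bsub>R\<^esub>"] by (intro ext) (auto simp: mem)
  qed (auto simp: p z s mem M.M.a_ac M.smult_l_distr M.smult_r_distr M.smult_assoc1)
qed

text \<open>Both \<open>Ext_map\<close> and \<open>residue_proj\<close> are defined by a union over
  representatives, and both are the map \<open>T\<close> for a suitable \<open>p\<close>.\<close>

lemma quotient_map:
  assumes H: "module R H" and H': "module R H'" and p: "lin R H H' p"
    and B: "submodule B R H" and B': "submodule B' R H'" and pB: "\<And>b. b \<in> B \<Longrightarrow> p b \<in> B'"
  defines "T \<equiv> \<lambda>X. \<Union>x\<in>X. B' +>\<^bsub>H'\<^esub> p x"
  shows quotient_map_coset: "x \<in> carrier H \<Longrightarrow> T (B +>\<^bsub>H\<^esub> x) = B' +>\<^bsub>H'\<^esub> p x"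
    and quotient_map_lin: "lin R (quotient_module H B) (quotient_module H' B') T"
proof -
  interpret H: module R H by fact
  interpret H': module R H' by fact
  have c: "T (B +>\<^bsub>H\<^esub> x) = B' +>\<^bsub>H'\<^esub> p x" if x: "x \<in> carrier H" for x
    unfolding T_def
  proof (rule UN_constant_eq[OF H.coset_self[OF B x]], rule ballI)
    fix y assume "y \<in> B +>\<^bsub>H\<^esub> x"
    then have y: "y \<in> carrier H" "y \<ominus>\<^bsub>H\<^esub> x \<in> B" using H.coset_mem_iff[OF B x] by auto
    have "p y \<ominus>\<^bsub>H'\<^esub> p x \<in> B'" using pB[OF y(2)] lin_diff[OF H H' p y(1) x] by simp
    then show "B' +>\<^bsub>H'\<^esub> p y = B' +>\<^bsub>H'\<^esub> p x"
      using H'.coset_eq_iff[OF B'] lin_closed[OF p] x y by simp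
  qed
  then show "x \<in> carrier H \<Longrightarrow> T (B +>\<^bsub>H\<^esub> x) = B' +>\<^bsub>H'\<^esub> p x" .
  note pc = lin_closed[OF p]
  show "lin R (quotient_module H B) (quotient_module H' B') T"
  proof (rule linI)
    fix X assume "X \<in> carrier (quotient_module H B)"
    then obtain x where x: "x \<in> carrier H" "X = B +>\<^bsub>H\<^esub> x" by (rule H.quotient_carrierE[OF B])
    show "T X \<in> carrier (quotient_module H' B')"
      unfolding x(2) c[OF x(1)] by (rule H'.quotient_carrierI[OF B' pc[OF x(1)]])
    fix r assume r: "r \<in> carrier R"
    show "T (r \<odot>\<^bsub>quotient_module H B\<^esub> X) = r \<odot>\<^bsub>quotient_module H' B'\<^esub> T X"
      unfolding x(2) H.quotient_smult[OF B r x(1)] c[OF x(1)] c[OF H.smult_closed[OF r x(1)]]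
        lin_smult[OF p r x(1)] H'.quotient_smult[OF B' r pc[OF x(1)]] ..
  next
    fix X Y assume "X \<in> carrier (quotient_module H B)" "Y \<in> carrier (quotient_module H B)"
    then obtain x y where x: "x \<in> carrier H" "X = B +>\<^bsub>H\<^esub> x" and y: "y \<in> carrier H" "Y = B +>\<^bsub>H\<^esub> y"
      by (metis H.quotient_carrierE[OF B])
    show "T (X \<oplus>\<^bsub>quotient_module H B\<^esub> Y) = T X \<oplus>\<^bsub>quotient_module H' B'\<^esub> T Y"
      unfolding x(2) y(2) H.quotient_add[OF B x(1) y(1)] c[OF x(1)] c[OF y(1)] c[OF H.M.a_closed[OF x(1) y(1)]]
        lin_add[OF p x(1) y(1)] H'.quotient_add[OF B' pc[OF x(1)] pc[OF y(1)]] ..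
  qed
qed

lemma a_r_coset_update [simp]: "B +>\<^bsub>H\<lparr>carrier := Z\<rparr>\<^esub> x = B +>\<^bsub>H\<^esub> x"
  by (simp add: a_r_coset_def r_coset_def)

text \<open>Despite the name the carrier consists of cocycles only; Ext is the quotient of this
  module by the coboundaries.\<close>

definition cochains ::
    "('a, 'r) ring_scheme \<Rightarrow> ('a, 'n, 's) module_scheme \<Rightarrow> ('a, 'm, 't) module_scheme \<Rightarrow> nat
      \<Rightarrow> ('a, (('a, 'n) syz \<Rightarrow> 'a) \<Rightarrow> 'm) module" where
  "cochains R N M i = Hom_module R (resolution R N i) M\<lparr>carrier := Ext_cocycles R N M i\<rparr>"

lemma cochains_simps [simp]:
  "carrier (cochains R N M i) = Ext_cocycles R N M i"
  "\<zero>\<^bsub>cochains R N M i\<^esub> = (\<lambda>x\<in>carrier (resolution R N i). \<zero>\<^bsub>M\<^esub>)"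
  "f \<oplus>\<^bsub>cochains R N M i\<^esub> g = (\<lambda>x\<in>carrier (resolution R N i). f x \<oplus>\<^bsub>M\<^esub> g x)"
  "r \<odot>\<^bsub>cochains R N M i\<^esub> f = (\<lambda>x\<in>carrier (resolution R N i). r \<odot>\<^bsub>M\<^esub> f x)"
  by (simp_all add: cochains_def)

lemma Ext_cochains: "Ext R i N M = quotient_module (cochains R N M i) (Ext_coboundaries R N M i)"
  by (simp add: Ext_def cochains_def)

lemma Ext_cocyclesD:
  assumes "f \<in> Ext_cocycles R N M i"
  shows "f \<in> linear_maps R (resolution R N i) M" "lin R (resolution R N i) M f"
    "v \<in> carrier (resolution R N (Suc i)) \<Longrightarrow> f (differential R v) = \<zero>\<^bsub>M\<^esub>"
  using assms by (auto simp: Ext_cocycles_def linear_maps_lin)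

text \<open>Formed for an arbitrary map \<open>\<tau>\<close> of resolutions, so that composites of
  induced chain maps are covered as well.\<close>

definition pull_back :: "('a, 'r) ring_scheme \<Rightarrow> ('a, 'k, 's) module_scheme \<Rightarrow> nat \<Rightarrow>
    ((('a, 'k) syz \<Rightarrow> 'a) \<Rightarrow> ('a, 'n) syz \<Rightarrow> 'a) \<Rightarrow> ((('a, 'n) syz \<Rightarrow> 'a) \<Rightarrow> 'm) \<Rightarrow> (('a, 'k) syz \<Rightarrow> 'a) \<Rightarrow> 'm" where
  "pull_back R N' i \<tau> f = (\<lambda>v\<in>carrier (resolution R N' i). f (\<tau> v))"

context
  fixes R :: "('a, 'r) ring_scheme" and N :: "('a, 'n, 's) module_scheme" and M :: "('a, 'm, 't) module_scheme"
  assumes N: "module R N" and M: "module R M"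
begin

interpretation N: module R N by (rule N)
interpretation M: module R M by (rule M)
interpretation F: module R "N.F i" for i by (rule N.resolution_module)
interpretation H: module R "Hom_module R (N.F i) M" for i by (rule Hom_is_module[OF N.resolution_module M])

lemma d_d: "v \<in> carrier (N.F (Suc (Suc i))) \<Longrightarrow> N.d (N.d v) = \<zero>\<^bsub>N.F i\<^esub>"
  using N.image_d_subset[of v "Suc i"] by (simp add: resolution_def free_simps)

lemma cocycles_submodule: "submodule (Ext_cocycles R N M i) R (Hom_module R (N.F i) M)"
proof (rule H.submoduleI')
  note dc = lin_closed[OF N.d_lin, of _ i]
  show "Ext_cocycles R N M i \<subseteq> carrier (Hom_module R (N.F i) M)" by (auto simp: Ext_cocycles_def)
  show "\<zero>\<^bsub>Hom_module R (N.F i) M\<^esub> \<in> Ext_cocycles R N M i"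
    using H.M.zero_closed[of i] dc unfolding Ext_cocycles_def by simp
  fix f assume f: "f \<in> Ext_cocycles R N M i"
  have fH: "f \<in> carrier (Hom_module R (N.F i) M)" using f by (auto simp: Ext_cocycles_def)
  show "r \<odot>\<^bsub>Hom_module R (N.F i) M\<^esub> f \<in> Ext_cocycles R N M i" if r: "r \<in> carrier R" for r
    using H.smult_closed[OF r fH] r dc Ext_cocyclesD(3)[OF f] by (auto simp: Ext_cocycles_def)
  fix g assume g: "g \<in> Ext_cocycles R N M i"
  have gH: "g \<in> carrier (Hom_module R (N.F i) M)" using g by (auto simp: Ext_cocycles_def)
  show "f \<oplus>\<^bsub>Hom_module R (N.F i) M\<^esub> g \<in> Ext_cocycles R N M i"
    using H.M.a_closed[OF fH gH] dc Ext_cocyclesD(3)[OF f] Ext_cocyclesD(3)[OF g] by (auto simp: Ext_cocycles_def)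
qed

lemma cochains_module: "module R (cochains R N M i)"
  unfolding cochains_def
  by (rule submodule.submodule_is_module[OF cocycles_submodule H.module_axioms])

interpretation Z: module R "cochains R N M i" for i by (rule cochains_module)

lemma coboundaryI:
  assumes "lin R (N.F j) M G"
  shows "(\<lambda>v\<in>carrier (N.F (Suc j)). G (N.d v)) \<in> Ext_coboundaries R N M (Suc j)"
proof -
  have "(\<lambda>v\<in>carrier (N.F (Suc j)). G (N.d v)) =
      (\<lambda>v\<in>carrier (N.F (Suc j)). restrict G (carrier (N.F j)) (N.d v))"
    using lin_closed[OF N.d_lin] by auto
  moreover have "restrict G (carrier (N.F j)) \<in> linear_maps R (N.F j) M"
    using assms by (simp add: linear_maps_lin lin_restrict_iff[OF N.resolution_module])
  ultimately show ?thesis by (simp only: Ext_coboundaries_def nat.case) blast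
qed

lemma coboundaryE:
  assumes "f \<in> Ext_coboundaries R N M (Suc j)"
  obtains G where "lin R (N.F j) M G" "f = (\<lambda>v\<in>carrier (N.F (Suc j)). G (N.d v))"
  using assms by (auto simp: Ext_coboundaries_def linear_maps_lin)

lemma coboundaries_submodule: "submodule (Ext_coboundaries R N M i) R (cochains R N M i)"
proof (cases i)
  case 0
  then show ?thesis using Z.submodule_trivial[of 0] by (simp add: Ext_coboundaries_def)
next
  case (Suc j)
  show ?thesis unfolding Suc
  proof (rule Z.submoduleI')
    note dc = lin_closed[OF N.d_lin, of _ j]
    note dl = N.d_lin[of j]
    show "Ext_coboundaries R N M (Suc j) \<subseteq> carrier (cochains R N M (Suc j))"
    proof
      fix f assume "f \<in> Ext_coboundaries R N M (Suc j)"
      then obtain G where G: "lin R (N.F j) M G" "f = (\<lambda>v\<in>carrier (N.F (Suc j)). G (N.d v))"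
        by (rule coboundaryE)
      then show "f \<in> carrier (cochains R N M (Suc j))"
        using lin_comp[OF G(1) dl] d_d[of _ j] lin_zero[OF N.resolution_module M G(1)] lin_closed[OF N.d_lin]
        by (auto simp: Ext_cocycles_def linear_maps_lin lin_restrict_iff[OF N.resolution_module])
    qed
    have "lin R (N.F j) M (\<lambda>v. \<zero>\<^bsub>M\<^esub>)" by (rule linI) auto
    from coboundaryI[OF this] show "\<zero>\<^bsub>cochains R N M (Suc j)\<^esub> \<in> Ext_coboundaries R N M (Suc j)" by simp
    fix f assume "f \<in> Ext_coboundaries R N M (Suc j)"
    then obtain G where G: "lin R (N.F j) M G" "f = (\<lambda>v\<in>carrier (N.F (Suc j)). G (N.d v))"
      by (rule coboundaryE)
    show "r \<odot>\<^bsub>cochains R N M (Suc j)\<^esub> f \<in> Ext_coboundaries R N M (Suc j)" if r: "r \<in> carrier R" for r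
      using coboundaryI[OF lin_scale[OF M G(1) r]] by (simp add: G(2) cong: restrict_cong)
    fix g assume "g \<in> Ext_coboundaries R N M (Suc j)"
    then obtain G' where G': "lin R (N.F j) M G'" "g = (\<lambda>v\<in>carrier (N.F (Suc j)). G' (N.d v))"
      by (rule coboundaryE)
    show "f \<oplus>\<^bsub>cochains R N M (Suc j)\<^esub> g \<in> Ext_coboundaries R N M (Suc j)"
      using coboundaryI[OF lin_plus[OF M G(1) G'(1)]] by (simp add: G(2) G'(2) cong: restrict_cong)
  qed
qed

lemma Ext_module: "module R (Ext R i N M)"
  unfolding Ext_cochains by (rule Z.quotient_is_module[OF coboundaries_submodule])

end

lemma pull_back_props:
  assumes N': "module R N'" and N: "module R N" and M: "module R M"
    and l: "\<And>j. lin R (resolution R N' j) (resolution R N j) \<tau>"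
    and chain: "\<And>j v. v \<in> carrier (resolution R N' (Suc j)) \<Longrightarrow> differential R (\<tau> v) = \<tau> (differential R v)"
  shows pull_back_lin: "lin R (cochains R N M i) (cochains R N' M i) (pull_back R N' i \<tau>)"
    and pull_back_coboundary: "f \<in> Ext_coboundaries R N M i \<Longrightarrow> pull_back R N' i \<tau> f \<in> Ext_coboundaries R N' M i"
proof -
  interpret N: module R N by fact
  interpret N': module R N' by fact
  note res = N'.resolution_module
  have closed: "\<tau> v \<in> carrier (resolution R N j)" if "v \<in> carrier (resolution R N' j)" for j v
    using lin_closed[OF l that] .
  have cocycle: "pull_back R N' i \<tau> f \<in> Ext_cocycles R N' M i" if f: "f \<in> Ext_cocycles R N M i" for f
    using lin_comp[OF Ext_cocyclesD(2)[OF f] l] Ext_cocyclesD(3)[OF f] chain[symmetric] closed lin_closed[OF N'.d_lin]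
    by (auto simp: Ext_cocycles_def pull_back_def linear_maps_lin lin_restrict_iff[OF res])
  show "lin R (cochains R N M i) (cochains R N' M i) (pull_back R N' i \<tau>)"
    using cocycle closed by (intro linI) (auto simp: pull_back_def)
  show "pull_back R N' i \<tau> f \<in> Ext_coboundaries R N' M i" if f: "f \<in> Ext_coboundaries R N M i"
  proof (cases i)
    case 0
    then show ?thesis using f closed by (auto simp: Ext_coboundaries_def pull_back_def)
  next
    case (Suc j)
    from f[unfolded Suc] obtain G where G: "lin R (resolution R N j) M G"
        "f = (\<lambda>v\<in>carrier (resolution R N (Suc j)). G (differential R v))"
      by (rule coboundaryE[OF N M])
    have "pull_back R N' i \<tau> f = (\<lambda>v\<in>carrier (resolution R N' (Suc j)). G (\<tau> (differential R v)))"
      using closed by (auto simp: pull_back_def G(2) Suc chain)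
    then show ?thesis using coboundaryI[OF N' M lin_comp[OF G(1) l]] by (simp add: Suc)
  qed
qed

lemma pull_back_Ext:
  assumes N': "module R N'" and N: "module R N" and M: "module R M" and \<phi>: "lin R N' N \<phi>"
  shows Ext_map_coset: "f \<in> Ext_cocycles R N M i \<Longrightarrow>
      Ext_map R i N' \<phi> M (Ext_coboundaries R N M i +>\<^bsub>cochains R N M i\<^esub> f) =
      Ext_coboundaries R N' M i +>\<^bsub>cochains R N' M i\<^esub> pull_back R N' i (resolution_map R \<phi>) f"
    and Ext_map_lin: "lin R (Ext R i N M) (Ext R i N' M) (Ext_map R i N' \<phi> M)"
proof -
  note a = N' N M resolution_map_lin[OF N' N \<phi>] resolution_map_d[OF N' N \<phi>]
  note q = cochains_module[OF N M] cochains_module[OF N' M] pull_back_lin[OF a]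
    coboundaries_submodule[OF N M] coboundaries_submodule[OF N' M] pull_back_coboundary[OF a]
  have e: "Ext_map R i N' \<phi> M = (\<lambda>X. \<Union>f\<in>X. Ext_coboundaries R N' M i +>\<^bsub>cochains R N' M i\<^esub>
      pull_back R N' i (resolution_map R \<phi>) f)"
    by (simp add: Ext_map_def pull_back_def cochains_def fun_eq_iff)
  show "Ext_map R i N' \<phi> M (Ext_coboundaries R N M i +>\<^bsub>cochains R N M i\<^esub> f) =
      Ext_coboundaries R N' M i +>\<^bsub>cochains R N' M i\<^esub> pull_back R N' i (resolution_map R \<phi>) f"
    if "f \<in> Ext_cocycles R N M i"
    unfolding e by (rule quotient_map_coset[OF q]) (use that in auto)
  show "lin R (Ext R i N M) (Ext R i N' M) (Ext_map R i N' \<phi> M)"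
    unfolding e Ext_cochains by (rule quotient_map_lin[OF q])
qed

section \<open>Cyclic modules: cocycles as maps on syzygies\<close>

definition res_pres :: "('a, 'r) ring_scheme \<Rightarrow> ('a, 'n, 's) module_scheme \<Rightarrow> 'n \<Rightarrow> ('a, ('a, 'n) syz) pres" where
  "res_pres R N u = \<lparr>gens = res_basis R N 0, rels = res_basis R N 1, unit = basis_vec R (Gen u),
    ker = {v \<in> carrier (resolution R N 0). augmentation R N v = \<zero>\<^bsub>N\<^esub>}, diff = differential R\<rparr>"

text \<open>The surjection from the i-th term of the resolution onto the i-th syzygy, through which
  every cocycle factors.\<close>

definition to_syzygy :: "('a, 'r) ring_scheme \<Rightarrow> nat \<Rightarrow> (('a, 'n) syz \<Rightarrow> 'a) \<Rightarrow> ('a, 'n) syz \<Rightarrow> 'a" where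
  "to_syzygy R i = (if i = 0 then id else differential R)"

locale cyclic_module = module R N for R (structure) and N (structure) +
  fixes u
  assumes gen_closed: "u \<in> carrier N" and cyclic: "x \<in> carrier N \<Longrightarrow> \<exists>a\<in>carrier R. x = a \<odot>\<^bsub>N\<^esub> u"
begin

lemma aug_unit: "a \<in> carrier R \<Longrightarrow> aug (a \<odot>\<^bsub>F 0\<^esub> basis_vec R (Gen u)) = a \<odot>\<^bsub>N\<^esub> u"
  using lin_smult[OF aug_lin, of a "basis_vec R (Gen u)"] basis_in_free[of "Gen u" "res_basis R N 0"] gen_closed
  by (simp add: resolution_def aug_basis)

lemma res_pres_presentation: "presentation R (res_pres R N u)"
proof (intro presentation.intro presentation_axioms.intro R.is_cring)
  interpret F: module R "F 0" by (rule resolution_module)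
  let ?A = "res_pres R N u"
  have C0: "free_module R (gens ?A) = F 0" and C1: "free_module R (rels ?A) = F (Suc 0)"
    by (simp_all add: res_pres_def resolution_def)
  have e: "basis_vec R (Gen u) \<in> carrier (F 0)"
    unfolding resolution_def using gen_closed by (intro basis_in_free) auto
  then show "unit ?A \<in> carrier (free_module R (gens ?A))"
    unfolding C0 by (simp add: res_pres_def)
  show "submodule (ker ?A) R (free_module R (gens ?A))"
    unfolding C0 using F.submodule_ker[OF module_axioms aug_lin] by (simp add: res_pres_def)
  show "lin R (free_module R (rels ?A)) (free_module R (gens ?A)) (diff ?A)"
    unfolding C0 C1 using d_lin by (simp add: res_pres_def)
  show "diff ?A ` carrier (free_module R (rels ?A)) = ker ?A"
    unfolding C0 C1 using image_d0 by (simp add: res_pres_def)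
  fix v assume "v \<in> carrier (free_module R (gens ?A))"
  then have v: "v \<in> carrier (F 0)" unfolding C0 .
  obtain a where a: "a \<in> carrier R" "aug v = a \<odot>\<^bsub>N\<^esub> u" using cyclic lin_closed[OF aug_lin v] by blast
  let ?x = "a \<odot>\<^bsub>F 0\<^esub> basis_vec R (Gen u)"
  have x: "?x \<in> carrier (F 0)" using a e by auto
  have "aug (v \<ominus>\<^bsub>F 0\<^esub> ?x) = \<zero>\<^bsub>N\<^esub>"
    using lin_diff[OF F.module_axioms module_axioms aug_lin v x] a gen_closed
    by (simp add: aug_unit a_minus_def M.r_neg)
  moreover have "v = ?x \<oplus>\<^bsub>F 0\<^esub> (v \<ominus>\<^bsub>F 0\<^esub> ?x)"
    using v x by (simp add: a_minus_def F.M.a_lcomm F.M.r_neg)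
  ultimately show "\<exists>a\<in>carrier R. \<exists>k\<in>ker ?A.
      v = a \<odot>\<^bsub>free_module R (gens ?A)\<^esub> unit ?A \<oplus>\<^bsub>free_module R (gens ?A)\<^esub> k"
    unfolding C0 using a v x
    by (intro bexI[of _ a] bexI[of _ "v \<ominus>\<^bsub>F 0\<^esub> ?x"]) (auto simp: res_pres_def)
qed

lemma res_pres_ideal: "pres_ideal R (res_pres R N u) = {a \<in> carrier R. a \<odot>\<^bsub>N\<^esub> u = \<zero>\<^bsub>N\<^esub>}"
proof -
  interpret F: module R "F 0" by (rule resolution_module)
  have "basis_vec R (Gen u) \<in> carrier (F 0)"
    unfolding resolution_def using gen_closed by (intro basis_in_free) auto
  then have "a \<odot>\<^bsub>F 0\<^esub> basis_vec R (Gen u) \<in> carrier (F 0)" if "a \<in> carrier R" for a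
    using that by auto
  then show ?thesis
    using aug_unit unfolding pres_ideal_def by (auto simp: res_pres_def simp flip: resolution_def res_basis.simps)
qed

lemma ambient_res: "ambient R (res_pres R N u) 0 = F 0" "ambient R (res_pres R N u) (Suc 0) = F 0"
    "ambient R (res_pres R N u) 2 = F (Suc 0)"
  by (simp_all add: ambient_def res_pres_def resolution_def)

lemma syzygy_res: "syzygy R (res_pres R N u) 0 = carrier (F 0)"
    "syzygy R (res_pres R N u) (Suc 0) = differential R ` carrier (F (Suc 0))"
    "syzygy R (res_pres R N u) 2 = differential R ` carrier (F 2)"
  using image_d0 image_d_Suc[of 0]
  by (simp_all add: syzygy_def ambient_def) (simp_all add: res_pres_def resolution_def numeral_2_eq_2)

lemma syzygy_image:
  assumes "i \<le> 2"
  shows "syzygy R (res_pres R N u) i = to_syzygy R i ` carrier (F i)"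
proof -
  consider "i = 0" | "i = 1" | "i = 2" using assms by linarith
  then show ?thesis using syzygy_res by cases (auto simp: to_syzygy_def)
qed

text \<open>A cocycle vanishes on the image of the next differential, which by exactness is the
  kernel of the differential onto the syzygy. So it factors through the syzygy.\<close>

lemma cocycle_class:
  assumes M: "module R M" and i: "i \<le> 2" and f: "f \<in> Ext_cocycles R N M i"
  obtains g where "ext_class R (res_pres R N u) M i g" "f = (\<lambda>v\<in>carrier (F i). g (to_syzygy R i v))"
proof -
  have ext: "f = (\<lambda>v\<in>carrier (F i). f v)"
    using f by (auto simp: Ext_cocycles_def linear_maps_lin extensional_restrict)
  note fl = Ext_cocyclesD(2)[OF f] and f0 = Ext_cocyclesD(3)[OF f]
  show ?thesis
  proof (cases i)
    case 0
    have "ext_class R (res_pres R N u) M i f"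
    proof -
      have "f v = \<zero>\<^bsub>M\<^esub>" if "v \<in> ker (res_pres R N u)" for v
      proof -
        have "v \<in> d ` carrier (F (Suc 0))" using that by (simp add: image_d0 res_pres_def)
        then show ?thesis using f0 0 by auto
      qed
      then show ?thesis
        using fl 0 by (simp add: ext_class_def ambient_res syzygy_res lin_def)
    qed
    then show ?thesis using that ext 0 by (simp add: to_syzygy_def)
  next
    case (Suc j)
    have "f x = \<zero>\<^bsub>M\<^esub>" if x: "x \<in> carrier (F (Suc j))" "d x = \<zero>\<^bsub>F j\<^esub>" for x
    proof -
      have "x \<in> d ` carrier (F (Suc (Suc j)))" using x image_d_Suc by blast
      then show ?thesis using f0 Suc by auto
    qed
    then obtain g where g: "lin R (F j\<lparr>carrier := d ` carrier (F (Suc j))\<rparr>) M g"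
        "\<And>x. x \<in> carrier (F (Suc j)) \<Longrightarrow> g (d x) = f x"
      using lin_factor[OF resolution_module resolution_module M d_lin fl[unfolded Suc]] by blast
    have "j = 0 \<or> j = Suc 0" using i Suc by auto
    then have "ext_class R (res_pres R N u) M i g"
      using g(1) Suc syzygy_res ambient_res by (auto simp: ext_class_def numeral_2_eq_2)
    moreover have "f = (\<lambda>v\<in>carrier (F i). g (to_syzygy R i v))"
      by (subst ext, rule restrict_ext) (simp add: Suc to_syzygy_def g(2))
    ultimately show ?thesis by (rule that)
  qed
qed

lemma to_syzygy_lin: "i \<le> 2 \<Longrightarrow> lin R (F i) (ambient R (res_pres R N u) i) (to_syzygy R i)"
  using ambient_res d_lin[of 0] d_lin[of 1]
  by (auto simp: to_syzygy_def le_Suc_eq numeral_2_eq_2 intro: linI)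

lemma class_cocycle:
  assumes M: "module R M" and i: "i \<le> 2" and g: "ext_class R (res_pres R N u) M i g"
  shows "(\<lambda>v\<in>carrier (F i). g (to_syzygy R i v)) \<in> Ext_cocycles R N M i"
proof -
  let ?A = "res_pres R N u"
  interpret A: presentation R ?A by (rule res_pres_presentation)
  let ?S = "ambient R ?A i\<lparr>carrier := syzygy R ?A i\<rparr>"
  have S: "module R ?S" by (rule submodule.submodule_is_module[OF A.syzygy_submodule A.ambient_module])
  have gl: "lin R ?S M g" using g by (simp add: ext_class_def)
  have "lin R (F i) ?S (to_syzygy R i)"
    by (rule lin_restrict_cod[OF to_syzygy_lin[OF i]]) (use syzygy_image[OF i] in auto)
  from lin_comp[OF gl this] have l: "lin R (F i) M (\<lambda>v. g (to_syzygy R i v))" .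
  have "g (to_syzygy R i (d v)) = \<zero>\<^bsub>M\<^esub>" if v: "v \<in> carrier (F (Suc i))" for v
  proof (cases i)
    case 0
    then show ?thesis using g v image_d0 by (auto simp: ext_class_def to_syzygy_def res_pres_def)
  next
    case (Suc j)
    have "d (d v) = \<zero>\<^bsub>?S\<^esub>"
      using v image_d_Suc[of j] Suc by (auto simp: ambient_def resolution_def free_simps)
    then show ?thesis using lin_zero[OF S M gl] Suc by (simp add: to_syzygy_def)
  qed
  then show ?thesis
    using l lin_closed[OF d_lin]
    by (auto simp: Ext_cocycles_def linear_maps_lin lin_restrict_iff[OF resolution_module])
qed

text \<open>In positive degree a cocycle is \<open>g\<close> composed with the differential and a
  coboundary is some \<open>G\<close>, defined on the free module below, composed with the
  differential. The two agree exactly when \<open>G\<close> extends \<open>g\<close> from the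
  syzygy.\<close>

lemma coboundary_iff_null:
  assumes M: "module R M" and i: "i \<le> 2"
  shows "(\<lambda>v\<in>carrier (F i). g (to_syzygy R i v)) \<in> Ext_coboundaries R N M i \<longleftrightarrow>
    ext_null R (res_pres R N u) M i g"
proof (cases i)
  case 0
  then show ?thesis
    by (auto simp: Ext_coboundaries_def ext_null_def syzygy_res to_syzygy_def fun_eq_iff)
next
  case (Suc j)
  have amb: "ambient R (res_pres R N u) i = F j"
    using i Suc ambient_res by (cases j) (auto simp: numeral_2_eq_2)
  have syz: "syzygy R (res_pres R N u) i = d ` carrier (F (Suc j))"
    using syzygy_image[OF i] Suc by (simp add: to_syzygy_def)
  show ?thesis
  proof
    assume "(\<lambda>v\<in>carrier (F i). g (to_syzygy R i v)) \<in> Ext_coboundaries R N M i"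
    then obtain G where G: "lin R (F j) M G"
        "(\<lambda>v\<in>carrier (F i). g (to_syzygy R i v)) = (\<lambda>v\<in>carrier (F (Suc j)). G (d v))"
      unfolding Suc by (rule coboundaryE[OF module_axioms M])
    have "G (d v) = g (d v)" if "v \<in> carrier (F (Suc j))" for v
      using fun_cong[OF G(2), of v] that Suc by (simp add: to_syzygy_def)
    then show "ext_null R (res_pres R N u) M i g"
      using G(1) Suc unfolding ext_null_def amb syz by auto
  next
    assume "ext_null R (res_pres R N u) M i g"
    then obtain G where G: "lin R (F j) M G" "\<forall>v\<in>carrier (F (Suc j)). G (d v) = g (d v)"
      using Suc unfolding ext_null_def amb syz by auto
    have "(\<lambda>v\<in>carrier (F (Suc j)). G (d v)) = (\<lambda>v\<in>carrier (F i). g (to_syzygy R i v))"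
      using G(2) Suc by (auto simp: to_syzygy_def fun_eq_iff)
    then show "(\<lambda>v\<in>carrier (F i). g (to_syzygy R i v)) \<in> Ext_coboundaries R N M i"
      using coboundaryI[OF module_axioms M G(1)] Suc by simp
  qed
qed

end

section \<open>Towers of cyclic modules and the limit of their Ext modules\<close>

locale cyclic_tower =
  fixes R :: "('a, 'r) ring_scheme" and N :: "nat \<Rightarrow> ('a, 'n, 's) module_scheme" and u :: "nat \<Rightarrow> 'n"
    and \<pi> :: "nat \<Rightarrow> 'n \<Rightarrow> 'n" and M :: "('a, 'm, 't) module_scheme"
  assumes cyclic: "cyclic_module R (N n) (u n)" and step: "lin R (N (Suc n)) (N n) (\<pi> n)"
    and step_gen: "\<pi> n (u (Suc n)) = u n" and target: "module R M"
begin

interpretation N: cyclic_module R "N n" "u n" for n by (rule cyclic)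
interpretation M: module R M by (rule target)

abbreviation "F n \<equiv> resolution R (N n)"
abbreviation "A n \<equiv> res_pres R (N n) (u n)"

primrec tau :: "nat \<Rightarrow> nat \<Rightarrow> (('a, 'n) syz \<Rightarrow> 'a) \<Rightarrow> ('a, 'n) syz \<Rightarrow> 'a" where
  "tau n 0 = (\<lambda>v. v)"
| "tau n (Suc k) = (\<lambda>v. tau n k (resolution_map R (\<pi> (n + k)) v))"

lemmas map_lin = resolution_map_lin[OF N.module_axioms N.module_axioms step]
lemmas map_d = resolution_map_d[OF N.module_axioms N.module_axioms step]

lemma tau_lin: "lin R (F (n + k) j) (F n j) (tau n k)"
proof (induction k)
  case 0
  show ?case by (rule linI) auto
next
  case (Suc k)
  show ?case using lin_comp[OF Suc map_lin[of "n + k"]] by simp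
qed

lemma tau_d: "v \<in> carrier (F (n + k) (Suc j)) \<Longrightarrow> differential R (tau n k v) = tau n k (differential R v)"
proof (induction k arbitrary: v)
  case (Suc k)
  then show ?case using lin_closed[OF map_lin, of v "n + k" "Suc j"] map_d[of v "n + k" j] by simp
qed simp

lemma tau_gen: "tau n k (basis_vec R (Gen (u (n + k)))) = basis_vec R (Gen (u n))"
proof (induction k)
  case (Suc k)
  then show ?case using step_gen[of "n + k"] by (simp add: N.resolution_map_basis)
qed simp

lemma tau_unital: "unital_map R (A (n + k)) (A n) (\<lambda>_. tau n k)"
proof -
  interpret F: module R "F n 0" by (rule N.resolution_module)
  have "basis_vec R (Gen (u n)) \<in> carrier (F n 0)"
    unfolding resolution_def using N.gen_closed by (intro N.basis_in_free) auto
  then have "basis_vec R (Gen (u n)) = basis_vec R (Gen (u n)) \<oplus>\<^bsub>F n 0\<^esub> \<zero>\<^bsub>F n 0\<^esub>" by simp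
  moreover have "\<zero>\<^bsub>F n 0\<^esub> \<in> carrier (F n 0)" "augmentation R (N n) \<zero>\<^bsub>F n 0\<^esub> = \<zero>\<^bsub>N n\<^esub>"
    using lin_zero[OF N.resolution_module N.module_axioms N.aug_lin] by auto
  ultimately show ?thesis
    using tau_lin[of n k 0] tau_lin[of n k 1] tau_d[of _ n k 0] tau_gen[of n k]
    unfolding unital_map_def by (auto simp: res_pres_def resolution_def)
qed

abbreviation "B i n \<equiv> Ext_coboundaries R (N n) M i"
abbreviation "Z i n \<equiv> cochains R (N n) M i"
abbreviation "E i n \<equiv> Ext R i (N n) M"
abbreviation "t i n \<equiv> Ext_map R i (N (Suc n)) (\<pi> n) M"

lemma Ext_system: "direct_system R (E i) (t i)"
  by (rule direct_system.intro)
    (rule Ext_module[OF N.module_axioms target], rule Ext_map_lin[OF N.module_axioms N.module_axioms target step])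

lemma pull_back_cocycle: "f \<in> Ext_cocycles R (N n) M i \<Longrightarrow>
    pull_back R (N (n + k)) i (tau n k) f \<in> Ext_cocycles R (N (n + k)) M i"
  using lin_closed[OF pull_back_lin[OF N.module_axioms N.module_axioms target tau_lin tau_d]] by simp

lemma transition_Ext:
  assumes "f \<in> Ext_cocycles R (N n) M i"
  shows "transition (t i) n (n + k) (B i n +>\<^bsub>Z i n\<^esub> f) =
    B i (n + k) +>\<^bsub>Z i (n + k)\<^esub> pull_back R (N (n + k)) i (tau n k) f"
proof (induction k)
  case 0
  have "pull_back R (N n) i (\<lambda>v. v) f = f"
    using assms by (auto simp: pull_back_def Ext_cocycles_def linear_maps_lin extensional_restrict)
  then show ?case by (simp add: transition_def)
next
  case (Suc k)
  interpret D: direct_system R "E i" "t i" by (rule Ext_system)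
  have "pull_back R (N (Suc (n + k))) i (resolution_map R (\<pi> (n + k))) (pull_back R (N (n + k)) i (tau n k) f) =
      pull_back R (N (Suc (n + k))) i (tau n (Suc k)) f"
    unfolding pull_back_def using lin_closed[OF map_lin] by (intro restrict_ext) simp
  then show ?case
    using Suc Ext_map_coset[OF N.module_axioms N.module_axioms target step pull_back_cocycle[OF assms]]
    by (simp add: D.tr_Suc)
qed

lemma transition_zero_iff:
  assumes i: "i \<le> 2" and g: "ext_class R (A n) M i g" and y: "y \<in> carrier R"
    and f: "f = (\<lambda>v\<in>carrier (F n i). g (to_syzygy R i v))"
  shows "transition (t i) n (n + k) (y \<odot>\<^bsub>E i n\<^esub> (B i n +>\<^bsub>Z i n\<^esub> f)) = \<zero>\<^bsub>E i (n + k)\<^esub> \<longleftrightarrow>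
    ext_null R (A (n + k)) M i (\<lambda>v. y \<odot>\<^bsub>M\<^esub> g (tau n k v))"
proof -
  have fc: "f \<in> Ext_cocycles R (N n) M i" unfolding f by (rule N.class_cocycle[OF target i g])
  interpret Z: module R "Z i q" for q by (rule cochains_module[OF N.module_axioms target])
  note cob = coboundaries_submodule[OF N.module_axioms target]
  let ?yf = "y \<odot>\<^bsub>Z i n\<^esub> f"
  have yf: "?yf \<in> Ext_cocycles R (N n) M i" using Z.smult_closed[OF y, of f] fc by simp
  have syz: "to_syzygy R i (tau n k v) = tau n k (to_syzygy R i v)" if "v \<in> carrier (F (n + k) i)" for v
    using tau_d[of v n k] that by (cases i) (auto simp: to_syzygy_def)
  have "pull_back R (N (n + k)) i (tau n k) ?yf =
      (\<lambda>v\<in>carrier (F (n + k) i). y \<odot>\<^bsub>M\<^esub> g (tau n k (to_syzygy R i v)))"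
    unfolding pull_back_def f using lin_closed[OF tau_lin] syz by (intro restrict_ext) simp
  moreover have "y \<odot>\<^bsub>E i n\<^esub> (B i n +>\<^bsub>Z i n\<^esub> f) = B i n +>\<^bsub>Z i n\<^esub> ?yf"
    unfolding Ext_cochains using Z.quotient_smult[OF cob y] fc by simp
  ultimately have "transition (t i) n (n + k) (y \<odot>\<^bsub>E i n\<^esub> (B i n +>\<^bsub>Z i n\<^esub> f)) =
      B i (n + k) +>\<^bsub>Z i (n + k)\<^esub> (\<lambda>v\<in>carrier (F (n + k) i). y \<odot>\<^bsub>M\<^esub> g (tau n k (to_syzygy R i v)))"
    using transition_Ext[OF yf, of k] by simp
  moreover have "(\<lambda>v\<in>carrier (F (n + k) i). y \<odot>\<^bsub>M\<^esub> g (tau n k (to_syzygy R i v))) \<in> carrier (Z i (n + k))"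
    using pull_back_cocycle[OF yf, of k] calculation(1) \<open>pull_back R (N (n + k)) i (tau n k) ?yf = _\<close> by simp
  ultimately show ?thesis
    using Z.coset_zero_iff[OF cob] N.coboundary_iff_null[OF target i, where g = "\<lambda>v. y \<odot>\<^bsub>M\<^esub> g (tau n k v)"]
    unfolding Ext_cochains quotient_module_simps by simp
qed

text \<open>Every element of a stage is the class of a cocycle, hence of a map on a syzygy. The
  iterated transition map acts on it by composition with \<open>tau\<close>, a unital map, so the
  condition on the limit takes the form of \<open>kills_specific\<close>.\<close>

theorem kills_limit_iff_kills:
  assumes i: "i \<le> 2" and y: "y \<in> carrier R"
  shows "(\<forall>h\<in>carrier (direct_limit (E i) (t i)). y \<odot>\<^bsub>direct_limit (E i) (t i)\<^esub> h = \<zero>\<^bsub>direct_limit (E i) (t i)\<^esub>)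
    \<longleftrightarrow> kills R A M i y"
proof -
  interpret D: direct_system R "E i" "t i" by (rule Ext_system)
  interpret Z: module R "Z i q" for q by (rule cochains_module[OF N.module_axioms target])
  note cob = coboundaries_submodule[OF N.module_axioms target]
  have *: "(\<exists>k\<ge>n. transition (t i) n k (y \<odot>\<^bsub>E i n\<^esub> (B i n +>\<^bsub>Z i n\<^esub> (\<lambda>v\<in>carrier (F n i). g (to_syzygy R i v)))) = \<zero>\<^bsub>E i k\<^esub>)
      \<longleftrightarrow> (\<exists>m\<ge>n. ext_null R (A m) M i (\<lambda>v. y \<odot>\<^bsub>M\<^esub> g (degree_part (\<lambda>_. tau n (m - n)) i v)))"
    if g: "ext_class R (A n) M i g" for n g
  proof -
    have "transition (t i) n m (y \<odot>\<^bsub>E i n\<^esub> (B i n +>\<^bsub>Z i n\<^esub> (\<lambda>v\<in>carrier (F n i). g (to_syzygy R i v)))) = \<zero>\<^bsub>E i m\<^esub>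
        \<longleftrightarrow> ext_null R (A m) M i (\<lambda>v. y \<odot>\<^bsub>M\<^esub> g (degree_part (\<lambda>_. tau n (m - n)) i v))" if "n \<le> m" for m
      using transition_zero_iff[OF i g y refl, of "m - n"] that by (simp add: degree_part_def)
    then show ?thesis by blast
  qed
  have "(\<forall>x\<in>carrier (E i n). \<exists>k\<ge>n. transition (t i) n k (y \<odot>\<^bsub>E i n\<^esub> x) = \<zero>\<^bsub>E i k\<^esub>) \<longleftrightarrow>
      (\<forall>g. ext_class R (A n) M i g \<longrightarrow>
        (\<exists>m\<ge>n. ext_null R (A m) M i (\<lambda>v. y \<odot>\<^bsub>M\<^esub> g (degree_part (\<lambda>_. tau n (m - n)) i v))))" for n
  proof (intro iffI allI impI ballI)
    fix g assume H: "\<forall>x\<in>carrier (E i n). \<exists>k\<ge>n. transition (t i) n k (y \<odot>\<^bsub>E i n\<^esub> x) = \<zero>\<^bsub>E i k\<^esub>"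
      and g: "ext_class R (A n) M i g"
    have "B i n +>\<^bsub>Z i n\<^esub> (\<lambda>v\<in>carrier (F n i). g (to_syzygy R i v)) \<in> carrier (E i n)"
      unfolding Ext_cochains using Z.quotient_carrierI[OF cob] N.class_cocycle[OF target i g] by simp
    with H * [OF g] show "\<exists>m\<ge>n. ext_null R (A m) M i (\<lambda>v. y \<odot>\<^bsub>M\<^esub> g (degree_part (\<lambda>_. tau n (m - n)) i v))"
      by blast
  next
    fix x assume H: "\<forall>g. ext_class R (A n) M i g \<longrightarrow>
        (\<exists>m\<ge>n. ext_null R (A m) M i (\<lambda>v. y \<odot>\<^bsub>M\<^esub> g (degree_part (\<lambda>_. tau n (m - n)) i v)))"
      and x: "x \<in> carrier (E i n)"
    obtain f where f: "f \<in> Ext_cocycles R (N n) M i" "x = B i n +>\<^bsub>Z i n\<^esub> f"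
      using x unfolding Ext_cochains by (metis Z.quotient_carrierE[OF cob] cochains_simps(1))
    obtain g where g: "ext_class R (A n) M i g" "f = (\<lambda>v\<in>carrier (F n i). g (to_syzygy R i v))"
      by (rule N.cocycle_class[OF target i f(1)])
    show "\<exists>k\<ge>n. transition (t i) n k (y \<odot>\<^bsub>E i n\<^esub> x) = \<zero>\<^bsub>E i k\<^esub>"
      using H g(1) * [OF g(1)] unfolding f(2) g(2) by blast
  qed
  moreover have "unital_map R (A m) (A n) (\<lambda>_. tau n (m - n))" if "n \<le> m" for m n
    using tau_unital[of n "m - n"] that by simp
  ultimately show ?thesis
    using kills_specific[OF N.res_pres_presentation target y, where \<tau> = "\<lambda>m n _. tau n (m - n)"]
    unfolding D.kills_limit_iff[OF y] by simp
qed

end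

section \<open>Powers of ideals\<close>

context cring
begin

lemma ideals_monoid: "Group.monoid (ideals_set R)"
  using ideals_set_is_semiring by (simp add: semiring_def)

lemma ideal_power_ideal: "ideal I R \<Longrightarrow> ideal (ideal_power R I n) R"
  using monoid.nat_pow_closed[OF ideals_monoid, of I n] by (simp add: ideal_power_def ideals_set_def)

lemma ideal_power_0: "ideal_power R I 0 = carrier R"
  by (simp add: ideal_power_def ideals_set_def)

lemma ideal_power_Suc: "ideal_power R I (Suc n) = ideal_prod R (ideal_power R I n) I"
  by (simp add: ideal_power_def ideals_set_def)

lemma ideal_power_1: "ideal I R \<Longrightarrow> ideal_power R I 1 = I"
  using monoid.nat_pow_eone[OF ideals_monoid, of I] by (simp add: ideal_power_def ideals_set_def)

lemma ideal_power_mult: "ideal I R \<Longrightarrow> ideal_power R (ideal_power R I m) n = ideal_power R I (m * n)"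
  using monoid.nat_pow_pow[OF ideals_monoid, of I m n] by (simp add: ideal_power_def ideals_set_def)

lemma ideal_prod_mono: "I \<subseteq> I' \<Longrightarrow> J \<subseteq> J' \<Longrightarrow> ideal_prod R I J \<subseteq> ideal_prod R I' J'"
proof
  fix x assume "I \<subseteq> I'" "J \<subseteq> J'" "x \<in> ideal_prod R I J"
  from this(3,1,2) show "x \<in> ideal_prod R I' J'"
    by induction (auto intro: ideal_prod.intros)
qed

lemma ideal_power_mono: "I \<subseteq> J \<Longrightarrow> ideal_power R I n \<subseteq> ideal_power R J n"
  by (induction n) (simp_all add: ideal_power_0 ideal_power_Suc ideal_prod_mono)

lemma ideal_power_antimono: "ideal I R \<Longrightarrow> m \<le> n \<Longrightarrow> ideal_power R I n \<subseteq> ideal_power R I m"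
proof (induction n rule: nat_induct)
  case (Suc n)
  have "ideal_power R I (Suc n) \<subseteq> ideal_power R I n"
    unfolding ideal_power_Suc using ideal_prod_inter[OF ideal_power_ideal] Suc.prems by blast
  then show ?case using Suc by (cases "m = Suc n") auto
qed simp

lemma power_in_ideal_power: "ideal I R \<Longrightarrow> x \<in> I \<Longrightarrow> x [^] n \<in> ideal_power R I n"
proof (induction n)
  case (Suc n)
  then show ?case by (simp add: ideal_power_Suc ideal_prod.prod)
qed (simp add: ideal_power_0)

text \<open>Adjoining to an ideal a nilpotent element modulo this ideal is reversed by a power:
  \<open>(A + (y))\<^sup>k \<subseteq> A + (y\<^sup>k)\<close>.\<close>

lemma ideal_power_adjoin:
  assumes A: "ideal A R" and y: "y \<in> carrier R" "y [^] (k::nat) \<in> A"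
    and B: "ideal B R" "B \<subseteq> {a \<oplus> r \<otimes> y | a r. a \<in> A \<and> r \<in> carrier R}"
  shows "ideal_power R B k \<subseteq> A"
proof -
  interpret A: ideal A R by fact
  have "ideal_power R B n \<subseteq> {a \<oplus> r \<otimes> y [^] n | a r. a \<in> A \<and> r \<in> carrier R}" for n :: nat
  proof (induction n)
    case 0
    have "x \<in> {a \<oplus> r \<otimes> y [^] (0::nat) | a r. a \<in> A \<and> r \<in> carrier R}" if "x \<in> carrier R" for x
      by (intro CollectI exI[of _ \<zero>] exI[of _ x]) (use that in auto)
    then show ?case by (auto simp only: ideal_power_0)
  next
    case (Suc n)
    show ?case
    proof
      fix x assume "x \<in> ideal_power R B (Suc n)"
      then have "x \<in> ideal_prod R (ideal_power R B n) B" by (simp add: ideal_power_Suc)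
      then show "x \<in> {a \<oplus> r \<otimes> y [^] Suc n | a r. a \<in> A \<and> r \<in> carrier R}"
      proof induction
        case (prod i j)
        obtain a r where i: "i = a \<oplus> r \<otimes> y [^] n" "a \<in> A" "r \<in> carrier R" using prod(1) Suc by blast
        obtain b s where j: "j = b \<oplus> s \<otimes> y" "b \<in> A" "s \<in> carrier R" using prod(2) B(2) by blast
        have c: "a \<in> carrier R" "b \<in> carrier R" using i(2) j(2) A.Icarr by auto
        have "i \<otimes> j = (a \<otimes> (b \<oplus> s \<otimes> y) \<oplus> (r \<otimes> y [^] n) \<otimes> b) \<oplus> (r \<otimes> s) \<otimes> y [^] Suc n"
          using c i j y by (simp add: l_distr r_distr m_ac a_ac)
        moreover have "a \<otimes> (b \<oplus> s \<otimes> y) \<oplus> (r \<otimes> y [^] n) \<otimes> b \<in> A"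
          using i j c y by (intro A.a_closed A.I_r_closed A.I_l_closed) auto
        ultimately show ?case using i j by blast
      next
        case (sum s1 s2)
        then obtain a r b s where "s1 = a \<oplus> r \<otimes> y [^] Suc n" "a \<in> A" "r \<in> carrier R"
          "s2 = b \<oplus> s \<otimes> y [^] Suc n" "b \<in> A" "s \<in> carrier R" by blast
        then have "s1 \<oplus> s2 = (a \<oplus> b) \<oplus> (r \<oplus> s) \<otimes> y [^] Suc n" "a \<oplus> b \<in> A" "r \<oplus> s \<in> carrier R"
          using y(1) A.Icarr A.a_closed by (auto simp: l_distr a_ac)
        then show ?case by blast
      qed
    qed
  qed
  from this[of k] show ?thesis
    using y A.I_l_closed A.a_closed by (auto simp del: nat_pow_Suc dest!: subsetD)
qed

text \<open>The \<open>y j\<close> are adjoined one at a time; each step is undone by the power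
  \<open>k q\<close>, and the exponents multiply. It yields both that a power of an ideal lies in
  the ideal of powers of its generators and that a power of an ideal annihilates as soon as powers
  of its generators do.\<close>

lemma ideal_power_subset:
  fixes y :: "nat \<Rightarrow> 'a" and k :: "nat \<Rightarrow> nat"
  assumes A: "ideal A R" and y: "\<And>j. j < q \<Longrightarrow> y j \<in> carrier R" "\<And>j. j < q \<Longrightarrow> y j [^] k j \<in> A"
  shows "\<exists>K. ideal_power R (Idl (A \<union> y ` {..<q})) K \<subseteq> A"
  using y
proof (induction q)
  case 0
  have "Idl A = A" using genideal_minimal[OF A] genideal_self[OF ideal.Icarr[OF A, THEN subsetI]] by blast
  then show ?case using ideal_power_1[OF A] by auto
next
  case (Suc q)
  have Ac: "A \<subseteq> carrier R" using ideal.Icarr[OF A] by blast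
  let ?B = "Idl (A \<union> y ` {..<q})" and ?C = "Idl (A \<union> y ` {..<Suc q})"
  from Suc obtain K where K: "ideal_power R ?B K \<subseteq> A" by auto
  have sub: "A \<union> y ` {..<q} \<subseteq> carrier R" "A \<union> y ` {..<Suc q} \<subseteq> carrier R" using Ac Suc.prems(1) by auto
  have B: "ideal ?B R" and C: "ideal ?C R" by (auto intro!: genideal_ideal sub)
  interpret B: ideal ?B R by (rule B)
  have AB: "A \<subseteq> ?B" "y ` {..<q} \<subseteq> ?B" using genideal_self[OF sub(1)] by auto
  let ?S = "{a \<oplus> r \<otimes> y q | a r. a \<in> ?B \<and> r \<in> carrier R}"
  have yq: "y q \<in> carrier R" using Suc.prems(1) by simp
  have S: "?S = ?B <+> PIdl (y q)"
    by (auto simp: set_add_def' cgenideal_def)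
  have "ideal ?S R" unfolding S by (rule add_ideals[OF B cgenideal_ideal[OF yq]])
  moreover have "A \<union> y ` {..<Suc q} \<subseteq> ?S"
  proof
    fix x assume x: "x \<in> A \<union> y ` {..<Suc q}"
    show "x \<in> ?S"
    proof (cases "x = y q")
      case True
      then show ?thesis using yq B.zero_closed by (intro CollectI exI[of _ \<zero>] exI[of _ \<one>]) auto
    next
      case False
      then have "x \<in> A \<union> y ` {..<q}" using x by (auto simp: less_Suc_eq)
      then have "x \<in> ?B" using AB by blast
      then show ?thesis using yq B.Icarr by (intro CollectI exI[of _ x] exI[of _ \<zero>]) auto
    qed
  qed
  ultimately have "?C \<subseteq> ?S" by (rule genideal_minimal)
  then have "ideal_power R ?C (k q) \<subseteq> ?B"
    using Suc.prems AB yq by (intro ideal_power_adjoin[OF B yq _ C]) auto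
  then have "ideal_power R (ideal_power R ?C (k q)) K \<subseteq> A"
    using ideal_power_mono[of _ ?B K] K by blast
  then show ?case using ideal_power_mult[OF C] by auto
qed

end

section \<open>Elementary description of the annihilators\<close>

lemma (in cring) residue_cyclic:
  assumes "ideal I R"
  shows "cyclic_module R (residue_module R I n) (ideal_power R I n +>\<^bsub>R\<^esub> \<one>)"
proof -
  interpret Rm: module R "regular_module R" by (rule module_regular)
  have s: "submodule (ideal_power R I n) R (regular_module R)"
    by (rule ideal_imp_submodule_regular[OF is_cring ideal_power_ideal[OF assms]])
  show ?thesis
  proof (intro cyclic_module.intro cyclic_module_axioms.intro)
    show "module R (residue_module R I n)"
      unfolding residue_module_def by (rule Rm.quotient_is_module[OF s])
    show "ideal_power R I n +>\<^bsub>R\<^esub> \<one> \<in> carrier (residue_module R I n)"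
      unfolding residue_module_def additive_coset_regular[of R, symmetric] by (rule Rm.quotient_carrierI[OF s]) simp
    fix X assume "X \<in> carrier (residue_module R I n)"
    then obtain a where "a \<in> carrier R" "X = ideal_power R I n +>\<^bsub>regular_module R\<^esub> a"
      unfolding residue_module_def by (metis Rm.quotient_carrierE[OF s] regular_module_simps(1))
    then show "\<exists>a\<in>carrier R. X = a \<odot>\<^bsub>residue_module R I n\<^esub> (ideal_power R I n +>\<^bsub>R\<^esub> \<one>)"
      using Rm.quotient_smult[OF s, of a \<one>]
      unfolding residue_module_def additive_coset_regular[of R, symmetric] by auto
  qed
qed

lemma (in cring) residue_annihilator:
  assumes "ideal I R"
  shows "{a \<in> carrier R. a \<odot>\<^bsub>residue_module R I n\<^esub> (ideal_power R I n +>\<^bsub>R\<^esub> \<one>) = \<zero>\<^bsub>residue_module R I n\<^esub>}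
    = ideal_power R I n"
proof -
  interpret Rm: module R "regular_module R" by (rule module_regular)
  interpret J: ideal "ideal_power R I n" R by (rule ideal_power_ideal[OF assms])
  have s: "submodule (ideal_power R I n) R (regular_module R)"
    by (rule ideal_imp_submodule_regular[OF is_cring ideal_power_ideal[OF assms]])
  have "a \<odot>\<^bsub>residue_module R I n\<^esub> (ideal_power R I n +>\<^bsub>R\<^esub> \<one>) = \<zero>\<^bsub>residue_module R I n\<^esub> \<longleftrightarrow>
      a \<in> ideal_power R I n" if "a \<in> carrier R" for a
    unfolding residue_module_def additive_coset_regular[of R, symmetric]
    using Rm.quotient_smult[OF s, of a \<one>] Rm.coset_zero_iff[OF s, of a] that
    by (simp del: quotient_module_simps(4))
  then show ?thesis using J.Icarr by blast
qed

lemma (in cring) residue_tower: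
  assumes I: "ideal I R" and M: "module R M"
  shows "cyclic_tower R (\<lambda>n. residue_module R I (Suc n)) (\<lambda>n. ideal_power R I (Suc n) +>\<^bsub>R\<^esub> \<one>)
    (\<lambda>n. residue_proj R I (Suc n)) M"
proof (intro cyclic_tower.intro residue_cyclic[OF I] M)
  fix n
  interpret Rm: module R "regular_module R" by (rule module_regular)
  have s: "submodule (ideal_power R I n) R (regular_module R)" for n
    by (rule ideal_imp_submodule_regular[OF is_cring ideal_power_ideal[OF I]])
  have l: "lin R (regular_module R) (regular_module R) (\<lambda>x. x)" by (rule linI) auto
  have sub: "b \<in> ideal_power R I (Suc n)" if "b \<in> ideal_power R I (Suc (Suc n))" for b
    using ideal_power_antimono[OF I, of "Suc n" "Suc (Suc n)"] that by auto
  have e: "residue_proj R I (Suc n) = (\<lambda>X. \<Union>x\<in>X. ideal_power R I (Suc n) +>\<^bsub>regular_module R\<^esub> x)"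
    by (simp add: residue_proj_def fun_eq_iff additive_coset_regular)
  show "lin R (residue_module R I (Suc (Suc n))) (residue_module R I (Suc n)) (residue_proj R I (Suc n))"
    unfolding e residue_module_def
    by (rule quotient_map_lin[OF Rm.module_axioms Rm.module_axioms l s s sub])
  show "residue_proj R I (Suc n) (ideal_power R I (Suc (Suc n)) +>\<^bsub>R\<^esub> \<one>) = ideal_power R I (Suc n) +>\<^bsub>R\<^esub> \<one>"
    unfolding e additive_coset_regular[of R, symmetric]
    by (rule quotient_map_coset[OF Rm.module_axioms Rm.module_axioms l s s sub]) auto
qed

section \<open>Conditions on tuples and relations in degrees 0, 1 and 2\<close>

definition comb :: "('a, 'm, 's) module_scheme \<Rightarrow> nat \<Rightarrow> (nat \<Rightarrow> 'a) \<Rightarrow> (nat \<Rightarrow> 'm) \<Rightarrow> 'm" where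
  "comb M r v w = (\<Oplus>\<^bsub>M\<^esub>i\<in>{..<r}. v i \<odot>\<^bsub>M\<^esub> w i)"

definition power_relations :: "('a, 'r) ring_scheme \<Rightarrow> nat \<Rightarrow> (nat \<Rightarrow> 'a) \<Rightarrow> nat \<Rightarrow> (nat \<Rightarrow> 'a) set" where
  "power_relations R r x n =
    {v \<in> carrier (free_module R {..<r}). comb (regular_module R) r v (\<lambda>i. x i [^]\<^bsub>R\<^esub> n) = \<zero>\<^bsub>R\<^esub>}"

text \<open>The tuples \<open>m\<close> for which sending \<open>x i ^ n\<close> to
  \<open>m i\<close> is a well defined linear map from the ideal generated by these powers to
  \<open>M\<close>.\<close>

definition cocycle1 where
  "cocycle1 R M r x n m \<longleftrightarrow> m \<in> UNIV \<rightarrow> carrier M \<and> (\<forall>v\<in>power_relations R r x n. comb M r v m = \<zero>\<^bsub>M\<^esub>)"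

text \<open>Restricted to the ideal of the powers of exponent \<open>N + n\<close>, the map takes
  \<open>x i ^ (N + n)\<close> to \<open>x i ^ N\<close> times \<open>m i\<close>; it is null when
  there it is multiplication by some \<open>u\<close>, that is, when it extends to the ring.\<close>

definition null1 where
  "null1 R M r x n m \<longleftrightarrow>
    (\<exists>N. \<exists>u\<in>carrier M. \<forall>i<r. x i [^]\<^bsub>R\<^esub> (N::nat) \<odot>\<^bsub>M\<^esub> m i = x i [^]\<^bsub>R\<^esub> (N + n) \<odot>\<^bsub>M\<^esub> u)"

definition cocycle2 where
  "cocycle2 R M r x n g \<longleftrightarrow> lin R (free_module R {..<r}\<lparr>carrier := power_relations R r x n\<rparr>) M g"

text \<open>A relation among the powers of exponent \<open>n + N\<close> becomes one among those of
  exponent \<open>n\<close> by absorbing \<open>x i ^ N\<close> into its coefficients.\<close>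

definition shift :: "('a, 'r) ring_scheme \<Rightarrow> (nat \<Rightarrow> 'a) \<Rightarrow> nat \<Rightarrow> (nat \<Rightarrow> 'a) \<Rightarrow> nat \<Rightarrow> 'a" where
  "shift R x N v = (\<lambda>i. x i [^]\<^bsub>R\<^esub> N \<otimes>\<^bsub>R\<^esub> v i)"

text \<open>After passing to a later stage the map on relations extends to the whole free module,
  with \<open>w\<close> as its values at the basis.\<close>

definition null2 where
  "null2 R M r x n g \<longleftrightarrow>
    (\<exists>N. \<exists>w\<in>UNIV \<rightarrow> carrier M. \<forall>v\<in>power_relations R r x (n + N). g (shift R x N v) = comb M r v w)"

definition annihilates ::
    "('a, 'r) ring_scheme \<Rightarrow> ('a, 'm, 's) module_scheme \<Rightarrow> nat \<Rightarrow> (nat \<Rightarrow> 'a) \<Rightarrow> nat \<Rightarrow> 'a \<Rightarrow> bool" where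
  "annihilates R M r x i y \<longleftrightarrow>
    (if i = 0 then \<forall>n. \<forall>m\<in>carrier M. (\<forall>i<r. x i [^]\<^bsub>R\<^esub> (n::nat) \<odot>\<^bsub>M\<^esub> m = \<zero>\<^bsub>M\<^esub>) \<longrightarrow> y \<odot>\<^bsub>M\<^esub> m = \<zero>\<^bsub>M\<^esub>
     else if i = 1 then \<forall>n m. cocycle1 R M r x n m \<longrightarrow> null1 R M r x n (\<lambda>i. y \<odot>\<^bsub>M\<^esub> m i)
     else \<forall>n g. cocycle2 R M r x n g \<longrightarrow> null2 R M r x n (\<lambda>v. y \<odot>\<^bsub>M\<^esub> g v))"

text \<open>Presents the ring modulo the ideal of the n-th powers. The single generator has index 0
  and the relations carry the indices of the \<open>x i\<close>, so both bases are sets of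
  naturals.\<close>

definition power_pres :: "('a, 'r) ring_scheme \<Rightarrow> nat \<Rightarrow> (nat \<Rightarrow> 'a) \<Rightarrow> nat \<Rightarrow> ('a, nat) pres" where
  "power_pres R r x n =
    (let d = lin_ext R (free_module R {0}) (\<lambda>i. x i [^]\<^bsub>R\<^esub> n \<odot>\<^bsub>free_module R {0}\<^esub> basis_vec R 0) in
      \<lparr>gens = {0}, rels = {..<r}, unit = basis_vec R 0, ker = d ` carrier (free_module R {..<r}), diff = d\<rparr>)"

lemma ex_ge_iff: "(\<exists>m\<ge>n. Q (m - n) m) \<longleftrightarrow> (\<exists>N::nat. Q N (n + N))"
  by (metis le_add1 add_diff_cancel_left' le_add_diff_inverse)

locale power_system = module R M for R (structure) and M (structure) +
  fixes r :: nat and x :: "nat \<Rightarrow> 'a"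
  assumes x_closed [simp, intro]: "x i \<in> carrier R"
begin

abbreviation "P \<equiv> power_pres R r x"
abbreviation "Fr \<equiv> free_module R {..<r}"
abbreviation "F0 \<equiv> free_module R {0::nat}"
abbreviation "rel \<equiv> power_relations R r x"
abbreviation "e0 \<equiv> basis_vec R (0::nat)"

sublocale Fr: module R Fr by (rule free_is_module)
sublocale F0: module R F0 by (rule free_is_module)
sublocale Rm: module R "regular_module R" by (rule module_regular)

lemma P_simps [simp]: "gens (P n) = {0}" "rels (P n) = {..<r}" "unit (P n) = e0"
    "ker (P n) = diff (P n) ` carrier Fr"
  by (simp_all add: power_pres_def Let_def)

lemma e0_closed [simp]: "e0 \<in> carrier F0"
  by (rule basis_in_free) simp

lemma basis_Fr [simp]: "i < r \<Longrightarrow> basis_vec R i \<in> carrier Fr"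
  by (rule basis_in_free) simp

lemma comb_lin_ext:
  assumes "module R L" "v \<in> carrier Fr" "w \<in> UNIV \<rightarrow> carrier L"
  shows "comb L r v w = lin_ext R L w v"
proof -
  have "{i. v i \<noteq> \<zero>} \<subseteq> {..<r}" using assms(2) by (auto simp: free_carrier)
  then show ?thesis
    unfolding comb_def by (intro lin_ext_eq[OF assms(1) _ assms(2), symmetric]) (use assms(3) in auto)
qed

lemma lin_comb: "module R L \<Longrightarrow> w \<in> UNIV \<rightarrow> carrier L \<Longrightarrow> lin R Fr L (\<lambda>v. comb L r v w)"
  by (rule lin_cong[of R Fr L "lin_ext R L w"], rule lin_lin_ext) (auto simp: comb_lin_ext)

lemma comb_basis: "module R L \<Longrightarrow> w \<in> UNIV \<rightarrow> carrier L \<Longrightarrow> i < r \<Longrightarrow> comb L r (basis_vec R i) w = w i"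
  using comb_lin_ext[of L "basis_vec R i" w] lin_ext_basis[of L w "{..<r}" i] by auto

lemma lin_eq_comb:
  assumes L: "module R L" and G: "lin R Fr L G" and w: "w \<in> UNIV \<rightarrow> carrier L"
    and "\<And>i. i < r \<Longrightarrow> G (basis_vec R i) = w i" and "v \<in> carrier Fr"
  shows "G v = comb L r v w"
  by (rule lin_free_eq[OF L G lin_comb[OF L w] _ assms(5)]) (use assms comb_basis[OF L w] in auto)

lemma diff_lin: "lin R Fr F0 (diff (P n))"
  unfolding power_pres_def Let_def by (simp, rule lin_lin_ext[OF free_is_module]) auto

lemma diff_basis: "i < r \<Longrightarrow> diff (P n) (basis_vec R i) = x i [^] n \<odot>\<^bsub>F0\<^esub> e0"
  unfolding power_pres_def Let_def by (simp, rule lin_ext_basis[OF free_is_module, of _ "{..<r}"]) auto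

lemma F0_expand: "v \<in> carrier F0 \<Longrightarrow> v = v 0 \<odot>\<^bsub>F0\<^esub> e0"
  by (auto simp: free_simps free_carrier basis_vec_def fun_eq_iff)

lemma diff_comb:
  assumes "v \<in> carrier Fr"
  shows "diff (P n) v = comb (regular_module R) r v (\<lambda>i. x i [^] n) \<odot>\<^bsub>F0\<^esub> e0"
proof -
  have w: "(\<lambda>i. x i [^] n) \<in> UNIV \<rightarrow> carrier (regular_module R)" by auto
  note l = lin_comb[OF Rm.module_axioms w]
  have "lin R Fr F0 (\<lambda>v. comb (regular_module R) r v (\<lambda>i. x i [^] n) \<odot>\<^bsub>F0\<^esub> e0)"
    using l by (intro linI) (auto simp: lin_def Pi_iff F0.smult_l_distr F0.smult_assoc1)
  then show ?thesis
    by (rule lin_free_eq[OF F0.module_axioms diff_lin _ _ assms])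
      (auto simp: diff_basis comb_basis[OF Rm.module_axioms w])
qed

lemma smult_e0_zero: "a \<in> carrier R \<Longrightarrow> a \<odot>\<^bsub>F0\<^esub> e0 = \<zero>\<^bsub>F0\<^esub> \<longleftrightarrow> a = \<zero>"
  by (auto simp: free_simps basis_vec_def fun_eq_iff split: if_splits)

lemma rel_diff: "rel n = {v \<in> carrier Fr. diff (P n) v = \<zero>\<^bsub>F0\<^esub>}"
proof -
  have w: "(\<lambda>i. x i [^] n) \<in> UNIV \<rightarrow> carrier (regular_module R)" by auto
  show ?thesis
    using lin_closed[OF lin_comb[OF Rm.module_axioms w]]
    by (auto simp: power_relations_def diff_comb smult_e0_zero)
qed

lemma rel_submodule: "submodule (rel n) R Fr"
  unfolding rel_diff by (rule Fr.submodule_ker[OF F0.module_axioms diff_lin])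

lemma presentation: "presentation R (P n)"
proof (intro presentation.intro presentation_axioms.intro)
  have z: "\<zero>\<^bsub>F0\<^esub> \<in> ker (P n)"
    using imageI[OF Fr.M.zero_closed, of "diff (P n)"] lin_zero[OF Fr.module_axioms F0.module_axioms diff_lin, of n]
    by simp
  fix v assume "v \<in> carrier (free_module R (gens (P n)))"
  then have v: "v \<in> carrier F0" by simp
  have "v 0 \<in> carrier R" by (rule free_closed[OF v])
  then show "\<exists>a\<in>carrier R. \<exists>k\<in>ker (P n).
      v = a \<odot>\<^bsub>free_module R (gens (P n))\<^esub> unit (P n) \<oplus>\<^bsub>free_module R (gens (P n))\<^esub> k"
    using F0_expand[OF v] z v by (intro bexI[of _ "v 0"] bexI[of _ "\<zero>\<^bsub>F0\<^esub>"]) auto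
qed (use R.is_cring diff_lin submodule_image[OF Fr.module_axioms F0.module_axioms diff_lin] in auto)

lemma shift_lin: "lin R Fr Fr (shift R x N)"
proof (rule linI)
  fix v assume v: "v \<in> carrier Fr"
  have "{i. x i [^] N \<otimes> v i \<noteq> \<zero>} \<subseteq> {..<r}" using v by (auto simp: free_carrier)
  then show "shift R x N v \<in> carrier Fr"
    using v by (auto simp: free_carrier shift_def intro: finite_subset)
qed (auto simp: shift_def free_simps r_distr m_ac free_closed)

lemma shift_basis: "shift R x N (basis_vec R i) = x i [^] N \<odot>\<^bsub>Fr\<^esub> basis_vec R i"
  by (auto simp: shift_def free_simps basis_vec_def)

lemma diff_shift: "v \<in> carrier Fr \<Longrightarrow> n \<le> m \<Longrightarrow> diff (P n) (shift R x (m - n) v) = diff (P m) v"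
proof (rule lin_free_eq[OF F0.module_axioms lin_comp[OF diff_lin shift_lin] diff_lin])
  fix i assume "i \<in> {..<r}" "n \<le> m"
  then show "diff (P n) (shift R x (m - n) (basis_vec R i)) = diff (P m) (basis_vec R i)"
    by (simp add: shift_basis lin_smult[OF diff_lin] diff_basis R.nat_pow_mult flip: F0.smult_assoc1)
qed

lemma shift_rel: "v \<in> rel (n + N) \<Longrightarrow> shift R x N v \<in> rel n"
  using diff_shift[of v n "n + N"] lin_closed[OF shift_lin, of v N] by (auto simp: rel_diff)

text \<open>A chain map lifting the projection between two residue rings. As it is the identity on
  the generator, the transition shows up as \<open>shift\<close> in degree 2 only; in degree 1 it is
  the restriction to a smaller ideal.\<close>

definition step_map :: "nat \<Rightarrow> nat \<Rightarrow> nat \<Rightarrow> (nat \<Rightarrow> 'a) \<Rightarrow> nat \<Rightarrow> 'a" where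
  "step_map m n j = (if j = 0 then (\<lambda>v. v) else shift R x (m - n))"

lemma step_map_unital: "n \<le> m \<Longrightarrow> unital_map R (P m) (P n) (step_map m n)"
proof -
  assume "n \<le> m"
  have z: "\<zero>\<^bsub>F0\<^esub> \<in> ker (P n)"
    using imageI[OF Fr.M.zero_closed, of "diff (P n)"] lin_zero[OF Fr.module_axioms F0.module_axioms diff_lin, of n]
    by simp
  have "lin R F0 F0 (\<lambda>v. v)" by (rule linI) auto
  then show ?thesis
    using shift_lin diff_shift[OF _ \<open>n \<le> m\<close>] bexI[OF _ z, of "\<lambda>k. e0 = e0 \<oplus>\<^bsub>F0\<^esub> k"]
    unfolding unital_map_def step_map_def by simp
qed

lemma kills_P_specific:
  assumes "y \<in> carrier R"
  shows "kills R P M i y \<longleftrightarrow> (\<forall>n g. ext_class R (P n) M i g \<longrightarrow>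
    (\<exists>m\<ge>n. ext_null R (P m) M i (\<lambda>v. y \<odot>\<^bsub>M\<^esub> g (degree_part (step_map m n) i v))))"
  by (rule kills_specific[OF presentation module_axioms assms step_map_unital])

lemma F0_lin:
  assumes "u \<in> carrier M"
  obtains G where "lin R F0 M G" "G e0 = u"
  using lin_lin_ext[OF module_axioms, of "\<lambda>_. u" "{0::nat}"]
    lin_ext_basis[OF module_axioms, of "\<lambda>_. u" "{0::nat}" 0] assms by auto

text \<open>A map on the free module of rank one is an element of \<open>M\<close>; it kills the
  kernel when the element is annihilated by all \<open>x i ^ n\<close>. The transition maps leave
  this element unchanged, so later stages add nothing.\<close>

lemma kills_P0: "y \<in> carrier R \<Longrightarrow> kills R P M 0 y \<longleftrightarrow> annihilates R M r x 0 y"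
proof -
  assume y: "y \<in> carrier R"
  have c: "ext_class R (P n) M 0 g \<longleftrightarrow> lin R F0 M g \<and> (\<forall>i<r. x i [^] n \<odot>\<^bsub>M\<^esub> g e0 = \<zero>\<^bsub>M\<^esub>)" for n g
  proof -
    have 1: "ext_class R (P n) M 0 g \<longleftrightarrow> lin R F0 M g \<and> (\<forall>v\<in>carrier Fr. g (diff (P n) v) = \<zero>\<^bsub>M\<^esub>)"
      by (auto simp: ext_class_def ambient_def syzygy_def lin_def)
    have "(\<forall>v\<in>carrier Fr. g (diff (P n) v) = \<zero>\<^bsub>M\<^esub>) \<longleftrightarrow> (\<forall>i<r. x i [^] n \<odot>\<^bsub>M\<^esub> g e0 = \<zero>\<^bsub>M\<^esub>)" if g: "lin R F0 M g"
    proof -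
      have b: "g (diff (P n) (basis_vec R i)) = x i [^] n \<odot>\<^bsub>M\<^esub> g e0" if "i < r" for i
        using that by (simp add: diff_basis lin_smult[OF g])
      show ?thesis
      proof
        assume "\<forall>v\<in>carrier Fr. g (diff (P n) v) = \<zero>\<^bsub>M\<^esub>"
        then show "\<forall>i<r. x i [^] n \<odot>\<^bsub>M\<^esub> g e0 = \<zero>\<^bsub>M\<^esub>" using b basis_Fr by metis
      next
        assume z: "\<forall>i<r. x i [^] n \<odot>\<^bsub>M\<^esub> g e0 = \<zero>\<^bsub>M\<^esub>"
        show "\<forall>v\<in>carrier Fr. g (diff (P n) v) = \<zero>\<^bsub>M\<^esub>"
          using lin_free_mem[OF module_axioms lin_comp[OF g diff_lin] submodule_trivial] b z by auto
      qed
    qed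
    with 1 show ?thesis by blast
  qed
  have nul: "ext_null R (P m) M 0 (\<lambda>v. y \<odot>\<^bsub>M\<^esub> g v) \<longleftrightarrow> y \<odot>\<^bsub>M\<^esub> g e0 = \<zero>\<^bsub>M\<^esub>" if g: "lin R F0 M g" for m g
  proof -
    have "y \<odot>\<^bsub>M\<^esub> g v = \<zero>\<^bsub>M\<^esub>" if "y \<odot>\<^bsub>M\<^esub> g e0 = \<zero>\<^bsub>M\<^esub>" "v \<in> carrier F0" for v
      using lin_free_mem[OF module_axioms lin_scale[OF module_axioms g y] submodule_trivial _ that(2)] that(1) by auto
    then show ?thesis by (auto simp: ext_null_def syzygy_def ambient_def)
  qed
  have "kills R P M 0 y \<longleftrightarrow> (\<forall>(n::nat) g. lin R F0 M g \<and> (\<forall>i<r. x i [^] n \<odot>\<^bsub>M\<^esub> g e0 = \<zero>\<^bsub>M\<^esub>) \<longrightarrow> y \<odot>\<^bsub>M\<^esub> g e0 = \<zero>\<^bsub>M\<^esub>)"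
    unfolding kills_P_specific[OF y] c
    using nul by (simp add: degree_part_def step_map_def) (metis order_refl)
  also have "\<dots> \<longleftrightarrow> annihilates R M r x 0 y"
  proof -
    have "(\<forall>g. lin R F0 M g \<longrightarrow> Q (g e0)) \<longleftrightarrow> (\<forall>m\<in>carrier M. Q m)" for Q
      using F0_lin lin_closed[OF _ e0_closed] by metis
    from this[of "\<lambda>m. (\<forall>i<r. x i [^] n \<odot>\<^bsub>M\<^esub> m = \<zero>\<^bsub>M\<^esub>) \<longrightarrow> y \<odot>\<^bsub>M\<^esub> m = \<zero>\<^bsub>M\<^esub>" for n :: nat]
    show ?thesis unfolding annihilates_def by (simp add: imp_conjL)
  qed
  finally show ?thesis .
qed

text \<open>A map on the image of the differential corresponds to its values \<open>m i\<close> at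
  the elements \<open>x i ^ n \<odot> e0\<close>. At stage \<open>n + N\<close> these elements are
  multiplied by \<open>x i ^ N\<close>, whence this factor in \<open>null1\<close>; the element
  \<open>u\<close> is the value of the extension at \<open>e0\<close>.\<close>

lemma kills_P1: "y \<in> carrier R \<Longrightarrow> kills R P M 1 y \<longleftrightarrow> annihilates R M r x 1 y"
proof -
  assume y: "y \<in> carrier R"
  have c: "ext_class R (P n) M 1 g \<longleftrightarrow> lin R (F0\<lparr>carrier := diff (P n) ` carrier Fr\<rparr>) M g" for n g
    by (auto simp: ext_class_def ambient_def syzygy_def)
  have nul: "ext_null R (P m) M 1 g \<longleftrightarrow> (\<exists>G. lin R F0 M G \<and> (\<forall>v\<in>carrier Fr. G (diff (P m) v) = g (diff (P m) v)))" for m g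
    by (auto simp: ext_null_def syzygy_def ambient_def)
  have k: "kills R P M 1 y \<longleftrightarrow> (\<forall>n g. lin R (F0\<lparr>carrier := diff (P n) ` carrier Fr\<rparr>) M g \<longrightarrow>
      (\<exists>m\<ge>n. \<exists>G. lin R F0 M G \<and> (\<forall>v\<in>carrier Fr. G (diff (P m) v) = y \<odot>\<^bsub>M\<^esub> g (diff (P m) v))))"
    unfolding kills_P_specific[OF y] c nul
    by (simp add: degree_part_def step_map_def)
  have K: "annihilates R M r x 1 y \<longleftrightarrow> (\<forall>n m. cocycle1 R M r x n m \<longrightarrow> null1 R M r x n (\<lambda>i. y \<odot>\<^bsub>M\<^esub> m i))"
    by (simp add: annihilates_def)
  have split: "diff (P m) (basis_vec R i) = x i [^] (m - n) \<odot>\<^bsub>F0\<^esub> diff (P n) (basis_vec R i)" if "n \<le> m" "i < r" for m n i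
    using that by (simp add: diff_basis R.nat_pow_mult flip: F0.smult_assoc1)
  have g_basis: "g (diff (P m) (basis_vec R i)) = x i [^] (m - n) \<odot>\<^bsub>M\<^esub> g (diff (P n) (basis_vec R i))"
    if g: "lin R (F0\<lparr>carrier := diff (P n) ` carrier Fr\<rparr>) M g" and "n \<le> m" "i < r" for g m n i
    unfolding split[OF that(2,3)] using lin_smult[OF g, of "x i [^] (m - n)"] that(3) by simp
  show ?thesis unfolding k K
  proof (intro iffI allI impI)
    fix n m
    assume H: "\<forall>n g. lin R (F0\<lparr>carrier := diff (P n) ` carrier Fr\<rparr>) M g \<longrightarrow>
      (\<exists>m\<ge>n. \<exists>G. lin R F0 M G \<and> (\<forall>v\<in>carrier Fr. G (diff (P m) v) = y \<odot>\<^bsub>M\<^esub> g (diff (P m) v)))"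
      and m: "cocycle1 R M r x n m"
    have mc: "m \<in> UNIV \<rightarrow> carrier M" using m by (auto simp: cocycle1_def)
    have z: "comb M r v m = \<zero>\<^bsub>M\<^esub>" if "v \<in> carrier Fr" "diff (P n) v = \<zero>\<^bsub>F0\<^esub>" for v
      using m that unfolding cocycle1_def rel_diff by auto
    obtain g where g: "lin R (F0\<lparr>carrier := diff (P n) ` carrier Fr\<rparr>) M g"
        "\<And>v. v \<in> carrier Fr \<Longrightarrow> g (diff (P n) v) = comb M r v m"
      using lin_factor[OF Fr.module_axioms F0.module_axioms module_axioms diff_lin lin_comb[OF module_axioms mc] z] by blast
    then obtain k G where k: "k \<ge> n" and G: "lin R F0 M G"
        "\<forall>v\<in>carrier Fr. G (diff (P k) v) = y \<odot>\<^bsub>M\<^esub> g (diff (P k) v)" using H by blast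
    have "x i [^] (k - n) \<odot>\<^bsub>M\<^esub> (y \<odot>\<^bsub>M\<^esub> m i) = x i [^] (k - n + n) \<odot>\<^bsub>M\<^esub> G e0" if i: "i < r" for i
    proof -
      have mi: "m i \<in> carrier M" using mc by auto
      have "x i [^] k \<odot>\<^bsub>M\<^esub> G e0 = y \<odot>\<^bsub>M\<^esub> g (diff (P k) (basis_vec R i))"
        using bspec[OF G(2) basis_Fr[OF i]] lin_smult[OF G(1), of "x i [^] k" e0] i by (simp add: diff_basis)
      also have "\<dots> = y \<odot>\<^bsub>M\<^esub> (x i [^] (k - n) \<odot>\<^bsub>M\<^esub> m i)"
        using g_basis[OF g(1) k i] g(2)[OF basis_Fr[OF i]] comb_basis[OF module_axioms mc i] by simp
      also have "\<dots> = x i [^] (k - n) \<odot>\<^bsub>M\<^esub> (y \<odot>\<^bsub>M\<^esub> m i)"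
        using y mi by (simp add: m_comm flip: smult_assoc1)
      finally show ?thesis using k by simp
    qed
    then show "null1 R M r x n (\<lambda>i. y \<odot>\<^bsub>M\<^esub> m i)"
      unfolding null1_def using lin_closed[OF G(1) e0_closed] by blast
  next
    fix n g
    assume H: "\<forall>n m. cocycle1 R M r x n m \<longrightarrow> null1 R M r x n (\<lambda>i. y \<odot>\<^bsub>M\<^esub> m i)"
      and g: "lin R (F0\<lparr>carrier := diff (P n) ` carrier Fr\<rparr>) M g"
    define m where "m i = (if i < r then g (diff (P n) (basis_vec R i)) else \<zero>\<^bsub>M\<^esub>)" for i
    have mc: "m \<in> UNIV \<rightarrow> carrier M" using lin_closed[OF g] by (auto simp: m_def)
    have lg: "lin R Fr M (\<lambda>v. g (diff (P n) v))"
      by (rule lin_comp[OF g lin_restrict_cod[OF diff_lin]]) auto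
    have "comb M r v m = \<zero>\<^bsub>M\<^esub>" if v: "v \<in> rel n" for v
    proof -
      have vF: "v \<in> carrier Fr" and "diff (P n) v = \<zero>\<^bsub>F0\<^esub>" using v by (auto simp: rel_diff)
      then have "diff (P n) v = diff (P n) \<zero>\<^bsub>Fr\<^esub>"
        using lin_zero[OF Fr.module_axioms F0.module_axioms diff_lin] by simp
      then have "g (diff (P n) v) = \<zero>\<^bsub>M\<^esub>"
        using lin_zero[OF Fr.module_axioms module_axioms lg] by simp
      then show ?thesis using lin_eq_comb[OF module_axioms lg mc _ vF] by (simp add: m_def)
    qed
    then have "cocycle1 R M r x n m" using mc by (auto simp: cocycle1_def)
    then obtain N u where u: "u \<in> carrier M" "\<forall>i<r. x i [^] N \<odot>\<^bsub>M\<^esub> (y \<odot>\<^bsub>M\<^esub> m i) = x i [^] (N + n) \<odot>\<^bsub>M\<^esub> u"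
      using H unfolding null1_def by blast
    obtain G where G: "lin R F0 M G" "G e0 = u" by (rule F0_lin[OF u(1)])
    have "G (diff (P (n + N)) v) = y \<odot>\<^bsub>M\<^esub> g (diff (P (n + N)) v)" if v: "v \<in> carrier Fr" for v
    proof -
      have "lin R Fr M (\<lambda>v. g (diff (P n) (shift R x N v)))" by (rule lin_comp[OF lg shift_lin])
      then have l2: "lin R Fr M (\<lambda>v. y \<odot>\<^bsub>M\<^esub> g (diff (P n) (shift R x N v)))" by (rule lin_scale[OF module_axioms _ y])
      have "G (diff (P (n + N)) v) = y \<odot>\<^bsub>M\<^esub> g (diff (P n) (shift R x N v))"
      proof (rule lin_free_eq[OF module_axioms lin_comp[OF G(1) diff_lin] l2 _ v])
        fix i assume "i \<in> {..<r}"
        then have i: "i < r" by simp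
        have mi: "m i \<in> carrier M" using mc by auto
        have "diff (P n) (shift R x N (basis_vec R i)) = diff (P (n + N)) (basis_vec R i)"
          using diff_shift[of "basis_vec R i" n "n + N"] i by simp
        moreover have "y \<odot>\<^bsub>M\<^esub> (x i [^] N \<odot>\<^bsub>M\<^esub> m i) = x i [^] N \<odot>\<^bsub>M\<^esub> (y \<odot>\<^bsub>M\<^esub> m i)"
          using y mi by (simp add: m_comm flip: smult_assoc1)
        moreover have "g (diff (P (n + N)) (basis_vec R i)) = x i [^] N \<odot>\<^bsub>M\<^esub> m i"
          using g_basis[OF g le_add1 i, of N] i by (simp add: m_def)
        ultimately show "G (diff (P (n + N)) (basis_vec R i)) = y \<odot>\<^bsub>M\<^esub> g (diff (P n) (shift R x N (basis_vec R i)))"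
          using u(2) i by (simp add: diff_basis[OF i] lin_smult[OF G(1)] G(2) add.commute)
      qed
      then show ?thesis using diff_shift[OF v, of n "n + N"] by simp
    qed
    then show "\<exists>m\<ge>n. \<exists>G. lin R F0 M G \<and> (\<forall>v\<in>carrier Fr. G (diff (P m) v) = y \<odot>\<^bsub>M\<^esub> g (diff (P m) v))"
      using G(1) le_add1 by blast
  qed
qed

text \<open>The second syzygy is the module of relations, and an extension to the free module is
  given by the tuple of its values at the basis.\<close>

lemma kills_P2: "y \<in> carrier R \<Longrightarrow> kills R P M 2 y \<longleftrightarrow> annihilates R M r x 2 y"
proof -
  assume y: "y \<in> carrier R"
  have syz: "syzygy R (P n) 2 = rel n" for n
    by (simp add: syzygy_def rel_diff ambient_def)
  have c: "ext_class R (P n) M 2 g \<longleftrightarrow> cocycle2 R M r x n g" for n g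
    by (simp add: ext_class_def syz cocycle2_def ambient_def)
  have nul: "ext_null R (P m) M 2 h \<longleftrightarrow> (\<exists>w\<in>UNIV \<rightarrow> carrier M. \<forall>v\<in>rel m. h v = comb M r v w)" for m h
  proof
    assume "ext_null R (P m) M 2 h"
    then obtain G where G: "lin R Fr M G" "\<forall>v\<in>rel m. G v = h v"
      by (auto simp: ext_null_def syz ambient_def)
    let ?w = "\<lambda>i. if i < r then G (basis_vec R i) else \<zero>\<^bsub>M\<^esub>"
    have w: "?w \<in> UNIV \<rightarrow> carrier M" using lin_closed[OF G(1)] by auto
    have "h v = comb M r v ?w" if "v \<in> rel m" for v
      using lin_eq_comb[OF module_axioms G(1) w, of v] G(2) that by (auto simp: rel_diff)
    then show "\<exists>w\<in>UNIV \<rightarrow> carrier M. \<forall>v\<in>rel m. h v = comb M r v w" using w by blast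
  next
    assume "\<exists>w\<in>UNIV \<rightarrow> carrier M. \<forall>v\<in>rel m. h v = comb M r v w"
    then show "ext_null R (P m) M 2 h"
      using lin_comb[OF module_axioms] by (auto simp: ext_null_def syz ambient_def) (metis Pi_I UNIV_I)
  qed
  have "(\<exists>m\<ge>n. \<exists>w\<in>UNIV \<rightarrow> carrier M. \<forall>v\<in>rel m. y \<odot>\<^bsub>M\<^esub> g (shift R x (m - n) v) = comb M r v w) \<longleftrightarrow>
      null2 R M r x n (\<lambda>v. y \<odot>\<^bsub>M\<^esub> g v)" for n g
    unfolding null2_def
    by (rule ex_ge_iff[of n "\<lambda>N m. \<exists>w\<in>UNIV \<rightarrow> carrier M. \<forall>v\<in>rel m. y \<odot>\<^bsub>M\<^esub> g (shift R x N v) = comb M r v w"])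
  then show ?thesis
    unfolding kills_P_specific[OF y] c nul annihilates_def
    by (simp add: degree_part_def step_map_def)
qed

lemma kills_P:
  assumes "y \<in> carrier R" "i \<le> 2"
  shows "kills R P M i y \<longleftrightarrow> annihilates R M r x i y"
proof -
  consider "i = 0" | "i = 1" | "i = 2" using assms(2) by linarith
  then show ?thesis using kills_P0[OF assms(1)] kills_P1[OF assms(1)] kills_P2[OF assms(1)] by cases auto
qed

lemma pres_ideal_ideal: "ideal (pres_ideal R (P n)) R"
proof -
  have l: "lin R (regular_module R) F0 (\<lambda>a. a \<odot>\<^bsub>F0\<^esub> e0)"
    by (rule linI) (auto simp: F0.smult_l_distr F0.smult_assoc1)
  have "submodule (ker (P n)) R F0"
    using submodule_image[OF Fr.module_axioms F0.module_axioms diff_lin] by simp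
  from Rm.submodule_vimage[OF F0.module_axioms l this] show ?thesis
    by (intro submodule_regular_imp_ideal R.is_cring) (simp add: pres_ideal_def)
qed

lemma power_in_pres_ideal: "i < r \<Longrightarrow> x i [^] n \<in> pres_ideal R (P n)"
  using basis_Fr diff_basis[of i n] by (auto simp: pres_ideal_def image_iff intro!: bexI[of _ "basis_vec R i"])

text \<open>With \<open>power_in_pres_ideal\<close> and \<open>pres_ideal_ideal\<close> this
  identifies the presented ideal as the one generated by the powers \<open>x i ^ n\<close>.\<close>

lemma pres_ideal_subset:
  assumes "ideal J R" "\<And>i. i < r \<Longrightarrow> x i [^] n \<in> J"
  shows "pres_ideal R (P n) \<subseteq> J"
proof
  fix a assume "a \<in> pres_ideal R (P n)"
  then obtain v where a: "a \<in> carrier R" and v: "v \<in> carrier Fr" "a \<odot>\<^bsub>F0\<^esub> e0 = diff (P n) v"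
    by (auto simp: pres_ideal_def)
  let ?c = "comb (regular_module R) r v (\<lambda>i. x i [^] n)"
  have w: "(\<lambda>i. x i [^] n) \<in> UNIV \<rightarrow> carrier (regular_module R)" by auto
  have c: "?c \<in> carrier R" using lin_closed[OF lin_comb[OF Rm.module_axioms w] v(1)] by simp
  have "a = ?c" using fun_cong[OF v(2)[unfolded diff_comb[OF v(1)]], of 0] a c
    by (simp add: free_simps basis_vec_def)
  also have "?c \<in> J"
    by (rule lin_free_mem[OF Rm.module_axioms lin_comb[OF Rm.module_axioms w]
          ideal_imp_submodule_regular[OF R.is_cring assms(1)] _ v(1)])
      (use assms(2) comb_basis[OF Rm.module_axioms w] in auto)
  finally show "a \<in> J" .
qed

text \<open>The powers of \<open>I\<close> and the ideals of powers of its generators are cofinal,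
  so the functorial resolutions of the residue rings may be exchanged for the finite presentations;
  the latter are unravelled by \<open>kills_P\<close>.\<close>

theorem kills_local_cohomology:
  assumes i: "i \<le> 2" and y: "y \<in> carrier R" and I: "I = Idl (x ` {..<r})"
  shows "(\<forall>h\<in>carrier (local_cohomology R I i M).
      y \<odot>\<^bsub>local_cohomology R I i M\<^esub> h = \<zero>\<^bsub>local_cohomology R I i M\<^esub>) \<longleftrightarrow> annihilates R M r x i y"
proof -
  have xs: "x ` {..<r} \<subseteq> carrier R" by auto
  have II: "ideal I R" unfolding I by (rule genideal_ideal[OF xs])
  interpret T: cyclic_tower R "\<lambda>n. residue_module R I (Suc n)" "\<lambda>n. ideal_power R I (Suc n) +> \<one>"
    "\<lambda>n. residue_proj R I (Suc n)" M
    by (rule residue_tower[OF II module_axioms])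
  interpret N: cyclic_module R "residue_module R I (Suc n)" "ideal_power R I (Suc n) +> \<one>" for n
    by (rule residue_cyclic[OF II])
  have id: "pres_ideal R (T.A n) = ideal_power R I (Suc n)" for n
    unfolding N.res_pres_ideal by (rule residue_annihilator[OF II])
  have sub1: "pres_ideal R (P n) \<subseteq> ideal_power R I n" for n
    using genideal_self[OF xs] I
    by (intro pres_ideal_subset ideal_power_ideal[OF II] power_in_ideal_power[OF II]) auto
  \<comment> \<open>Every \<open>x i\<close> is nilpotent modulo the ideal generated by the powers
    of exponent \<open>m\<close>, so some power of \<open>I\<close> falls into that ideal.\<close>
  have sub2: "\<exists>l\<ge>n. ideal_power R I (Suc l) \<subseteq> pres_ideal R (P m)" for m n
  proof -
    let ?A = "pres_ideal R (P m)"
    obtain K where K: "ideal_power R (Idl (?A \<union> x ` {..<r})) K \<subseteq> ?A"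
      using ideal_power_subset[OF pres_ideal_ideal, of r x "\<lambda>_. m" m] power_in_pres_ideal by auto
    have "I \<subseteq> Idl (?A \<union> x ` {..<r})"
      unfolding I using genideal_self[of "?A \<union> x ` {..<r}"] genideal_ideal[of "?A \<union> x ` {..<r}"]
      by (intro genideal_minimal) (auto simp: pres_ideal_def)
    then have "ideal_power R I K \<subseteq> ?A" using ideal_power_mono K by blast
    moreover have "ideal_power R I (Suc (max n K)) \<subseteq> ideal_power R I K"
      by (rule ideal_power_antimono[OF II]) simp
    ultimately show ?thesis by (intro exI[of _ "max n K"]) auto
  qed
  have "(\<forall>h\<in>carrier (local_cohomology R I i M).
      y \<odot>\<^bsub>local_cohomology R I i M\<^esub> h = \<zero>\<^bsub>local_cohomology R I i M\<^esub>) \<longleftrightarrow> kills R T.A M i y"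
    unfolding local_cohomology_def by (rule T.kills_limit_iff_kills[OF i y])
  also have "\<dots> \<longleftrightarrow> kills R P M i y"
  proof
    assume k: "kills R T.A M i y"
    show "kills R P M i y"
    proof (rule kills_transfer[OF presentation N.res_pres_presentation _ _ k])
      show "\<exists>m. pres_ideal R (T.A m) \<subseteq> pres_ideal R (P n)" for n using sub2 id by blast
      show "\<exists>l\<ge>n. pres_ideal R (P l) \<subseteq> pres_ideal R (T.A m)" for m n
        using sub1[of "max n (Suc m)"] ideal_power_antimono[OF II, of "Suc m" "max n (Suc m)"] id
        \<comment> \<open>Stage \<open>m\<close> of the tower belongs to the power
          \<open>Suc m\<close> of \<open>I\<close>, while stage \<open>l\<close> of the
          presentations lies in the l-th power.\<close>
        by (intro exI[of _ "max n (Suc m)"]) auto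
    qed
  next
    assume k: "kills R P M i y"
    show "kills R T.A M i y"
    proof (rule kills_transfer[OF N.res_pres_presentation presentation _ _ k])
      show "\<exists>m. pres_ideal R (P m) \<subseteq> pres_ideal R (T.A n)" for n using sub1 id by blast
      show "\<exists>l\<ge>n. pres_ideal R (T.A l) \<subseteq> pres_ideal R (P m)" for m n using sub2 id by simp
    qed
  qed
  also have "\<dots> \<longleftrightarrow> annihilates R M r x i y" by (rule kills_P[OF y i])
  finally show ?thesis .
qed

end

section \<open>Noetherian modules\<close>

context module
begin

lemma comb_closed: "v \<in> UNIV \<rightarrow> carrier R \<Longrightarrow> w \<in> UNIV \<rightarrow> carrier M \<Longrightarrow> comb M r v w \<in> carrier M"
  unfolding comb_def by (intro M.finsum_closed) (auto simp: Pi_iff)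

lemma comb_add_left:
  assumes "v \<in> UNIV \<rightarrow> carrier R" "v' \<in> UNIV \<rightarrow> carrier R" "w \<in> UNIV \<rightarrow> carrier M"
  shows "comb M r (\<lambda>i. v i \<oplus> v' i) w = comb M r v w \<oplus>\<^bsub>M\<^esub> comb M r v' w"
proof -
  have "comb M r (\<lambda>i. v i \<oplus> v' i) w = (\<Oplus>\<^bsub>M\<^esub>i\<in>{..<r}. v i \<odot>\<^bsub>M\<^esub> w i \<oplus>\<^bsub>M\<^esub> v' i \<odot>\<^bsub>M\<^esub> w i)"
    unfolding comb_def using assms by (intro M.finsum_cong') (auto simp: Pi_iff smult_l_distr)
  also have "\<dots> = comb M r v w \<oplus>\<^bsub>M\<^esub> comb M r v' w"
    unfolding comb_def using assms by (intro M.finsum_addf) (auto simp: Pi_iff)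
  finally show ?thesis .
qed

lemma comb_add_right:
  assumes "v \<in> UNIV \<rightarrow> carrier R" "w \<in> UNIV \<rightarrow> carrier M" "w' \<in> UNIV \<rightarrow> carrier M"
  shows "comb M r v (\<lambda>i. w i \<oplus>\<^bsub>M\<^esub> w' i) = comb M r v w \<oplus>\<^bsub>M\<^esub> comb M r v w'"
proof -
  have "comb M r v (\<lambda>i. w i \<oplus>\<^bsub>M\<^esub> w' i) = (\<Oplus>\<^bsub>M\<^esub>i\<in>{..<r}. v i \<odot>\<^bsub>M\<^esub> w i \<oplus>\<^bsub>M\<^esub> v i \<odot>\<^bsub>M\<^esub> w' i)"
    unfolding comb_def using assms by (intro M.finsum_cong') (auto simp: Pi_iff smult_r_distr)
  also have "\<dots> = comb M r v w \<oplus>\<^bsub>M\<^esub> comb M r v w'"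
    unfolding comb_def using assms by (intro M.finsum_addf) (auto simp: Pi_iff)
  finally show ?thesis .
qed

lemma comb_smult_right:
  assumes "a \<in> carrier R" "v \<in> UNIV \<rightarrow> carrier R" "w \<in> UNIV \<rightarrow> carrier M"
  shows "comb M r v (\<lambda>i. a \<odot>\<^bsub>M\<^esub> w i) = a \<odot>\<^bsub>M\<^esub> comb M r v w"
proof -
  have "comb M r v (\<lambda>i. a \<odot>\<^bsub>M\<^esub> w i) = (\<Oplus>\<^bsub>M\<^esub>i\<in>{..<r}. a \<odot>\<^bsub>M\<^esub> (v i \<odot>\<^bsub>M\<^esub> w i))"
    unfolding comb_def using assms by (intro M.finsum_cong') (auto simp: Pi_iff m_comm simp flip: smult_assoc1)
  also have "\<dots> = a \<odot>\<^bsub>M\<^esub> comb M r v w"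
    unfolding comb_def using assms by (intro finsum_smult_ldistr[symmetric]) (auto simp: Pi_iff)
  finally show ?thesis .
qed

lemma comb_assoc:
  assumes "a \<in> UNIV \<rightarrow> carrier R" "v \<in> UNIV \<rightarrow> carrier R" "w \<in> UNIV \<rightarrow> carrier M"
  shows "comb M r (\<lambda>i. a i \<otimes> v i) w = comb M r v (\<lambda>i. a i \<odot>\<^bsub>M\<^esub> w i)"
  unfolding comb_def using assms by (intro M.finsum_cong') (auto simp: Pi_iff m_comm simp flip: smult_assoc1)

lemma comb_smult_left:
  assumes "a \<in> carrier R" "v \<in> UNIV \<rightarrow> carrier R" "w \<in> UNIV \<rightarrow> carrier M"
  shows "comb M r (\<lambda>i. a \<otimes> v i) w = a \<odot>\<^bsub>M\<^esub> comb M r v w"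
  using comb_assoc[of "\<lambda>_. a" v w r] comb_smult_right[OF assms] assms by simp

lemma comb_cong:
  assumes "\<And>i. i < r \<Longrightarrow> v i = v' i" "\<And>i. i < r \<Longrightarrow> w i = w' i"
    "v' \<in> UNIV \<rightarrow> carrier R" "w' \<in> UNIV \<rightarrow> carrier M"
  shows "comb M r v w = comb M r v' w'"
  unfolding comb_def using assms by (intro M.finsum_cong') (auto simp: Pi_iff)

lemma comb_0 [simp]: "comb M 0 v w = \<zero>\<^bsub>M\<^esub>"
  by (simp add: comb_def)

lemma comb_Suc:
  assumes "v \<in> UNIV \<rightarrow> carrier R" "w \<in> UNIV \<rightarrow> carrier M"
  shows "comb M (Suc r) v w = v r \<odot>\<^bsub>M\<^esub> w r \<oplus>\<^bsub>M\<^esub> comb M r v w"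
  unfolding comb_def lessThan_Suc using assms by (subst M.finsum_insert) (auto simp: Pi_iff)

lemma comb_zero_right: "v \<in> UNIV \<rightarrow> carrier R \<Longrightarrow> (\<And>i. i < r \<Longrightarrow> w i = \<zero>\<^bsub>M\<^esub>) \<Longrightarrow> comb M r v w = \<zero>\<^bsub>M\<^esub>"
  unfolding comb_def by (intro M.add.finprod_one_eqI) (auto simp: Pi_iff)

lemma comb_minus_right:
  assumes "v \<in> UNIV \<rightarrow> carrier R" "w \<in> UNIV \<rightarrow> carrier M" "w' \<in> UNIV \<rightarrow> carrier M"
  shows "comb M r v (\<lambda>i. w i \<ominus>\<^bsub>M\<^esub> w' i) = comb M r v w \<ominus>\<^bsub>M\<^esub> comb M r v w'"
proof -
  have "comb M r v (\<lambda>i. w i \<oplus>\<^bsub>M\<^esub> (\<ominus> \<one>) \<odot>\<^bsub>M\<^esub> w' i) = comb M r v w \<oplus>\<^bsub>M\<^esub> (\<ominus> \<one>) \<odot>\<^bsub>M\<^esub> comb M r v w'"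
    using assms comb_add_right[of v w "\<lambda>i. (\<ominus> \<one>) \<odot>\<^bsub>M\<^esub> w' i" r] comb_smult_right[of "\<ominus> \<one>" v w' r]
    by (simp add: Pi_iff)
  moreover have "w i \<ominus>\<^bsub>M\<^esub> w' i = w i \<oplus>\<^bsub>M\<^esub> (\<ominus> \<one>) \<odot>\<^bsub>M\<^esub> w' i" for i
    using assms by (simp add: a_minus_def smult_l_minus Pi_iff)
  ultimately show ?thesis
    using comb_closed[of v w' r] assms by (simp add: a_minus_def smult_l_minus)
qed

lemma comb_in_submodule:
  assumes "submodule H R M" "v \<in> UNIV \<rightarrow> carrier R" "w \<in> UNIV \<rightarrow> H"
  shows "comb M r v w \<in> H"
proof -
  have w: "w \<in> UNIV \<rightarrow> carrier M" using assms(3) submoduleE(1)[OF assms(1)] by auto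
  show ?thesis
  proof (induction r)
    case (Suc r)
    then show ?case using assms submoduleE(4,5)[OF assms(1)] by (simp add: comb_Suc[OF assms(2) w] Pi_iff)
  qed (simp add: submodule_zero[OF assms(1)])
qed

end

definition noetherian_module :: "('a, 'r) ring_scheme \<Rightarrow> ('a, 'm, 's) module_scheme \<Rightarrow> bool" where
  "noetherian_module R M \<longleftrightarrow> module R M \<and>
    (\<forall>C::nat \<Rightarrow> 'm set. (\<forall>n. submodule (C n) R M) \<and> (\<forall>n. C n \<subseteq> C (Suc n)) \<longrightarrow> (\<exists>n. \<forall>k\<ge>n. C k = C n))"

lemma noetherian_moduleD:
  fixes C :: "nat \<Rightarrow> 'm set"
  assumes "noetherian_module R M" "\<And>n. submodule (C n) R M" "\<And>n. C n \<subseteq> C (Suc n)"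
  shows "\<exists>n. \<forall>k\<ge>n. C k = C n"
  using assms(1)[unfolded noetherian_module_def, THEN conjunct2, rule_format, of C] assms(2,3) by blast

text \<open>Submodules of the regular module are ideals, and the union of a chain of ideals in a
  Noetherian ring belongs to the chain.\<close>

lemma noetherian_regular:
  assumes "cring R" "noetherian_ring R"
  shows "noetherian_module R (regular_module R)"
proof -
  interpret R: cring R by fact
  interpret N: noetherian_ring R by fact
  have "\<exists>n. \<forall>k\<ge>n. C k = C n"
    if s: "\<And>n. submodule (C n) R (regular_module R)" and m: "\<And>n. C n \<subseteq> C (Suc n)" for C :: "nat \<Rightarrow> 'a set"
  proof -
    have mono: "i \<le> j \<Longrightarrow> C i \<subseteq> C j" for i j using lift_Suc_mono_le[of C i j] m by blast
    have "C i \<subseteq> C j \<or> C j \<subseteq> C i" for i j using mono nat_le_linear by metis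
    then have "subset.chain {I. ideal I R} (range C)"
      unfolding pred_on.chain_def using submodule_regular_imp_ideal[OF assms(1) s] by blast
    from N.ideal_chain_is_trivial[OF _ this] obtain n where "\<Union>(range C) = C n" by auto
    then have "C k = C n" if "k \<ge> n" for k using mono[OF that] by auto
    then show ?thesis by blast
  qed
  then show ?thesis unfolding noetherian_module_def using R.module_regular by blast
qed

lemma noetherian_image:
  assumes X: "noetherian_module R X" and Y: "module R Y" and f: "lin R X Y f" and sur: "f ` carrier X = carrier Y"
  shows "noetherian_module R Y"
  unfolding noetherian_module_def
proof (intro conjI Y allI impI)
  interpret X: module R X using X by (simp add: noetherian_module_def)
  interpret Y: module R Y by (rule Y)
  fix C assume C: "(\<forall>n. submodule (C n) R Y) \<and> (\<forall>n::nat. C n \<subseteq> C (Suc n))"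
  let ?D = "\<lambda>n. {x \<in> carrier X. f x \<in> C n}"
  have D1: "submodule (?D n) R X" for n using C by (intro X.submodule_vimage[OF Y f]) auto
  have D2: "?D n \<subseteq> ?D (Suc n)" for n using C by auto
  obtain n where n: "\<forall>k\<ge>n. ?D k = ?D n" using noetherian_moduleD[where C = ?D, OF X D1 D2] ..
  have im: "C k = f ` ?D k" for k
  proof -
    have "C k \<subseteq> f ` carrier X" unfolding sur using Y.submoduleE(1) C by blast
    then show ?thesis by blast
  qed
  have "C k = C n" if "k \<ge> n" for k
  proof -
    have "C k = f ` ?D k" by (rule im)
    also have "\<dots> = f ` ?D n" using n[rule_format, OF that] by (rule arg_cong)
    also have "\<dots> = C n" by (rule im[symmetric])
    finally show ?thesis .
  qed
  then show "\<exists>n. \<forall>k\<ge>n. C k = C n" by blast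
qed

definition tuples :: "('a, 'm, 's) module_scheme \<Rightarrow> nat \<Rightarrow> ('a, nat \<Rightarrow> 'm) module" where
  "tuples M r = \<lparr>carrier = {f. (\<forall>i. f i \<in> carrier M) \<and> (\<forall>i\<ge>r. f i = \<zero>\<^bsub>M\<^esub>)}, monoid.mult = undefined,
     one = undefined, zero = (\<lambda>_. \<zero>\<^bsub>M\<^esub>), add = (\<lambda>f g i. f i \<oplus>\<^bsub>M\<^esub> g i), smult = (\<lambda>a f i. a \<odot>\<^bsub>M\<^esub> f i)\<rparr>"

lemma tuples_simps [simp]:
  "carrier (tuples M r) = {f. (\<forall>i. f i \<in> carrier M) \<and> (\<forall>i\<ge>r. f i = \<zero>\<^bsub>M\<^esub>)}"
  "\<zero>\<^bsub>tuples M r\<^esub> = (\<lambda>_. \<zero>\<^bsub>M\<^esub>)"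
  "f \<oplus>\<^bsub>tuples M r\<^esub> g = (\<lambda>i. f i \<oplus>\<^bsub>M\<^esub> g i)"
  "a \<odot>\<^bsub>tuples M r\<^esub> f = (\<lambda>i. a \<odot>\<^bsub>M\<^esub> f i)"
  by (simp_all add: tuples_def)

lemma (in module) tuples_module: "module R (tuples M r)"
proof (rule moduleI[OF R.is_cring abelian_groupI], goal_cases)
  case (6 x)
  then show ?case by (intro bexI[of _ "\<lambda>i. \<ominus>\<^bsub>M\<^esub> x i"]) (auto simp: M.l_neg)
qed (auto simp: M.a_ac smult_l_distr smult_r_distr smult_assoc1)

text \<open>Induction on \<open>r\<close>: a chain of submodules is stationary once its projections
  to the last coordinate and its intersections with the kernel of that projection are.\<close>

lemma noetherian_tuples:
  assumes M: "noetherian_module R M"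
  shows "noetherian_module R (tuples M r)"
proof -
  interpret M: module R M using M by (simp add: noetherian_module_def)
  show ?thesis
  proof (induction r)
    case 0
    interpret T: module R "tuples M 0" by (rule M.tuples_module)
    have "C = {\<lambda>_. \<zero>\<^bsub>M\<^esub>}" if "submodule C R (tuples M 0)" for C
      using T.submoduleE(1)[OF that] T.submodule_zero[OF that] by auto
    then have "\<exists>n. \<forall>k\<ge>n. C k = C n" if "\<forall>n. submodule (C n) R (tuples M 0)" for C :: "nat \<Rightarrow> _"
      using that by metis
    then show ?case unfolding noetherian_module_def using T.module_axioms by blast
  next
    case (Suc r)
    interpret T: module R "tuples M (Suc r)" by (rule M.tuples_module)
    interpret T': module R "tuples M r" by (rule M.tuples_module)
    have "\<exists>n. \<forall>k\<ge>n. C k = C n"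
      if C: "\<And>n. submodule (C n) R (tuples M (Suc r))" "\<And>n. C n \<subseteq> C (Suc n)" for C :: "nat \<Rightarrow> _"
    proof -
      note sub = T.submoduleE(1)[OF C(1)] and add = T.submoduleE(5)[OF C(1)]
        and smult = T.submoduleE(4)[OF C(1)] and zero = T.submodule_zero[OF C(1)]
      have mono: "i \<le> j \<Longrightarrow> C i \<subseteq> C j" for i j using lift_Suc_mono_le[of C i j] C(2) by blast
      let ?P = "\<lambda>n. (\<lambda>f. f r) ` C n" and ?K = "\<lambda>n. {f \<in> C n. f r = \<zero>\<^bsub>M\<^esub>}"
      have P1: "submodule (?P n) R M" for n
      proof (rule M.submoduleI')
        show "?P n \<subseteq> carrier M" using sub by auto
        show "\<zero>\<^bsub>M\<^esub> \<in> ?P n" using zero by (intro image_eqI[of _ _ "\<lambda>_. \<zero>\<^bsub>M\<^esub>"]) auto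
        show "a \<oplus>\<^bsub>M\<^esub> b \<in> ?P n" if "a \<in> ?P n" "b \<in> ?P n" for a b
          using that add by (force intro: image_eqI[rotated])
        show "c \<odot>\<^bsub>M\<^esub> a \<in> ?P n" if "c \<in> carrier R" "a \<in> ?P n" for c a
          using that smult by (force intro: image_eqI[rotated])
      qed
      have P2: "?P n \<subseteq> ?P (Suc n)" for n using C(2) by auto
      obtain n1 where n1: "\<forall>k\<ge>n1. ?P k = ?P n1" using noetherian_moduleD[where C = ?P, OF M P1 P2] ..
      have sub': "?K n \<subseteq> carrier (tuples M r)" for n
        using sub[of n] by (force simp: le_Suc_eq not_less_eq_eq)
      have K1: "submodule (?K n) R (tuples M r)" for n
      proof (rule T'.submoduleI')
        show "?K n \<subseteq> carrier (tuples M r)" by (rule sub')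
        show "\<zero>\<^bsub>tuples M r\<^esub> \<in> ?K n" using zero by auto
        show "a \<oplus>\<^bsub>tuples M r\<^esub> b \<in> ?K n" if "a \<in> ?K n" "b \<in> ?K n" for a b
          using that add[of a n b] by auto
        show "c \<odot>\<^bsub>tuples M r\<^esub> a \<in> ?K n" if "c \<in> carrier R" "a \<in> ?K n" for c a
          using that smult[of c a n] by auto
      qed
      have K2: "?K n \<subseteq> ?K (Suc n)" for n using C(2) by auto
      obtain n2 where n2: "\<forall>k\<ge>n2. ?K k = ?K n2" using noetherian_moduleD[where C = ?K, OF Suc K1 K2] ..
      let ?n = "max n1 n2"
      have "C k \<subseteq> C ?n" if k: "k \<ge> ?n" for k
      proof
        fix f assume f: "f \<in> C k"
        have "f r \<in> ?P ?n" using n1[rule_format, of k] n1[rule_format, of ?n] k f by auto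
        then obtain g where g: "g \<in> C ?n" "g r = f r" by auto
        have fg: "f i \<in> carrier M" "g i \<in> carrier M" for i using f g sub by auto
        \<comment> \<open>\<open>g\<close> comes from the stable stage and has the same last
          coordinate as \<open>f\<close>, so the difference belongs to the part of the chain with
          last coordinate zero, which is stable too.\<close>
        let ?h = "\<lambda>i. f i \<oplus>\<^bsub>M\<^esub> (\<ominus>\<^bsub>R\<^esub> \<one>\<^bsub>R\<^esub>) \<odot>\<^bsub>M\<^esub> g i"
        have "g \<in> C k" using g(1) mono[OF k] by auto
        then have "?h \<in> C k" using add[OF f smult[of "\<ominus>\<^bsub>R\<^esub> \<one>\<^bsub>R\<^esub>" g k]] by simp
        moreover have "?h r = \<zero>\<^bsub>M\<^esub>" using fg[of r] g(2) by (simp add: M.smult_l_minus M.M.r_neg)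
        ultimately have "?h \<in> ?K ?n" using n2[rule_format, of k] n2[rule_format, of ?n] k by auto
        then have "?h \<oplus>\<^bsub>tuples M (Suc r)\<^esub> g \<in> C ?n" using add g(1) by auto
        moreover have "?h \<oplus>\<^bsub>tuples M (Suc r)\<^esub> g = f"
          using fg by (auto simp: fun_eq_iff M.smult_l_minus M.M.a_assoc M.M.l_neg)
        ultimately show "f \<in> C ?n" by simp
      qed
      then show ?thesis using mono by (intro exI[of _ ?n]) blast
    qed
    then show ?case unfolding noetherian_module_def using T.module_axioms by blast
  qed
qed

lemma noetherian_free:
  assumes "cring R" "noetherian_ring R"
  shows "noetherian_module R (free_module R {..<r::nat})"
proof -
  interpret R: cring R by fact
  interpret T: module R "tuples (regular_module R) r" by (rule module.tuples_module[OF R.module_regular])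
  have "f \<in> carrier (tuples (regular_module R) r) \<longleftrightarrow> f \<in> carrier (free_module R {..<r})" for f
  proof
    assume f: "f \<in> carrier (tuples (regular_module R) r)"
    have "i < r" if "f i \<noteq> \<zero>\<^bsub>R\<^esub>" for i
      by (rule ccontr) (use f that in \<open>auto simp: not_less\<close>)
    then have "finite {i. f i \<noteq> \<zero>\<^bsub>R\<^esub>}"
      by - (rule finite_subset[of _ "{..<r}"], auto)
    with f show "f \<in> carrier (free_module R {..<r})" by (auto simp: free_carrier)
  next
    assume f: "f \<in> carrier (free_module R {..<r})"
    then show "f \<in> carrier (tuples (regular_module R) r)"
      using R.free_closed[OF f] by (auto simp: free_carrier)
  qed
  then have c: "carrier (tuples (regular_module R) r) = carrier (free_module R {..<r})" by blast
  show ?thesis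
    by (rule noetherian_image[OF noetherian_tuples[OF noetherian_regular[OF assms]] R.free_is_module, where f = "\<lambda>v. v"])
      (auto simp: c[symmetric] lin_def free_simps)
qed

lemma noetherian_finitely_generated:
  assumes "cring R" "noetherian_ring R" and M: "module R M" and fg: "finitely_generated_module R M"
  shows "noetherian_module R M"
proof -
  interpret M: module R M by (rule M)
  obtain S where S: "finite S" "S \<subseteq> carrier M"
      "carrier M = {\<Oplus>\<^bsub>M\<^esub>x\<in>S. c x \<odot>\<^bsub>M\<^esub> x | c. c \<in> S \<rightarrow> carrier R}"
    using fg unfolding finitely_generated_module_def by blast
  obtain s where s: "bij_betw s {..<card S} S" using ex_bij_betw_nat_finite[OF S(1)] by (auto simp: atLeast0LessThan)
  have s': "s \<in> {..<card S} \<rightarrow> carrier M" using s S(2) by (auto simp: bij_betw_def)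
  note l = M.lin_lin_ext[OF M s']
  have "lin_ext R M s ` carrier (free_module R {..<card S}) = carrier M"
  proof (intro equalityI subsetI)
    fix y assume "y \<in> carrier M"
    then obtain c where c: "c \<in> S \<rightarrow> carrier R" "y = (\<Oplus>\<^bsub>M\<^esub>x\<in>S. c x \<odot>\<^bsub>M\<^esub> x)" using S(3) by auto
    let ?v = "\<lambda>i. if i < card S then c (s i) else \<zero>\<^bsub>R\<^esub>"
    have v: "?v \<in> carrier (free_module R {..<card S})"
      using c(1) s by (auto simp: free_carrier bij_betw_def intro: finite_subset[of _ "{..<card S}"])
    have sc: "c (s i) \<in> carrier R" "s i \<in> carrier M" if "i < card S" for i
      using that s s' c(1) by (auto simp: bij_betw_def)
    have "y = (\<Oplus>\<^bsub>M\<^esub>i\<in>{..<card S}. c (s i) \<odot>\<^bsub>M\<^esub> s i)"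
      unfolding c(2) using s c(1) S(2)
      by (subst M.M.add.finprod_reindex[of "\<lambda>x. c x \<odot>\<^bsub>M\<^esub> x" s "{..<card S}", symmetric]) (auto simp: bij_betw_def Pi_iff)
    also have "\<dots> = (\<Oplus>\<^bsub>M\<^esub>i\<in>{..<card S}. ?v i \<odot>\<^bsub>M\<^esub> s i)"
      using sc by (intro M.M.finsum_cong') auto
    also have "\<dots> = lin_ext R M s ?v"
      by (rule M.lin_ext_eq[OF M s' v, symmetric]) auto
    finally show "y \<in> lin_ext R M s ` carrier (free_module R {..<card S})" using v by blast
  qed (use lin_closed[OF l] in auto)
  then show ?thesis by (rule noetherian_image[OF noetherian_free[OF assms(1,2)] M l])
qed

lemma noetherian_maximal:
  assumes M: "noetherian_module R M" and V: "V \<noteq> {}" "\<And>H. H \<in> V \<Longrightarrow> submodule H R M"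
  obtains H where "H \<in> V" "\<And>H'. H' \<in> V \<Longrightarrow> H \<subseteq> H' \<Longrightarrow> H' = H"
proof -
  have "\<exists>H\<in>V. \<forall>H'\<in>V. H \<subseteq> H' \<longrightarrow> H' = H"
  proof (rule ccontr)
    assume "\<not> ?thesis"
    then have step: "\<exists>H'. H' \<in> V \<and> H \<subset> H'" if "H \<in> V" for H using that by blast
    obtain H0 where "H0 \<in> V" using V(1) by blast
    then have "\<exists>C. \<forall>n::nat. C n \<in> V \<and> C n \<subset> C (Suc n)"
      by - (rule dependent_nat_choice, use step in auto)
    then obtain C :: "nat \<Rightarrow> _" where C: "\<And>n. C n \<in> V \<and> C n \<subset> C (Suc n)" by blast
    have C1: "submodule (C n) R M" "C n \<subseteq> C (Suc n)" for n using C[of n] V(2) by auto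
    obtain n where n: "\<forall>k\<ge>n. C k = C n" using noetherian_moduleD[where C = C, OF M C1] ..
    have "C (Suc n) = C n" by (rule n[rule_format]) simp
    then show False using C[of n] by simp
  qed
  then show ?thesis using that by blast
qed

text \<open>Among the spans of finite tuples from \<open>Z\<close> there is a maximal one; adjoining
  any \<open>w\<close> of \<open>Z\<close> to its generators cannot enlarge it, so it contains
  \<open>w\<close>.\<close>

lemma noetherian_submodule_fg:
  assumes M: "noetherian_module R M" and Z: "submodule Z R M"
  obtains q z where "z \<in> UNIV \<rightarrow> Z" "\<And>w. w \<in> Z \<Longrightarrow> \<exists>c\<in>UNIV \<rightarrow> carrier R. w = comb M q c z"
proof -
  interpret M: module R M using M by (simp add: noetherian_module_def)
  note Zc = M.submoduleE(1)[OF Z]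
  define span where "span q z = {comb M q c z | c. c \<in> UNIV \<rightarrow> carrier R}" for q and z :: "nat \<Rightarrow> 'c"
  have z': "z \<in> UNIV \<rightarrow> carrier M" if "z \<in> UNIV \<rightarrow> Z" for z :: "nat \<Rightarrow> 'c" using that Zc by auto
  have sub: "submodule (span q z) R M" if "z \<in> UNIV \<rightarrow> Z" for q and z :: "nat \<Rightarrow> 'c"
  proof (rule M.submoduleI')
    note z = z'[OF that]
    show "span q z \<subseteq> carrier M" using M.comb_closed[OF _ z] by (auto simp: span_def)
    have "comb M q (\<lambda>_. \<zero>\<^bsub>R\<^esub>) z = \<zero>\<^bsub>M\<^esub>"
      unfolding comb_def by (intro M.M.add.finprod_one_eqI) (use z in \<open>auto simp: Pi_iff\<close>)
    then show "\<zero>\<^bsub>M\<^esub> \<in> span q z" unfolding span_def by (intro CollectI exI[of _ "\<lambda>_. \<zero>\<^bsub>R\<^esub>"]) auto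
    fix a assume "a \<in> span q z"
    then obtain c where c: "c \<in> UNIV \<rightarrow> carrier R" "a = comb M q c z" by (auto simp: span_def)
    show "s \<odot>\<^bsub>M\<^esub> a \<in> span q z" if "s \<in> carrier R" for s
      unfolding span_def using M.comb_smult_left[OF that c(1) z, of q] c that
      by (intro CollectI exI[of _ "\<lambda>i. s \<otimes>\<^bsub>R\<^esub> c i"]) (auto simp: Pi_iff)
    fix b assume "b \<in> span q z"
    then obtain c' where c': "c' \<in> UNIV \<rightarrow> carrier R" "b = comb M q c' z" by (auto simp: span_def)
    show "a \<oplus>\<^bsub>M\<^esub> b \<in> span q z"
      unfolding span_def using M.comb_add_left[OF c(1) c'(1) z, of q] c c'
      by (intro CollectI exI[of _ "\<lambda>i. c i \<oplus>\<^bsub>R\<^esub> c' i"]) (auto simp: Pi_iff)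
  qed
  let ?V = "{span q z | q z. z \<in> UNIV \<rightarrow> Z}"
  have "?V \<noteq> {}" using M.submodule_zero[OF Z] by (auto intro!: exI[of _ "\<lambda>_. \<zero>\<^bsub>M\<^esub>"])
  then obtain H where H: "H \<in> ?V" "\<And>H'. H' \<in> ?V \<Longrightarrow> H \<subseteq> H' \<Longrightarrow> H' = H"
    by (rule noetherian_maximal[OF M]) (use sub in auto)
  then obtain q z where z: "z \<in> UNIV \<rightarrow> Z" "H = span q z" by blast
  have "\<exists>c\<in>UNIV \<rightarrow> carrier R. w = comb M q c z" if w: "w \<in> Z" for w
  proof -
    let ?z = "z(q := w)"
    have zz: "?z \<in> UNIV \<rightarrow> Z" using z(1) w by auto
    note zc = z'[OF z(1)] and zzc = z'[OF zz]
    have eq: "comb M (Suc q) c ?z = c q \<odot>\<^bsub>M\<^esub> w \<oplus>\<^bsub>M\<^esub> comb M q c z" if c: "c \<in> UNIV \<rightarrow> carrier R" for c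
      using M.comb_Suc[OF c zzc, of q] M.comb_cong[of q c c ?z z] c zc by simp
    have wc: "w \<in> carrier M" using w Zc by auto
    have "H \<subseteq> span (Suc q) ?z"
    proof
      fix a assume "a \<in> H"
      then obtain c where c: "c \<in> UNIV \<rightarrow> carrier R" "a = comb M q c z" using z by (auto simp: span_def)
      \<comment> \<open>Coefficients are total functions, so the one at the position of the new
        generator must be set to zero.\<close>
      let ?c = "c(q := \<zero>\<^bsub>R\<^esub>)"
      have cc: "?c \<in> UNIV \<rightarrow> carrier R" using c by auto
      have "comb M (Suc q) ?c ?z = a"
        using eq[OF cc] M.comb_cong[of q ?c c z z] c zc M.comb_closed[OF c(1) zc, of q] wc by simp
      then show "a \<in> span (Suc q) ?z" using cc by (auto simp: span_def)
    qed
    then have HH: "span (Suc q) ?z = H" using H(2) zz by blast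
    let ?c = "\<lambda>i. if i = q then \<one>\<^bsub>R\<^esub> else \<zero>\<^bsub>R\<^esub>"
    have cc: "?c \<in> UNIV \<rightarrow> carrier R" by auto
    have "comb M q ?c z = \<zero>\<^bsub>M\<^esub>"
      unfolding comb_def by (intro M.M.add.finprod_one_eqI) (use zc in \<open>auto simp: Pi_iff\<close>)
    then have "comb M (Suc q) ?c ?z = w" using eq[OF cc] wc by simp
    then have "w \<in> span (Suc q) ?z" using cc unfolding span_def by (intro CollectI exI[of _ ?c]) auto
    then have "w \<in> H" using HH by simp
    then show ?thesis unfolding z(2) span_def by blast
  qed
  then show ?thesis using that z(1) by blast
qed

subsection \<open>Detection by finitely many primes\<close>

text \<open>If the members are annihilators of elements, \<open>Q\<close> is not contained in
  \<open>P\<close> when the element dies in the localization at \<open>P\<close>, and contains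
  \<open>\<one>\<close> when the element is zero. The condition then says that finitely many
  localizations detect nonzero elements.\<close>

definition prime_detected :: "('a, 'r) ring_scheme \<Rightarrow> 'a set set \<Rightarrow> bool" where
  "prime_detected R C \<longleftrightarrow> (\<exists>PP. finite PP \<and> (\<forall>P\<in>PP. primeideal P R) \<and>
    (\<forall>Q\<in>C. (\<forall>P\<in>PP. \<not> Q \<subseteq> P) \<longrightarrow> \<one>\<^bsub>R\<^esub> \<in> Q))"

definition colon :: "('a, 'r) ring_scheme \<Rightarrow> ('a, 'm, 's) module_scheme \<Rightarrow> 'm set \<Rightarrow> 'm \<Rightarrow> 'a set" where
  "colon R M H a = {s \<in> carrier R. s \<odot>\<^bsub>M\<^esub> a \<in> H}"

lemma (in module) colon_ideal:
  assumes H: "submodule H R M" and a: "a \<in> carrier M"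
  shows "ideal (colon R M H a) R"
proof -
  interpret Rm: module R "regular_module R" by (rule module_regular)
  have "lin R (regular_module R) M (\<lambda>s. s \<odot>\<^bsub>M\<^esub> a)"
    using a by (intro linI) (auto simp: smult_l_distr smult_assoc1)
  from Rm.submodule_vimage[OF module_axioms this H] show ?thesis
    by (intro submodule_regular_imp_ideal R.is_cring) (simp add: colon_def)
qed

text \<open>Let \<open>V\<close> be maximal among the submodules over \<open>Y\<close> whose
  elements are detected. If \<open>V\<close> is not everything, a maximal ideal among those of the
  form \<open>V : a\<close> with \<open>a\<close> outside \<open>V\<close> is prime, and adding this
  one prime detects the elements of \<open>V + R a\<close>, a contradiction.\<close>

lemma noetherian_prime_detected:
  assumes R: "cring R" "noetherian_ring R" and M: "noetherian_module R M" and Y: "submodule Y R M"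
  shows "prime_detected R (colon R M Y ` carrier M)"
proof -
  interpret M: module R M using M by (simp add: noetherian_module_def)
  let ?det = "\<lambda>V. prime_detected R (colon R M Y ` V)"
  let ?V = "{V. submodule V R M \<and> Y \<subseteq> V \<and> ?det V}"
  have "?det Y"
    unfolding prime_detected_def using M.submoduleE(1)[OF Y] by (intro exI[of _ "{}"]) (auto simp: colon_def)
  then have "?V \<noteq> {}" using Y by blast
  then obtain V where V: "V \<in> ?V" and max: "\<And>V'. V' \<in> ?V \<Longrightarrow> V \<subseteq> V' \<Longrightarrow> V' = V"
    by (rule noetherian_maximal[OF M]) auto
  have Vs: "submodule V R M" and YV: "Y \<subseteq> V" and Vd: "?det V" using V by auto
  note Vc = M.submoduleE(1)[OF Vs] and Vadd = M.submoduleE(5)[OF Vs] and Vsm = M.submoduleE(4)[OF Vs]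
    and Vz = M.submodule_zero[OF Vs]
  have "V = carrier M"
  proof (rule ccontr)
    assume "V \<noteq> carrier M"
    then have ne: "colon R M V ` (carrier M - V) \<noteq> {}" using Vc by auto
    have "submodule J R (regular_module R)" if "J \<in> colon R M V ` (carrier M - V)" for J
      using that M.colon_ideal[OF Vs] ideal_imp_submodule_regular[OF R(1)] by auto
    \<comment> \<open>The usual argument for associated primes of the quotient by \<open>V\<close>:
      a maximal annihilator of a nonzero element is prime.\<close>
    then obtain P where P: "P \<in> colon R M V ` (carrier M - V)"
        "\<And>P'. P' \<in> colon R M V ` (carrier M - V) \<Longrightarrow> P \<subseteq> P' \<Longrightarrow> P' = P"
      using noetherian_maximal[OF noetherian_regular[OF R] ne] by blast
    then obtain a where a: "a \<in> carrier M" "a \<notin> V" "P = colon R M V a" by auto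
    have prime: "primeideal P R"
    proof (intro primeideal.intro primeideal_axioms.intro M.is_cring)
      show "ideal P R" unfolding a(3) by (rule M.colon_ideal[OF Vs a(1)])
      have "\<one>\<^bsub>R\<^esub> \<notin> P" using a by (simp add: colon_def)
      then show "carrier R \<noteq> P" by auto
      fix b c assume b: "b \<in> carrier R" and c: "c \<in> carrier R" and bc: "b \<otimes>\<^bsub>R\<^esub> c \<in> P"
      show "b \<in> P \<or> c \<in> P"
      proof (rule ccontr)
        assume nb: "\<not> (b \<in> P \<or> c \<in> P)"
        then have ca: "c \<odot>\<^bsub>M\<^esub> a \<in> carrier M - V" using c a by (auto simp: colon_def)
        have "P \<subseteq> colon R M V (c \<odot>\<^bsub>M\<^esub> a)"
        proof
          fix s assume "s \<in> P"
          then have s: "s \<in> carrier R" "s \<odot>\<^bsub>M\<^esub> a \<in> V" using a by (auto simp: colon_def)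
          have "s \<odot>\<^bsub>M\<^esub> (c \<odot>\<^bsub>M\<^esub> a) = c \<odot>\<^bsub>M\<^esub> (s \<odot>\<^bsub>M\<^esub> a)"
            using s c a by (simp add: M.m_comm flip: M.smult_assoc1)
          then show "s \<in> colon R M V (c \<odot>\<^bsub>M\<^esub> a)" using s Vsm[OF c s(2)] by (simp add: colon_def)
        qed
        then have "colon R M V (c \<odot>\<^bsub>M\<^esub> a) = P" using P(2) ca by blast
        moreover have "b \<in> colon R M V (c \<odot>\<^bsub>M\<^esub> a)"
          using bc b c a by (simp add: colon_def M.smult_assoc1)
        ultimately show False using nb by simp
      qed
    qed
    let ?W = "{v \<oplus>\<^bsub>M\<^esub> c \<odot>\<^bsub>M\<^esub> a | v c. v \<in> V \<and> c \<in> carrier R}"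
    have W: "submodule ?W R M"
    proof (rule M.submoduleI')
      show "?W \<subseteq> carrier M" using Vc a by auto
      show "\<zero>\<^bsub>M\<^esub> \<in> ?W" using Vz a by (intro CollectI exI[of _ "\<zero>\<^bsub>M\<^esub>"] exI[of _ "\<zero>\<^bsub>R\<^esub>"]) auto
      fix w assume "w \<in> ?W"
      then obtain v c where w: "w = v \<oplus>\<^bsub>M\<^esub> c \<odot>\<^bsub>M\<^esub> a" "v \<in> V" "c \<in> carrier R" by auto
      show "s \<odot>\<^bsub>M\<^esub> w \<in> ?W" if s: "s \<in> carrier R" for s
        using s w Vc a Vsm[OF s w(2)]
        by (intro CollectI exI[of _ "s \<odot>\<^bsub>M\<^esub> v"] exI[of _ "s \<otimes>\<^bsub>R\<^esub> c"]) (auto simp: M.smult_r_distr M.smult_assoc1)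
      fix w' assume "w' \<in> ?W"
      then obtain v' c' where w': "w' = v' \<oplus>\<^bsub>M\<^esub> c' \<odot>\<^bsub>M\<^esub> a" "v' \<in> V" "c' \<in> carrier R" by auto
      have vc: "v \<in> carrier M" "v' \<in> carrier M" using w w' Vc by auto
      show "w \<oplus>\<^bsub>M\<^esub> w' \<in> ?W"
        using w w' vc a Vadd[OF w(2) w'(2)]
        by (intro CollectI exI[of _ "v \<oplus>\<^bsub>M\<^esub> v'"] exI[of _ "c \<oplus>\<^bsub>R\<^esub> c'"]) (auto simp: M.smult_l_distr M.M.a_ac)
    qed
    have VW: "V \<subseteq> ?W"
    proof
      fix v assume "v \<in> V"
      then show "v \<in> ?W" using Vc a by (intro CollectI exI[of _ v] exI[of _ "\<zero>\<^bsub>R\<^esub>"]) auto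
    qed
    have "a \<in> ?W" using Vz a by (intro CollectI exI[of _ "\<zero>\<^bsub>M\<^esub>"] exI[of _ "\<one>\<^bsub>R\<^esub>"]) auto
    obtain PP where PP: "finite PP" "\<And>P. P \<in> PP \<Longrightarrow> primeideal P R"
        "\<And>v. v \<in> V \<Longrightarrow> (\<forall>P\<in>PP. \<not> colon R M Y v \<subseteq> P) \<Longrightarrow> \<one>\<^bsub>R\<^esub> \<in> colon R M Y v"
      using Vd unfolding prime_detected_def by auto
    have "?det ?W"
      unfolding prime_detected_def
    proof (intro exI[of _ "insert P PP"] conjI ballI impI)
      fix Q assume "Q \<in> colon R M Y ` ?W" and Q: "\<forall>P\<in>insert P PP. \<not> Q \<subseteq> P"
      then obtain v c where vc: "v \<in> V" "c \<in> carrier R" "Q = colon R M Y (v \<oplus>\<^bsub>M\<^esub> c \<odot>\<^bsub>M\<^esub> a)" by auto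
      let ?w = "v \<oplus>\<^bsub>M\<^esub> c \<odot>\<^bsub>M\<^esub> a"
      have v: "v \<in> carrier M" using vc(1) Vc by auto
      \<comment> \<open>An \<open>s\<close> outside \<open>P\<close> moves \<open>v + c a\<close>
        into \<open>Y\<close>, hence \<open>s c a\<close> into \<open>V\<close>. Then
        \<open>s c\<close> is in \<open>P\<close>, so \<open>c\<close> is in \<open>P\<close>, and
        \<open>v + c a\<close> was in \<open>V\<close> from the start, where the old primes detect
        it.\<close>
      obtain s where s: "s \<in> carrier R" "s \<odot>\<^bsub>M\<^esub> ?w \<in> Y" "s \<notin> P" using Q vc(3) by (auto simp: colon_def)
      have "s \<odot>\<^bsub>M\<^esub> ?w \<ominus>\<^bsub>M\<^esub> s \<odot>\<^bsub>M\<^esub> v \<in> V"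
        by (rule M.submodule_diff[OF Vs]) (use s YV Vsm vc in auto)
      moreover have "s \<odot>\<^bsub>M\<^esub> ?w \<ominus>\<^bsub>M\<^esub> s \<odot>\<^bsub>M\<^esub> v = (s \<otimes>\<^bsub>R\<^esub> c) \<odot>\<^bsub>M\<^esub> a"
        using s v vc a by (simp add: M.smult_r_distr a_minus_def M.M.a_ac M.M.r_neg2 M.M.r_neg1 M.smult_assoc1)
      ultimately have "s \<otimes>\<^bsub>R\<^esub> c \<in> P" using s vc a by (simp add: colon_def)
      then have "c \<in> P" using primeideal.I_prime[OF prime s(1) vc(2)] s(3) by blast
      then have "?w \<in> V" using Vadd[OF vc(1)] a by (simp add: colon_def)
      then show "\<one>\<^bsub>R\<^esub> \<in> Q" using PP(3) Q vc(3) by auto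
    qed (use PP prime in auto)
    then have "?W = V" using max[of ?W] W VW YV by blast
    then show False using \<open>a \<in> ?W\<close> a by simp
  qed
  then show ?thesis using Vd by simp
qed

text \<open>The members of \<open>C\<close> play the role of the annihilators of the elements of a module: they are
  closed under passing to the annihilator of a multiple.\<close>

lemma prime_detected_power:
  assumes R: "cring R" and x: "x \<in> carrier R" and A: "finite A" "A \<subseteq> carrier R"
    and ideals: "\<And>Q. Q \<in> C \<Longrightarrow> ideal Q R"
    and colon: "\<And>Q c. Q \<in> C \<Longrightarrow> c \<in> carrier R \<Longrightarrow> {s \<in> carrier R. s \<otimes>\<^bsub>R\<^esub> c \<in> Q} \<in> C"
    and torsion: "\<And>Q a. Q \<in> C \<Longrightarrow> a \<in> A \<Longrightarrow> \<exists>n::nat. a [^]\<^bsub>R\<^esub> n \<in> Q"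
    and socle: "prime_detected R {Q \<in> C. A \<subseteq> Q}"
    and local: "\<And>P. primeideal P R \<Longrightarrow> \<exists>k::nat. \<forall>Q\<in>C. \<exists>s\<in>carrier R - P. s \<otimes>\<^bsub>R\<^esub> x [^]\<^bsub>R\<^esub> k \<in> Q"
  shows "\<exists>k::nat. \<forall>Q\<in>C. x [^]\<^bsub>R\<^esub> k \<in> Q"
proof -
  interpret R: cring R by fact
  obtain PP where PP: "finite PP" "\<And>P. P \<in> PP \<Longrightarrow> primeideal P R"
      "\<And>Q. Q \<in> C \<Longrightarrow> A \<subseteq> Q \<Longrightarrow> (\<forall>P\<in>PP. \<not> Q \<subseteq> P) \<Longrightarrow> \<one>\<^bsub>R\<^esub> \<in> Q"
    using socle unfolding prime_detected_def by auto
  have "\<forall>P\<in>PP. \<exists>k::nat. \<forall>Q\<in>C. \<exists>s\<in>carrier R - P. s \<otimes>\<^bsub>R\<^esub> x [^]\<^bsub>R\<^esub> k \<in> Q"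
    using local PP(2) by blast
  then obtain k where k: "\<And>P Q. P \<in> PP \<Longrightarrow> Q \<in> C \<Longrightarrow> \<exists>s\<in>carrier R - P. s \<otimes>\<^bsub>R\<^esub> x [^]\<^bsub>R\<^esub> (k P :: nat) \<in> Q"
    by metis
  \<comment> \<open>One exponent for all detecting primes; inserting 0 covers the case that there
    are none.\<close>
  let ?k = "Max (insert 0 (k ` PP))"
  have kP: "k P \<le> ?k" if "P \<in> PP" for P using that PP(1) by auto
  have bigk: "\<exists>s\<in>carrier R - P. s \<otimes>\<^bsub>R\<^esub> x [^]\<^bsub>R\<^esub> ?k \<in> Q" if P: "P \<in> PP" and Q: "Q \<in> C" for P Q
  proof -
    obtain s where s: "s \<in> carrier R - P" "s \<otimes>\<^bsub>R\<^esub> x [^]\<^bsub>R\<^esub> k P \<in> Q" using k[OF P Q] by blast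
    interpret Q: ideal Q R using ideals[OF Q] .
    have "(s \<otimes>\<^bsub>R\<^esub> x [^]\<^bsub>R\<^esub> k P) \<otimes>\<^bsub>R\<^esub> x [^]\<^bsub>R\<^esub> (?k - k P) \<in> Q" by (rule Q.I_r_closed) (use s x in auto)
    moreover have "x [^]\<^bsub>R\<^esub> k P \<otimes>\<^bsub>R\<^esub> x [^]\<^bsub>R\<^esub> (?k - k P) = x [^]\<^bsub>R\<^esub> ?k"
      using x kP[OF P] by (simp add: R.nat_pow_mult)
    ultimately show ?thesis using s x by (auto simp: R.m_assoc)
  qed
  \<comment> \<open>In the language of classes: a nonzero class has a nonzero multiple killed by all
    of \<open>B\<close>. For each further \<open>a\<close> the multiple is replaced by its product
    with the highest power of \<open>a\<close> that does not annihilate it.\<close>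
  have killed: "\<exists>c\<in>carrier R. c \<notin> Q \<and> (\<forall>a\<in>B. a \<otimes>\<^bsub>R\<^esub> c \<in> Q)"
    if Q: "Q \<in> C" "\<one>\<^bsub>R\<^esub> \<notin> Q" and B: "finite B" "B \<subseteq> A" for B Q
    using B
  proof (induction B)
    case empty
    then show ?case using Q by (intro bexI[of _ "\<one>\<^bsub>R\<^esub>"]) auto
  next
    case (insert a B)
    then obtain c where c: "c \<in> carrier R" "c \<notin> Q" "\<forall>b\<in>B. b \<otimes>\<^bsub>R\<^esub> c \<in> Q" by auto
    interpret Q: ideal Q R using ideals[OF Q(1)] .
    have a: "a \<in> carrier R" "a \<in> A" using insert.prems A by auto
    obtain n :: nat where "a [^]\<^bsub>R\<^esub> n \<in> Q" using torsion[OF Q(1) a(2)] by blast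
    then have n: "a [^]\<^bsub>R\<^esub> n \<otimes>\<^bsub>R\<^esub> c \<in> Q" using c by (intro Q.I_r_closed) auto
    define m where "m = (LEAST n::nat. a [^]\<^bsub>R\<^esub> n \<otimes>\<^bsub>R\<^esub> c \<in> Q)"
    have m: "a [^]\<^bsub>R\<^esub> m \<otimes>\<^bsub>R\<^esub> c \<in> Q" unfolding m_def by (rule LeastI[of _ n]) (rule n)
    have "m \<noteq> 0" using m c by (intro notI) simp
    then obtain l where l: "m = Suc l" using not0_implies_Suc by blast
    have nl: "a [^]\<^bsub>R\<^esub> l \<otimes>\<^bsub>R\<^esub> c \<notin> Q" using not_less_Least[of l "\<lambda>n. a [^]\<^bsub>R\<^esub> n \<otimes>\<^bsub>R\<^esub> c \<in> Q"] l by (simp add: m_def)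
    have "a \<otimes>\<^bsub>R\<^esub> (a [^]\<^bsub>R\<^esub> l \<otimes>\<^bsub>R\<^esub> c) = a [^]\<^bsub>R\<^esub> m \<otimes>\<^bsub>R\<^esub> c"
      using a c by (simp add: l R.m_ac)
    moreover have "b \<otimes>\<^bsub>R\<^esub> (a [^]\<^bsub>R\<^esub> l \<otimes>\<^bsub>R\<^esub> c) \<in> Q" if b: "b \<in> B" for b
    proof -
      have bc: "b \<in> carrier R" using b insert.prems A(2) by blast
      have "a [^]\<^bsub>R\<^esub> l \<otimes>\<^bsub>R\<^esub> (b \<otimes>\<^bsub>R\<^esub> c) \<in> Q" by (rule Q.I_l_closed) (use c b a in auto)
      moreover have "a [^]\<^bsub>R\<^esub> l \<otimes>\<^bsub>R\<^esub> (b \<otimes>\<^bsub>R\<^esub> c) = b \<otimes>\<^bsub>R\<^esub> (a [^]\<^bsub>R\<^esub> l \<otimes>\<^bsub>R\<^esub> c)"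
        using a bc c by (simp add: R.m_lcomm)
      ultimately show ?thesis by simp
    qed
    ultimately show ?case using m nl a c by (intro bexI[of _ "a [^]\<^bsub>R\<^esub> l \<otimes>\<^bsub>R\<^esub> c"]) auto
  qed
  have "x [^]\<^bsub>R\<^esub> ?k \<in> Q" if Q: "Q \<in> C" for Q
  proof (rule ccontr)
    assume no: "x [^]\<^bsub>R\<^esub> ?k \<notin> Q"
    have xk: "x [^]\<^bsub>R\<^esub> ?k \<in> carrier R" using x by simp
    let ?Q = "{s \<in> carrier R. s \<otimes>\<^bsub>R\<^esub> x [^]\<^bsub>R\<^esub> ?k \<in> Q}"
    have Q': "?Q \<in> C" by (rule colon[OF Q xk])
    have "\<one>\<^bsub>R\<^esub> \<notin> ?Q" using no xk by simp
    from killed[OF Q' this A(1)] obtain c where c: "c \<in> carrier R" "c \<notin> ?Q" "\<forall>a\<in>A. a \<otimes>\<^bsub>R\<^esub> c \<in> ?Q" by auto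
    \<comment> \<open>If \<open>Q\<close> annihilates a class, \<open>?Q\<close> annihilates its
      multiple by the power of \<open>x\<close>, and \<open>?Q''\<close> a further multiple by
      \<open>c\<close>, which is nonzero and killed by \<open>A\<close>. By the choice of the
      exponent it dies in all localizations at detecting primes, so it would have to be
      zero.\<close>
    let ?Q'' = "{s \<in> carrier R. s \<otimes>\<^bsub>R\<^esub> c \<in> ?Q}"
    have Q'': "?Q'' \<in> C" by (rule colon[OF Q' c(1)])
    interpret Q': ideal ?Q R using ideals[OF Q'] .
    have sub: "?Q \<subseteq> ?Q''"
    proof
      fix s assume s: "s \<in> ?Q"
      have "s \<otimes>\<^bsub>R\<^esub> c \<in> ?Q" by (rule Q'.I_r_closed[OF s c(1)])
      then show "s \<in> ?Q''" using s by blast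
    qed
    have np: "\<not> ?Q'' \<subseteq> P" if P: "P \<in> PP" for P
    proof -
      obtain s where s: "s \<in> carrier R - P" "s \<otimes>\<^bsub>R\<^esub> x [^]\<^bsub>R\<^esub> ?k \<in> Q" using bigk[OF P Q] by blast
      then have "s \<in> ?Q" by blast
      then have "s \<in> ?Q''" by (rule subsetD[OF sub])
      then show ?thesis using s(1) by blast
    qed
    have AQ: "A \<subseteq> ?Q''"
    proof
      fix a assume a: "a \<in> A"
      show "a \<in> ?Q''" by (rule CollectI, rule conjI[OF subsetD[OF A(2) a] bspec[OF c(3) a]])
    qed
    have "\<one>\<^bsub>R\<^esub> \<in> ?Q''" using np by (intro PP(3)[OF Q'' AQ] ballI)
    then have "\<one>\<^bsub>R\<^esub> \<in> carrier R \<and> \<one>\<^bsub>R\<^esub> \<otimes>\<^bsub>R\<^esub> c \<in> ?Q" by (rule CollectD)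
    then have "\<one>\<^bsub>R\<^esub> \<otimes>\<^bsub>R\<^esub> c \<in> ?Q" by (rule conjunct2)
    then show False using c(2) unfolding R.l_one[OF c(1)] by (rule notE[rotated])
  qed
  then show ?thesis by blast
qed

section \<open>Localization\<close>

lemma localize_module_simps:
  "carrier (localize_module R S M) = {fraction R S M m s | m s. m \<in> carrier M \<and> s \<in> S}"
  "\<zero>\<^bsub>localize_module R S M\<^esub> = fraction R S M \<zero>\<^bsub>M\<^esub> \<one>\<^bsub>R\<^esub>"
  "X \<oplus>\<^bsub>localize_module R S M\<^esub> Y = (\<Union>(m, s)\<in>X. \<Union>(n, t)\<in>Y.
       fraction R S M (t \<odot>\<^bsub>M\<^esub> m \<oplus>\<^bsub>M\<^esub> s \<odot>\<^bsub>M\<^esub> n) (s \<otimes>\<^bsub>R\<^esub> t))"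
  "A \<odot>\<^bsub>localize_module R S M\<^esub> Y = (\<Union>(r, s)\<in>A. \<Union>(m, t)\<in>Y. fraction R S M (r \<odot>\<^bsub>M\<^esub> m) (s \<otimes>\<^bsub>R\<^esub> t))"
  by (simp_all add: localize_module_def)

lemma localize_ring_simps:
  "carrier (localize_ring R S) = carrier (localize_module R S (regular_module R))"
  "monoid.mult (localize_ring R S) = smult (localize_module R S (regular_module R))"
  "\<one>\<^bsub>localize_ring R S\<^esub> = fraction R S (regular_module R) \<one>\<^bsub>R\<^esub> \<one>\<^bsub>R\<^esub>"
  "\<zero>\<^bsub>localize_ring R S\<^esub> = \<zero>\<^bsub>localize_module R S (regular_module R)\<^esub>"
  "add (localize_ring R S) = add (localize_module R S (regular_module R))"
  by (simp_all add: localize_ring_def Let_def)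

text \<open>The localized ring and the localization of the regular module are different records that
  share their additive part.\<close>

lemma abelian_group_cong:
  assumes "abelian_group G" "carrier H = carrier G" "add H = add G" "\<zero>\<^bsub>H\<^esub> = \<zero>\<^bsub>G\<^esub>"
  shows "abelian_group H"
proof -
  interpret G: abelian_group G by fact
  show ?thesis
    by (rule abelian_groupI) (use assms(2-4) G.a_assoc G.a_comm G.l_neg in \<open>auto intro: bexI[of _ "\<ominus>\<^bsub>G\<^esub> _"]\<close>)
qed

locale localized = module R M for R (structure) and M (structure) +
  fixes S
  assumes S_sub: "S \<subseteq> carrier R" and one_S [simp]: "\<one> \<in> S"
    and mult_S [simp]: "s \<in> S \<Longrightarrow> t \<in> S \<Longrightarrow> s \<otimes> t \<in> S"
begin

abbreviation "RS \<equiv> localize_ring R S"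
abbreviation "MS \<equiv> localize_module R S M"
abbreviation "fr \<equiv> fraction R S M"
abbreviation "frR \<equiv> fraction R S (regular_module R)"

lemma S_carrier [simp]: "s \<in> S \<Longrightarrow> s \<in> carrier R"
  using S_sub by auto

lemma localized_regular: "localized R (regular_module R) S"
  by (intro localized.intro localized_axioms.intro module_regular S_sub) auto

lemma fr_mem: "(m', s') \<in> fr m s \<longleftrightarrow>
    m' \<in> carrier M \<and> s' \<in> S \<and> (\<exists>u\<in>S. (u \<otimes> s') \<odot>\<^bsub>M\<^esub> m = (u \<otimes> s) \<odot>\<^bsub>M\<^esub> m')"
  by (simp add: fraction_def)

text \<open>Transitivity of equality of fractions. The multiplier contains the middle denominator
  \<open>s'\<close> besides \<open>u\<close> and \<open>v\<close>, since neither equation can be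
  divided by it.\<close>

lemma fr_trans:
  assumes "m \<in> carrier M" "m' \<in> carrier M" "m'' \<in> carrier M" "s \<in> S" "s' \<in> S" "s'' \<in> S"
    and "u \<in> S" "(u \<otimes> s') \<odot>\<^bsub>M\<^esub> m = (u \<otimes> s) \<odot>\<^bsub>M\<^esub> m'"
    and "v \<in> S" "(v \<otimes> s'') \<odot>\<^bsub>M\<^esub> m' = (v \<otimes> s') \<odot>\<^bsub>M\<^esub> m''"
  shows "\<exists>w\<in>S. (w \<otimes> s'') \<odot>\<^bsub>M\<^esub> m = (w \<otimes> s) \<odot>\<^bsub>M\<^esub> m''"
proof -
  let ?w = "(u \<otimes> v) \<otimes> s'"
  have c: "s \<in> carrier R" "s' \<in> carrier R" "s'' \<in> carrier R" "u \<in> carrier R" "v \<in> carrier R"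
    using assms by auto
  have "(?w \<otimes> s'') \<odot>\<^bsub>M\<^esub> m = (v \<otimes> s'') \<odot>\<^bsub>M\<^esub> ((u \<otimes> s') \<odot>\<^bsub>M\<^esub> m)"
    using c assms(1) by (simp add: m_ac flip: smult_assoc1)
  also have "\<dots> = (u \<otimes> s) \<odot>\<^bsub>M\<^esub> ((v \<otimes> s'') \<odot>\<^bsub>M\<^esub> m')"
    unfolding assms(8) using c assms(2) by (simp add: m_ac flip: smult_assoc1)
  also have "\<dots> = (?w \<otimes> s) \<odot>\<^bsub>M\<^esub> m''"
    unfolding assms(10) using c assms(3) by (simp add: m_ac flip: smult_assoc1)
  finally show ?thesis using assms by (intro bexI[of _ ?w]) auto
qed

lemma fr_self: "m \<in> carrier M \<Longrightarrow> s \<in> S \<Longrightarrow> (m, s) \<in> fr m s"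
  by (auto simp: fr_mem intro: bexI[of _ \<one>])

lemma fr_eqI:
  assumes "m \<in> carrier M" "m' \<in> carrier M" "s \<in> S" "s' \<in> S"
    and "u \<in> S" "(u \<otimes> s') \<odot>\<^bsub>M\<^esub> m = (u \<otimes> s) \<odot>\<^bsub>M\<^esub> m'"
  shows "fr m s = fr m' s'"
proof (rule Set.set_eqI)
  fix p :: "'c \<times> 'a"
  obtain n t where p: "p = (n, t)" by fastforce
  have "(n, t) \<in> fr m s \<longleftrightarrow> (n, t) \<in> fr m' s'"
  proof
    assume "(n, t) \<in> fr m s"
    then obtain v where v: "n \<in> carrier M" "t \<in> S" "v \<in> S" "(v \<otimes> t) \<odot>\<^bsub>M\<^esub> m = (v \<otimes> s) \<odot>\<^bsub>M\<^esub> n"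
      by (auto simp: fr_mem)
    show "(n, t) \<in> fr m' s'"
      using fr_trans[OF assms(2,1) v(1) assms(4,3) v(2) assms(5) assms(6)[symmetric] v(3,4)] v by (simp add: fr_mem)
  next
    assume "(n, t) \<in> fr m' s'"
    then obtain v where v: "n \<in> carrier M" "t \<in> S" "v \<in> S" "(v \<otimes> t) \<odot>\<^bsub>M\<^esub> m' = (v \<otimes> s') \<odot>\<^bsub>M\<^esub> n"
      by (auto simp: fr_mem)
    show "(n, t) \<in> fr m s"
      using fr_trans[OF assms(1,2) v(1) assms(3,4) v(2) assms(5,6) v(3,4)] v by (simp add: fr_mem)
  qed
  then show "p \<in> fr m s \<longleftrightarrow> p \<in> fr m' s'" by (simp add: p)
qed

lemma fr_eqD:
  assumes "fr m s = fr m' s'" "m' \<in> carrier M" "s' \<in> S"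
  obtains u where "u \<in> S" "(u \<otimes> s') \<odot>\<^bsub>M\<^esub> m = (u \<otimes> s) \<odot>\<^bsub>M\<^esub> m'"
  using fr_self[OF assms(2,3)] unfolding assms(1)[symmetric] by (auto simp: fr_mem)

lemma fr_scale: "m \<in> carrier M \<Longrightarrow> s \<in> S \<Longrightarrow> t \<in> S \<Longrightarrow> fr (t \<odot>\<^bsub>M\<^esub> m) (t \<otimes> s) = fr m s"
  by (rule fr_eqI[of _ _ _ _ \<one>]) (auto simp: m_comm simp flip: smult_assoc1)

lemma fr_closed [simp]: "m \<in> carrier M \<Longrightarrow> s \<in> S \<Longrightarrow> fr m s \<in> carrier MS"
  by (auto simp: localize_module_simps)

lemma MS_E:
  assumes "X \<in> carrier MS"
  obtains m s where "m \<in> carrier M" "s \<in> S" "X = fr m s"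
  using assms by (auto simp: localize_module_simps)

lemma fr_add:
  assumes "m \<in> carrier M" "n \<in> carrier M" "s \<in> S" "t \<in> S"
  shows "fr m s \<oplus>\<^bsub>MS\<^esub> fr n t = fr (t \<odot>\<^bsub>M\<^esub> m \<oplus>\<^bsub>M\<^esub> s \<odot>\<^bsub>M\<^esub> n) (s \<otimes> t)"
proof -
  have "fr (t' \<odot>\<^bsub>M\<^esub> m' \<oplus>\<^bsub>M\<^esub> s' \<odot>\<^bsub>M\<^esub> n') (s' \<otimes> t') = fr (t \<odot>\<^bsub>M\<^esub> m \<oplus>\<^bsub>M\<^esub> s \<odot>\<^bsub>M\<^esub> n) (s \<otimes> t)"
    if "(m', s') \<in> fr m s" "(n', t') \<in> fr n t" for m' s' n' t'
  proof -
    from that obtain u v where u: "m' \<in> carrier M" "s' \<in> S" "u \<in> S" "(u \<otimes> s') \<odot>\<^bsub>M\<^esub> m = (u \<otimes> s) \<odot>\<^bsub>M\<^esub> m'"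
      and v: "n' \<in> carrier M" "t' \<in> S" "v \<in> S" "(v \<otimes> t') \<odot>\<^bsub>M\<^esub> n = (v \<otimes> t) \<odot>\<^bsub>M\<^esub> n'"
      by (auto simp: fr_mem)
    have c: "s \<in> carrier R" "s' \<in> carrier R" "t \<in> carrier R" "t' \<in> carrier R" "u \<in> carrier R" "v \<in> carrier R"
      using assms u v by auto
    have "((u \<otimes> v) \<otimes> (s \<otimes> t)) \<odot>\<^bsub>M\<^esub> (t' \<odot>\<^bsub>M\<^esub> m' \<oplus>\<^bsub>M\<^esub> s' \<odot>\<^bsub>M\<^esub> n') =
        (v \<otimes> (t \<otimes> t')) \<odot>\<^bsub>M\<^esub> ((u \<otimes> s) \<odot>\<^bsub>M\<^esub> m') \<oplus>\<^bsub>M\<^esub> (u \<otimes> (s \<otimes> s')) \<odot>\<^bsub>M\<^esub> ((v \<otimes> t) \<odot>\<^bsub>M\<^esub> n')"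
      using c u v by (simp add: smult_r_distr m_ac flip: smult_assoc1)
    also have "\<dots> = ((u \<otimes> v) \<otimes> (s' \<otimes> t')) \<odot>\<^bsub>M\<^esub> (t \<odot>\<^bsub>M\<^esub> m \<oplus>\<^bsub>M\<^esub> s \<odot>\<^bsub>M\<^esub> n)"
      unfolding u(4)[symmetric] v(4)[symmetric]
      using c assms by (simp add: smult_r_distr m_ac flip: smult_assoc1)
    finally show ?thesis
      using assms u v by (intro fr_eqI[of _ _ _ _ "u \<otimes> v"]) auto
  qed
  then show ?thesis
    unfolding localize_module_simps
    apply (intro UN_constant_eq[OF fr_self[OF assms(1,3)]])
    apply (clarify, intro UN_constant_eq[OF fr_self[OF assms(2,4)]])
    apply auto
    done
qed

lemma fr_smult:
  assumes "a \<in> carrier R" "m \<in> carrier M" "s \<in> S" "t \<in> S"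
  shows "frR a s \<odot>\<^bsub>MS\<^esub> fr m t = fr (a \<odot>\<^bsub>M\<^esub> m) (s \<otimes> t)"
proof -
  interpret reg: localized R "regular_module R" S by (rule localized_regular)
  have "fr (a' \<odot>\<^bsub>M\<^esub> m') (s' \<otimes> t') = fr (a \<odot>\<^bsub>M\<^esub> m) (s \<otimes> t)"
    if "(a', s') \<in> frR a s" "(m', t') \<in> fr m t" for a' s' m' t'
  proof -
    from that obtain u v where u: "a' \<in> carrier R" "s' \<in> S" "u \<in> S" "(u \<otimes> s') \<otimes> a = (u \<otimes> s) \<otimes> a'"
      and v: "m' \<in> carrier M" "t' \<in> S" "v \<in> S" "(v \<otimes> t') \<odot>\<^bsub>M\<^esub> m = (v \<otimes> t) \<odot>\<^bsub>M\<^esub> m'"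
      by (auto simp: fr_mem reg.fr_mem)
    have c: "s \<in> carrier R" "s' \<in> carrier R" "t \<in> carrier R" "t' \<in> carrier R" "u \<in> carrier R" "v \<in> carrier R"
      using assms u v by auto
    have "((u \<otimes> v) \<otimes> (s \<otimes> t)) \<odot>\<^bsub>M\<^esub> (a' \<odot>\<^bsub>M\<^esub> m') = ((u \<otimes> s) \<otimes> a') \<odot>\<^bsub>M\<^esub> ((v \<otimes> t) \<odot>\<^bsub>M\<^esub> m')"
      using c u v by (simp add: m_ac flip: smult_assoc1)
    also have "\<dots> = ((u \<otimes> v) \<otimes> (s' \<otimes> t')) \<odot>\<^bsub>M\<^esub> (a \<odot>\<^bsub>M\<^esub> m)"
      unfolding u(4)[symmetric] v(4)[symmetric]
      using c assms by (simp add: m_ac flip: smult_assoc1)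
    finally show ?thesis
      using assms u v by (intro fr_eqI[of _ _ _ _ "u \<otimes> v"]) auto
  qed
  then show ?thesis
    unfolding localize_module_simps
    apply (intro UN_constant_eq[OF reg.fr_self])
    using assms apply simp
    using assms apply simp
    apply (clarify, intro UN_constant_eq[OF fr_self[OF assms(2,4)]])
    apply auto
    done
qed

lemma fr_add_same: "m \<in> carrier M \<Longrightarrow> n \<in> carrier M \<Longrightarrow> s \<in> S \<Longrightarrow> fr m s \<oplus>\<^bsub>MS\<^esub> fr n s = fr (m \<oplus>\<^bsub>M\<^esub> n) s"
  using fr_scale[of "m \<oplus>\<^bsub>M\<^esub> n" s s] by (simp add: fr_add smult_r_distr)

lemma fr_zero: "s \<in> S \<Longrightarrow> \<zero>\<^bsub>MS\<^esub> = fr \<zero>\<^bsub>M\<^esub> s"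
  unfolding localize_module_simps by (rule fr_eqI[of _ _ _ _ \<one>]) auto

lemma fr_zero_iff:
  assumes "m \<in> carrier M" "s \<in> S"
  shows "fr m s = \<zero>\<^bsub>MS\<^esub> \<longleftrightarrow> (\<exists>u\<in>S. u \<odot>\<^bsub>M\<^esub> m = \<zero>\<^bsub>M\<^esub>)"
proof
  assume "fr m s = \<zero>\<^bsub>MS\<^esub>"
  then have "fr m s = fr \<zero>\<^bsub>M\<^esub> \<one>" by (simp add: fr_zero[of \<one>])
  then obtain u where "u \<in> S" "(u \<otimes> \<one>) \<odot>\<^bsub>M\<^esub> m = (u \<otimes> s) \<odot>\<^bsub>M\<^esub> \<zero>\<^bsub>M\<^esub>"
    by (rule fr_eqD) auto
  then show "\<exists>u\<in>S. u \<odot>\<^bsub>M\<^esub> m = \<zero>\<^bsub>M\<^esub>" using assms by auto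
next
  assume "\<exists>u\<in>S. u \<odot>\<^bsub>M\<^esub> m = \<zero>\<^bsub>M\<^esub>"
  then obtain u where "u \<in> S" "u \<odot>\<^bsub>M\<^esub> m = \<zero>\<^bsub>M\<^esub>" by blast
  then show "fr m s = \<zero>\<^bsub>MS\<^esub>"
    unfolding fr_zero[OF one_S] using assms by (intro fr_eqI[of _ _ _ _ u]) auto
qed

text \<open>A common denominator for three fractions reduces the module axioms to identities between
  numerators.\<close>

lemma MS_reps:
  assumes "X \<in> carrier MS" "Y \<in> carrier MS" "Z \<in> carrier MS"
  obtains m n l s where "m \<in> carrier M" "n \<in> carrier M" "l \<in> carrier M" "s \<in> S"
    "X = fr m s" "Y = fr n s" "Z = fr l s"
proof -
  obtain m s n t l u where X: "m \<in> carrier M" "s \<in> S" "X = fr m s" and Y: "n \<in> carrier M" "t \<in> S" "Y = fr n t"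
    and Z: "l \<in> carrier M" "u \<in> S" "Z = fr l u"
    using assms by (metis MS_E)
  let ?d = "s \<otimes> (t \<otimes> u)"
  have "X = fr ((t \<otimes> u) \<odot>\<^bsub>M\<^esub> m) ?d" using fr_scale[of m s "t \<otimes> u"] X Y Z by (simp add: m_ac)
  moreover have "Y = fr ((s \<otimes> u) \<odot>\<^bsub>M\<^esub> n) ?d" using fr_scale[of n t "s \<otimes> u"] X Y Z by (simp add: m_ac)
  moreover have "Z = fr ((s \<otimes> t) \<odot>\<^bsub>M\<^esub> l) ?d" using fr_scale[of l u "s \<otimes> t"] X Y Z by (simp add: m_ac)
  ultimately show ?thesis using that X Y Z by (metis S_carrier mult_S smult_closed)
qed

section \<open>The ring and module axioms for fractions\<close>

lemma MS_abelian: "abelian_group MS"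
proof (rule abelian_groupI, goal_cases)
  case (1 X Y)
  from 1(1,2,2) show ?case by (rule MS_reps) (simp add: fr_add_same)
next
  case 2
  show ?case by (simp add: fr_zero[OF one_S])
next
  case (3 X Y Z)
  then show ?case by (rule MS_reps) (simp add: fr_add_same M.a_assoc)
next
  case (4 X Y)
  from 4(1,2,2) show ?case by (rule MS_reps) (simp add: fr_add_same M.a_comm)
next
  case (5 X)
  then obtain m s where "m \<in> carrier M" "s \<in> S" "X = fr m s" by (rule MS_E)
  then show ?case by (simp add: fr_zero[of s] fr_add_same)
next
  case (6 X)
  then obtain m s where "m \<in> carrier M" "s \<in> S" "X = fr m s" by (rule MS_E)
  then show ?case by (intro bexI[of _ "fr (\<ominus>\<^bsub>M\<^esub> m) s"]) (simp_all add: fr_zero[of s] fr_add_same M.l_neg)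
qed

lemma RS_cring: "cring RS"
proof -
  interpret reg: localized R "regular_module R" S by (rule localized_regular)
  have ab: "abelian_group RS"
    by (rule abelian_group_cong[OF reg.MS_abelian]) (simp_all add: localize_ring_simps)
  note mult = reg.fr_smult[simplified]
  note add = reg.fr_add_same[simplified]
  show ?thesis
  proof (rule cringI[OF ab comm_monoidI], unfold localize_ring_simps, goal_cases)
    case (1 X Y)
    from 1(1,2,2) show ?case by (rule reg.MS_reps) (simp add: mult)
  next
    case 2
    show ?case by simp
  next
    case (3 X Y Z)
    then show ?case by (rule reg.MS_reps) (simp add: mult m_assoc)
  next
    case (4 X)
    from 4(1,1,1) show ?case by (rule reg.MS_reps) (simp add: mult)
  next
    case (5 X Y)
    from 5(1,2,2) show ?case by (rule reg.MS_reps) (simp add: mult m_comm)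
  next
    case (6 X Y Z)
    then show ?case by (rule reg.MS_reps) (simp add: mult add l_distr)
  qed
qed

lemma MS_module: "module RS MS"
proof -
  interpret reg: localized R "regular_module R" S by (rule localized_regular)
  note mult = reg.fr_smult[simplified]
  note add = reg.fr_add_same[simplified]
  show ?thesis
  proof (rule moduleI[OF RS_cring MS_abelian], unfold localize_ring_simps, goal_cases)
    case (1 A X)
    from 1(1,1,1) obtain a s where "a \<in> carrier R" "s \<in> S" "A = frR a s" by (rule reg.MS_reps) simp
    moreover from 1(2,2,2) obtain m t where "m \<in> carrier M" "t \<in> S" "X = fr m t" by (rule MS_reps)
    ultimately show ?case by (simp add: fr_smult)
  next
    case (2 A B X)
    from 2(1,2,2) obtain a b s where "a \<in> carrier R" "b \<in> carrier R" "s \<in> S" "A = frR a s" "B = frR b s"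
      by (rule reg.MS_reps) simp
    moreover from 2(3,3,3) obtain m t where "m \<in> carrier M" "t \<in> S" "X = fr m t" by (rule MS_reps)
    ultimately show ?case by (simp add: fr_smult add fr_add_same smult_l_distr)
  next
    case (3 A X Y)
    from 3(1,1,1) obtain a s where "a \<in> carrier R" "s \<in> S" "A = frR a s" by (rule reg.MS_reps) simp
    moreover from 3(2,3,3) obtain m n t where "m \<in> carrier M" "n \<in> carrier M" "t \<in> S" "X = fr m t" "Y = fr n t"
      by (rule MS_reps)
    ultimately show ?case by (simp add: fr_smult fr_add_same smult_r_distr)
  next
    case (4 A B X)
    from 4(1,2,2) obtain a b s where "a \<in> carrier R" "b \<in> carrier R" "s \<in> S" "A = frR a s" "B = frR b s"
      by (rule reg.MS_reps) simp
    moreover from 4(3,3,3) obtain m t where "m \<in> carrier M" "t \<in> S" "X = fr m t" by (rule MS_reps)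
    ultimately show ?case by (simp add: fr_smult mult smult_assoc1 m_assoc)
  next
    case (5 X)
    then obtain m t where "m \<in> carrier M" "t \<in> S" "X = fr m t" by (rule MS_E)
    then show ?case by (simp add: fr_smult)
  qed
qed

sublocale MS: module RS MS by (rule MS_module)

lemma frR_closed [simp]: "a \<in> carrier R \<Longrightarrow> s \<in> S \<Longrightarrow> frR a s \<in> carrier RS"
  using localized.fr_closed[OF localized_regular] by (simp add: localize_ring_simps)

lemma RS_E:
  assumes "X \<in> carrier RS"
  obtains a s where "a \<in> carrier R" "s \<in> S" "X = frR a s"
  using assms localized.MS_E[OF localized_regular, of X] by (auto simp: localize_ring_simps)

lemma frR_mult: "a \<in> carrier R \<Longrightarrow> b \<in> carrier R \<Longrightarrow> s \<in> S \<Longrightarrow> t \<in> S \<Longrightarrow>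
    frR a s \<otimes>\<^bsub>RS\<^esub> frR b t = frR (a \<otimes> b) (s \<otimes> t)"
  using localized.fr_smult[OF localized_regular, of a b s t] by (simp add: localize_ring_simps)

lemma frR_add: "a \<in> carrier R \<Longrightarrow> b \<in> carrier R \<Longrightarrow> s \<in> S \<Longrightarrow> frR a s \<oplus>\<^bsub>RS\<^esub> frR b s = frR (a \<oplus> b) s"
  using localized.fr_add_same[OF localized_regular, of a b s] by (simp add: localize_ring_simps)

lemma frR_zero: "s \<in> S \<Longrightarrow> \<zero>\<^bsub>RS\<^esub> = frR \<zero> s"
  using localized.fr_zero[OF localized_regular, of s] by (simp add: localize_ring_simps)

lemma frR_zero_iff: "a \<in> carrier R \<Longrightarrow> s \<in> S \<Longrightarrow> frR a s = \<zero>\<^bsub>RS\<^esub> \<longleftrightarrow> (\<exists>u\<in>S. u \<otimes> a = \<zero>)"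
  using localized.fr_zero_iff[OF localized_regular, of a s] by (simp add: localize_ring_simps)

lemma frR_scale: "a \<in> carrier R \<Longrightarrow> s \<in> S \<Longrightarrow> t \<in> S \<Longrightarrow> frR (t \<otimes> a) (t \<otimes> s) = frR a s"
  using localized.fr_scale[OF localized_regular, of a s t] by simp

lemma frR_pow: "a \<in> carrier R \<Longrightarrow> frR a \<one> [^]\<^bsub>RS\<^esub> (n::nat) = frR (a [^] n) \<one>"
proof (induction n)
  case 0
  show ?case by (simp add: localize_ring_simps)
next
  case (Suc n)
  then show ?case by (simp add: frR_mult)
qed

text \<open>The product of finitely many multipliers works for all conditions at once, as each
  condition survives further multiplication.\<close>

lemma common_multiplier:
  fixes r :: nat
  assumes "\<And>i. i < r \<Longrightarrow> \<exists>u\<in>S. Q i u" "\<And>i u v. u \<in> S \<Longrightarrow> v \<in> S \<Longrightarrow> Q i u \<Longrightarrow> Q i (v \<otimes> u)"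
  shows "\<exists>u\<in>S. \<forall>i<r. Q i u"
  using assms(1)
proof (induction r)
  case 0
  show ?case by (rule bexI[of _ \<one>]) auto
next
  case (Suc r)
  then obtain u where u: "u \<in> S" "\<forall>i<r. Q i u" by (metis less_Suc_eq)
  obtain v where v: "v \<in> S" "Q r v" using Suc.prems by blast
  have "Q i (u \<otimes> v)" if "i < Suc r" for i
  proof (cases "i = r")
    case True
    then show ?thesis using assms(2) u v by blast
  next
    case False
    then have "Q i (v \<otimes> u)" using that assms(2) u v by simp
    then show ?thesis using u v by (simp add: m_comm)
  qed
  then show ?case using u v by (intro bexI[of _ "u \<otimes> v"]) auto
qed

text \<open>A common denominator for the first \<open>r\<close> entries only; infinitely many
  entries need not have one.\<close>

lemma tuple_rep:
  assumes "w \<in> UNIV \<rightarrow> carrier MS"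
  shows "\<exists>s\<in>S. \<exists>m\<in>UNIV \<rightarrow> carrier M. \<forall>i<r::nat. w i = fr (m i) s"
proof (induction r)
  case 0
  show ?case by (intro bexI[of _ \<one>] bexI[of _ "\<lambda>_. \<zero>\<^bsub>M\<^esub>"]) auto
next
  case (Suc r)
  then obtain s m where s: "s \<in> S" "m \<in> UNIV \<rightarrow> carrier M" "\<forall>i<r. w i = fr (m i) s" by blast
  have "w r \<in> carrier MS" using assms by auto
  then obtain n t where n: "n \<in> carrier M" "t \<in> S" "w r = fr n t" by (rule MS_E)
  let ?m = "\<lambda>i. if i = r then s \<odot>\<^bsub>M\<^esub> n else t \<odot>\<^bsub>M\<^esub> m i"
  have mc: "m i \<in> carrier M" for i using s by auto
  have "w i = fr (?m i) (t \<otimes> s)" if "i < Suc r" for i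
    using that s n mc fr_scale[of n t s] fr_scale[of "m i" s t] by (auto simp: m_comm less_Suc_eq)
  then show ?case using s n mc by (intro bexI[of _ "t \<otimes> s"] bexI[of _ ?m]) auto
qed

lemma comb_fr:
  assumes "a \<in> UNIV \<rightarrow> carrier R" "m \<in> UNIV \<rightarrow> carrier M" "s \<in> S" "t \<in> S"
  shows "comb MS r (\<lambda>i. frR (a i) s) (\<lambda>i. fr (m i) t) = fr (comb M r a m) (s \<otimes> t)"
proof (induction r)
  case 0
  show ?case using assms by (simp add: fr_zero[of "s \<otimes> t"])
next
  case (Suc r)
  have c: "a i \<in> carrier R" "m i \<in> carrier M" for i using assms by auto
  have "(\<lambda>i. frR (a i) s) \<in> UNIV \<rightarrow> carrier RS" "(\<lambda>i. fr (m i) t) \<in> UNIV \<rightarrow> carrier MS"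
    using c assms by auto
  then show ?case
    using Suc c assms comb_closed[OF assms(1,2)]
    by (simp add: MS.comb_Suc comb_Suc fr_smult fr_add_same)
qed

abbreviation "lift a s \<equiv> (\<lambda>i. frR (a i) s)"

lemma lift_free:
  assumes "a \<in> carrier (free_module R {..<r::nat})" "s \<in> S"
  shows "lift a s \<in> carrier (free_module RS {..<r})"
proof -
  have 0: "lift a s i = \<zero>\<^bsub>RS\<^esub>" if "\<not> i < r" for i
    using assms that by (simp add: free_carrier frR_zero[OF assms(2)])
  then have "{i. lift a s i \<noteq> \<zero>\<^bsub>RS\<^esub>} \<subseteq> {..<r}" by auto
  from finite_subset[OF this] show ?thesis
    using assms 0 free_closed[OF assms(1)] by (auto simp: free_carrier)
qed

lemma comb_regular_fr:
  assumes "a \<in> UNIV \<rightarrow> carrier R" "b \<in> UNIV \<rightarrow> carrier R" "s \<in> S"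
  shows "comb (regular_module RS) r (lift a s) (lift b \<one>) = frR (comb (regular_module R) r a b) s"
proof -
  interpret RR: module RS "regular_module RS" by (rule MS.module_regular)
  interpret Rm: module R "regular_module R" by (rule module_regular)
  show ?thesis
  proof (induction r)
    case 0
    show ?case using assms by (simp add: frR_zero)
  next
    case (Suc r)
    have c: "a i \<in> carrier R" "b i \<in> carrier R" for i using assms by auto
    have "lift a s \<in> UNIV \<rightarrow> carrier RS" "lift b \<one> \<in> UNIV \<rightarrow> carrier (regular_module RS)"
      using c assms by auto
    moreover have "b \<in> UNIV \<rightarrow> carrier (regular_module R)" using assms by simp
    moreover from this have "comb (regular_module R) r a b \<in> carrier R" using Rm.comb_closed[OF assms(1)] by simp
    ultimately show ?case
      using Suc c assms by (simp add: RR.comb_Suc Rm.comb_Suc frR_mult frR_add)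
  qed
qed

end

text \<open>The submodule \<open>Z\<close> is finitely generated, and a multiplier that works for
  the generators works for their combinations.\<close>

lemma noetherian_common_multiplier:
  assumes loc: "localized R M S" and X: "noetherian_module R X" and Z: "submodule Z R X"
    and f: "lin R (X\<lparr>carrier := Z\<rparr>) M f" and ex: "\<And>a. a \<in> Z \<Longrightarrow> \<exists>u\<in>S. u \<odot>\<^bsub>M\<^esub> f a = \<zero>\<^bsub>M\<^esub>"
  shows "\<exists>u\<in>S. \<forall>a\<in>Z. u \<odot>\<^bsub>M\<^esub> f a = \<zero>\<^bsub>M\<^esub>"
proof -
  interpret localized R M S by fact
  interpret X: module R X using X by (simp add: noetherian_module_def)
  obtain q z where z: "z \<in> UNIV \<rightarrow> Z" "\<And>w. w \<in> Z \<Longrightarrow> \<exists>c\<in>UNIV \<rightarrow> carrier R. w = comb X q c z"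
    by (rule noetherian_submodule_fg[OF X Z]) blast
  have fz: "f (z i) \<in> carrier M" for i using lin_closed[OF f] z(1) by auto
  have "\<exists>u\<in>S. \<forall>i<q. u \<odot>\<^bsub>M\<^esub> f (z i) = \<zero>\<^bsub>M\<^esub>"
  proof (rule common_multiplier)
    show "\<exists>u\<in>S. u \<odot>\<^bsub>M\<^esub> f (z i) = \<zero>\<^bsub>M\<^esub>" for i using ex z(1) by auto
    show "(v \<otimes>\<^bsub>R\<^esub> u) \<odot>\<^bsub>M\<^esub> f (z i) = \<zero>\<^bsub>M\<^esub>" if "u \<in> S" "v \<in> S" "u \<odot>\<^bsub>M\<^esub> f (z i) = \<zero>\<^bsub>M\<^esub>" for i u v
      using that fz by (simp add: smult_assoc1)
  qed
  then obtain u where u: "u \<in> S" "\<forall>i<q. u \<odot>\<^bsub>M\<^esub> f (z i) = \<zero>\<^bsub>M\<^esub>" by blast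
  have zX: "z \<in> UNIV \<rightarrow> carrier X" using z(1) X.submoduleE(1)[OF Z] by auto
  have f_comb: "f (comb X q c z) = comb M q c (\<lambda>i. f (z i))" if c: "c \<in> UNIV \<rightarrow> carrier R" for c q
  proof (induction q)
    case 0
    have "module R (X\<lparr>carrier := Z\<rparr>)" by (rule submodule.submodule_is_module[OF Z X.module_axioms])
    from lin_zero[OF this module_axioms f] show ?case by simp
  next
    case (Suc q)
    have "c q \<odot>\<^bsub>X\<^esub> z q \<in> Z" "comb X q c z \<in> Z" "z q \<in> Z" "c q \<in> carrier R"
      using z(1) c X.submoduleE(4)[OF Z] X.comb_in_submodule[OF Z c z(1)] by auto
    then show ?case
      using Suc c zX fz lin_add[OF f, of "c q \<odot>\<^bsub>X\<^esub> z q" "comb X q c z"] lin_smult[OF f, of "c q" "z q"]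
      by (simp add: X.comb_Suc comb_Suc)
  qed
  have "u \<odot>\<^bsub>M\<^esub> f a = \<zero>\<^bsub>M\<^esub>" if a: "a \<in> Z" for a
  proof -
    obtain c where c: "c \<in> UNIV \<rightarrow> carrier R" "a = comb X q c z" using z(2)[OF a] by blast
    have "u \<odot>\<^bsub>M\<^esub> f a = comb M q c (\<lambda>i. u \<odot>\<^bsub>M\<^esub> f (z i))"
      unfolding c(2) f_comb[OF c(1)] using comb_smult_right[of u c "\<lambda>i. f (z i)" q] u c fz by simp
    also have "\<dots> = \<zero>\<^bsub>M\<^esub>" by (rule comb_zero_right[OF c(1)]) (use u in auto)
    finally show ?thesis .
  qed
  then show ?thesis using u by blast
qed

text \<open>Stated for an arbitrary ring \<open>R'\<close> because it is applied both over the
  original ring and over its localization.\<close>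

lemma lin_comb_image:
  assumes X: "module R' X" and L: "module R' L" and Z: "submodule Z R' X" and f: "lin R' (X\<lparr>carrier := Z\<rparr>) L f"
    and c: "c \<in> UNIV \<rightarrow> carrier R'" and z: "z \<in> UNIV \<rightarrow> Z"
  shows "f (comb X q c z) = comb L q c (\<lambda>i. f (z i))"
proof -
  interpret X: module R' X by (rule X)
  interpret L: module R' L by (rule L)
  have zX: "z \<in> UNIV \<rightarrow> carrier X" using z X.submoduleE(1)[OF Z] by auto
  have fz: "f (z i) \<in> carrier L" for i using lin_closed[OF f] z by auto
  show ?thesis
  proof (induction q)
    case 0
    have "module R' (X\<lparr>carrier := Z\<rparr>)" by (rule submodule.submodule_is_module[OF Z X])
    from lin_zero[OF this L f] show ?case by simp
  next
    case (Suc q)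
    have "c q \<odot>\<^bsub>X\<^esub> z q \<in> Z" "comb X q c z \<in> Z" "z q \<in> Z" "c q \<in> carrier R'"
      using z c X.submoduleE(4)[OF Z] X.comb_in_submodule[OF Z c z] by auto
    then show ?case
      using Suc c zX fz lin_add[OF f, of "c q \<odot>\<^bsub>X\<^esub> z q" "comb X q c z"] lin_smult[OF f, of "c q" "z q"]
      by (simp add: X.comb_Suc L.comb_Suc)
  qed
qed

section \<open>Relations and cocycles over the localization\<close>

locale localized_system = localized R M S + power_system R M r x
  for R (structure) and M (structure) and S and r :: nat and x
begin

abbreviation "x' \<equiv> \<lambda>i. frR (x i) \<one>"

text \<open>The localized data satisfy the same assumptions, so everything proved about tuples and
  relations is at hand over the localization too.\<close>

sublocale loc: power_system RS MS r x'
  by (intro power_system.intro power_system_axioms.intro MS_module frR_closed x_closed one_S)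

abbreviation "relS \<equiv> power_relations RS r x'"

lemma free_fun: "a \<in> carrier Fr \<Longrightarrow> a \<in> UNIV \<rightarrow> carrier R"
  by (rule Pi_I) (rule free_closed)

lemma rel_free: "a \<in> rel n \<Longrightarrow> a \<in> carrier Fr"
  by (simp add: power_relations_def)

lemma lift_rel:
  assumes "a \<in> rel n" "s \<in> S"
  shows "lift a s \<in> relS n"
proof -
  have a: "a \<in> carrier Fr" "comb (regular_module R) r a (\<lambda>i. x i [^] n) = \<zero>"
    using assms by (auto simp: power_relations_def)
  have "comb (regular_module RS) r (lift a s) (lift (\<lambda>i. x i [^] n) \<one>) = frR \<zero> s"
    using comb_regular_fr[OF free_fun[OF a(1)] _ assms(2), of "\<lambda>i. x i [^] n" r] a(2) by auto
  then show ?thesis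
    using lift_free[OF a(1) assms(2)] frR_zero[OF assms(2)] by (simp add: power_relations_def frR_pow)
qed

lemma frR_eq: "a \<in> carrier R \<Longrightarrow> b \<in> carrier R \<Longrightarrow> s \<in> S \<Longrightarrow> t \<in> S \<Longrightarrow> frR a s = frR b t \<Longrightarrow>
    \<exists>u\<in>S. (u \<otimes> t) \<otimes> a = (u \<otimes> s) \<otimes> b"
  using localized.fr_eqD[OF localized_regular, of a s b t] by auto

text \<open>Clearing denominators gives numerators whose defining sum vanishes only after
  multiplication by some \<open>u\<close> in \<open>S\<close>. Expanding the fractions by
  \<open>u\<close> makes the numerators a genuine relation.\<close>

lemma relS_rep:
  assumes "v \<in> relS n"
  obtains a s where "a \<in> rel n" "s \<in> S" "v = lift a s"
proof -
  have v: "v \<in> carrier (free_module RS {..<r})" "comb (regular_module RS) r v (\<lambda>i. x' i [^]\<^bsub>RS\<^esub> n) = \<zero>\<^bsub>RS\<^esub>"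
    using assms by (auto simp: power_relations_def)
  have vc: "v i \<in> carrier RS" for i by (rule MS.free_closed[OF v(1)])
  interpret reg: localized R "regular_module R" S by (rule localized_regular)
  have "v \<in> UNIV \<rightarrow> carrier reg.MS" using vc by (simp add: localize_ring_simps)
  from reg.tuple_rep[OF this, of r] obtain s b where s: "s \<in> S" and b: "b \<in> UNIV \<rightarrow> carrier R" "\<forall>i<r. v i = frR (b i) s"
    by auto
  \<comment> \<open>\<open>tuple_rep\<close> controls only the entries below \<open>r\<close>;
    beyond them \<open>v\<close> vanishes and the numerators are taken to be zero.\<close>
  let ?b = "\<lambda>i. if i < r then b i else \<zero>"
  have bc: "?b \<in> UNIV \<rightarrow> carrier R" using b by auto
  have v_eq: "v = lift ?b s"
  proof
    fix i show "v i = lift ?b s i"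
      using b(2) v(1) frR_zero[OF s] by (auto simp: free_carrier)
  qed
  let ?c = "comb (regular_module R) r ?b (\<lambda>i. x i [^] n)"
  have c: "?c \<in> carrier R" using Rm.comb_closed[OF bc, of "\<lambda>i. x i [^] n" r] by auto
  have "frR ?c s = \<zero>\<^bsub>RS\<^esub>"
    using v(2) comb_regular_fr[OF bc _ s, of "\<lambda>i. x i [^] n" r] v_eq by (simp add: frR_pow)
  then obtain u where u: "u \<in> S" "u \<otimes> ?c = \<zero>" using frR_zero_iff[OF c s] by blast
  let ?a = "\<lambda>i. u \<otimes> ?b i"
  have "comb (regular_module R) r ?a (\<lambda>i. x i [^] n) = \<zero>"
    using Rm.comb_smult_left[of u ?b "\<lambda>i. x i [^] n" r] u bc by auto
  moreover have "?a \<in> carrier Fr"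
  proof -
    have "{i. ?a i \<noteq> \<zero>} \<subseteq> {..<r}" using u by auto
    from finite_subset[OF this] show ?thesis using u b(1) by (auto simp: free_carrier Pi_iff)
  qed
  ultimately have an: "?a \<in> rel n" by (simp add: power_relations_def)
  have va: "v = lift ?a (u \<otimes> s)"
  proof
    fix i
    have "?b i \<in> carrier R" using b(1) by auto
    then show "v i = lift ?a (u \<otimes> s) i" unfolding v_eq by (rule frR_scale[OF _ s u(1), symmetric])
  qed
  show ?thesis by (rule that[OF an mult_S[OF u(1) s] va])
qed

lemma lift_scale:
  assumes "a \<in> carrier Fr" "s \<in> S" "t \<in> S"
  shows "lift (t \<odot>\<^bsub>Fr\<^esub> a) (t \<otimes> s) = lift a s"
  using frR_scale[OF free_closed[OF assms(1)] assms(2,3)] by (simp add: free_simps)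

lemma lift_add:
  assumes "a \<in> carrier Fr" "b \<in> carrier Fr" "s \<in> S"
  shows "lift (a \<oplus>\<^bsub>Fr\<^esub> b) s = lift a s \<oplus>\<^bsub>loc.Fr\<^esub> lift b s"
  using frR_add[OF free_closed[OF assms(1)] free_closed[OF assms(2)] assms(3)] by (simp add: free_simps)

lemma lift_smult:
  assumes "c \<in> carrier R" "a \<in> carrier Fr" "s \<in> S" "t \<in> S"
  shows "lift (c \<odot>\<^bsub>Fr\<^esub> a) (t \<otimes> s) = frR c t \<odot>\<^bsub>loc.Fr\<^esub> lift a s"
  using frR_mult[OF assms(1) free_closed[OF assms(2)] assms(4,3)] by (simp add: free_simps)

lemma lift_shift:
  assumes "a \<in> carrier Fr" "s \<in> S"
  shows "shift RS x' N (lift a s) = lift (shift R x N a) s"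
  using frR_mult[OF _ free_closed[OF assms(1)] one_S assms(2), of "x _ [^] N"] assms(2)
  by (simp add: shift_def frR_pow)

text \<open>Equality of the fractions gives a multiplier for each coordinate. Only \<open>r\<close>
  coordinates can be nonzero, so one multiplier serves for all of them.\<close>

lemma lift_eqD:
  assumes a: "a \<in> carrier Fr" "b \<in> carrier Fr" "s \<in> S" "t \<in> S" and eq: "lift a s = lift b t"
  obtains u where "u \<in> S" "(u \<otimes> t) \<odot>\<^bsub>Fr\<^esub> a = (u \<otimes> s) \<odot>\<^bsub>Fr\<^esub> b"
proof -
  have c: "a i \<in> carrier R" "b i \<in> carrier R" for i
    using free_closed[OF a(1)] free_closed[OF a(2)] by auto
  have "\<exists>u\<in>S. \<forall>i<r. (u \<otimes> t) \<otimes> a i = (u \<otimes> s) \<otimes> b i"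
  proof (rule common_multiplier)
    show "\<exists>u\<in>S. (u \<otimes> t) \<otimes> a i = (u \<otimes> s) \<otimes> b i" for i
      by (rule frR_eq[OF c a(3,4) fun_cong[OF eq]])
    show "((v \<otimes> u) \<otimes> t) \<otimes> a i = ((v \<otimes> u) \<otimes> s) \<otimes> b i"
      if "u \<in> S" "v \<in> S" "(u \<otimes> t) \<otimes> a i = (u \<otimes> s) \<otimes> b i" for i u v
      using arg_cong[OF that(3), of "\<lambda>z. v \<otimes> z"] that(1,2) c a(3,4) by (simp add: m_assoc)
  qed
  then obtain u where u: "u \<in> S" "\<forall>i<r. (u \<otimes> t) \<otimes> a i = (u \<otimes> s) \<otimes> b i" by blast
  have "(u \<otimes> t) \<otimes> a i = (u \<otimes> s) \<otimes> b i" for i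
    using u a by (cases "i < r") (auto simp: free_carrier)
  then show ?thesis using that u(1) by (simp add: free_simps)
qed

lemma lift_fun: "a \<in> UNIV \<rightarrow> carrier R \<Longrightarrow> s \<in> S \<Longrightarrow> lift a s \<in> UNIV \<rightarrow> carrier RS"
  and fr_fun: "w \<in> UNIV \<rightarrow> carrier M \<Longrightarrow> s \<in> S \<Longrightarrow> (\<lambda>i. fr (w i) s) \<in> UNIV \<rightarrow> carrier MS"
  by (simp_all add: Pi_iff)

section \<open>Annihilation over the ring and over its localization\<close>

lemma local_annihilates0:
  assumes "annihilates RS MS r x' 0 (frR y \<one>)" "y \<in> carrier R" "m \<in> carrier M"
    and "\<forall>i<r. x i [^] (n::nat) \<odot>\<^bsub>M\<^esub> m = \<zero>\<^bsub>M\<^esub>"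
  shows "\<exists>s\<in>S. s \<odot>\<^bsub>M\<^esub> (y \<odot>\<^bsub>M\<^esub> m) = \<zero>\<^bsub>M\<^esub>"
proof -
  have "x' i [^]\<^bsub>RS\<^esub> n \<odot>\<^bsub>MS\<^esub> fr m \<one> = \<zero>\<^bsub>MS\<^esub>" if "i < r" for i
    using assms that by (simp add: frR_pow fr_smult fr_zero[of \<one>])
  then have "frR y \<one> \<odot>\<^bsub>MS\<^esub> fr m \<one> = \<zero>\<^bsub>MS\<^esub>"
    using mp[OF bspec[OF spec[OF assms(1)[unfolded annihilates_def if_P[OF refl]], of n] fr_closed[OF assms(3) one_S]]]
    by blast
  then show ?thesis using assms by (simp add: fr_smult fr_zero_iff)
qed

lemma annihilates_local0:
  assumes "annihilates R M r x 0 y" "y \<in> carrier R"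
  shows "annihilates RS MS r x' 0 (frR y \<one>)"
proof -
  have "frR y \<one> \<odot>\<^bsub>MS\<^esub> X = \<zero>\<^bsub>MS\<^esub>"
    if X: "X \<in> carrier MS" and z: "\<forall>i<r. x' i [^]\<^bsub>RS\<^esub> (n::nat) \<odot>\<^bsub>MS\<^esub> X = \<zero>\<^bsub>MS\<^esub>" for X n
  proof -
    obtain m s where m: "m \<in> carrier M" "s \<in> S" "X = fr m s" using X by (rule MS_E)
    have "\<exists>u\<in>S. \<forall>i<r. u \<odot>\<^bsub>M\<^esub> (x i [^] n \<odot>\<^bsub>M\<^esub> m) = \<zero>\<^bsub>M\<^esub>"
    proof (rule common_multiplier)
      show "\<exists>u\<in>S. u \<odot>\<^bsub>M\<^esub> (x i [^] n \<odot>\<^bsub>M\<^esub> m) = \<zero>\<^bsub>M\<^esub>" if "i < r" for i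
        using z that m by (simp add: frR_pow fr_smult fr_zero_iff)
    qed (use m in \<open>auto simp: smult_assoc1\<close>)
    then obtain u where u: "u \<in> S" "\<forall>i<r. u \<odot>\<^bsub>M\<^esub> (x i [^] n \<odot>\<^bsub>M\<^esub> m) = \<zero>\<^bsub>M\<^esub>" by blast
    have "x i [^] n \<odot>\<^bsub>M\<^esub> (u \<odot>\<^bsub>M\<^esub> m) = \<zero>\<^bsub>M\<^esub>" if "i < r" for i
      using u that m by (simp add: m_comm flip: smult_assoc1)
    moreover have "u \<odot>\<^bsub>M\<^esub> m \<in> carrier M" using u(1) m(1) by simp
    ultimately have "y \<odot>\<^bsub>M\<^esub> (u \<odot>\<^bsub>M\<^esub> m) = \<zero>\<^bsub>M\<^esub>"
      using mp[OF bspec[OF spec[OF assms(1)[unfolded annihilates_def if_P[OF refl]], of n]]] by blast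
    then have "u \<odot>\<^bsub>M\<^esub> (y \<odot>\<^bsub>M\<^esub> m) = \<zero>\<^bsub>M\<^esub>" using u m assms(2) by (simp add: m_comm flip: smult_assoc1)
    then show ?thesis using m assms(2) u by (auto simp: fr_smult fr_zero_iff)
  qed
  then show ?thesis by (simp add: annihilates_def)
qed

text \<open>The tuple with entries \<open>m i / 1\<close> is a cocycle over the localization. If
  \<open>u / t\<close> witnesses that \<open>y\<close> kills its class, clearing denominators by a
  common \<open>v\<close> shows that \<open>v \<otimes> t\<close> times \<open>y m\<close> is null,
  with witness \<open>v \<odot> u\<close>.\<close>

lemma local_annihilates1:
  assumes K: "annihilates RS MS r x' 1 (frR y \<one>)" and y: "y \<in> carrier R" and m: "cocycle1 R M r x n m"
  shows "\<exists>s\<in>S. null1 R M r x n (\<lambda>i. s \<odot>\<^bsub>M\<^esub> (y \<odot>\<^bsub>M\<^esub> m i))"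
proof -
  have mc: "m \<in> UNIV \<rightarrow> carrier M" "m i \<in> carrier M" for i using m by (auto simp: cocycle1_def)
  have "cocycle1 RS MS r x' n (\<lambda>i. fr (m i) \<one>)"
    unfolding cocycle1_def
  proof (intro conjI ballI)
    show "(\<lambda>i. fr (m i) \<one>) \<in> UNIV \<rightarrow> carrier MS" by (rule fr_fun[OF mc(1) one_S])
    fix v assume "v \<in> relS n"
    then obtain a s where a: "a \<in> rel n" "s \<in> S" "v = lift a s" by (rule relS_rep)
    have "comb M r a m = \<zero>\<^bsub>M\<^esub>" using m a(1) by (simp add: cocycle1_def)
    then show "comb MS r v (\<lambda>i. fr (m i) \<one>) = \<zero>\<^bsub>MS\<^esub>"
      using comb_fr[OF free_fun[OF rel_free[OF a(1)]] mc(1) a(2) one_S, of r] a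
      by (simp add: fr_zero[of s])
  qed
  then have "null1 RS MS r x' n (\<lambda>i. frR y \<one> \<odot>\<^bsub>MS\<^esub> fr (m i) \<one>)" using K by (simp add: annihilates_def)
  then obtain N U where U: "U \<in> carrier MS"
      "\<forall>i<r. x' i [^]\<^bsub>RS\<^esub> N \<odot>\<^bsub>MS\<^esub> (frR y \<one> \<odot>\<^bsub>MS\<^esub> fr (m i) \<one>) = x' i [^]\<^bsub>RS\<^esub> (N + n) \<odot>\<^bsub>MS\<^esub> U"
    unfolding null1_def by blast
  obtain u t where u: "u \<in> carrier M" "t \<in> S" "U = fr u t" by (rule MS_E[OF U(1)])
  have "\<exists>v\<in>S. \<forall>i<r. (v \<otimes> t) \<odot>\<^bsub>M\<^esub> (x i [^] N \<odot>\<^bsub>M\<^esub> (y \<odot>\<^bsub>M\<^esub> m i)) = v \<odot>\<^bsub>M\<^esub> (x i [^] (N + n) \<odot>\<^bsub>M\<^esub> u)"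
  proof (rule common_multiplier)
    fix i assume "i < r"
    then have "fr (x i [^] N \<odot>\<^bsub>M\<^esub> (y \<odot>\<^bsub>M\<^esub> m i)) \<one> = fr (x i [^] (N + n) \<odot>\<^bsub>M\<^esub> u) t"
      using U(2) u y mc by (simp add: frR_pow fr_smult)
    then obtain v where "v \<in> S" "(v \<otimes> t) \<odot>\<^bsub>M\<^esub> (x i [^] N \<odot>\<^bsub>M\<^esub> (y \<odot>\<^bsub>M\<^esub> m i)) = (v \<otimes> \<one>) \<odot>\<^bsub>M\<^esub> (x i [^] (N + n) \<odot>\<^bsub>M\<^esub> u)"
      by (rule fr_eqD) (use u in auto)
    then show "\<exists>v\<in>S. (v \<otimes> t) \<odot>\<^bsub>M\<^esub> (x i [^] N \<odot>\<^bsub>M\<^esub> (y \<odot>\<^bsub>M\<^esub> m i)) = v \<odot>\<^bsub>M\<^esub> (x i [^] (N + n) \<odot>\<^bsub>M\<^esub> u)"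
      by auto
  next
    fix i v w assume "v \<in> S" "w \<in> S" "(v \<otimes> t) \<odot>\<^bsub>M\<^esub> (x i [^] N \<odot>\<^bsub>M\<^esub> (y \<odot>\<^bsub>M\<^esub> m i)) = v \<odot>\<^bsub>M\<^esub> (x i [^] (N + n) \<odot>\<^bsub>M\<^esub> u)"
    then show "((w \<otimes> v) \<otimes> t) \<odot>\<^bsub>M\<^esub> (x i [^] N \<odot>\<^bsub>M\<^esub> (y \<odot>\<^bsub>M\<^esub> m i)) = (w \<otimes> v) \<odot>\<^bsub>M\<^esub> (x i [^] (N + n) \<odot>\<^bsub>M\<^esub> u)"
      using u y mc by (simp add: m_assoc smult_assoc1[of w])
  qed
  then obtain v where v: "v \<in> S"
      "\<forall>i<r. (v \<otimes> t) \<odot>\<^bsub>M\<^esub> (x i [^] N \<odot>\<^bsub>M\<^esub> (y \<odot>\<^bsub>M\<^esub> m i)) = v \<odot>\<^bsub>M\<^esub> (x i [^] (N + n) \<odot>\<^bsub>M\<^esub> u)" by blast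
  have "x i [^] N \<odot>\<^bsub>M\<^esub> ((v \<otimes> t) \<odot>\<^bsub>M\<^esub> (y \<odot>\<^bsub>M\<^esub> m i)) = x i [^] (N + n) \<odot>\<^bsub>M\<^esub> (v \<odot>\<^bsub>M\<^esub> u)" if "i < r" for i
  proof -
    have "x i [^] N \<odot>\<^bsub>M\<^esub> ((v \<otimes> t) \<odot>\<^bsub>M\<^esub> (y \<odot>\<^bsub>M\<^esub> m i)) = (v \<otimes> t) \<odot>\<^bsub>M\<^esub> (x i [^] N \<odot>\<^bsub>M\<^esub> (y \<odot>\<^bsub>M\<^esub> m i))"
      using v(1) u(2) y mc by (simp add: m_ac flip: smult_assoc1)
    also have "\<dots> = x i [^] (N + n) \<odot>\<^bsub>M\<^esub> (v \<odot>\<^bsub>M\<^esub> u)"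
      using v that u by (simp add: m_ac flip: smult_assoc1)
    finally show ?thesis .
  qed
  then show ?thesis
    using v(1) u unfolding null1_def by (intro bexI[of _ "v \<otimes> t"] exI[of _ N] bexI[of _ "v \<odot>\<^bsub>M\<^esub> u"]) auto
qed

lemma noetherian_rel_multiplier:
  assumes noeth: "noetherian_ring R" and f: "lin R (Fr\<lparr>carrier := rel n\<rparr>) M f"
    and "\<And>a. a \<in> rel n \<Longrightarrow> \<exists>u\<in>S. u \<odot>\<^bsub>M\<^esub> f a = \<zero>\<^bsub>M\<^esub>"
  shows "\<exists>u\<in>S. \<forall>a\<in>rel n. u \<odot>\<^bsub>M\<^esub> f a = \<zero>\<^bsub>M\<^esub>"
  by (rule noetherian_common_multiplier[OF localized_axioms noetherian_free[OF R.is_cring noeth] rel_submodule f assms(3)])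

text \<open>The numerators of a local cocycle satisfy each relation only up to a multiplier.
  Relations are finitely generated, so a single \<open>u\<close> makes \<open>u m\<close> a cocycle
  over \<open>R\<close>, to which the hypothesis applies.\<close>

lemma annihilates_local1:
  assumes noeth: "noetherian_ring R" and K: "annihilates R M r x 1 y" and y: "y \<in> carrier R"
  shows "annihilates RS MS r x' 1 (frR y \<one>)"
proof -
  have "null1 RS MS r x' n (\<lambda>i. frR y \<one> \<odot>\<^bsub>MS\<^esub> X i)" if X: "cocycle1 RS MS r x' n X" for n X
  proof -
    have Xc: "X \<in> UNIV \<rightarrow> carrier MS" using X by (simp add: cocycle1_def)
    obtain s m where s: "s \<in> S" and mc: "m \<in> UNIV \<rightarrow> carrier M" and Xm: "\<forall>i<r. X i = fr (m i) s"
      using tuple_rep[OF Xc, of r] by blast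
    have mi: "m i \<in> carrier M" for i using mc by auto
    have ex: "\<exists>u\<in>S. u \<odot>\<^bsub>M\<^esub> comb M r a m = \<zero>\<^bsub>M\<^esub>" if a: "a \<in> rel n" for a
    proof -
      have af: "a \<in> UNIV \<rightarrow> carrier R" by (rule free_fun[OF rel_free[OF a]])
      have la: "lift a \<one> \<in> UNIV \<rightarrow> carrier RS" by (rule lift_fun[OF af one_S])
      have "\<zero>\<^bsub>MS\<^esub> = comb MS r (lift a \<one>) X" using X lift_rel[OF a one_S] by (simp add: cocycle1_def)
      also have "\<dots> = comb MS r (lift a \<one>) (\<lambda>i. fr (m i) s)"
        using Xm mi s la by (intro MS.comb_cong) auto
      also have "\<dots> = fr (comb M r a m) (\<one> \<otimes> s)" by (rule comb_fr[OF af mc one_S s])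
      finally show ?thesis using fr_zero_iff[OF comb_closed[OF af mc], of s r] s by simp
    qed
    have "lin R (Fr\<lparr>carrier := rel n\<rparr>) M (\<lambda>a. comb M r a m)"
      by (rule lin_restrict_dom[OF lin_comb[OF module_axioms mc]]) (use rel_free in auto)
    from noetherian_rel_multiplier[OF noeth this ex] obtain u where u: "u \<in> S" "\<forall>a\<in>rel n. u \<odot>\<^bsub>M\<^esub> comb M r a m = \<zero>\<^bsub>M\<^esub>"
      by blast
    have "cocycle1 R M r x n (\<lambda>i. u \<odot>\<^bsub>M\<^esub> m i)"
      unfolding cocycle1_def using u mi comb_smult_right[OF _ free_fun[OF rel_free] mc, of u _ n r] by auto
    then have "null1 R M r x n (\<lambda>i. y \<odot>\<^bsub>M\<^esub> (u \<odot>\<^bsub>M\<^esub> m i))" using K by (simp add: annihilates_def)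
    then obtain N w where w: "w \<in> carrier M" "\<forall>i<r. x i [^] N \<odot>\<^bsub>M\<^esub> (y \<odot>\<^bsub>M\<^esub> (u \<odot>\<^bsub>M\<^esub> m i)) = x i [^] (N + n) \<odot>\<^bsub>M\<^esub> w"
      unfolding null1_def by blast
    have "x' i [^]\<^bsub>RS\<^esub> N \<odot>\<^bsub>MS\<^esub> (frR y \<one> \<odot>\<^bsub>MS\<^esub> X i) = x' i [^]\<^bsub>RS\<^esub> (N + n) \<odot>\<^bsub>MS\<^esub> fr w (u \<otimes> s)" if i: "i < r" for i
    proof -
      have "x' i [^]\<^bsub>RS\<^esub> N \<odot>\<^bsub>MS\<^esub> (frR y \<one> \<odot>\<^bsub>MS\<^esub> X i) = fr (x i [^] N \<odot>\<^bsub>M\<^esub> (y \<odot>\<^bsub>M\<^esub> m i)) s"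
        using Xm i s y mi by (simp add: frR_pow fr_smult)
      also have "\<dots> = fr (u \<odot>\<^bsub>M\<^esub> (x i [^] N \<odot>\<^bsub>M\<^esub> (y \<odot>\<^bsub>M\<^esub> m i))) (u \<otimes> s)"
        using fr_scale[of "x i [^] N \<odot>\<^bsub>M\<^esub> (y \<odot>\<^bsub>M\<^esub> m i)" s u] s y mi u by simp
      also have "u \<odot>\<^bsub>M\<^esub> (x i [^] N \<odot>\<^bsub>M\<^esub> (y \<odot>\<^bsub>M\<^esub> m i)) = x i [^] (N + n) \<odot>\<^bsub>M\<^esub> w"
        using w(2) i u(1) y mi by (simp add: m_ac flip: smult_assoc1)
      also have "fr (x i [^] (N + n) \<odot>\<^bsub>M\<^esub> w) (u \<otimes> s) = x' i [^]\<^bsub>RS\<^esub> (N + n) \<odot>\<^bsub>MS\<^esub> fr w (u \<otimes> s)"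
        using w(1) u s by (simp add: frR_pow fr_smult)
      finally show ?thesis .
    qed
    then show ?thesis
      unfolding null1_def using w(1) u s by (intro exI[of _ N] bexI[of _ "fr w (u \<otimes> s)"]) auto
  qed
  then show ?thesis by (simp add: annihilates_def)
qed

text \<open>\<open>G\<close> is computed from a chosen way of writing a local relation as a fraction
  of a relation. By \<open>lift_eqD\<close> two ways agree after multiplication by an element of
  \<open>S\<close>, so the value does not depend on the choice.\<close>

lemma cocycle2_localize:
  assumes g: "cocycle2 R M r x n g"
  obtains G where "cocycle2 RS MS r x' n G" "\<And>a s. a \<in> rel n \<Longrightarrow> s \<in> S \<Longrightarrow> G (lift a s) = fr (g a) s"
proof -
  define G where "G v = (let p = SOME p. fst p \<in> rel n \<and> snd p \<in> S \<and> v = lift (fst p) (snd p)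
      in fr (g (fst p)) (snd p))" for v
  have gl: "lin R (Fr\<lparr>carrier := rel n\<rparr>) M g" using g by (simp add: cocycle2_def)
  have gc: "g a \<in> carrier M" if "a \<in> rel n" for a using lin_closed[OF gl] that by simp
  note rs = Fr.submoduleE(4,5)[OF rel_submodule]
  have eq: "G (lift a s) = fr (g a) s" if a: "a \<in> rel n" "s \<in> S" for a s
  proof -
    let ?p = "SOME p. fst p \<in> rel n \<and> snd p \<in> S \<and> lift a s = lift (fst p) (snd p)"
    have "fst (a, s) \<in> rel n \<and> snd (a, s) \<in> S \<and> lift a s = lift (fst (a, s)) (snd (a, s))" using a by simp
    then have p: "fst ?p \<in> rel n \<and> snd ?p \<in> S \<and> lift a s = lift (fst ?p) (snd ?p)" by (rule someI)
    then obtain u where u: "u \<in> S" "(u \<otimes> snd ?p) \<odot>\<^bsub>Fr\<^esub> a = (u \<otimes> s) \<odot>\<^bsub>Fr\<^esub> fst ?p"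
      using lift_eqD[OF rel_free[OF a(1)] rel_free[of "fst ?p" n] a(2), of "snd ?p"] by blast
    have "(u \<otimes> snd ?p) \<odot>\<^bsub>M\<^esub> g a = g ((u \<otimes> snd ?p) \<odot>\<^bsub>Fr\<^esub> a)"
      using lin_smult[OF gl, of "u \<otimes> snd ?p" a] a p u(1) by simp
    also have "\<dots> = (u \<otimes> s) \<odot>\<^bsub>M\<^esub> g (fst ?p)"
      unfolding u(2) using lin_smult[OF gl, of "u \<otimes> s" "fst ?p"] a p u(1) by simp
    finally have "fr (g a) s = fr (g (fst ?p)) (snd ?p)"
      using a p u(1) gc by (intro fr_eqI[of _ _ _ _ u]) auto
    then show ?thesis by (simp add: G_def Let_def)
  qed
  have "lin RS (loc.Fr\<lparr>carrier := relS n\<rparr>) MS G"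
  proof (rule linI, simp_all)
    fix v assume "v \<in> relS n"
    then obtain a s where a: "a \<in> rel n" "s \<in> S" "v = lift a s" by (rule relS_rep)
    then show "G v \<in> carrier MS" using eq gc by simp
    fix A assume "A \<in> carrier RS"
    then obtain c t where c: "c \<in> carrier R" "t \<in> S" "A = frR c t" by (rule RS_E)
    show "G (A \<odot>\<^bsub>loc.Fr\<^esub> v) = A \<odot>\<^bsub>MS\<^esub> G v"
      using lift_smult[OF c(1) rel_free[OF a(1)] a(2) c(2)] eq[OF rs(1)[OF c(1) a(1)], of "t \<otimes> s"] a c
        lin_smult[OF gl, of c a] gc
      by (simp add: eq fr_smult)
  next
    fix v w assume "v \<in> relS n" "w \<in> relS n"
    then obtain a s b t where a: "a \<in> rel n" "s \<in> S" "v = lift a s" and b: "b \<in> rel n" "t \<in> S" "w = lift b t"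
      by (metis relS_rep)
    let ?a = "t \<odot>\<^bsub>Fr\<^esub> a" and ?b = "s \<odot>\<^bsub>Fr\<^esub> b"
    have ab: "?a \<in> rel n" "?b \<in> rel n" using rs(1) a b by auto
    have v: "v = lift ?a (t \<otimes> s)" using lift_scale[OF rel_free[OF a(1)] a(2) b(2)] a(3) by simp
    have w: "w = lift ?b (t \<otimes> s)" using lift_scale[OF rel_free[OF b(1)] b(2) a(2)] b(3) a(2) b(2) by (simp add: m_comm)
    have "v \<oplus>\<^bsub>loc.Fr\<^esub> w = lift (?a \<oplus>\<^bsub>Fr\<^esub> ?b) (t \<otimes> s)"
      unfolding v w using lift_add[OF rel_free[OF ab(1)] rel_free[OF ab(2)], of "t \<otimes> s"] a b by simp
    then show "G (v \<oplus>\<^bsub>loc.Fr\<^esub> w) = G v \<oplus>\<^bsub>MS\<^esub> G w"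
      using eq[OF rs(2)[OF ab], of "t \<otimes> s"] eq[OF ab(1), of "t \<otimes> s"] eq[OF ab(2), of "t \<otimes> s"] a b v w
        lin_add[OF gl, of ?a ?b] ab gc by (simp add: fr_add_same)
  qed
  then show ?thesis using that eq by (simp add: cocycle2_def)
qed

lemma shift_fr_smult:
  assumes a: "a \<in> rel (n + N)" and t: "t \<in> S"
  shows "shift RS x' N (lift a t) = lift (shift R x N a) t" "shift R x N a \<in> rel n"
  using lift_shift[OF rel_free[OF a] t] shift_rel[OF a] by auto

text \<open>A local extension of \<open>y g\<close> has numerators \<open>m\<close> with a common
  denominator \<open>s\<close>. The map \<open>?f\<close> measures how far these fail to extend
  \<open>s y g\<close> over \<open>R\<close>; it vanishes locally, and finite generation of the
  relations gives one multiplier removing the failure.\<close>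

lemma local_annihilates2:
  assumes noeth: "noetherian_ring R" and K: "annihilates RS MS r x' 2 (frR y \<one>)" and y: "y \<in> carrier R"
    and g: "cocycle2 R M r x n g"
  shows "\<exists>s\<in>S. null2 R M r x n (\<lambda>v. s \<odot>\<^bsub>M\<^esub> (y \<odot>\<^bsub>M\<^esub> g v))"
proof -
  obtain G where G: "cocycle2 RS MS r x' n G" "\<And>a s. a \<in> rel n \<Longrightarrow> s \<in> S \<Longrightarrow> G (lift a s) = fr (g a) s"
    using cocycle2_localize[OF g] by blast
  have gl: "lin R (Fr\<lparr>carrier := rel n\<rparr>) M g" using g by (simp add: cocycle2_def)
  have gc: "g a \<in> carrier M" if "a \<in> rel n" for a using lin_closed[OF gl] that by simp
  have "null2 RS MS r x' n (\<lambda>v. frR y \<one> \<odot>\<^bsub>MS\<^esub> G v)" using K G(1) by (simp add: annihilates_def)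
  then obtain N W where W: "W \<in> UNIV \<rightarrow> carrier MS"
      "\<forall>v\<in>relS (n + N). frR y \<one> \<odot>\<^bsub>MS\<^esub> G (shift RS x' N v) = comb MS r v W"
    unfolding null2_def by blast
  obtain s m where s: "s \<in> S" and mc: "m \<in> UNIV \<rightarrow> carrier M" and Wm: "\<forall>i<r. W i = fr (m i) s"
    using tuple_rep[OF W(1), of r] by blast
  have mi: "m i \<in> carrier M" for i using mc by auto
  let ?f = "\<lambda>a. s \<odot>\<^bsub>M\<^esub> (y \<odot>\<^bsub>M\<^esub> g (shift R x N a)) \<ominus>\<^bsub>M\<^esub> comb M r a m"
  have cc: "comb M r a m \<in> carrier M" if "a \<in> rel k" for a k
    using comb_closed[OF free_fun[OF rel_free[OF that]] mc] .
  have ex: "\<exists>u\<in>S. u \<odot>\<^bsub>M\<^esub> ?f a = \<zero>\<^bsub>M\<^esub>" if a: "a \<in> rel (n + N)" for a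
  proof -
    have af: "a \<in> UNIV \<rightarrow> carrier R" by (rule free_fun[OF rel_free[OF a]])
    have la: "lift a \<one> \<in> UNIV \<rightarrow> carrier RS" by (rule lift_fun[OF af one_S])
    have gs: "g (shift R x N a) \<in> carrier M" using gc shift_fr_smult(2)[OF a one_S] by blast
    have "fr (y \<odot>\<^bsub>M\<^esub> g (shift R x N a)) \<one> = frR y \<one> \<odot>\<^bsub>MS\<^esub> G (shift RS x' N (lift a \<one>))"
      unfolding shift_fr_smult(1)[OF a one_S] G(2)[OF shift_fr_smult(2)[OF a one_S] one_S]
      using y gs by (simp add: fr_smult)
    also have "\<dots> = comb MS r (lift a \<one>) W" using W(2) lift_rel[OF a one_S] by blast
    also have "\<dots> = comb MS r (lift a \<one>) (\<lambda>i. fr (m i) s)" using Wm mi s la by (intro MS.comb_cong) auto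
    also have "\<dots> = fr (comb M r a m) (\<one> \<otimes> s)" by (rule comb_fr[OF af mc one_S s])
    finally have "fr (y \<odot>\<^bsub>M\<^esub> g (shift R x N a)) \<one> = fr (comb M r a m) s" using s by simp
    then obtain u where u: "u \<in> S" "(u \<otimes> s) \<odot>\<^bsub>M\<^esub> (y \<odot>\<^bsub>M\<^esub> g (shift R x N a)) = (u \<otimes> \<one>) \<odot>\<^bsub>M\<^esub> comb M r a m"
      by (rule fr_eqD) (use s cc[OF a] in auto)
    have "u \<odot>\<^bsub>M\<^esub> (s \<odot>\<^bsub>M\<^esub> (y \<odot>\<^bsub>M\<^esub> g (shift R x N a))) = u \<odot>\<^bsub>M\<^esub> comb M r a m"
      using u s y gs by (simp add: smult_assoc1)
    then have "u \<odot>\<^bsub>M\<^esub> ?f a = \<zero>\<^bsub>M\<^esub>"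
      using u(1) s y gs cc[OF a] by (simp add: a_minus_def smult_r_distr smult_r_minus M.r_neg)
    then show ?thesis using u(1) by blast
  qed
  have ls: "lin R (Fr\<lparr>carrier := rel (n + N)\<rparr>) (Fr\<lparr>carrier := rel n\<rparr>) (shift R x N)"
    by (rule lin_restrict_cod[OF lin_restrict_dom[OF shift_lin]]) (use rel_free shift_rel in auto)
  have "lin R (Fr\<lparr>carrier := rel (n + N)\<rparr>) M ?f"
    by (intro lin_sub[OF module_axioms] lin_scale[OF module_axioms] lin_comp[OF gl ls] y S_carrier s
        lin_restrict_dom[OF lin_comb[OF module_axioms mc]]) (use rel_free in auto)
  from noetherian_rel_multiplier[OF noeth this ex] obtain u where
    u: "u \<in> S" "\<forall>a\<in>rel (n + N). u \<odot>\<^bsub>M\<^esub> ?f a = \<zero>\<^bsub>M\<^esub>" by blast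
  have "(u \<otimes> s) \<odot>\<^bsub>M\<^esub> (y \<odot>\<^bsub>M\<^esub> g (shift R x N a)) = comb M r a (\<lambda>i. u \<odot>\<^bsub>M\<^esub> m i)" if a: "a \<in> rel (n + N)" for a
  proof -
    have af: "a \<in> UNIV \<rightarrow> carrier R" by (rule free_fun[OF rel_free[OF a]])
    have gs: "g (shift R x N a) \<in> carrier M" using gc shift_rel[OF a] by blast
    have "u \<odot>\<^bsub>M\<^esub> (s \<odot>\<^bsub>M\<^esub> (y \<odot>\<^bsub>M\<^esub> g (shift R x N a))) \<ominus>\<^bsub>M\<^esub> u \<odot>\<^bsub>M\<^esub> comb M r a m = \<zero>\<^bsub>M\<^esub>"
      using bspec[OF u(2) a] u(1) s y gs cc[OF a] by (simp add: a_minus_def smult_r_distr smult_r_minus)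
    then have "u \<odot>\<^bsub>M\<^esub> (s \<odot>\<^bsub>M\<^esub> (y \<odot>\<^bsub>M\<^esub> g (shift R x N a))) = u \<odot>\<^bsub>M\<^esub> comb M r a m"
      using u(1) s y gs cc[OF a] by (simp add: M.minus_eq_zero_iff)
    then show ?thesis using comb_smult_right[of u a m r] u(1) s y gs af mc by (simp add: smult_assoc1)
  qed
  then show ?thesis
    unfolding null2_def using u(1) s mi
    by (intro bexI[of _ "u \<otimes> s"] exI[of _ N] bexI[of _ "\<lambda>i. u \<odot>\<^bsub>M\<^esub> m i"]) auto
qed

lemma lift_comb:
  assumes "c \<in> UNIV \<rightarrow> carrier R" "z \<in> UNIV \<rightarrow> carrier Fr"
  shows "lift (comb Fr q c z) \<one> = comb loc.Fr q (lift c \<one>) (\<lambda>l. lift (z l) \<one>)"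
proof (induction q)
  case 0
  show ?case by (simp add: free_simps frR_zero[of \<one>])
next
  case (Suc q)
  have z: "z l \<in> carrier Fr" "c l \<in> carrier R" for l using assms by auto
  have c': "lift c \<one> \<in> UNIV \<rightarrow> carrier RS" "(\<lambda>l. lift (z l) \<one>) \<in> UNIV \<rightarrow> carrier loc.Fr"
    using z lift_free[OF _ one_S] by auto
  have "lift (comb Fr (Suc q) c z) \<one> = lift (c q \<odot>\<^bsub>Fr\<^esub> z q) \<one> \<oplus>\<^bsub>loc.Fr\<^esub> lift (comb Fr q c z) \<one>"
    unfolding Fr.comb_Suc[OF assms] by (rule lift_add) (use z Fr.comb_closed[OF assms] in auto)
  also have "lift (c q \<odot>\<^bsub>Fr\<^esub> z q) \<one> = frR (c q) \<one> \<odot>\<^bsub>loc.Fr\<^esub> lift (z q) \<one>"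
    using lift_smult[of "c q" "z q" \<one> \<one>] z by simp
  finally show ?case unfolding loc.Fr.comb_Suc[OF c'] Suc .
qed

text \<open>A linear map on the localized relations is, up to a unit, the localization of a linear map,
  because the module of relations is finitely presented.\<close>

lemma cocycle2_descend:
  assumes noeth: "noetherian_ring R" and G: "cocycle2 RS MS r x' n G"
  obtains g d where "cocycle2 R M r x n g" "d \<in> S" "\<And>a. a \<in> rel n \<Longrightarrow> G (lift a \<one>) = fr (g a) d"
proof -
  have Gl: "lin RS (loc.Fr\<lparr>carrier := relS n\<rparr>) MS G" using G by (simp add: cocycle2_def)
  obtain q z where z: "z \<in> UNIV \<rightarrow> rel n" "\<And>w. w \<in> rel n \<Longrightarrow> \<exists>c\<in>UNIV \<rightarrow> carrier R. w = comb Fr q c z"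
    by (rule noetherian_submodule_fg[OF noetherian_free[OF R.is_cring noeth] rel_submodule]) blast
  have zF: "z \<in> UNIV \<rightarrow> carrier Fr" using z(1) rel_free by auto
  have zl: "(\<lambda>l. lift (z l) \<one>) \<in> UNIV \<rightarrow> relS n" using z(1) by (simp add: Pi_iff lift_rel)
  then have "(\<lambda>l. G (lift (z l) \<one>)) \<in> UNIV \<rightarrow> carrier MS" using lin_closed[OF Gl] by auto
  from tuple_rep[OF this, of q] obtain s m where s: "s \<in> S" and mc: "m \<in> UNIV \<rightarrow> carrier M"
    and Gm: "\<forall>l<q. G (lift (z l) \<one>) = fr (m l) s" by blast
  have mi: "m i \<in> carrier M" for i using mc by auto
  have G_comb: "G (lift (comb Fr q c z) \<one>) = fr (comb M q c m) s" if c: "c \<in> UNIV \<rightarrow> carrier R" for c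
  proof -
    have lc: "lift c \<one> \<in> UNIV \<rightarrow> carrier RS" by (rule lift_fun[OF c one_S])
    have "G (lift (comb Fr q c z) \<one>) = comb MS q (lift c \<one>) (\<lambda>l. G (lift (z l) \<one>))"
      unfolding lift_comb[OF c zF]
      by (rule lin_comb_image[OF loc.Fr.module_axioms MS_module loc.rel_submodule Gl lc zl])
    also have "\<dots> = comb MS q (lift c \<one>) (\<lambda>l. fr (m l) s)" using Gm mi s lc by (intro MS.comb_cong) auto
    also have "\<dots> = fr (comb M q c m) (\<one> \<otimes> s)" by (rule comb_fr[OF c mc one_S s])
    finally show ?thesis using s by simp
  qed
  let ?X = "free_module R {..<q}"
  \<comment> \<open>Only the free module on \<open>q\<close> basis elements and its linear
    combinations are wanted; the sequence of ring elements is filled with zeros.\<close>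
  interpret X: power_system R M q "\<lambda>_. \<zero>" by unfold_locales auto
  let ?d = "\<lambda>c. comb Fr q c z"
  have d: "lin R ?X Fr ?d" by (rule X.lin_comb[OF Fr.module_axioms zF])
  have th: "lin R ?X M (\<lambda>c. comb M q c m)" by (rule X.lin_comb[OF module_axioms mc])
  have Xfun: "c \<in> UNIV \<rightarrow> carrier R" if "c \<in> carrier ?X" for c using free_closed[OF that] by blast
  let ?K = "{c \<in> carrier ?X. ?d c = \<zero>\<^bsub>Fr\<^esub>}"
  have Ks: "submodule ?K R ?X" by (rule X.Fr.submodule_ker[OF Fr.module_axioms d])
  have lK: "lin R (?X\<lparr>carrier := ?K\<rparr>) M (\<lambda>c. comb M q c m)" by (rule lin_restrict_dom[OF th]) auto
  have ex: "\<exists>u\<in>S. u \<odot>\<^bsub>M\<^esub> comb M q c m = \<zero>\<^bsub>M\<^esub>" if c: "c \<in> ?K" for c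
  proof -
    have cf: "c \<in> UNIV \<rightarrow> carrier R" using Xfun c by blast
    have "G (lift \<zero>\<^bsub>Fr\<^esub> \<one>) = \<zero>\<^bsub>MS\<^esub>"
    proof -
      have "module RS (loc.Fr\<lparr>carrier := relS n\<rparr>)"
        by (rule submodule.submodule_is_module[OF loc.rel_submodule loc.Fr.module_axioms])
      from lin_zero[OF this MS_module Gl] show ?thesis by (simp add: free_simps frR_zero[of \<one>])
    qed
    then have "fr (comb M q c m) s = \<zero>\<^bsub>MS\<^esub>" using G_comb[OF cf] c by simp
    then show ?thesis using fr_zero_iff[OF comb_closed[OF cf mc] s] by blast
  qed
  \<comment> \<open>The values \<open>m l\<close> at the generators respect the relations among the
    generators only locally. These relations are finitely generated as well, so one \<open>u\<close>
    makes the values \<open>u m\<close> respect all of them, and a linear map on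
    \<open>rel n\<close> results.\<close>
  obtain u where u: "u \<in> S" "\<forall>c\<in>?K. u \<odot>\<^bsub>M\<^esub> comb M q c m = \<zero>\<^bsub>M\<^esub>"
    using noetherian_common_multiplier[OF localized_axioms noetherian_free[OF R.is_cring noeth] Ks lK ex] by blast
  have f: "lin R ?X M (\<lambda>c. u \<odot>\<^bsub>M\<^esub> comb M q c m)" by (rule lin_scale[OF module_axioms th]) (use u in auto)
  obtain g where g: "lin R (Fr\<lparr>carrier := ?d ` carrier ?X\<rparr>) M g"
      "\<And>c. c \<in> carrier ?X \<Longrightarrow> g (?d c) = u \<odot>\<^bsub>M\<^esub> comb M q c m"
    using lin_factor[OF X.Fr.module_axioms Fr.module_axioms module_axioms d f] u(2) by blast
  have rep: "\<exists>c\<in>carrier ?X. w = ?d c" if w: "w \<in> rel n" for w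
  proof -
    obtain c where c: "c \<in> UNIV \<rightarrow> carrier R" "w = comb Fr q c z" using z(2)[OF w] by blast
    let ?c = "\<lambda>l. if l < q then c l else \<zero>"
    have "finite {l. ?c l \<noteq> \<zero>}" by (rule finite_subset[of _ "{..<q}"]) auto
    then have "?c \<in> carrier ?X" using c(1) by (auto simp: free_carrier)
    moreover have "comb Fr q ?c z = comb Fr q c z" using c(1) zF by (intro Fr.comb_cong) auto
    ultimately show ?thesis using c(2) by metis
  qed
  have im: "?d ` carrier ?X = rel n"
    using rep Fr.comb_in_submodule[OF rel_submodule Xfun z(1)] by auto
  have GG: "G (lift a \<one>) = fr (g a) (u \<otimes> s)" if a: "a \<in> rel n" for a
  proof -
    obtain c where c: "c \<in> carrier ?X" "a = ?d c" using rep[OF a] by blast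
    show ?thesis
      unfolding c(2) G_comb[OF Xfun[OF c(1)]] g(2)[OF c(1)]
      using fr_scale[OF comb_closed[OF Xfun[OF c(1)] mc] s u(1)] by simp
  qed
  show ?thesis
    by (rule that[OF _ mult_S[OF u(1) s] GG]) (use g(1) in \<open>simp_all add: cocycle2_def im\<close>)
qed

lemma annihilates_local2:
  assumes noeth: "noetherian_ring R" and K: "annihilates R M r x 2 y" and y: "y \<in> carrier R"
  shows "annihilates RS MS r x' 2 (frR y \<one>)"
proof -
  have "null2 RS MS r x' n (\<lambda>v. frR y \<one> \<odot>\<^bsub>MS\<^esub> G v)" if G: "cocycle2 RS MS r x' n G" for n G
  proof -
    have Gl: "lin RS (loc.Fr\<lparr>carrier := relS n\<rparr>) MS G" using G by (simp add: cocycle2_def)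
    obtain g d where g: "cocycle2 R M r x n g" and d: "d \<in> S" and Gg: "\<And>a. a \<in> rel n \<Longrightarrow> G (lift a \<one>) = fr (g a) d"
      using cocycle2_descend[OF noeth G] by blast
    have gl: "lin R (Fr\<lparr>carrier := rel n\<rparr>) M g" using g by (simp add: cocycle2_def)
    have "null2 R M r x n (\<lambda>v. y \<odot>\<^bsub>M\<^esub> g v)" using K g by (simp add: annihilates_def)
    then obtain N w where w: "w \<in> UNIV \<rightarrow> carrier M" "\<forall>v\<in>rel (n + N). y \<odot>\<^bsub>M\<^esub> g (shift R x N v) = comb M r v w"
      unfolding null2_def by blast
    have "frR y \<one> \<odot>\<^bsub>MS\<^esub> G (shift RS x' N v) = comb MS r v (\<lambda>i. fr (w i) d)" if v: "v \<in> relS (n + N)" for v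
    proof -
      obtain a t where a: "a \<in> rel (n + N)" and t: "t \<in> S" and v_eq: "v = lift a t" by (rule relS_rep[OF v])
      let ?b = "shift R x N a"
      note b = shift_fr_smult(2)[OF a t]
      have gb: "g ?b \<in> carrier M" using lin_closed[OF gl] b by simp
      \<comment> \<open>The description of \<open>G\<close> by \<open>g\<close> concerns denominator
        \<open>\<one>\<close>, so the factor \<open>1/t\<close> is taken out by linearity.\<close>
      have "lift ?b t = frR \<one> t \<odot>\<^bsub>loc.Fr\<^esub> lift ?b \<one>"
        using lift_smult[of \<one> ?b \<one> t] rel_free[OF b] t by simp
      then have "G (lift ?b t) = frR \<one> t \<odot>\<^bsub>MS\<^esub> fr (g ?b) d"
        using lin_smult[OF Gl, of "frR \<one> t" "lift ?b \<one>"] Gg[OF b] lift_rel[OF b one_S] t by simp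
      also have "\<dots> = fr (g ?b) (t \<otimes> d)" using gb t d by (simp add: fr_smult)
      finally have "frR y \<one> \<odot>\<^bsub>MS\<^esub> G (shift RS x' N v) = fr (comb M r a w) (t \<otimes> d)"
        unfolding v_eq shift_fr_smult(1)[OF a t] using w(2) a gb t d y by (simp add: fr_smult)
      also have "\<dots> = comb MS r v (\<lambda>i. fr (w i) d)"
        unfolding v_eq by (rule comb_fr[OF free_fun[OF rel_free[OF a]] w(1) t d, symmetric])
      finally show ?thesis .
    qed
    moreover have "(\<lambda>i. fr (w i) d) \<in> UNIV \<rightarrow> carrier MS" by (rule fr_fun[OF w(1) d])
    ultimately show ?thesis unfolding null2_def by blast
  qed
  then show ?thesis by (simp add: annihilates_def)
qed

lemma annihilates_localize:
  assumes "noetherian_ring R" "annihilates R M r x i y" "y \<in> carrier R" "i \<le> 2"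
  shows "annihilates RS MS r x' i (frR y \<one>)"
proof -
  consider "i = 0" | "i = 1" | "i = 2" using assms(4) by linarith
  then show ?thesis
    using annihilates_local0[OF _ assms(3)] annihilates_local1[OF assms(1) _ assms(3)]
      annihilates_local2[OF assms(1) _ assms(3)] assms(2) by cases auto
qed

end

section \<open>Uniform annihilation from local annihilation\<close>

text \<open>Vanishing of \<open>y\<close> times a class in the localization at \<open>S\<close>,
  expressed over \<open>R\<close>. The multiplier \<open>s\<close> may depend on the class, whereas
  \<open>y\<close> may not.\<close>

definition locally_annihilates ::
    "('a, 'r) ring_scheme \<Rightarrow> ('a, 'm, 's) module_scheme \<Rightarrow> nat \<Rightarrow> (nat \<Rightarrow> 'a) \<Rightarrow> nat \<Rightarrow> 'a set \<Rightarrow> 'a \<Rightarrow> bool" where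
  "locally_annihilates R M r x i S y \<longleftrightarrow>
    (if i = 0 then \<forall>n. \<forall>m\<in>carrier M. (\<forall>i<r. x i [^]\<^bsub>R\<^esub> (n::nat) \<odot>\<^bsub>M\<^esub> m = \<zero>\<^bsub>M\<^esub>) \<longrightarrow> (\<exists>s\<in>S. s \<odot>\<^bsub>M\<^esub> (y \<odot>\<^bsub>M\<^esub> m) = \<zero>\<^bsub>M\<^esub>)
     else if i = 1 then \<forall>n m. cocycle1 R M r x n m \<longrightarrow> (\<exists>s\<in>S. null1 R M r x n (\<lambda>i. s \<odot>\<^bsub>M\<^esub> (y \<odot>\<^bsub>M\<^esub> m i)))
     else \<forall>n g. cocycle2 R M r x n g \<longrightarrow> (\<exists>s\<in>S. null2 R M r x n (\<lambda>v. s \<odot>\<^bsub>M\<^esub> (y \<odot>\<^bsub>M\<^esub> g v))))"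

text \<open>The sum of the individual bounds is at least each of them, and it makes sense for
  \<open>r = 0\<close>.\<close>

lemma uniform_bound:
  fixes p :: "nat \<Rightarrow> nat \<Rightarrow> bool"
  assumes "\<And>j. j < r \<Longrightarrow> \<exists>N. p j N" and "\<And>j N K. j < r \<Longrightarrow> p j N \<Longrightarrow> p j (N + K)"
  shows "\<exists>N. \<forall>j<r. p j N"
proof -
  obtain f where f: "\<And>j. j < r \<Longrightarrow> p j (f j)" using assms(1) by metis
  have "p j (\<Sum>j<r. f j)" if "j < r" for j
    using assms(2)[OF that f[OF that], of "(\<Sum>j<r. f j) - f j"] member_le_sum[of j "{..<r}" f] that by simp
  then show ?thesis by blast
qed

lemma (in cring) pred_ideal:
  assumes "p \<zero>" "\<And>s t. s \<in> carrier R \<Longrightarrow> t \<in> carrier R \<Longrightarrow> p s \<Longrightarrow> p t \<Longrightarrow> p (s \<oplus> t)"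
    and "\<And>c s. c \<in> carrier R \<Longrightarrow> s \<in> carrier R \<Longrightarrow> p s \<Longrightarrow> p (c \<otimes> s)"
  shows "ideal {s \<in> carrier R. p s} R"
  by (intro submodule_regular_imp_ideal is_cring module.submoduleI'[OF module_regular]) (use assms in auto)

text \<open>Transfers detection from a Noetherian module: each class is assigned an element
  annihilated by everything that annihilates the class and vanishing only if the class does. The
  assignment may be a mere choice, and \<open>Q\<close> may be strictly smaller than
  \<open>Q'\<close>.\<close>

lemma prime_detected_mono:
  assumes "prime_detected R C'"
    and "\<And>Q. Q \<in> C \<Longrightarrow> \<exists>Q'\<in>C'. Q \<subseteq> Q' \<and> (\<one>\<^bsub>R\<^esub> \<in> Q' \<longrightarrow> \<one>\<^bsub>R\<^esub> \<in> Q)"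
  shows "prime_detected R C"
proof -
  obtain PP where PP: "finite PP" "\<forall>P\<in>PP. primeideal P R"
      "\<And>Q. Q \<in> C' \<Longrightarrow> (\<forall>P\<in>PP. \<not> Q \<subseteq> P) \<Longrightarrow> \<one>\<^bsub>R\<^esub> \<in> Q"
    using assms(1) unfolding prime_detected_def by blast
  have "\<one>\<^bsub>R\<^esub> \<in> Q" if "Q \<in> C" "\<forall>P\<in>PP. \<not> Q \<subseteq> P" for Q
    using assms(2)[OF that(1)] that(2) PP(3) by (meson subset_trans)
  then show ?thesis unfolding prime_detected_def using PP(1,2) by blast
qed

text \<open>The ideal is the annihilator of \<open>\<one>\<close> modulo \<open>Q\<close>, so
  detection for the regular module replaces the usual appeal to maximal ideals.\<close>

lemma ideal_detected:
  assumes "cring R" "noetherian_ring R" "ideal Q R" "\<And>P. primeideal P R \<Longrightarrow> \<not> Q \<subseteq> P"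
  shows "\<one>\<^bsub>R\<^esub> \<in> Q"
proof -
  interpret cring R by fact
  interpret Q: ideal Q R by fact
  have "colon R (regular_module R) Q \<one>\<^bsub>R\<^esub> = Q" using Q.Icarr by (auto simp: colon_def)
  then have "Q \<in> colon R (regular_module R) Q ` carrier (regular_module R)" by (metis image_eqI one_closed regular_module_simps(1))
  then show ?thesis
    using noetherian_prime_detected[OF assms(1,2) noetherian_regular[OF assms(1,2)]
        ideal_imp_submodule_regular[OF assms(1,3)]] assms(4)
    unfolding prime_detected_def by blast
qed

context module
begin

lemma pow_smult: "a \<in> carrier R \<Longrightarrow> m \<in> carrier M \<Longrightarrow>
    a [^] (k::nat) \<odot>\<^bsub>M\<^esub> (a [^] (l::nat) \<odot>\<^bsub>M\<^esub> m) = a [^] (k + l) \<odot>\<^bsub>M\<^esub> m"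
  by (simp add: R.nat_pow_mult flip: smult_assoc1)

lemma smult_r_diff: "a \<in> carrier R \<Longrightarrow> p \<in> carrier M \<Longrightarrow> q \<in> carrier M \<Longrightarrow>
    a \<odot>\<^bsub>M\<^esub> (p \<ominus>\<^bsub>M\<^esub> q) = a \<odot>\<^bsub>M\<^esub> p \<ominus>\<^bsub>M\<^esub> a \<odot>\<^bsub>M\<^esub> q"
  by (simp add: a_minus_def smult_r_distr smult_r_minus)

lemma pow_smult_raise:
  assumes "a \<in> carrier R" "u \<in> carrier M" "b \<in> carrier M"
    and "a [^] (k::nat) \<odot>\<^bsub>M\<^esub> u = a [^] (l::nat) \<odot>\<^bsub>M\<^esub> b"
  shows "a [^] (k + L) \<odot>\<^bsub>M\<^esub> u = a [^] (l + L) \<odot>\<^bsub>M\<^esub> b"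
  using arg_cong[OF assms(4), of "\<lambda>z. a [^] L \<odot>\<^bsub>M\<^esub> z"] assms(1-3) by (simp add: pow_smult add.commute)

lemma smult_comm: "a \<in> carrier R \<Longrightarrow> b \<in> carrier R \<Longrightarrow> m \<in> carrier M \<Longrightarrow>
    a \<odot>\<^bsub>M\<^esub> (b \<odot>\<^bsub>M\<^esub> m) = b \<odot>\<^bsub>M\<^esub> (a \<odot>\<^bsub>M\<^esub> m)"
  by (simp add: m_comm flip: smult_assoc1)

end

section \<open>Degree one: null tuples and annihilators of classes\<close>

context power_system
begin

text \<open>The exponent is made explicit so that finitely many null tuples can be brought to a
  common one.\<close>

definition null1_at where
  "null1_at n N m \<longleftrightarrow> (\<exists>u\<in>carrier M. \<forall>i<r. x i [^] (N::nat) \<odot>\<^bsub>M\<^esub> m i = x i [^] (N + n) \<odot>\<^bsub>M\<^esub> u)"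

lemma null1_iff: "null1 R M r x n m \<longleftrightarrow> (\<exists>N. null1_at n N m)"
  by (simp add: null1_def null1_at_def)

lemma null1_cong: "(\<And>i. i < r \<Longrightarrow> m i = m' i) \<Longrightarrow> null1 R M r x n m \<longleftrightarrow> null1 R M r x n m'"
  by (simp add: null1_def)

lemma null1_at_mono:
  assumes m: "m \<in> UNIV \<rightarrow> carrier M" and N: "null1_at n N m"
  shows "null1_at n (N + K) m"
proof -
  obtain u where u: "u \<in> carrier M" "\<And>i. i < r \<Longrightarrow> x i [^] N \<odot>\<^bsub>M\<^esub> m i = x i [^] (N + n) \<odot>\<^bsub>M\<^esub> u"
    using N by (auto simp: null1_at_def)
  have "x i [^] (N + K) \<odot>\<^bsub>M\<^esub> m i = x i [^] (N + K + n) \<odot>\<^bsub>M\<^esub> u" if i: "i < r" for i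
  proof -
    have "x i [^] K \<odot>\<^bsub>M\<^esub> (x i [^] N \<odot>\<^bsub>M\<^esub> m i) = x i [^] K \<odot>\<^bsub>M\<^esub> (x i [^] (N + n) \<odot>\<^bsub>M\<^esub> u)"
      by (simp only: u(2)[OF i])
    then show ?thesis using m u(1) by (simp add: pow_smult Pi_iff ac_simps)
  qed
  then show ?thesis using u(1) by (auto simp: null1_at_def)
qed

lemma null1_add:
  assumes m: "m \<in> UNIV \<rightarrow> carrier M" "m' \<in> UNIV \<rightarrow> carrier M"
    and "null1 R M r x n m" "null1 R M r x n m'"
  shows "null1 R M r x n (\<lambda>i. m i \<oplus>\<^bsub>M\<^esub> m' i)"
proof -
  obtain N N' where "null1_at n N m" "null1_at n N' m'" using assms(3,4) by (auto simp: null1_iff)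
  then have "null1_at n (N + N') m" "null1_at n (N + N') m'"
    using null1_at_mono[OF m(1), of n N N'] null1_at_mono[OF m(2), of n N' N] by (simp_all add: add.commute)
  then obtain u u' where u: "u \<in> carrier M" "u' \<in> carrier M"
      "\<And>i. i < r \<Longrightarrow> x i [^] (N + N') \<odot>\<^bsub>M\<^esub> m i = x i [^] (N + N' + n) \<odot>\<^bsub>M\<^esub> u"
      "\<And>i. i < r \<Longrightarrow> x i [^] (N + N') \<odot>\<^bsub>M\<^esub> m' i = x i [^] (N + N' + n) \<odot>\<^bsub>M\<^esub> u'"
    by (auto simp: null1_at_def)
  have "null1_at n (N + N') (\<lambda>i. m i \<oplus>\<^bsub>M\<^esub> m' i)"
    unfolding null1_at_def using u m by (intro bexI[of _ "u \<oplus>\<^bsub>M\<^esub> u'"]) (auto simp: smult_r_distr Pi_iff)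
  then show ?thesis by (auto simp: null1_iff)
qed

lemma null1_smult:
  assumes m: "m \<in> UNIV \<rightarrow> carrier M" and c: "c \<in> carrier R" and "null1 R M r x n m"
  shows "null1 R M r x n (\<lambda>i. c \<odot>\<^bsub>M\<^esub> m i)"
proof -
  obtain N u where u: "u \<in> carrier M" "\<And>i. i < r \<Longrightarrow> x i [^] N \<odot>\<^bsub>M\<^esub> m i = x i [^] (N + n) \<odot>\<^bsub>M\<^esub> u"
    using assms(3) by (auto simp: null1_iff null1_at_def)
  have "null1_at n N (\<lambda>i. c \<odot>\<^bsub>M\<^esub> m i)"
    unfolding null1_at_def using u m c
    by (intro bexI[of _ "c \<odot>\<^bsub>M\<^esub> u"]) (auto simp: smult_comm[of _ c] Pi_iff)
  then show ?thesis by (auto simp: null1_iff)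
qed

lemma null1_zero: "null1 R M r x n (\<lambda>_. \<zero>\<^bsub>M\<^esub>)"
  unfolding null1_def by (intro exI[of _ 0] bexI[of _ "\<zero>\<^bsub>M\<^esub>"]) auto

text \<open>The tuple on the left is the image of \<open>m\<close> at the later stage
  \<open>n + K\<close>; a class of the limit is zero exactly when this image is.\<close>

lemma null1_raise_iff:
  assumes m: "m \<in> UNIV \<rightarrow> carrier M"
  shows "null1 R M r x (n + K) (\<lambda>i. x i [^] K \<odot>\<^bsub>M\<^esub> m i) \<longleftrightarrow> null1 R M r x n m"
proof
  assume "null1 R M r x (n + K) (\<lambda>i. x i [^] K \<odot>\<^bsub>M\<^esub> m i)"
  then obtain N u where u: "u \<in> carrier M"
      "\<And>i. i < r \<Longrightarrow> x i [^] N \<odot>\<^bsub>M\<^esub> (x i [^] K \<odot>\<^bsub>M\<^esub> m i) = x i [^] (N + (n + K)) \<odot>\<^bsub>M\<^esub> u"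
    by (auto simp: null1_def)
  then have "null1_at n (N + K) m"
    unfolding null1_at_def using m by (intro bexI[of _ u]) (auto simp: pow_smult Pi_iff ac_simps)
  then show "null1 R M r x n m" by (auto simp: null1_iff)
next
  assume "null1 R M r x n m"
  then obtain N where "null1_at n N m" by (auto simp: null1_iff)
  from null1_at_mono[OF m this, of K] obtain u where u: "u \<in> carrier M"
      "\<And>i. i < r \<Longrightarrow> x i [^] (N + K) \<odot>\<^bsub>M\<^esub> m i = x i [^] (N + K + n) \<odot>\<^bsub>M\<^esub> u"
    by (auto simp: null1_at_def)
  then have "null1_at (n + K) N (\<lambda>i. x i [^] K \<odot>\<^bsub>M\<^esub> m i)"
    unfolding null1_at_def using m by (intro bexI[of _ u]) (auto simp: pow_smult Pi_iff ac_simps)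
  then show "null1 R M r x (n + K) (\<lambda>i. x i [^] K \<odot>\<^bsub>M\<^esub> m i)" by (auto simp: null1_iff)
qed

lemma rel_fun: "v \<in> rel n \<Longrightarrow> v \<in> UNIV \<rightarrow> carrier R"
  by (rule Pi_I) (auto simp: power_relations_def intro: free_closed)

lemma comb_shift:
  assumes "v \<in> UNIV \<rightarrow> carrier R" "m \<in> UNIV \<rightarrow> carrier M"
  shows "comb M r (shift R x K v) m = comb M r v (\<lambda>i. x i [^] K \<odot>\<^bsub>M\<^esub> m i)"
  unfolding shift_def by (rule comb_assoc) (use assms in auto)

lemma cocycle1_closed: "cocycle1 R M r x n m \<Longrightarrow> m \<in> UNIV \<rightarrow> carrier M"
  by (simp add: cocycle1_def)

lemma cocycle1_add: "cocycle1 R M r x n m \<Longrightarrow> cocycle1 R M r x n m' \<Longrightarrow> cocycle1 R M r x n (\<lambda>i. m i \<oplus>\<^bsub>M\<^esub> m' i)"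
  using comb_add_right[OF rel_fun, of _ n m m' r] by (auto simp: cocycle1_def)

lemma cocycle1_smult: "cocycle1 R M r x n m \<Longrightarrow> c \<in> carrier R \<Longrightarrow> cocycle1 R M r x n (\<lambda>i. c \<odot>\<^bsub>M\<^esub> m i)"
  using comb_smult_right[OF _ rel_fun, of c _ n m r] by (auto simp: cocycle1_def)

lemma cocycle1_zero: "cocycle1 R M r x n (\<lambda>_. \<zero>\<^bsub>M\<^esub>)"
  using comb_zero_right[OF rel_fun, of _ n r "\<lambda>_. \<zero>\<^bsub>M\<^esub>"] by (auto simp: cocycle1_def)

lemma cocycle1_raise: "cocycle1 R M r x n m \<Longrightarrow> cocycle1 R M r x (n + K) (\<lambda>i. x i [^] K \<odot>\<^bsub>M\<^esub> m i)"
  using comb_shift[OF rel_fun, of _ "n + K" m K] shift_rel[of _ n K] by (auto simp: cocycle1_def)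

text \<open>The Koszul relation between \<open>x i ^ n\<close> and \<open>x j ^ n\<close>, for fixed
  \<open>j\<close> as a family in \<open>i\<close>. The value zero for \<open>i\<close> beyond
  \<open>r\<close> makes every member a relation.\<close>

definition koszul :: "nat \<Rightarrow> nat \<Rightarrow> nat \<Rightarrow> nat \<Rightarrow> 'a" where
  "koszul n j i = (if i < r then (x j [^] n \<odot>\<^bsub>Fr\<^esub> basis_vec R i) \<ominus>\<^bsub>Fr\<^esub> (x i [^] n \<odot>\<^bsub>Fr\<^esub> basis_vec R j)
    else \<zero>\<^bsub>Fr\<^esub>)"

lemma koszul_rel: "j < r \<Longrightarrow> koszul n j i \<in> rel n"
proof (cases "i < r")
  case True
  assume j: "j < r"
  let ?D = "\<lambda>v. comb (regular_module R) r v (\<lambda>i. x i [^] n)"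
  have w: "(\<lambda>i. x i [^] n) \<in> UNIV \<rightarrow> carrier (regular_module R)" by auto
  note l = lin_comb[OF Rm.module_axioms w] and b = comb_basis[OF Rm.module_axioms w]
  let ?p = "x j [^] n \<odot>\<^bsub>Fr\<^esub> basis_vec R i" and ?q = "x i [^] n \<odot>\<^bsub>Fr\<^esub> basis_vec R j"
  have c: "?p \<in> carrier Fr" "?q \<in> carrier Fr" using True j by auto
  have "?D (?p \<ominus>\<^bsub>Fr\<^esub> ?q) = ?D ?p \<ominus>\<^bsub>regular_module R\<^esub> ?D ?q"
    by (rule lin_diff[OF Fr.module_axioms Rm.module_axioms l c])
  also have "?D ?p = x j [^] n \<otimes> x i [^] n"
    using lin_smult[OF l, of "x j [^] n" "basis_vec R i"] b[OF True] True by simp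
  also have "?D ?q = x j [^] n \<otimes> x i [^] n"
    using lin_smult[OF l, of "x i [^] n" "basis_vec R j"] b[OF j] j by (simp add: m_comm)
  also have "(x j [^] n \<otimes> x i [^] n) \<ominus>\<^bsub>regular_module R\<^esub> (x j [^] n \<otimes> x i [^] n) = \<zero>"
    using Rm.M.minus_eq_zero_iff[of "x j [^] n \<otimes> x i [^] n" "x j [^] n \<otimes> x i [^] n"] by simp
  finally show ?thesis using c True by (simp add: koszul_def power_relations_def)
next
  case False
  then show ?thesis using Fr.submodule_zero[OF rel_submodule] by (simp add: koszul_def)
qed

text \<open>The combination equals \<open>x j ^ n\<close> times \<open>v\<close> minus the value of
  the relation at the powers times the j-th basis vector, and that value is zero.\<close>

lemma comb_koszul: "v \<in> rel n \<Longrightarrow> j < r \<Longrightarrow> comb Fr r v (koszul n j) = x j [^] n \<odot>\<^bsub>Fr\<^esub> v"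
proof -
  assume v: "v \<in> rel n" and j: "j < r"
  have vc: "v \<in> carrier Fr" and v0: "comb (regular_module R) r v (\<lambda>i. x i [^] n) = \<zero>"
    using v by (auto simp: power_relations_def)
  let ?D = "\<lambda>v. comb (regular_module R) r v (\<lambda>i. x i [^] n)"
  have w: "(\<lambda>i. x i [^] n) \<in> UNIV \<rightarrow> carrier (regular_module R)" by auto
  note l = lin_comb[OF Rm.module_axioms w] and b = comb_basis[OF Rm.module_axioms w]
  have id: "lin R Fr Fr (\<lambda>v. v)" by (rule linI) auto
  have e: "lin R (regular_module R) Fr (\<lambda>a. a \<odot>\<^bsub>Fr\<^esub> basis_vec R j)"
    using j by (intro linI) (auto simp: Fr.smult_l_distr Fr.smult_assoc1)
  have "lin R Fr Fr (\<lambda>v. x j [^] n \<odot>\<^bsub>Fr\<^esub> v \<ominus>\<^bsub>Fr\<^esub> ?D v \<odot>\<^bsub>Fr\<^esub> basis_vec R j)"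
    by (intro lin_sub lin_scale id Fr.module_axioms lin_comp[OF e l]) auto
  moreover have "koszul n j \<in> UNIV \<rightarrow> carrier Fr"
    using koszul_rel[OF j] Fr.submoduleE(1)[OF rel_submodule] by auto
  moreover have "x j [^] n \<odot>\<^bsub>Fr\<^esub> basis_vec R i \<ominus>\<^bsub>Fr\<^esub> ?D (basis_vec R i) \<odot>\<^bsub>Fr\<^esub> basis_vec R j = koszul n j i"
    if "i < r" for i using b[OF that] that by (simp add: koszul_def)
  ultimately have "x j [^] n \<odot>\<^bsub>Fr\<^esub> v \<ominus>\<^bsub>Fr\<^esub> ?D v \<odot>\<^bsub>Fr\<^esub> basis_vec R j = comb Fr r v (koszul n j)"
    by (intro lin_eq_comb[OF Fr.module_axioms _ _ _ vc]) auto
  moreover have "x j [^] n \<odot>\<^bsub>Fr\<^esub> v \<ominus>\<^bsub>Fr\<^esub> \<zero> \<odot>\<^bsub>Fr\<^esub> basis_vec R j = x j [^] n \<odot>\<^bsub>Fr\<^esub> v"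
    using vc j by (simp add: a_minus_def)
  ultimately show ?thesis using v0 by simp
qed

lemma cocycle1_koszul:
  assumes m: "cocycle1 R M r x n m" and "i < r" "j < r"
  shows "x j [^] n \<odot>\<^bsub>M\<^esub> m i = x i [^] n \<odot>\<^bsub>M\<^esub> m j"
proof -
  note mc = cocycle1_closed[OF m]
  note l = lin_comb[OF module_axioms mc] and b = comb_basis[OF module_axioms mc]
  let ?p = "x j [^] n \<odot>\<^bsub>Fr\<^esub> basis_vec R i" and ?q = "x i [^] n \<odot>\<^bsub>Fr\<^esub> basis_vec R j"
  have "comb M r (?p \<ominus>\<^bsub>Fr\<^esub> ?q) m = comb M r ?p m \<ominus>\<^bsub>M\<^esub> comb M r ?q m"
    by (rule lin_diff[OF Fr.module_axioms module_axioms l]) (use assms in auto)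
  also have "comb M r ?p m = x j [^] n \<odot>\<^bsub>M\<^esub> m i"
    using lin_smult[OF l, of "x j [^] n" "basis_vec R i"] b assms by simp
  also have "comb M r ?q m = x i [^] n \<odot>\<^bsub>M\<^esub> m j"
    using lin_smult[OF l, of "x i [^] n" "basis_vec R j"] b assms by simp
  also have "comb M r (?p \<ominus>\<^bsub>Fr\<^esub> ?q) m = \<zero>\<^bsub>M\<^esub>"
    using m koszul_rel[OF assms(3), of n i] assms by (simp add: koszul_def cocycle1_def)
  finally show ?thesis using mc by (metis Pi_mem UNIV_I M.minus_eq_zero_iff smult_closed nat_pow_closed x_closed)
qed

text \<open>The Koszul relations turn multiplication by \<open>x j ^ n\<close> into the map given by
  the single element \<open>m j\<close>. So every class in degree 1 is killed by a power of each
  \<open>x j\<close>.\<close>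

lemma null1_koszul:
  assumes m: "cocycle1 R M r x n m" and j: "j < r"
  shows "null1 R M r x n (\<lambda>i. x j [^] n \<odot>\<^bsub>M\<^esub> m i)"
  unfolding null1_def using cocycle1_koszul[OF m _ j] cocycle1_closed[OF m]
  by (intro exI[of _ 0] bexI[of _ "m j"]) (auto simp: Pi_iff)

definition annihilator1 where
  "annihilator1 n m = {s \<in> carrier R. null1 R M r x n (\<lambda>i. s \<odot>\<^bsub>M\<^esub> m i)}"

lemma annihilator1_ideal:
  assumes m: "m \<in> UNIV \<rightarrow> carrier M"
  shows "ideal (annihilator1 n m) R"
  unfolding annihilator1_def
proof (rule pred_ideal)
  have mi: "m i \<in> carrier M" for i using m by auto
  show "null1 R M r x n (\<lambda>i. \<zero> \<odot>\<^bsub>M\<^esub> m i)" using null1_zero mi by simp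
  fix s t assume s: "s \<in> carrier R" "null1 R M r x n (\<lambda>i. s \<odot>\<^bsub>M\<^esub> m i)" and t: "t \<in> carrier R"
  show "null1 R M r x n (\<lambda>i. (s \<oplus> t) \<odot>\<^bsub>M\<^esub> m i)" if "null1 R M r x n (\<lambda>i. t \<odot>\<^bsub>M\<^esub> m i)"
    using null1_add[OF _ _ s(2) that] mi s(1) t by (simp add: smult_l_distr Pi_iff)
next
  have mi: "m i \<in> carrier M" for i using m by auto
  fix c s assume "c \<in> carrier R" "s \<in> carrier R" "null1 R M r x n (\<lambda>i. s \<odot>\<^bsub>M\<^esub> m i)"
  then show "null1 R M r x n (\<lambda>i. (c \<otimes> s) \<odot>\<^bsub>M\<^esub> m i)"
    using null1_smult[of "\<lambda>i. s \<odot>\<^bsub>M\<^esub> m i" c n] mi by (simp add: smult_assoc1 Pi_iff)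
qed

lemma annihilator1_colon:
  assumes m: "m \<in> UNIV \<rightarrow> carrier M" and c: "c \<in> carrier R"
  shows "{s \<in> carrier R. s \<otimes> c \<in> annihilator1 n m} = annihilator1 n (\<lambda>i. c \<odot>\<^bsub>M\<^esub> m i)"
proof -
  have mi: "m i \<in> carrier M" for i using m by auto
  then show ?thesis using c by (auto simp: annihilator1_def smult_assoc1)
qed

text \<open>On the classes killed by all \<open>x i\<close>, a class is determined up to annihilator by the tuple \<open>u\<close>
  with \<open>x i ^ (N + 1) m i = x i ^ (N + n) u i\<close>, which lives in a Noetherian module.\<close>

lemma socle1_detected:
  assumes R: "noetherian_ring R" and M: "noetherian_module R M"
  shows "prime_detected R {Q \<in> {annihilator1 n m | n m. cocycle1 R M r x n m}. x ` {..<r} \<subseteq> Q}"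
proof -
  let ?T = "tuples M r"
  interpret T: module R ?T by (rule tuples_module)
  \<comment> \<open>In the localization of \<open>M\<close> at the powers of \<open>x i\<close>, a
    cocycle is the fraction \<open>m i / x i ^ n\<close>, and it is null when all these fractions
    come from one element of \<open>M\<close>. \<open>Y\<close> expresses the same for the fractions
    \<open>y i / x i\<close>.\<close>
  define Y where "Y = {y \<in> carrier ?T. \<exists>K. \<exists>u\<in>carrier M. \<forall>i<r. x i [^] Suc K \<odot>\<^bsub>M\<^esub> u = x i [^] K \<odot>\<^bsub>M\<^esub> y i}"
  note raise = pow_smult_raise[OF x_closed, where k = "Suc K" and l = K and L = L for K L, unfolded add_Suc]
  have Y: "submodule Y R ?T"
  proof (rule T.submoduleI')
    show "\<zero>\<^bsub>?T\<^esub> \<in> Y" by (auto simp: Y_def intro!: bexI[of _ "\<zero>\<^bsub>M\<^esub>"])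
    fix y assume "y \<in> Y"
    then obtain K u where y: "y \<in> carrier ?T" "u \<in> carrier M"
        "\<And>i. i < r \<Longrightarrow> x i [^] Suc K \<odot>\<^bsub>M\<^esub> u = x i [^] K \<odot>\<^bsub>M\<^esub> y i" by (auto simp: Y_def)
    show "c \<odot>\<^bsub>?T\<^esub> y \<in> Y" if c: "c \<in> carrier R" for c
      unfolding Y_def using T.smult_closed[OF c y(1)] y c
      by (intro CollectI conjI exI[of _ K] bexI[of _ "c \<odot>\<^bsub>M\<^esub> u"]) (auto simp: smult_comm[of _ c] simp del: R.nat_pow_Suc)
    fix y' assume "y' \<in> Y"
    then obtain K' u' where y': "y' \<in> carrier ?T" "u' \<in> carrier M"
        "\<And>i. i < r \<Longrightarrow> x i [^] Suc K' \<odot>\<^bsub>M\<^esub> u' = x i [^] K' \<odot>\<^bsub>M\<^esub> y' i" by (auto simp: Y_def)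
    have yc: "y i \<in> carrier M" "y' i \<in> carrier M" for i using y(1) y'(1) by auto
    have "x i [^] Suc (K + K') \<odot>\<^bsub>M\<^esub> u = x i [^] (K + K') \<odot>\<^bsub>M\<^esub> y i"
      "x i [^] Suc (K + K') \<odot>\<^bsub>M\<^esub> u' = x i [^] (K + K') \<odot>\<^bsub>M\<^esub> y' i" if "i < r" for i
      using raise[OF y(2) yc(1) y(3)[OF that], of K'] raise[OF y'(2) yc(2) y'(3)[OF that], of K]
      by (simp_all add: add.commute[of K'])
    then show "y \<oplus>\<^bsub>?T\<^esub> y' \<in> Y"
      unfolding Y_def using T.M.a_closed[OF y(1) y'(1)] y(2) y'(2) yc
      by (intro CollectI conjI exI[of _ "K + K'"] bexI[of _ "u \<oplus>\<^bsub>M\<^esub> u'"]) (auto simp: smult_r_distr simp del: R.nat_pow_Suc)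
  qed (auto simp: Y_def)
  show ?thesis
  proof (rule prime_detected_mono[OF noetherian_prime_detected[OF R.is_cring R noetherian_tuples[OF M] Y]])
    fix Q assume "Q \<in> {Q \<in> {annihilator1 n m | n m. cocycle1 R M r x n m}. x ` {..<r} \<subseteq> Q}"
    then obtain n m where m: "cocycle1 R M r x n m" and Q: "Q = annihilator1 n m" and xQ: "x ` {..<r} \<subseteq> Q" by auto
    note mF = cocycle1_closed[OF m]
    have mc: "m i \<in> carrier M" for i using mF by auto
    have "\<exists>N. null1_at n N (\<lambda>i. x j \<odot>\<^bsub>M\<^esub> m i)" if "j < r" for j
      using xQ that by (auto simp: Q annihilator1_def null1_iff)
    then have "\<exists>N. \<forall>j<r. null1_at n N (\<lambda>i. x j \<odot>\<^bsub>M\<^esub> m i)"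
      by (rule uniform_bound) (use null1_at_mono mc in auto)
    then obtain N where N: "\<And>j. j < r \<Longrightarrow> null1_at n N (\<lambda>i. x j \<odot>\<^bsub>M\<^esub> m i)" by blast
    \<comment> \<open>Of the equations stating that \<open>x j\<close> kills the class only the one
      with index \<open>j\<close> is kept. It says that \<open>m j / x j ^ n\<close> equals
      \<open>u j / x j\<close>: the denominators no longer depend on the class.\<close>
    have "\<exists>u\<in>carrier M. x j [^] N \<odot>\<^bsub>M\<^esub> (x j \<odot>\<^bsub>M\<^esub> m j) = x j [^] (N + n) \<odot>\<^bsub>M\<^esub> u" if "j < r" for j
      using N[OF that] that by (auto simp: null1_at_def)
    then obtain u where u: "\<And>j. j < r \<Longrightarrow> u j \<in> carrier M"
        "\<And>j. j < r \<Longrightarrow> x j [^] Suc N \<odot>\<^bsub>M\<^esub> m j = x j [^] (N + n) \<odot>\<^bsub>M\<^esub> u j"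
      using mc by (simp flip: smult_assoc1) metis
    define w where "w i = (if i < r then u i else \<zero>\<^bsub>M\<^esub>)" for i
    have w: "w \<in> carrier ?T" using u(1) by (auto simp: w_def)
    have "Q \<subseteq> colon R ?T Y w"
    proof
      fix s assume "s \<in> Q"
      then obtain L v where s: "s \<in> carrier R" and v: "v \<in> carrier M"
          "\<And>i. i < r \<Longrightarrow> x i [^] L \<odot>\<^bsub>M\<^esub> (s \<odot>\<^bsub>M\<^esub> m i) = x i [^] (L + n) \<odot>\<^bsub>M\<^esub> v"
        by (auto simp: Q annihilator1_def null1_def)
      have "x i [^] Suc (L + N + n) \<odot>\<^bsub>M\<^esub> v = x i [^] (L + N + n) \<odot>\<^bsub>M\<^esub> (s \<odot>\<^bsub>M\<^esub> u i)" if i: "i < r" for i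
      proof -
        have "x i [^] Suc (L + N + n) \<odot>\<^bsub>M\<^esub> v = x i [^] Suc N \<odot>\<^bsub>M\<^esub> (x i [^] (L + n) \<odot>\<^bsub>M\<^esub> v)"
          unfolding pow_smult[OF x_closed v(1)] by (rule arg_cong[where f = "\<lambda>k. x i [^] k \<odot>\<^bsub>M\<^esub> v"]) simp
        also have "\<dots> = x i [^] Suc N \<odot>\<^bsub>M\<^esub> (x i [^] L \<odot>\<^bsub>M\<^esub> (s \<odot>\<^bsub>M\<^esub> m i))" by (simp only: v(2)[OF i])
        also have "\<dots> = x i [^] L \<odot>\<^bsub>M\<^esub> (s \<odot>\<^bsub>M\<^esub> (x i [^] Suc N \<odot>\<^bsub>M\<^esub> m i))"
          using mc s by (simp add: smult_comm del: R.nat_pow_Suc)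
        also have "\<dots> = x i [^] L \<odot>\<^bsub>M\<^esub> (s \<odot>\<^bsub>M\<^esub> (x i [^] (N + n) \<odot>\<^bsub>M\<^esub> u i))" by (simp only: u(2)[OF i])
        also have "\<dots> = x i [^] L \<odot>\<^bsub>M\<^esub> (x i [^] (N + n) \<odot>\<^bsub>M\<^esub> (s \<odot>\<^bsub>M\<^esub> u i))"
          using u(1)[OF i] s by (simp add: smult_comm[of s])
        also have "\<dots> = x i [^] (L + N + n) \<odot>\<^bsub>M\<^esub> (s \<odot>\<^bsub>M\<^esub> u i)"
          using u(1)[OF i] s by (simp add: pow_smult add.assoc)
        finally show ?thesis .
      qed
      then have "s \<odot>\<^bsub>?T\<^esub> w \<in> Y"
        unfolding Y_def using T.smult_closed[OF s w] v(1)
        by (intro CollectI conjI exI[of _ "L + N + n"] bexI[of _ v]) (auto simp: w_def)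
      then show "s \<in> colon R ?T Y w" using s by (simp add: colon_def)
    qed
    moreover have "\<one> \<in> Q" if "\<one> \<in> colon R ?T Y w"
    proof -
      have "w \<in> Y" using that T.smult_one[OF w] by (simp add: colon_def)
      then obtain K v where v: "v \<in> carrier M"
          "\<And>i. i < r \<Longrightarrow> x i [^] Suc K \<odot>\<^bsub>M\<^esub> v = x i [^] K \<odot>\<^bsub>M\<^esub> u i" by (auto simp: Y_def w_def)
      have "x i [^] (K + Suc N) \<odot>\<^bsub>M\<^esub> m i = x i [^] (K + Suc N + n) \<odot>\<^bsub>M\<^esub> v" if i: "i < r" for i
      proof -
        have "x i [^] (K + Suc N) \<odot>\<^bsub>M\<^esub> m i = x i [^] K \<odot>\<^bsub>M\<^esub> (x i [^] Suc N \<odot>\<^bsub>M\<^esub> m i)"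
          by (rule pow_smult[OF x_closed mc, symmetric])
        also have "\<dots> = x i [^] (N + n) \<odot>\<^bsub>M\<^esub> (x i [^] K \<odot>\<^bsub>M\<^esub> u i)"
          unfolding u(2)[OF i] using u(1)[OF i] by (simp add: smult_comm)
        also have "\<dots> = x i [^] (N + n) \<odot>\<^bsub>M\<^esub> (x i [^] Suc K \<odot>\<^bsub>M\<^esub> v)" by (simp only: v(2)[OF i])
        also have "\<dots> = x i [^] (K + Suc N + n) \<odot>\<^bsub>M\<^esub> v"
          unfolding pow_smult[OF x_closed v(1)] by (rule arg_cong[where f = "\<lambda>k. x i [^] k \<odot>\<^bsub>M\<^esub> v"]) simp
        finally show ?thesis .
      qed
      then have "null1 R M r x n m" unfolding null1_def using v(1) by blast
      then show ?thesis using mc by (simp add: Q annihilator1_def)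
    qed
    ultimately show "\<exists>Q'\<in>colon R ?T Y ` carrier ?T. Q \<subseteq> Q' \<and> (\<one> \<in> Q' \<longrightarrow> \<one> \<in> Q)" using w by blast
  qed
qed

lemma annihilates1_global:
  assumes R: "noetherian_ring R" and M: "noetherian_module R M" and y: "y \<in> carrier R"
    and loc: "\<And>P. primeideal P R \<Longrightarrow> \<exists>k::nat. locally_annihilates R M r x 1 (carrier R - P) (y [^] k)"
  shows "\<exists>k::nat. annihilates R M r x 1 (y [^] k)"
proof -
  let ?C = "{annihilator1 n m | n m. cocycle1 R M r x n m}"
  have "\<exists>k::nat. \<forall>Q\<in>?C. y [^] k \<in> Q"
  proof (rule prime_detected_power[OF R.is_cring y, where A = "x ` {..<r}"])
    show "ideal Q R" if "Q \<in> ?C" for Q using that annihilator1_ideal cocycle1_closed by auto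
    show "{s \<in> carrier R. s \<otimes> c \<in> Q} \<in> ?C" if "Q \<in> ?C" "c \<in> carrier R" for Q c
      using that annihilator1_colon[OF cocycle1_closed] cocycle1_smult by blast
    show "\<exists>n::nat. a [^] n \<in> Q" if "Q \<in> ?C" "a \<in> x ` {..<r}" for Q a
      using that null1_koszul by (auto simp: annihilator1_def)
    show "prime_detected R {Q \<in> ?C. x ` {..<r} \<subseteq> Q}" by (rule socle1_detected[OF R M])
    fix P assume "primeideal P R"
    from loc[OF this] obtain k :: nat where k: "locally_annihilates R M r x 1 (carrier R - P) (y [^] k)" by blast
    have "\<exists>s\<in>carrier R - P. s \<otimes> y [^] k \<in> annihilator1 n m" if m: "cocycle1 R M r x n m" for n m
    proof -
      have mc: "m i \<in> carrier M" for i using cocycle1_closed[OF m] by auto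
      obtain s where s: "s \<in> carrier R - P" "null1 R M r x n (\<lambda>i. s \<odot>\<^bsub>M\<^esub> (y [^] k \<odot>\<^bsub>M\<^esub> m i))"
        using k m by (auto simp: locally_annihilates_def)
      then show ?thesis using y mc by (intro bexI[of _ s]) (auto simp: annihilator1_def smult_assoc1)
    qed
    then show "\<exists>k::nat. \<forall>Q\<in>?C. \<exists>s\<in>carrier R - P. s \<otimes> y [^] k \<in> Q" by blast
  qed auto
  then obtain k :: nat where "\<forall>Q\<in>?C. y [^] k \<in> Q" by blast
  then show ?thesis by (intro exI[of _ k]) (auto simp: annihilates_def annihilator1_def)
qed

section \<open>Degree zero\<close>

lemma annihilates0_global:
  assumes R: "noetherian_ring R" and M: "noetherian_module R M" and y: "y \<in> carrier R"
    and loc: "\<And>P. primeideal P R \<Longrightarrow> \<exists>k::nat. locally_annihilates R M r x 0 (carrier R - P) (y [^] k)"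
  shows "\<exists>k::nat. annihilates R M r x 0 (y [^] k)"
proof -
  let ?G = "{m \<in> carrier M. \<exists>n::nat. \<forall>i<r. x i [^] n \<odot>\<^bsub>M\<^esub> m = \<zero>\<^bsub>M\<^esub>}"
  let ?C = "colon R M {\<zero>\<^bsub>M\<^esub>} ` ?G"
  have "\<exists>k::nat. \<forall>Q\<in>?C. y [^] k \<in> Q"
  \<comment> \<open>Classes in degree 0 are elements of the Noetherian module \<open>M\<close>, so
    all their annihilators are detected and no restriction to a socle is called for.\<close>
  proof (rule prime_detected_power[OF R.is_cring y, where A = "{}"])
    show "ideal Q R" if "Q \<in> ?C" for Q using that colon_ideal[OF submodule_trivial] by auto
    show "{s \<in> carrier R. s \<otimes> c \<in> Q} \<in> ?C" if Q: "Q \<in> ?C" and c: "c \<in> carrier R" for Q c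
    proof -
      obtain m where m: "m \<in> ?G" "Q = colon R M {\<zero>\<^bsub>M\<^esub>} m" using Q by blast
      have "x i [^] (n::nat) \<odot>\<^bsub>M\<^esub> (c \<odot>\<^bsub>M\<^esub> m) = \<zero>\<^bsub>M\<^esub>" if "x i [^] n \<odot>\<^bsub>M\<^esub> m = \<zero>\<^bsub>M\<^esub>" for i n
        using smult_comm[of "x i [^] n" c m] that c m by simp
      then have "c \<odot>\<^bsub>M\<^esub> m \<in> ?G" using m c by auto
      moreover have "{s \<in> carrier R. s \<otimes> c \<in> Q} = colon R M {\<zero>\<^bsub>M\<^esub>} (c \<odot>\<^bsub>M\<^esub> m)"
        using m c by (auto simp: colon_def smult_assoc1)
      ultimately show ?thesis by blast
    qed
    show "prime_detected R {Q \<in> ?C. {} \<subseteq> Q}"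
      by (rule prime_detected_mono[OF noetherian_prime_detected[OF R.is_cring R M submodule_trivial]]) auto
    fix P assume "primeideal P R"
    from loc[OF this] obtain k :: nat where k: "locally_annihilates R M r x 0 (carrier R - P) (y [^] k)" by blast
    have "\<exists>s\<in>carrier R - P. s \<otimes> y [^] k \<in> colon R M {\<zero>\<^bsub>M\<^esub>} m" if m: "m \<in> ?G" for m
    proof -
      have "\<exists>s\<in>carrier R - P. s \<odot>\<^bsub>M\<^esub> (y [^] k \<odot>\<^bsub>M\<^esub> m) = \<zero>\<^bsub>M\<^esub>"
        using k[unfolded locally_annihilates_def if_P[OF refl]] m by blast
      then obtain s where s: "s \<in> carrier R - P" "s \<odot>\<^bsub>M\<^esub> (y [^] k \<odot>\<^bsub>M\<^esub> m) = \<zero>\<^bsub>M\<^esub>" by blast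
      then show ?thesis using y m by (intro bexI[of _ s]) (auto simp: colon_def smult_assoc1)
    qed
    then show "\<exists>k::nat. \<forall>Q\<in>?C. \<exists>s\<in>carrier R - P. s \<otimes> y [^] k \<in> Q" by blast
  qed auto
  then obtain k :: nat where "\<forall>Q\<in>?C. y [^] k \<in> Q" by blast
  then show ?thesis by (intro exI[of _ k]) (auto simp: annihilates_def colon_def)
qed

section \<open>A bound on the torsion in degree one\<close>

lemma smult_pow_cancel:
  assumes reg: "\<And>m. m \<in> carrier M \<Longrightarrow> y \<odot>\<^bsub>M\<^esub> m = \<zero>\<^bsub>M\<^esub> \<Longrightarrow> m = \<zero>\<^bsub>M\<^esub>" and y: "y \<in> carrier R"
    and "a \<in> carrier M" "b \<in> carrier M" "y [^] (t::nat) \<odot>\<^bsub>M\<^esub> a = y [^] t \<odot>\<^bsub>M\<^esub> b"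
  shows "a = b"
proof -
  have z: "m = \<zero>\<^bsub>M\<^esub>" if "m \<in> carrier M" "y [^] (k::nat) \<odot>\<^bsub>M\<^esub> m = \<zero>\<^bsub>M\<^esub>" for k m
    using that(2)
  proof (induction k)
    case (Suc k)
    have "y \<odot>\<^bsub>M\<^esub> (y [^] k \<odot>\<^bsub>M\<^esub> m) = \<zero>\<^bsub>M\<^esub>"
      using Suc.prems y that(1) by (simp add: m_comm flip: smult_assoc1)
    then have "y [^] k \<odot>\<^bsub>M\<^esub> m = \<zero>\<^bsub>M\<^esub>" by (rule reg[rotated]) (use y that(1) in simp)
    then show ?case by (rule Suc.IH)
  qed (use that(1) in simp)
  have "y [^] t \<odot>\<^bsub>M\<^esub> (a \<ominus>\<^bsub>M\<^esub> b) = \<zero>\<^bsub>M\<^esub>"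
    using assms(2-5) by (simp add: a_minus_def smult_r_distr smult_r_minus M.r_neg)
  then have "a \<ominus>\<^bsub>M\<^esub> b = \<zero>\<^bsub>M\<^esub>" using z[of "a \<ominus>\<^bsub>M\<^esub> b" t] assms(3,4) by simp
  then show ?thesis using M.minus_eq_zero_iff assms(3,4) by blast
qed

text \<open>The connecting homomorphism of multiplication by \<open>y ^ t\<close> embeds the first cohomology into a
  quotient of \<open>M\<close>, so that the chain of the submodules \<open>U e\<close> measures which powers of the \<open>x j\<close> kill it.\<close>

lemma annihilates1_imp_torsion_bounded:
  assumes M: "noetherian_module R M" and y: "y \<in> carrier R"
    and reg: "\<And>m. m \<in> carrier M \<Longrightarrow> y \<odot>\<^bsub>M\<^esub> m = \<zero>\<^bsub>M\<^esub> \<Longrightarrow> m = \<zero>\<^bsub>M\<^esub>"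
    and ann: "annihilates R M r x 1 (y [^] (t::nat))"
  shows "\<exists>e::nat. \<forall>j<r. \<forall>n m. cocycle1 R M r x n m \<longrightarrow> null1 R M r x n (\<lambda>i. x j [^] e \<odot>\<^bsub>M\<^esub> m i)"
proof -
  \<comment> \<open>The condition says that in the localization at \<open>x i\<close> the fraction
    \<open>m i / x i ^ n\<close> times \<open>y ^ t\<close> is \<open>u\<close>, so the class of
    \<open>m\<close> is the image of \<open>u\<close> under the connecting map. \<open>U e\<close>
    collects the \<open>u\<close> for which this class is killed by all
    \<open>x j ^ e\<close>.\<close>
  define U where "U e = {u \<in> carrier M. \<exists>n m. cocycle1 R M r x n m \<and>
    (\<forall>j<r. null1 R M r x n (\<lambda>i. x j [^] (e::nat) \<odot>\<^bsub>M\<^esub> m i)) \<and> (\<forall>i<r. y [^] t \<odot>\<^bsub>M\<^esub> m i = x i [^] (n::nat) \<odot>\<^bsub>M\<^esub> u)}" for e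
  have raise: "cocycle1 R M r x (n + K) m' \<and> (\<forall>j<r. null1 R M r x (n + K) (\<lambda>i. x j [^] e \<odot>\<^bsub>M\<^esub> m' i)) \<and>
      (\<forall>i<r. y [^] t \<odot>\<^bsub>M\<^esub> m' i = x i [^] (n + K) \<odot>\<^bsub>M\<^esub> u)"
    if "u \<in> carrier M" "cocycle1 R M r x n m" and h: "\<forall>j<r. null1 R M r x n (\<lambda>i. x j [^] (e::nat) \<odot>\<^bsub>M\<^esub> m i)"
      and e: "\<forall>i<r. y [^] t \<odot>\<^bsub>M\<^esub> m i = x i [^] (n::nat) \<odot>\<^bsub>M\<^esub> u" and m': "m' = (\<lambda>i. x i [^] K \<odot>\<^bsub>M\<^esub> m i)"
    for e u n m K m'
  proof (intro conjI allI impI)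
    have mc: "m i \<in> carrier M" for i using cocycle1_closed[OF that(2)] by auto
    show "cocycle1 R M r x (n + K) m'" unfolding m' by (rule cocycle1_raise[OF that(2)])
    show "null1 R M r x (n + K) (\<lambda>i. x j [^] e \<odot>\<^bsub>M\<^esub> m' i)" if "j < r" for j
      unfolding m' using null1_raise_iff[of "\<lambda>i. x j [^] e \<odot>\<^bsub>M\<^esub> m i" n K] mc \<open>j < r\<close> h
      by (simp add: smult_comm[of "x j [^] e"] Pi_iff)
    show "y [^] t \<odot>\<^bsub>M\<^esub> m' i = x i [^] (n + K) \<odot>\<^bsub>M\<^esub> u" if "i < r" for i
      unfolding m' using smult_comm[of "y [^] t" "x i [^] K" "m i"] e[rule_format, OF that] mc y \<open>u \<in> carrier M\<close>
      by (simp add: pow_smult add.commute)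
  qed
  have U: "submodule (U e) R M" for e
  proof (rule submoduleI')
    show "\<zero>\<^bsub>M\<^esub> \<in> U e"
      unfolding U_def using cocycle1_zero[of 0] null1_zero y
      by (intro CollectI conjI exI[of _ "0::nat"] exI[of _ "\<lambda>_. \<zero>\<^bsub>M\<^esub>"]) auto
    fix u assume "u \<in> U e"
    then obtain n m where u: "u \<in> carrier M" and m: "cocycle1 R M r x n m"
        "\<forall>j<r. null1 R M r x n (\<lambda>i. x j [^] e \<odot>\<^bsub>M\<^esub> m i)"
        "\<forall>i<r. y [^] t \<odot>\<^bsub>M\<^esub> m i = x i [^] n \<odot>\<^bsub>M\<^esub> u" by (auto simp: U_def)
    have mc: "m i \<in> carrier M" for i using cocycle1_closed[OF m(1)] by auto
    show "c \<odot>\<^bsub>M\<^esub> u \<in> U e" if c: "c \<in> carrier R" for c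
    proof -
      have "null1 R M r x n (\<lambda>i. x j [^] e \<odot>\<^bsub>M\<^esub> (c \<odot>\<^bsub>M\<^esub> m i))" if "j < r" for j
        using null1_smult[of "\<lambda>i. x j [^] e \<odot>\<^bsub>M\<^esub> m i" c n] m(2) mc c that by (simp add: smult_comm[of _ c] Pi_iff)
      moreover have "y [^] t \<odot>\<^bsub>M\<^esub> (c \<odot>\<^bsub>M\<^esub> m i) = x i [^] n \<odot>\<^bsub>M\<^esub> (c \<odot>\<^bsub>M\<^esub> u)" if "i < r" for i
        using m(3)[rule_format, OF that] mc c u y by (simp add: smult_comm[of _ c])
      ultimately show ?thesis unfolding U_def using cocycle1_smult[OF m(1) c] u c by auto
    qed
    fix u' assume "u' \<in> U e"
    then obtain n' m' where u': "u' \<in> carrier M" and m': "cocycle1 R M r x n' m'"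
        "\<forall>j<r. null1 R M r x n' (\<lambda>i. x j [^] e \<odot>\<^bsub>M\<^esub> m' i)"
        "\<forall>i<r. y [^] t \<odot>\<^bsub>M\<^esub> m' i = x i [^] n' \<odot>\<^bsub>M\<^esub> u'" by (auto simp: U_def)
    have mc': "m' i \<in> carrier M" for i using cocycle1_closed[OF m'(1)] by auto
    let ?k = "\<lambda>i. x i [^] n' \<odot>\<^bsub>M\<^esub> m i" and ?k' = "\<lambda>i. x i [^] n \<odot>\<^bsub>M\<^esub> m' i"
    note k = raise[OF u m refl, of n'] and k' = raise[OF u' m' refl, of n, unfolded add.commute[of n' n]]
    let ?s = "\<lambda>i. ?k i \<oplus>\<^bsub>M\<^esub> ?k' i"
    have "cocycle1 R M r x (n + n') ?s" using cocycle1_add k k' by blast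
    moreover have "null1 R M r x (n + n') (\<lambda>i. x j [^] e \<odot>\<^bsub>M\<^esub> ?s i)" if "j < r" for j
      using null1_add[OF _ _ k[THEN conjunct2, THEN conjunct1, rule_format, OF that]
          k'[THEN conjunct2, THEN conjunct1, rule_format, OF that]] mc mc' by (simp add: smult_r_distr Pi_iff)
    moreover have "y [^] t \<odot>\<^bsub>M\<^esub> ?s i = x i [^] (n + n') \<odot>\<^bsub>M\<^esub> (u \<oplus>\<^bsub>M\<^esub> u')" if "i < r" for i
      using k k' that mc mc' u u' y by (simp add: smult_r_distr)
    moreover have "u \<oplus>\<^bsub>M\<^esub> u' \<in> carrier M" using u u' by simp
    ultimately show "u \<oplus>\<^bsub>M\<^esub> u' \<in> U e" unfolding U_def by (intro CollectI conjI exI[of _ "n + n'"] exI[of _ ?s]) auto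
  qed (auto simp: U_def)
  have U_Suc: "U e \<subseteq> U (Suc e)" for e
  proof
    fix u assume "u \<in> U e"
    then obtain n m where u: "u \<in> carrier M" and m: "cocycle1 R M r x n m"
        "\<forall>j<r. null1 R M r x n (\<lambda>i. x j [^] e \<odot>\<^bsub>M\<^esub> m i)"
        "\<forall>i<r. y [^] t \<odot>\<^bsub>M\<^esub> m i = x i [^] n \<odot>\<^bsub>M\<^esub> u" by (auto simp: U_def)
    have mc: "m i \<in> carrier M" for i using cocycle1_closed[OF m(1)] by auto
    have "null1 R M r x n (\<lambda>i. x j [^] Suc e \<odot>\<^bsub>M\<^esub> m i)" if "j < r" for j
      using null1_smult[OF _ x_closed, of "\<lambda>i. x j [^] e \<odot>\<^bsub>M\<^esub> m i" n j] m(2) that mc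
      by (simp add: Pi_iff m_comm flip: smult_assoc1)
    then show "u \<in> U (Suc e)" unfolding U_def using u m by blast
  qed
  obtain e where e: "\<forall>k\<ge>e. U k = U e" using noetherian_moduleD[where C = U, OF M U U_Suc] ..
  have Ue: "U k \<subseteq> U e" for k
  proof (cases "k \<ge> e")
    case True
    show ?thesis by (rule equalityD1[OF e[rule_format, OF True]])
  next
    case False
    then show ?thesis by - (rule lift_Suc_mono_le[of U k e, OF U_Suc], simp)
  qed
  have "null1 R M r x n (\<lambda>i. x j [^] e \<odot>\<^bsub>M\<^esub> m i)" if m: "cocycle1 R M r x n m" and j: "j < r" for j n m
  proof -
    have mc: "m i \<in> carrier M" for i using cocycle1_closed[OF m] by auto
    have "null1 R M r x n (\<lambda>i. y [^] t \<odot>\<^bsub>M\<^esub> m i)" using ann m by (simp add: annihilates_def)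
    then obtain N u where u: "u \<in> carrier M"
        "\<And>i. i < r \<Longrightarrow> x i [^] N \<odot>\<^bsub>M\<^esub> (y [^] t \<odot>\<^bsub>M\<^esub> m i) = x i [^] (N + n) \<odot>\<^bsub>M\<^esub> u" by (auto simp: null1_def)
    let ?m = "\<lambda>i. x i [^] N \<odot>\<^bsub>M\<^esub> m i"
    note m' = cocycle1_raise[OF m, of N]
    \<comment> \<open>The class of \<open>?m\<close> is killed by \<open>x j ^ (n + N)\<close>
      because of the Koszul relations, an exponent depending on the class; stability of the chain
      replaces it by \<open>e\<close>.\<close>
    have "u \<in> U (n + N)"
      unfolding U_def using u m' null1_koszul[OF m'] mc y
      by (intro CollectI conjI exI[of _ "n + N"] exI[of _ ?m]) (auto simp: smult_comm[of "y [^] t"] add.commute)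
    then have "u \<in> U e" using Ue by blast
    then obtain k m2 where m2: "cocycle1 R M r x k m2" "\<forall>j<r. null1 R M r x k (\<lambda>i. x j [^] e \<odot>\<^bsub>M\<^esub> m2 i)"
        "\<And>i. i < r \<Longrightarrow> y [^] t \<odot>\<^bsub>M\<^esub> m2 i = x i [^] k \<odot>\<^bsub>M\<^esub> u" by (auto simp: U_def)
    have mc2: "m2 i \<in> carrier M" for i using cocycle1_closed[OF m2(1)] by auto
    \<comment> \<open>Membership in \<open>U e\<close> only provides another tuple \<open>m2\<close>
      with the same \<open>u\<close>. Since \<open>y\<close> is regular, \<open>u\<close> determines
      the class, so \<open>m\<close> and \<open>m2\<close> agree at a common later stage.\<close>
    have eq: "x i [^] (k + N) \<odot>\<^bsub>M\<^esub> m i = x i [^] (N + n) \<odot>\<^bsub>M\<^esub> m2 i" if i: "i < r" for i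
    proof (rule smult_pow_cancel[OF reg y])
      have "y [^] t \<odot>\<^bsub>M\<^esub> (x i [^] (k + N) \<odot>\<^bsub>M\<^esub> m i) = x i [^] k \<odot>\<^bsub>M\<^esub> (x i [^] N \<odot>\<^bsub>M\<^esub> (y [^] t \<odot>\<^bsub>M\<^esub> m i))"
        using mc y by (simp add: pow_smult smult_comm[of "y [^] t"])
      also have "\<dots> = x i [^] (N + n) \<odot>\<^bsub>M\<^esub> (y [^] t \<odot>\<^bsub>M\<^esub> m2 i)"
        using u i m2(3)[OF i] by (simp add: pow_smult ac_simps)
      also have "\<dots> = y [^] t \<odot>\<^bsub>M\<^esub> (x i [^] (N + n) \<odot>\<^bsub>M\<^esub> m2 i)"
        using mc2 y by (simp add: smult_comm[of "y [^] t"])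
      finally show "y [^] t \<odot>\<^bsub>M\<^esub> (x i [^] (k + N) \<odot>\<^bsub>M\<^esub> m i) = y [^] t \<odot>\<^bsub>M\<^esub> (x i [^] (N + n) \<odot>\<^bsub>M\<^esub> m2 i)" .
    qed (use mc mc2 in auto)
    have "null1 R M r x (k + (N + n)) (\<lambda>i. x i [^] (N + n) \<odot>\<^bsub>M\<^esub> (x j [^] e \<odot>\<^bsub>M\<^esub> m2 i))"
      using null1_raise_iff[of "\<lambda>i. x j [^] e \<odot>\<^bsub>M\<^esub> m2 i" k "N + n"] m2(2) mc2 j by (simp add: Pi_iff)
    also have "null1 R M r x (k + (N + n)) (\<lambda>i. x i [^] (N + n) \<odot>\<^bsub>M\<^esub> (x j [^] e \<odot>\<^bsub>M\<^esub> m2 i)) \<longleftrightarrow>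
        null1 R M r x (k + (N + n)) (\<lambda>i. x i [^] (k + N) \<odot>\<^bsub>M\<^esub> (x j [^] e \<odot>\<^bsub>M\<^esub> m i))"
      using eq mc mc2 by (intro null1_cong) (simp add: smult_comm[of _ "x j [^] e"])
    finally show ?thesis
      using null1_raise_iff[of "\<lambda>i. x j [^] e \<odot>\<^bsub>M\<^esub> m i" n "k + N"] mc by (simp add: Pi_iff ac_simps)
  qed
  then show ?thesis by blast
qed

section \<open>Degree two: null maps on relations and annihilators of classes\<close>

lemma cocycle2_closed: "cocycle2 R M r x n g \<Longrightarrow> v \<in> rel n \<Longrightarrow> g v \<in> carrier M"
  unfolding cocycle2_def using lin_closed[of R "Fr\<lparr>carrier := rel n\<rparr>" M g v] by simp

lemma cocycle2_smult: "cocycle2 R M r x n g \<Longrightarrow> c \<in> carrier R \<Longrightarrow> cocycle2 R M r x n (\<lambda>v. c \<odot>\<^bsub>M\<^esub> g v)"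
  unfolding cocycle2_def by (rule lin_scale[OF module_axioms])

lemma cocycle2_shift: "cocycle2 R M r x n g \<Longrightarrow> cocycle2 R M r x (n + N) (\<lambda>v. g (shift R x N v))"
proof -
  assume g: "cocycle2 R M r x n g"
  have "lin R (Fr\<lparr>carrier := rel (n + N)\<rparr>) (Fr\<lparr>carrier := rel n\<rparr>) (shift R x N)"
    by (rule lin_restrict_cod[OF lin_restrict_dom[OF shift_lin Fr.submoduleE(1)[OF rel_submodule]]])
      (simp add: shift_rel)
  with g show ?thesis unfolding cocycle2_def by (rule lin_comp)
qed

definition null2_at where
  "null2_at n N g \<longleftrightarrow> (\<exists>w\<in>UNIV \<rightarrow> carrier M. \<forall>v\<in>rel (n + N). g (shift R x (N::nat) v) = comb M r v w)"

lemma null2_iff: "null2 R M r x n g \<longleftrightarrow> (\<exists>N. null2_at n N g)"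
  by (simp add: null2_def null2_at_def)

lemma shift_shift:
  assumes "v \<in> UNIV \<rightarrow> carrier R"
  shows "shift R x N (shift R x K v) = shift R x (N + K) v"
proof -
  have "v i \<in> carrier R" for i using assms by auto
  then show ?thesis by (simp add: shift_def R.nat_pow_mult flip: m_assoc)
qed

lemma null2_at_mono:
  assumes N: "null2_at n N g"
  shows "null2_at n (N + K) g"
proof -
  obtain w where w: "w \<in> UNIV \<rightarrow> carrier M" "\<And>v. v \<in> rel (n + N) \<Longrightarrow> g (shift R x N v) = comb M r v w"
    using N by (auto simp: null2_at_def)
  have "g (shift R x (N + K) v) = comb M r v (\<lambda>i. x i [^] K \<odot>\<^bsub>M\<^esub> w i)" if v: "v \<in> rel (n + (N + K))" for v
    using w(2)[OF shift_rel, of v K] comb_shift[OF rel_fun[OF v] w(1)] shift_shift[OF rel_fun[OF v]] v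
    by (simp add: add.assoc)
  then show ?thesis
    unfolding null2_at_def using w(1) by (intro bexI[of _ "\<lambda>i. x i [^] K \<odot>\<^bsub>M\<^esub> w i"]) auto
qed

lemma null2_add:
  assumes "null2 R M r x n g" "null2 R M r x n g'"
  shows "null2 R M r x n (\<lambda>v. g v \<oplus>\<^bsub>M\<^esub> g' v)"
proof -
  obtain N N' where "null2_at n N g" "null2_at n N' g'" using assms by (auto simp: null2_iff)
  then have "null2_at n (N + N') g" "null2_at n (N + N') g'"
    using null2_at_mono[of n N g N'] null2_at_mono[of n N' g' N] by (simp_all add: add.commute)
  then obtain w w' where w: "w \<in> UNIV \<rightarrow> carrier M" "w' \<in> UNIV \<rightarrow> carrier M"
      "\<And>v. v \<in> rel (n + (N + N')) \<Longrightarrow> g (shift R x (N + N') v) = comb M r v w"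
      "\<And>v. v \<in> rel (n + (N + N')) \<Longrightarrow> g' (shift R x (N + N') v) = comb M r v w'"
    by (auto simp: null2_at_def)
  have "null2_at n (N + N') (\<lambda>v. g v \<oplus>\<^bsub>M\<^esub> g' v)"
    unfolding null2_at_def using w comb_add_right[OF rel_fun w(1,2)]
    by (intro bexI[of _ "\<lambda>i. w i \<oplus>\<^bsub>M\<^esub> w' i"]) (auto simp: Pi_iff)
  then show ?thesis by (auto simp: null2_iff)
qed

lemma null2_smult:
  assumes "null2 R M r x n g" "c \<in> carrier R"
  shows "null2 R M r x n (\<lambda>v. c \<odot>\<^bsub>M\<^esub> g v)"
proof -
  obtain N w where w: "w \<in> UNIV \<rightarrow> carrier M" "\<And>v. v \<in> rel (n + N) \<Longrightarrow> g (shift R x N v) = comb M r v w"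
    using assms(1) by (auto simp: null2_iff null2_at_def)
  have "null2_at n N (\<lambda>v. c \<odot>\<^bsub>M\<^esub> g v)"
    unfolding null2_at_def using w comb_smult_right[OF assms(2) rel_fun w(1)] assms(2)
    by (intro bexI[of _ "\<lambda>i. c \<odot>\<^bsub>M\<^esub> w i"]) (auto simp: Pi_iff)
  then show ?thesis by (auto simp: null2_iff)
qed

lemma null2_cong: "(\<And>v. v \<in> rel n \<Longrightarrow> g v = g' v) \<Longrightarrow> null2 R M r x n g \<longleftrightarrow> null2 R M r x n g'"
  unfolding null2_def using shift_rel by simp

lemma null2_zero: "null2 R M r x n (\<lambda>_. \<zero>\<^bsub>M\<^esub>)"
  unfolding null2_def using comb_zero_right[OF rel_fun] by (intro exI[of _ 0] bexI[of _ "\<lambda>_. \<zero>\<^bsub>M\<^esub>"]) auto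

text \<open>Passing to a later stage does not change a class of the limit, so witnesses may be
  sought at any later stage.\<close>

lemma null2_shift_iff: "null2 R M r x (n + N) (\<lambda>v. g (shift R x N v)) \<longleftrightarrow> null2 R M r x n g"
proof -
  have 1: "null2_at (n + N) K (\<lambda>v. g (shift R x N v)) \<longleftrightarrow> null2_at n (N + K) g" for K
    unfolding null2_at_def using shift_shift[OF rel_fun] by (simp add: add.assoc)
  then show ?thesis unfolding null2_iff using null2_at_mono[of n _ g N] by (metis add.commute)
qed

text \<open>By \<open>comb_koszul\<close> the value of \<open>g\<close> at \<open>x j ^ n\<close>
  times \<open>v\<close> is the combination of the values of \<open>g\<close> at the Koszul
  relations, so these values form the tuple of an extension.\<close>

lemma null2_koszul:
  assumes g: "cocycle2 R M r x n g" and j: "j < r"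
  shows "null2 R M r x n (\<lambda>v. x j [^] n \<odot>\<^bsub>M\<^esub> g v)"
proof -
  have gl: "lin R (Fr\<lparr>carrier := rel n\<rparr>) M g" using g by (simp add: cocycle2_def)
  have k: "koszul n j \<in> UNIV \<rightarrow> rel n" using koszul_rel[OF j] by auto
  have w: "(\<lambda>i. g (koszul n j i)) \<in> UNIV \<rightarrow> carrier M" using cocycle2_closed[OF g koszul_rel[OF j]] by auto
  have "x j [^] n \<odot>\<^bsub>M\<^esub> g v = comb M r v (\<lambda>i. g (koszul n j i))" if v: "v \<in> rel n" for v
  proof -
    have "x j [^] n \<odot>\<^bsub>M\<^esub> g v = g (x j [^] n \<odot>\<^bsub>Fr\<^esub> v)"
      using lin_smult[OF gl, of "x j [^] n" v] v by simp
    also have "\<dots> = g (comb Fr r v (koszul n j))" by (simp only: comb_koszul[OF v j])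
    also have "\<dots> = comb M r v (\<lambda>i. g (koszul n j i))"
      by (rule lin_comb_image[OF Fr.module_axioms module_axioms rel_submodule gl rel_fun[OF v] k])
    finally show ?thesis .
  qed
  moreover have "shift R x 0 v = v" if "v \<in> rel n" for v
    using rel_fun[OF that] by (auto simp: shift_def fun_eq_iff Pi_iff)
  ultimately show ?thesis unfolding null2_def using w by (intro exI[of _ 0] bexI[OF _ w]) auto
qed

definition annihilator2 where
  "annihilator2 n g = {s \<in> carrier R. null2 R M r x n (\<lambda>v. s \<odot>\<^bsub>M\<^esub> g v)}"

lemma annihilator2_ideal:
  assumes g: "cocycle2 R M r x n g"
  shows "ideal (annihilator2 n g) R"
  unfolding annihilator2_def
proof (rule pred_ideal)
  note gc = cocycle2_closed[OF g]
  show "null2 R M r x n (\<lambda>v. \<zero> \<odot>\<^bsub>M\<^esub> g v)"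
    using null2_zero null2_cong[of n "\<lambda>v. \<zero> \<odot>\<^bsub>M\<^esub> g v" "\<lambda>_. \<zero>\<^bsub>M\<^esub>"] gc by simp
  fix s t assume s: "s \<in> carrier R" "null2 R M r x n (\<lambda>v. s \<odot>\<^bsub>M\<^esub> g v)" and t: "t \<in> carrier R"
  show "null2 R M r x n (\<lambda>v. (s \<oplus> t) \<odot>\<^bsub>M\<^esub> g v)" if "null2 R M r x n (\<lambda>v. t \<odot>\<^bsub>M\<^esub> g v)"
    using null2_add[OF s(2) that]
      null2_cong[of n "\<lambda>v. (s \<oplus> t) \<odot>\<^bsub>M\<^esub> g v" "\<lambda>v. s \<odot>\<^bsub>M\<^esub> g v \<oplus>\<^bsub>M\<^esub> t \<odot>\<^bsub>M\<^esub> g v"] gc s(1) t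
    by (simp add: smult_l_distr)
next
  note gc = cocycle2_closed[OF g]
  fix c s assume "c \<in> carrier R" "s \<in> carrier R" "null2 R M r x n (\<lambda>v. s \<odot>\<^bsub>M\<^esub> g v)"
  then show "null2 R M r x n (\<lambda>v. (c \<otimes> s) \<odot>\<^bsub>M\<^esub> g v)"
    using null2_smult[of n "\<lambda>v. s \<odot>\<^bsub>M\<^esub> g v" c]
      null2_cong[of n "\<lambda>v. (c \<otimes> s) \<odot>\<^bsub>M\<^esub> g v" "\<lambda>v. c \<odot>\<^bsub>M\<^esub> (s \<odot>\<^bsub>M\<^esub> g v)"] gc by (simp add: smult_assoc1)
qed

lemma annihilator2_mem:
  assumes g: "cocycle2 R M r x n g" and "s \<in> carrier R" "c \<in> carrier R"
  shows "s \<otimes> c \<in> annihilator2 n g \<longleftrightarrow> null2 R M r x n (\<lambda>v. s \<odot>\<^bsub>M\<^esub> (c \<odot>\<^bsub>M\<^esub> g v))"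
  using null2_cong[of n "\<lambda>v. (s \<otimes> c) \<odot>\<^bsub>M\<^esub> g v" "\<lambda>v. s \<odot>\<^bsub>M\<^esub> (c \<odot>\<^bsub>M\<^esub> g v)"] cocycle2_closed[OF g] assms
  by (simp add: annihilator2_def smult_assoc1)

lemma annihilator2_colon:
  assumes g: "cocycle2 R M r x n g" and c: "c \<in> carrier R"
  shows "{s \<in> carrier R. s \<otimes> c \<in> annihilator2 n g} = annihilator2 n (\<lambda>v. c \<odot>\<^bsub>M\<^esub> g v)"
  using annihilator2_mem[OF g _ c] by (auto simp: annihilator2_def[of n "\<lambda>v. c \<odot>\<^bsub>M\<^esub> g v"])

lemma annihilator2_shift: "annihilator2 (n + N) (\<lambda>v. g (shift R x N v)) = annihilator2 n g"
  unfolding annihilator2_def using null2_shift_iff[of n N "\<lambda>v. s \<odot>\<^bsub>M\<^esub> g v" for s] by simp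

text \<open>At a sufficiently late stage the finitely many null conditions, for \<open>y\<close> and
  for each \<open>x j\<close>, hold without further shift.\<close>

lemma socle2_normal_form:
  assumes g: "cocycle2 R M r x n g" and y: "y \<in> carrier R" "y \<in> annihilator2 n g" and xQ: "x ` {..<r} \<subseteq> annihilator2 n g"
  obtains k h w b where "cocycle2 R M r x k h" "annihilator2 k h = annihilator2 n g"
    "w \<in> UNIV \<rightarrow> carrier M" "\<And>v. v \<in> rel k \<Longrightarrow> y \<odot>\<^bsub>M\<^esub> h v = comb M r v w"
    "\<And>j. j < r \<Longrightarrow> b j \<in> UNIV \<rightarrow> carrier M"
    "\<And>j v. j < r \<Longrightarrow> v \<in> rel k \<Longrightarrow> x j \<odot>\<^bsub>M\<^esub> h v = comb M r v (b j)"
proof -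
  have "\<exists>N. null2_at n N (\<lambda>v. x j \<odot>\<^bsub>M\<^esub> g v)" if "j < r" for j
    using xQ that by (auto simp: annihilator2_def null2_iff)
  then have "\<exists>N. \<forall>j<r. null2_at n N (\<lambda>v. x j \<odot>\<^bsub>M\<^esub> g v)"
    by (rule uniform_bound) (use null2_at_mono in auto)
  then obtain N1 where N1: "\<And>j. j < r \<Longrightarrow> null2_at n N1 (\<lambda>v. x j \<odot>\<^bsub>M\<^esub> g v)" by blast
  obtain N2 where N2: "null2_at n N2 (\<lambda>v. y \<odot>\<^bsub>M\<^esub> g v)" using y by (auto simp: annihilator2_def null2_iff)
  let ?N = "N1 + N2"
  let ?h = "\<lambda>v. g (shift R x ?N v)"
  have "null2_at n ?N (\<lambda>v. y \<odot>\<^bsub>M\<^esub> g v)" using null2_at_mono[OF N2, of N1] by (simp add: add.commute)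
  then obtain w where w: "w \<in> UNIV \<rightarrow> carrier M" "\<And>v. v \<in> rel (n + ?N) \<Longrightarrow> y \<odot>\<^bsub>M\<^esub> ?h v = comb M r v w"
    by (auto simp: null2_at_def)
  have "\<exists>b\<in>UNIV \<rightarrow> carrier M. \<forall>v\<in>rel (n + ?N). x j \<odot>\<^bsub>M\<^esub> ?h v = comb M r v b" if "j < r" for j
    using null2_at_mono[OF N1[OF that], of N2] by (simp add: null2_at_def)
  then obtain b where b: "\<And>j. j < r \<Longrightarrow> b j \<in> UNIV \<rightarrow> carrier M"
      "\<And>j v. j < r \<Longrightarrow> v \<in> rel (n + ?N) \<Longrightarrow> x j \<odot>\<^bsub>M\<^esub> ?h v = comb M r v (b j)" by metis
  show ?thesis by (rule that[OF cocycle2_shift[OF g, of ?N] annihilator2_shift w b])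
qed

text \<open>Two extensions of the same map on relations differ by a degree 1 cocycle. This is how
  degree 1 enters the analysis of degree 2.\<close>

lemma cocycle1_diffI:
  assumes "m \<in> UNIV \<rightarrow> carrier M" "m' \<in> UNIV \<rightarrow> carrier M"
    and "\<And>v. v \<in> rel n \<Longrightarrow> comb M r v m = comb M r v m'"
  shows "cocycle1 R M r x n (\<lambda>i. m i \<ominus>\<^bsub>M\<^esub> m' i)"
proof -
  have "comb M r v (\<lambda>i. m i \<ominus>\<^bsub>M\<^esub> m' i) = \<zero>\<^bsub>M\<^esub>" if "v \<in> rel n" for v
    using comb_minus_right[OF rel_fun[OF that] assms(1,2), of r] assms(3)[OF that]
      comb_closed[OF rel_fun[OF that] assms(2), of r] by (simp add: a_minus_def M.r_neg)
  then show ?thesis using assms(1,2) by (auto simp: cocycle1_def)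
qed

text \<open>If \<open>x i ^ e\<close> kills the first cohomology, then a class killed by \<open>y\<close> and all \<open>x i\<close> is
  determined up to annihilator by the tuple \<open>u\<close> measuring the failure of the cochain \<open>w\<close> of
  \<open>y g = comb w\<close> to be divisible by \<open>y\<close>.\<close>

lemma socle2_detected:
  assumes R: "noetherian_ring R" and M: "noetherian_module R M" and y: "y \<in> carrier R"
    and reg: "\<And>m. m \<in> carrier M \<Longrightarrow> y \<odot>\<^bsub>M\<^esub> m = \<zero>\<^bsub>M\<^esub> \<Longrightarrow> m = \<zero>\<^bsub>M\<^esub>"
    and e: "\<And>j n m. j < r \<Longrightarrow> cocycle1 R M r x n m \<Longrightarrow> null1 R M r x n (\<lambda>i. x j [^] (e::nat) \<odot>\<^bsub>M\<^esub> m i)"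
  shows "prime_detected R {Q \<in> {annihilator2 n g | n g. cocycle2 R M r x n g}. insert y (x ` {..<r}) \<subseteq> Q}"
proof -
  let ?T = "tuples M r"
  interpret T: module R ?T by (rule tuples_module)
  \<comment> \<open>Read modulo \<open>y\<close>: the fractions \<open>t i / x i ^ (e + 1)\<close>
    agree with \<open>z i / x i ^ k\<close> for a cocycle \<open>z\<close> of \<open>M\<close>, so
    the degree 1 class they define over M/yM lifts to \<open>M\<close>. Such classes are exactly the
    ones that vanish in degree 2.\<close>
  define Y where "Y = {t \<in> carrier ?T. \<exists>k z. cocycle1 R M r x k z \<and>
    (\<forall>i<r. \<exists>c\<in>carrier M. x i [^] (e + 1) \<odot>\<^bsub>M\<^esub> z i = x i [^] k \<odot>\<^bsub>M\<^esub> t i \<oplus>\<^bsub>M\<^esub> y \<odot>\<^bsub>M\<^esub> c)}"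
  have raise: "\<exists>c'\<in>carrier M. x i [^] (e + 1) \<odot>\<^bsub>M\<^esub> (x i [^] L \<odot>\<^bsub>M\<^esub> z) = x i [^] (k + L) \<odot>\<^bsub>M\<^esub> t \<oplus>\<^bsub>M\<^esub> y \<odot>\<^bsub>M\<^esub> c'"
    if "z \<in> carrier M" "t \<in> carrier M" "c \<in> carrier M"
      "x i [^] (e + 1) \<odot>\<^bsub>M\<^esub> z = x i [^] k \<odot>\<^bsub>M\<^esub> t \<oplus>\<^bsub>M\<^esub> y \<odot>\<^bsub>M\<^esub> c" for z t c k i and L :: nat
  proof
    have "x i [^] (e + 1) \<odot>\<^bsub>M\<^esub> (x i [^] L \<odot>\<^bsub>M\<^esub> z) = x i [^] L \<odot>\<^bsub>M\<^esub> (x i [^] k \<odot>\<^bsub>M\<^esub> t \<oplus>\<^bsub>M\<^esub> y \<odot>\<^bsub>M\<^esub> c)"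
      unfolding that(4)[symmetric] using that by (intro smult_comm) auto
    also have "\<dots> = x i [^] (k + L) \<odot>\<^bsub>M\<^esub> t \<oplus>\<^bsub>M\<^esub> y \<odot>\<^bsub>M\<^esub> (x i [^] L \<odot>\<^bsub>M\<^esub> c)"
      using that y by (simp add: smult_r_distr pow_smult smult_comm[of y] add.commute)
    finally show "x i [^] (e + 1) \<odot>\<^bsub>M\<^esub> (x i [^] L \<odot>\<^bsub>M\<^esub> z) = x i [^] (k + L) \<odot>\<^bsub>M\<^esub> t \<oplus>\<^bsub>M\<^esub> y \<odot>\<^bsub>M\<^esub> (x i [^] L \<odot>\<^bsub>M\<^esub> c)" .
  qed (use that in auto)
  have Y: "submodule Y R ?T"
  proof (rule T.submoduleI')
    show "\<zero>\<^bsub>?T\<^esub> \<in> Y"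
      unfolding Y_def using cocycle1_zero[of 0] y
      by (intro CollectI conjI exI[of _ "0::nat"] exI[of _ "\<lambda>_. \<zero>\<^bsub>M\<^esub>"] allI impI bexI[of _ "\<zero>\<^bsub>M\<^esub>"]) auto
    fix t assume "t \<in> Y"
    then obtain k z where t: "t \<in> carrier ?T" and z: "cocycle1 R M r x k z"
        "\<And>i. i < r \<Longrightarrow> \<exists>c\<in>carrier M. x i [^] (e + 1) \<odot>\<^bsub>M\<^esub> z i = x i [^] k \<odot>\<^bsub>M\<^esub> t i \<oplus>\<^bsub>M\<^esub> y \<odot>\<^bsub>M\<^esub> c" by (auto simp: Y_def)
    have tc: "t i \<in> carrier M" "z i \<in> carrier M" for i using t cocycle1_closed[OF z(1)] by auto
    show "a \<odot>\<^bsub>?T\<^esub> t \<in> Y" if a: "a \<in> carrier R" for a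
    proof -
      have "\<exists>c\<in>carrier M. x i [^] (e + 1) \<odot>\<^bsub>M\<^esub> (a \<odot>\<^bsub>M\<^esub> z i) = x i [^] k \<odot>\<^bsub>M\<^esub> (a \<odot>\<^bsub>M\<^esub> t i) \<oplus>\<^bsub>M\<^esub> y \<odot>\<^bsub>M\<^esub> c" if i: "i < r" for i
      proof -
        obtain c where c: "c \<in> carrier M" "x i [^] (e + 1) \<odot>\<^bsub>M\<^esub> z i = x i [^] k \<odot>\<^bsub>M\<^esub> t i \<oplus>\<^bsub>M\<^esub> y \<odot>\<^bsub>M\<^esub> c" using z(2)[OF i] by blast
        have "x i [^] (e + 1) \<odot>\<^bsub>M\<^esub> (a \<odot>\<^bsub>M\<^esub> z i) = a \<odot>\<^bsub>M\<^esub> (x i [^] k \<odot>\<^bsub>M\<^esub> t i \<oplus>\<^bsub>M\<^esub> y \<odot>\<^bsub>M\<^esub> c)"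
          unfolding c(2)[symmetric] using a tc by (intro smult_comm) auto
        also have "\<dots> = x i [^] k \<odot>\<^bsub>M\<^esub> (a \<odot>\<^bsub>M\<^esub> t i) \<oplus>\<^bsub>M\<^esub> y \<odot>\<^bsub>M\<^esub> (a \<odot>\<^bsub>M\<^esub> c)"
          using a tc c(1) y by (simp add: smult_r_distr smult_comm[of a])
        finally show ?thesis using a c(1) by blast
      qed
      then show ?thesis unfolding Y_def using cocycle1_smult[OF z(1) a] T.smult_closed[OF a t]
        by (intro CollectI conjI exI[of _ k] exI[of _ "\<lambda>i. a \<odot>\<^bsub>M\<^esub> z i"]) auto
    qed
    fix t' assume "t' \<in> Y"
    then obtain k' z' where t': "t' \<in> carrier ?T" and z': "cocycle1 R M r x k' z'"
        "\<And>i. i < r \<Longrightarrow> \<exists>c\<in>carrier M. x i [^] (e + 1) \<odot>\<^bsub>M\<^esub> z' i = x i [^] k' \<odot>\<^bsub>M\<^esub> t' i \<oplus>\<^bsub>M\<^esub> y \<odot>\<^bsub>M\<^esub> c" by (auto simp: Y_def)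
    have tc': "t' i \<in> carrier M" "z' i \<in> carrier M" for i using t' cocycle1_closed[OF z'(1)] by auto
    let ?z = "\<lambda>i. x i [^] k' \<odot>\<^bsub>M\<^esub> z i" and ?z' = "\<lambda>i. x i [^] k \<odot>\<^bsub>M\<^esub> z' i"
    have "cocycle1 R M r x (k + k') (\<lambda>i. ?z i \<oplus>\<^bsub>M\<^esub> ?z' i)"
      using cocycle1_add[OF cocycle1_raise[OF z(1), of k'] cocycle1_raise[OF z'(1), of k, unfolded add.commute[of k' k]]] .
    moreover have "\<exists>c\<in>carrier M. x i [^] (e + 1) \<odot>\<^bsub>M\<^esub> (?z i \<oplus>\<^bsub>M\<^esub> ?z' i)
        = x i [^] (k + k') \<odot>\<^bsub>M\<^esub> (t i \<oplus>\<^bsub>M\<^esub> t' i) \<oplus>\<^bsub>M\<^esub> y \<odot>\<^bsub>M\<^esub> c" if i: "i < r" for i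
    proof -
      obtain c where c: "c \<in> carrier M" "x i [^] (e + 1) \<odot>\<^bsub>M\<^esub> ?z i = x i [^] (k + k') \<odot>\<^bsub>M\<^esub> t i \<oplus>\<^bsub>M\<^esub> y \<odot>\<^bsub>M\<^esub> c"
        using z(2)[OF i] raise[OF tc(2) tc(1)] by blast
      obtain c0 where c0: "c0 \<in> carrier M" "x i [^] (e + 1) \<odot>\<^bsub>M\<^esub> z' i = x i [^] k' \<odot>\<^bsub>M\<^esub> t' i \<oplus>\<^bsub>M\<^esub> y \<odot>\<^bsub>M\<^esub> c0"
        using z'(2)[OF i] by blast
      obtain c' where c': "c' \<in> carrier M" "x i [^] (e + 1) \<odot>\<^bsub>M\<^esub> ?z' i = x i [^] (k + k') \<odot>\<^bsub>M\<^esub> t' i \<oplus>\<^bsub>M\<^esub> y \<odot>\<^bsub>M\<^esub> c'"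
        using raise[OF tc'(2)[of i] tc'(1)[of i] c0, of k, unfolded add.commute[of k' k]] by blast
      have "x i [^] (e + 1) \<odot>\<^bsub>M\<^esub> (?z i \<oplus>\<^bsub>M\<^esub> ?z' i) = x i [^] (e + 1) \<odot>\<^bsub>M\<^esub> ?z i \<oplus>\<^bsub>M\<^esub> x i [^] (e + 1) \<odot>\<^bsub>M\<^esub> ?z' i"
        using tc tc' by (intro smult_r_distr) auto
      also have "\<dots> = x i [^] (k + k') \<odot>\<^bsub>M\<^esub> (t i \<oplus>\<^bsub>M\<^esub> t' i) \<oplus>\<^bsub>M\<^esub> y \<odot>\<^bsub>M\<^esub> (c \<oplus>\<^bsub>M\<^esub> c')"
        unfolding c(2) c'(2) using c(1) c'(1) tc tc' y by (simp add: smult_r_distr M.a_ac)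
      finally show ?thesis using c(1) c'(1) by blast
    qed
    ultimately show "t \<oplus>\<^bsub>?T\<^esub> t' \<in> Y" unfolding Y_def using T.M.a_closed[OF t t']
      by (intro CollectI conjI exI[of _ "k + k'"] exI[of _ "\<lambda>i. ?z i \<oplus>\<^bsub>M\<^esub> ?z' i"]) auto
  qed (auto simp: Y_def)
  show ?thesis
  proof (rule prime_detected_mono[OF noetherian_prime_detected[OF R.is_cring R noetherian_tuples[OF M] Y]])
    fix Q assume "Q \<in> {Q \<in> {annihilator2 n g | n g. cocycle2 R M r x n g}. insert y (x ` {..<r}) \<subseteq> Q}"
    then obtain n' g' where g': "cocycle2 R M r x n' g'" "Q = annihilator2 n' g'" "insert y (x ` {..<r}) \<subseteq> Q" by blast
    have yQ: "y \<in> annihilator2 n' g'" "x ` {..<r} \<subseteq> annihilator2 n' g'" using g'(2,3) by auto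
    obtain n g w b where g: "cocycle2 R M r x n g" and Q: "annihilator2 n g = annihilator2 n' g'"
      and w: "w \<in> UNIV \<rightarrow> carrier M" "\<And>v. v \<in> rel n \<Longrightarrow> y \<odot>\<^bsub>M\<^esub> g v = comb M r v w"
      and b: "\<And>j. j < r \<Longrightarrow> b j \<in> UNIV \<rightarrow> carrier M"
        "\<And>j v. j < r \<Longrightarrow> v \<in> rel n \<Longrightarrow> x j \<odot>\<^bsub>M\<^esub> g v = comb M r v (b j)"
      by (rule socle2_normal_form[OF g'(1) y yQ]) (rule that)
    note Q = g'(2)[folded Q] and gc = cocycle2_closed[OF g]
    have wc: "w i \<in> carrier M" for i using w(1) by auto
    have bc: "b j i \<in> carrier M" if "j < r" for j i using b(1)[OF that] by auto
    have "\<exists>N. null1_at n N (\<lambda>i. x j [^] e \<odot>\<^bsub>M\<^esub> (x j \<odot>\<^bsub>M\<^esub> w i \<ominus>\<^bsub>M\<^esub> y \<odot>\<^bsub>M\<^esub> b j i))" if j: "j < r" for j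
    proof -
      \<comment> \<open>Both tuples extend \<open>x j\<close> times \<open>y\<close> times
        \<open>g\<close>, once through \<open>w\<close> and once through \<open>b j\<close>; their
        difference is therefore a cocycle, killed by \<open>x j ^ e\<close> by assumption.\<close>
      have "comb M r v (\<lambda>i. x j \<odot>\<^bsub>M\<^esub> w i) = comb M r v (\<lambda>i. y \<odot>\<^bsub>M\<^esub> b j i)" if v: "v \<in> rel n" for v
        using comb_smult_right[OF x_closed rel_fun[OF v] w(1)] comb_smult_right[OF y rel_fun[OF v] b(1)[OF j]]
          w(2)[OF v] b(2)[OF j v] smult_comm[OF y x_closed gc[OF v]] by metis
      then have "cocycle1 R M r x n (\<lambda>i. x j \<odot>\<^bsub>M\<^esub> w i \<ominus>\<^bsub>M\<^esub> y \<odot>\<^bsub>M\<^esub> b j i)"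
        using wc bc[OF j] y by (intro cocycle1_diffI) auto
      from e[OF j this] show ?thesis by (simp add: null1_iff)
    qed
    then have "\<exists>N. \<forall>j<r. null1_at n N (\<lambda>i. x j [^] e \<odot>\<^bsub>M\<^esub> (x j \<odot>\<^bsub>M\<^esub> w i \<ominus>\<^bsub>M\<^esub> y \<odot>\<^bsub>M\<^esub> b j i))"
    proof (rule uniform_bound)
      fix j N K assume "j < r" "null1_at n N (\<lambda>i. x j [^] e \<odot>\<^bsub>M\<^esub> (x j \<odot>\<^bsub>M\<^esub> w i \<ominus>\<^bsub>M\<^esub> y \<odot>\<^bsub>M\<^esub> b j i))"
      then show "null1_at n (N + K) (\<lambda>i. x j [^] e \<odot>\<^bsub>M\<^esub> (x j \<odot>\<^bsub>M\<^esub> w i \<ominus>\<^bsub>M\<^esub> y \<odot>\<^bsub>M\<^esub> b j i))"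
        using wc bc y by (intro null1_at_mono) auto
    qed
    then obtain N where N: "\<And>j. j < r \<Longrightarrow> null1_at n N (\<lambda>i. x j [^] e \<odot>\<^bsub>M\<^esub> (x j \<odot>\<^bsub>M\<^esub> w i \<ominus>\<^bsub>M\<^esub> y \<odot>\<^bsub>M\<^esub> b j i))" by blast
    \<comment> \<open>The diagonal again: the j-th coordinate of the equation for \<open>x j\<close>
      says that \<open>w j / x j ^ n\<close> equals \<open>u j / x j ^ (e + 1)\<close> modulo
      \<open>y\<close>. The factor \<open>x j ^ e\<close> kills the cocycle and one more
      \<open>x j\<close> comes from the socle condition.\<close>
    have "\<exists>u\<in>carrier M. \<exists>d\<in>carrier M. x j [^] (N + e + 1) \<odot>\<^bsub>M\<^esub> w j = x j [^] (N + n) \<odot>\<^bsub>M\<^esub> u \<oplus>\<^bsub>M\<^esub> y \<odot>\<^bsub>M\<^esub> d" if j: "j < r" for j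
    proof -
      obtain u where u: "u \<in> carrier M"
          "x j [^] N \<odot>\<^bsub>M\<^esub> (x j [^] e \<odot>\<^bsub>M\<^esub> (x j \<odot>\<^bsub>M\<^esub> w j \<ominus>\<^bsub>M\<^esub> y \<odot>\<^bsub>M\<^esub> b j j)) = x j [^] (N + n) \<odot>\<^bsub>M\<^esub> u"
        using N[OF j] j by (auto simp: null1_at_def)
      let ?A = "x j [^] (N + e) \<odot>\<^bsub>M\<^esub> (x j \<odot>\<^bsub>M\<^esub> w j)" and ?d = "x j [^] (N + e) \<odot>\<^bsub>M\<^esub> b j j"
      have A: "?A \<in> carrier M" "?d \<in> carrier M" using wc bc[OF j] by auto
      have "?A \<ominus>\<^bsub>M\<^esub> y \<odot>\<^bsub>M\<^esub> ?d = x j [^] (N + n) \<odot>\<^bsub>M\<^esub> u"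
        unfolding u(2)[symmetric] using wc bc[OF j] y by (simp add: pow_smult smult_r_diff smult_comm[of y])
      then have "?A = x j [^] (N + n) \<odot>\<^bsub>M\<^esub> u \<oplus>\<^bsub>M\<^esub> y \<odot>\<^bsub>M\<^esub> ?d"
        using A y by (metis M.minus_closed M.add.inv_closed M.a_assoc M.l_neg M.r_zero a_minus_def smult_closed)
      moreover have "?A = x j [^] (N + e + 1) \<odot>\<^bsub>M\<^esub> w j"
        using wc by (simp flip: smult_assoc1)
      ultimately show ?thesis using u(1) A(2) by metis
    qed
    then obtain u d where u: "\<And>j. j < r \<Longrightarrow> u j \<in> carrier M" "\<And>j. j < r \<Longrightarrow> d j \<in> carrier M"
        and ud: "\<And>j. j < r \<Longrightarrow> x j [^] (N + e + 1) \<odot>\<^bsub>M\<^esub> w j = x j [^] (N + n) \<odot>\<^bsub>M\<^esub> u j \<oplus>\<^bsub>M\<^esub> y \<odot>\<^bsub>M\<^esub> d j"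
      by metis
    define t where "t i = (if i < r then u i else \<zero>\<^bsub>M\<^esub>)" for i
    have t: "t \<in> carrier ?T" using u(1) by (auto simp: t_def)
    have "Q \<subseteq> colon R ?T Y t"
    proof
      fix s assume "s \<in> Q"
      then obtain L c where s: "s \<in> carrier R" and c: "c \<in> UNIV \<rightarrow> carrier M"
          "\<And>v. v \<in> rel (n + L) \<Longrightarrow> s \<odot>\<^bsub>M\<^esub> g (shift R x L v) = comb M r v c"
        by (auto simp: Q annihilator2_def null2_def)
      have cc: "c i \<in> carrier M" for i using c(1) by auto
      \<comment> \<open>If \<open>c\<close> extends \<open>s\<close> times \<open>g\<close>, then
        \<open>s w\<close> at the later stage and \<open>y c\<close> both extend \<open>y\<close>
        times \<open>s\<close> times \<open>g\<close>. So \<open>z\<close> is a cocycle of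
        \<open>M\<close> that equals \<open>s w\<close> modulo \<open>y\<close>.\<close>
      define z where "z i = x i [^] L \<odot>\<^bsub>M\<^esub> (s \<odot>\<^bsub>M\<^esub> w i) \<ominus>\<^bsub>M\<^esub> y \<odot>\<^bsub>M\<^esub> c i" for i
      have "cocycle1 R M r x (n + L) z"
        unfolding z_def
      proof (rule cocycle1_diffI)
        fix v assume v: "v \<in> rel (n + L)"
        note vf = rel_fun[OF v] and vs = shift_rel[OF v]
        have sw: "(\<lambda>i. s \<odot>\<^bsub>M\<^esub> w i) \<in> UNIV \<rightarrow> carrier M" using s wc by auto
        have "comb M r v (\<lambda>i. x i [^] L \<odot>\<^bsub>M\<^esub> (s \<odot>\<^bsub>M\<^esub> w i)) = comb M r (shift R x L v) (\<lambda>i. s \<odot>\<^bsub>M\<^esub> w i)"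
          by (rule comb_shift[OF vf sw, symmetric])
        also have "\<dots> = s \<odot>\<^bsub>M\<^esub> (y \<odot>\<^bsub>M\<^esub> g (shift R x L v))"
          unfolding w(2)[OF vs] by (rule comb_smult_right[OF s rel_fun[OF vs] w(1)])
        also have "\<dots> = y \<odot>\<^bsub>M\<^esub> comb M r v c"
          unfolding c(2)[OF v, symmetric] by (rule smult_comm[OF s y gc[OF vs]])
        also have "\<dots> = comb M r v (\<lambda>i. y \<odot>\<^bsub>M\<^esub> c i)" by (rule comb_smult_right[OF y vf c(1), symmetric])
        finally show "comb M r v (\<lambda>i. x i [^] L \<odot>\<^bsub>M\<^esub> (s \<odot>\<^bsub>M\<^esub> w i)) = comb M r v (\<lambda>i. y \<odot>\<^bsub>M\<^esub> c i)" .
      qed (use s wc cc y in auto)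
      note z = cocycle1_raise[OF this, of N]
      have "\<exists>c'\<in>carrier M. x i [^] (e + 1) \<odot>\<^bsub>M\<^esub> (x i [^] N \<odot>\<^bsub>M\<^esub> z i)
          = x i [^] (n + L + N) \<odot>\<^bsub>M\<^esub> (s \<odot>\<^bsub>M\<^esub> u i) \<oplus>\<^bsub>M\<^esub> y \<odot>\<^bsub>M\<^esub> c'" if i: "i < r" for i
      proof
        let ?c = "x i [^] L \<odot>\<^bsub>M\<^esub> (s \<odot>\<^bsub>M\<^esub> d i)" and ?c' = "x i [^] (N + e + 1) \<odot>\<^bsub>M\<^esub> c i"
        have cl: "?c \<in> carrier M" "?c' \<in> carrier M" using s u[OF i] cc by auto
        have "x i [^] (e + 1) \<odot>\<^bsub>M\<^esub> (x i [^] N \<odot>\<^bsub>M\<^esub> z i) = x i [^] (N + e + 1) \<odot>\<^bsub>M\<^esub> z i"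
          using s wc cc y by (subst pow_smult) (auto simp: z_def ac_simps)
        also have "\<dots> = x i [^] L \<odot>\<^bsub>M\<^esub> (s \<odot>\<^bsub>M\<^esub> (x i [^] (N + e + 1) \<odot>\<^bsub>M\<^esub> w i)) \<ominus>\<^bsub>M\<^esub> y \<odot>\<^bsub>M\<^esub> ?c'"
        proof -
          have "x i [^] (N + e + 1) \<in> carrier R" "x i [^] L \<in> carrier R" "s \<odot>\<^bsub>M\<^esub> w i \<in> carrier M"
              "x i [^] L \<odot>\<^bsub>M\<^esub> (s \<odot>\<^bsub>M\<^esub> w i) \<in> carrier M" "y \<odot>\<^bsub>M\<^esub> c i \<in> carrier M"
            using s wc cc y by auto
          note a = this
          show ?thesis
            unfolding z_def smult_r_diff[OF a(1,4,5)] smult_comm[OF a(1-3)] smult_comm[OF a(1) s wc] smult_comm[OF a(1) y cc] ..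
        qed
        also have "\<dots> = x i [^] L \<odot>\<^bsub>M\<^esub> (s \<odot>\<^bsub>M\<^esub> (x i [^] (N + n) \<odot>\<^bsub>M\<^esub> u i \<oplus>\<^bsub>M\<^esub> y \<odot>\<^bsub>M\<^esub> d i)) \<ominus>\<^bsub>M\<^esub> y \<odot>\<^bsub>M\<^esub> ?c'"
          unfolding ud[OF i] ..
        also have "\<dots> = (x i [^] (n + L + N) \<odot>\<^bsub>M\<^esub> (s \<odot>\<^bsub>M\<^esub> u i) \<oplus>\<^bsub>M\<^esub> y \<odot>\<^bsub>M\<^esub> ?c) \<ominus>\<^bsub>M\<^esub> y \<odot>\<^bsub>M\<^esub> ?c'"
          using s u[OF i] y by (simp add: smult_r_distr smult_comm[of s] smult_comm[of _ y] pow_smult ac_simps)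
        also have "\<dots> = x i [^] (n + L + N) \<odot>\<^bsub>M\<^esub> (s \<odot>\<^bsub>M\<^esub> u i) \<oplus>\<^bsub>M\<^esub> y \<odot>\<^bsub>M\<^esub> (?c \<ominus>\<^bsub>M\<^esub> ?c')"
          unfolding smult_r_diff[OF y cl] unfolding a_minus_def using cl s y u[OF i] by (intro M.a_assoc) auto
        finally show "x i [^] (e + 1) \<odot>\<^bsub>M\<^esub> (x i [^] N \<odot>\<^bsub>M\<^esub> z i)
          = x i [^] (n + L + N) \<odot>\<^bsub>M\<^esub> (s \<odot>\<^bsub>M\<^esub> u i) \<oplus>\<^bsub>M\<^esub> y \<odot>\<^bsub>M\<^esub> (?c \<ominus>\<^bsub>M\<^esub> ?c')" .
        show "?c \<ominus>\<^bsub>M\<^esub> ?c' \<in> carrier M" using cl by (rule M.minus_closed)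
      qed
      then have "s \<odot>\<^bsub>?T\<^esub> t \<in> Y"
        unfolding Y_def using T.smult_closed[OF s t] z
        by (intro CollectI conjI exI[of _ "n + L + N"] exI[of _ "\<lambda>i. x i [^] N \<odot>\<^bsub>M\<^esub> z i"]) (auto simp: t_def)
      then show "s \<in> colon R ?T Y t" using s by (simp add: colon_def)
    qed
    moreover have "\<one> \<in> Q" if "\<one> \<in> colon R ?T Y t"
    proof -
      have "t \<in> Y" using that T.smult_one[OF t] by (simp add: colon_def)
      then obtain k z where z: "cocycle1 R M r x k z"
          and "\<And>i. i < r \<Longrightarrow> \<exists>c\<in>carrier M. x i [^] (e + 1) \<odot>\<^bsub>M\<^esub> z i = x i [^] k \<odot>\<^bsub>M\<^esub> u i \<oplus>\<^bsub>M\<^esub> y \<odot>\<^bsub>M\<^esub> c"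
        by (auto simp: Y_def t_def)
      then obtain c where c: "\<And>i. i < r \<Longrightarrow> c i \<in> carrier M"
          "\<And>i. i < r \<Longrightarrow> x i [^] (e + 1) \<odot>\<^bsub>M\<^esub> z i = x i [^] k \<odot>\<^bsub>M\<^esub> u i \<oplus>\<^bsub>M\<^esub> y \<odot>\<^bsub>M\<^esub> c i" by metis
      have zc: "z i \<in> carrier M" for i using cocycle1_closed[OF z] by auto
      \<comment> \<open>Chosen so that, after multiplication by powers of \<open>x i\<close>,
        \<open>w\<close> is the cocycle \<open>z\<close> plus \<open>y q\<close>. As
        \<open>z\<close> contributes nothing on relations, \<open>y g\<close> equals
        \<open>y\<close> times the map of \<open>q\<close>, and cancelling the regular
        \<open>y\<close> exhibits \<open>q\<close> as an extension of \<open>g\<close>.\<close>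
      define q where "q i = (if i < r then x i [^] k \<odot>\<^bsub>M\<^esub> d i \<ominus>\<^bsub>M\<^esub> x i [^] (N + n) \<odot>\<^bsub>M\<^esub> c i else \<zero>\<^bsub>M\<^esub>)" for i
      have q: "q \<in> UNIV \<rightarrow> carrier M" using u(2) c(1) by (auto simp: q_def)
      \<comment> \<open>The stages of \<open>g\<close> and \<open>z\<close> are raised to the same
        one: \<open>n + ?L = k + ?K\<close>.\<close>
      let ?L = "k + (N + e + 1)" and ?K = "(N + n) + (e + 1)"
      have wz: "x i [^] ?L \<odot>\<^bsub>M\<^esub> w i = x i [^] ?K \<odot>\<^bsub>M\<^esub> z i \<oplus>\<^bsub>M\<^esub> y \<odot>\<^bsub>M\<^esub> q i" if i: "i < r" for i
      proof -
        let ?D = "y \<odot>\<^bsub>M\<^esub> (x i [^] k \<odot>\<^bsub>M\<^esub> d i)" and ?E = "y \<odot>\<^bsub>M\<^esub> (x i [^] (N + n) \<odot>\<^bsub>M\<^esub> c i)"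
          and ?U = "x i [^] (N + n) \<odot>\<^bsub>M\<^esub> (x i [^] k \<odot>\<^bsub>M\<^esub> u i)"
        have cl: "?D \<in> carrier M" "?E \<in> carrier M" "?U \<in> carrier M" using u[OF i] c(1)[OF i] y by auto
        have "x i [^] ?L \<odot>\<^bsub>M\<^esub> w i = x i [^] k \<odot>\<^bsub>M\<^esub> (x i [^] (N + e + 1) \<odot>\<^bsub>M\<^esub> w i)"
          by (rule pow_smult[OF x_closed wc, symmetric])
        also have "\<dots> = ?U \<oplus>\<^bsub>M\<^esub> ?D"
          unfolding ud[OF i] using u[OF i] y by (simp add: smult_r_distr smult_comm[of y] pow_smult add.commute)
        also have "\<dots> = (?U \<oplus>\<^bsub>M\<^esub> ?E) \<oplus>\<^bsub>M\<^esub> (?D \<ominus>\<^bsub>M\<^esub> ?E)"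
          using cl by (simp add: a_minus_def M.a_ac M.r_neg1 M.r_neg2)
        also have "?U \<oplus>\<^bsub>M\<^esub> ?E = x i [^] (N + n) \<odot>\<^bsub>M\<^esub> (x i [^] (e + 1) \<odot>\<^bsub>M\<^esub> z i)"
          unfolding c(2)[OF i] using u[OF i] c(1)[OF i] y by (simp add: smult_r_distr smult_comm[of y])
        also have "\<dots> = x i [^] ?K \<odot>\<^bsub>M\<^esub> z i" by (rule pow_smult[OF x_closed zc])
        also have "?D \<ominus>\<^bsub>M\<^esub> ?E = y \<odot>\<^bsub>M\<^esub> q i"
          using u[OF i] c(1)[OF i] y i by (simp add: q_def smult_r_diff)
        finally show ?thesis .
      qed
      have "g (shift R x ?L v) = comb M r v q" if v: "v \<in> rel (n + ?L)" for v
      proof -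
        have "n + ?L = k + ?K" by simp
        with v have v': "v \<in> rel (k + ?K)" by metis
        note vs = shift_rel[OF v] and vf = rel_fun[OF v]
        have zK: "(\<lambda>i. x i [^] ?K \<odot>\<^bsub>M\<^esub> z i) \<in> UNIV \<rightarrow> carrier M" "(\<lambda>i. y \<odot>\<^bsub>M\<^esub> q i) \<in> UNIV \<rightarrow> carrier M"
          using zc q y by auto
        have "y \<odot>\<^bsub>M\<^esub> g (shift R x ?L v) = comb M r v (\<lambda>i. x i [^] ?L \<odot>\<^bsub>M\<^esub> w i)"
          using w(2)[OF vs] comb_shift[OF vf w(1)] by metis
        also have "\<dots> = comb M r v (\<lambda>i. x i [^] ?K \<odot>\<^bsub>M\<^esub> z i \<oplus>\<^bsub>M\<^esub> y \<odot>\<^bsub>M\<^esub> q i)"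
          by (rule comb_cong[OF refl wz]) (use vf zc q y in \<open>auto simp: Pi_iff\<close>)
        also have "\<dots> = comb M r v (\<lambda>i. x i [^] ?K \<odot>\<^bsub>M\<^esub> z i) \<oplus>\<^bsub>M\<^esub> comb M r v (\<lambda>i. y \<odot>\<^bsub>M\<^esub> q i)"
          by (rule comb_add_right[OF vf zK])
        also have "comb M r v (\<lambda>i. x i [^] ?K \<odot>\<^bsub>M\<^esub> z i) = \<zero>\<^bsub>M\<^esub>"
          using cocycle1_raise[OF z, of ?K] v' unfolding cocycle1_def by blast
        also have "comb M r v (\<lambda>i. y \<odot>\<^bsub>M\<^esub> q i) = y \<odot>\<^bsub>M\<^esub> comb M r v q"
          by (rule comb_smult_right[OF y vf q])
        finally have "y \<odot>\<^bsub>M\<^esub> g (shift R x ?L v) = y \<odot>\<^bsub>M\<^esub> comb M r v q"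
          using comb_closed[OF vf q] y by simp
        then show ?thesis
          using smult_pow_cancel[OF reg y gc[OF vs] comb_closed[OF vf q], of 1] y by (simp only: R.nat_pow_eone)
      qed
      then have "null2 R M r x n g" unfolding null2_def using q by blast
      then show ?thesis
        using null2_cong[of n "\<lambda>v. \<one> \<odot>\<^bsub>M\<^esub> g v" g] gc by (simp add: Q annihilator2_def)
    qed
    ultimately show "\<exists>Q'\<in>colon R ?T Y ` carrier ?T. Q \<subseteq> Q' \<and> (\<one> \<in> Q' \<longrightarrow> \<one> \<in> Q)" using t by blast
  qed
qed

lemma annihilates2_global_regular:
  assumes R: "noetherian_ring R" and M: "noetherian_module R M" and y: "y \<in> carrier R"
    and reg: "\<And>m. m \<in> carrier M \<Longrightarrow> y \<odot>\<^bsub>M\<^esub> m = \<zero>\<^bsub>M\<^esub> \<Longrightarrow> m = \<zero>\<^bsub>M\<^esub>"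
    and loc: "\<And>i P. i \<in> {1, 2} \<Longrightarrow> primeideal P R \<Longrightarrow> \<exists>k::nat. locally_annihilates R M r x i (carrier R - P) (y [^] k)"
  shows "\<exists>k::nat. annihilates R M r x 2 (y [^] k)"
proof -
  have "\<exists>k::nat. annihilates R M r x 1 (y [^] k)" by (rule annihilates1_global[OF R M y]) (rule loc, auto)
  then obtain t :: nat where "annihilates R M r x 1 (y [^] t)" by blast
  from annihilates1_imp_torsion_bounded[OF M y reg this] obtain e :: nat
    where e: "\<And>j n m. j < r \<Longrightarrow> cocycle1 R M r x n m \<Longrightarrow> null1 R M r x n (\<lambda>i. x j [^] e \<odot>\<^bsub>M\<^esub> m i)" by blast
  let ?C = "{annihilator2 n g | n g. cocycle2 R M r x n g}"
  have local: "\<exists>k::nat. \<forall>Q\<in>?C. \<exists>s\<in>carrier R - P. s \<otimes> y [^] k \<in> Q" if P: "primeideal P R" for P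
  proof -
    obtain k :: nat where k: "locally_annihilates R M r x 2 (carrier R - P) (y [^] k)" using loc[OF _ P] by blast
    have "\<exists>s\<in>carrier R - P. s \<otimes> y [^] k \<in> annihilator2 n g" if g: "cocycle2 R M r x n g" for n g
    proof -
      obtain s where s: "s \<in> carrier R - P" "null2 R M r x n (\<lambda>v. s \<odot>\<^bsub>M\<^esub> (y [^] k \<odot>\<^bsub>M\<^esub> g v))"
        using k g by (auto simp: locally_annihilates_def)
      then show ?thesis using y annihilator2_mem[OF g] by (intro bexI[of _ s]) auto
    qed
    then show ?thesis by blast
  qed
  have "\<exists>k::nat. \<forall>Q\<in>?C. y [^] k \<in> Q"
  \<comment> \<open>\<open>y\<close> is put into \<open>A\<close> because detection in degree 2 is
    available only for classes killed by \<open>y\<close> as well.\<close>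
  proof (rule prime_detected_power[OF R.is_cring y, where A = "insert y (x ` {..<r})"])
    show ideals: "ideal Q R" if "Q \<in> ?C" for Q using that annihilator2_ideal by auto
    show "{s \<in> carrier R. s \<otimes> c \<in> Q} \<in> ?C" if "Q \<in> ?C" "c \<in> carrier R" for Q c
      using that annihilator2_colon cocycle2_smult by blast
    show "\<exists>n::nat. a [^] n \<in> Q" if Q: "Q \<in> ?C" and a: "a \<in> insert y (x ` {..<r})" for Q a
    proof (cases "a = y")
      case False
      then show ?thesis using Q a null2_koszul by (auto simp: annihilator2_def)
    next
      case True
      interpret Q: ideal Q R by (rule ideals[OF Q])
      \<comment> \<open>That some power of \<open>y\<close> kills the class is itself a local
        statement: the elements that kill some \<open>y ^ k\<close> multiple of it form an ideal,
        which by the local hypothesis lies in no prime.\<close>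
      let ?p = "\<lambda>s. \<exists>k::nat. s \<otimes> y [^] k \<in> Q"
      have J: "ideal {s \<in> carrier R. ?p s} R"
      proof (rule pred_ideal)
        show "?p \<zero>" using y Q.zero_closed by auto
        show "?p (s \<oplus> t)" if s: "s \<in> carrier R" "?p s" and t: "t \<in> carrier R" "?p t" for s t
        proof -
          obtain k l :: nat where kl: "s \<otimes> y [^] k \<in> Q" "t \<otimes> y [^] l \<in> Q" using s t by blast
          have "(s \<otimes> y [^] k) \<otimes> y [^] l \<oplus> (t \<otimes> y [^] l) \<otimes> y [^] k \<in> Q"
            by (rule Q.a_closed[OF Q.I_r_closed[OF kl(1)] Q.I_r_closed[OF kl(2)]]) (use y in auto)
          moreover have "(s \<otimes> y [^] k) \<otimes> y [^] l \<oplus> (t \<otimes> y [^] l) \<otimes> y [^] k = (s \<oplus> t) \<otimes> y [^] (k + l)"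
            using s t y by (simp add: R.l_distr R.m_assoc R.nat_pow_mult add.commute)
          ultimately show ?thesis by metis
        qed
        show "?p (c \<otimes> s)" if c: "c \<in> carrier R" and s: "s \<in> carrier R" "?p s" for c s
        proof -
          obtain k :: nat where "s \<otimes> y [^] k \<in> Q" using s by blast
          from Q.I_l_closed[OF this c] show ?thesis using c s y by (auto simp: R.m_assoc)
        qed
      qed
      have "\<one> \<in> {s \<in> carrier R. ?p s}"
        by (rule ideal_detected[OF R.is_cring R J]) (use local Q in blast)
      then show ?thesis using True y by auto
    qed
    show "prime_detected R {Q \<in> ?C. insert y (x ` {..<r}) \<subseteq> Q}" by (rule socle2_detected[OF R M y reg e])
  qed (use y local in auto)
  then obtain k :: nat where "\<forall>Q\<in>?C. y [^] k \<in> Q" by blast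
  then show ?thesis by (intro exI[of _ k]) (auto simp: annihilates_def annihilator2_def)
qed

section \<open>Change of the coefficient module\<close>

lemma lin_comb_map:
  assumes "module R N" "lin R M N f" "v \<in> UNIV \<rightarrow> carrier R" "w \<in> UNIV \<rightarrow> carrier M"
  shows "f (comb M r v w) = comb N r v (\<lambda>i. f (w i))"
  using lin_comb_image[OF module_axioms assms(1) carrier_is_submodule, of f v w r] assms by simp

lemma cocycle1_map:
  assumes N: "module R N" and f: "lin R M N f" and m: "cocycle1 R M r x n m"
  shows "cocycle1 R N r x n (\<lambda>i. f (m i))"
  using lin_comb_map[OF N f rel_fun cocycle1_closed[OF m], of _ n, symmetric] m lin_zero[OF module_axioms N f]
    lin_closed[OF f] by (auto simp: cocycle1_def)

lemma null1_map:
  assumes f: "lin R M N f" and m: "m \<in> UNIV \<rightarrow> carrier M" "null1 R M r x n m"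
  shows "null1 R N r x n (\<lambda>i. f (m i))"
proof -
  obtain k u where u: "u \<in> carrier M" "\<And>i. i < r \<Longrightarrow> x i [^] k \<odot>\<^bsub>M\<^esub> m i = x i [^] (k + n) \<odot>\<^bsub>M\<^esub> u"
    using m(2) by (auto simp: null1_def)
  have "x i [^] k \<odot>\<^bsub>N\<^esub> f (m i) = x i [^] (k + n) \<odot>\<^bsub>N\<^esub> f u" if i: "i < r" for i
    using arg_cong[OF u(2)[OF i], of f] lin_smult[OF f, of _ "m i"] lin_smult[OF f, of _ u] u(1) m(1) by (simp add: Pi_iff)
  then show ?thesis unfolding null1_def using lin_closed[OF f u(1)] by blast
qed

lemma cocycle2_map: "lin R M N f \<Longrightarrow> cocycle2 R M r x n g \<Longrightarrow> cocycle2 R N r x n (\<lambda>v. f (g v))"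
  unfolding cocycle2_def by (rule lin_comp)

lemma null2_map:
  assumes N: "module R N" and f: "lin R M N f" and g: "null2 R M r x n g"
  shows "null2 R N r x n (\<lambda>v. f (g v))"
proof -
  obtain k w where w: "w \<in> UNIV \<rightarrow> carrier M" "\<And>v. v \<in> rel (n + k) \<Longrightarrow> g (shift R x k v) = comb M r v w"
    using g by (auto simp: null2_def)
  have "f (g (shift R x k v)) = comb N r v (\<lambda>i. f (w i))" if v: "v \<in> rel (n + k)" for v
    unfolding w(2)[OF v] by (rule lin_comb_map[OF N f rel_fun[OF v] w(1)])
  moreover have "(\<lambda>i. f (w i)) \<in> UNIV \<rightarrow> carrier N" using w(1) lin_closed[OF f] by auto
  ultimately show ?thesis unfolding null2_def by blast
qed

lemma lin_homothety: "a \<in> carrier R \<Longrightarrow> lin R M M (\<lambda>m. a \<odot>\<^bsub>M\<^esub> m)"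
  by (rule linI) (auto simp: smult_r_distr smult_comm)

text \<open>The kernels of the powers of \<open>y\<close> form an ascending chain; once it is
  stationary at \<open>k\<close>, the submodule \<open>y ^ k M\<close> has no
  \<open>y\<close>-torsion.\<close>

lemma torsion_stabilizes:
  assumes M: "noetherian_module R M" and y: "y \<in> carrier R"
  obtains k :: nat where "\<And>m. m \<in> carrier M \<Longrightarrow> y \<odot>\<^bsub>M\<^esub> (y [^] k \<odot>\<^bsub>M\<^esub> m) = \<zero>\<^bsub>M\<^esub> \<Longrightarrow> y [^] k \<odot>\<^bsub>M\<^esub> m = \<zero>\<^bsub>M\<^esub>"
proof -
  let ?K = "\<lambda>k::nat. {m \<in> carrier M. y [^] k \<odot>\<^bsub>M\<^esub> m = \<zero>\<^bsub>M\<^esub>}"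
  have step: "y [^] Suc k \<odot>\<^bsub>M\<^esub> m = y \<odot>\<^bsub>M\<^esub> (y [^] k \<odot>\<^bsub>M\<^esub> m)" if "m \<in> carrier M" for k m
    using y that by (simp add: m_comm flip: smult_assoc1)
  have 1: "submodule (?K k) R M" for k by (rule submodule_ker[OF module_axioms lin_homothety]) (use y in auto)
  have 2: "?K k \<subseteq> ?K (Suc k)" for k using step y by auto
  obtain k where k: "\<forall>l\<ge>k. ?K l = ?K k" using noetherian_moduleD[where C = ?K, OF M 1 2] ..
  have eq: "?K (Suc k) = ?K k" by (rule k[rule_format]) simp
  show ?thesis
  proof (rule that)
    fix m assume m: "m \<in> carrier M" "y \<odot>\<^bsub>M\<^esub> (y [^] k \<odot>\<^bsub>M\<^esub> m) = \<zero>\<^bsub>M\<^esub>"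
    have "y [^] Suc k \<odot>\<^bsub>M\<^esub> m = \<zero>\<^bsub>M\<^esub>" unfolding step[OF m(1)] by (rule m(2))
    with m(1) have "m \<in> ?K (Suc k)" by (intro CollectI conjI)
    from subsetD[OF equalityD1[OF eq] this] show "y [^] k \<odot>\<^bsub>M\<^esub> m = \<zero>\<^bsub>M\<^esub>" by blast
  qed
qed

text \<open>Replacing \<open>M\<close> by \<open>y ^ k M\<close> makes \<open>y\<close> regular, and the maps \<open>M \<rightarrow> y ^ k M \<rightarrow> M\<close> both compose to
  multiplication by \<open>y ^ k\<close>, so the annihilators change by a power of \<open>y\<close> only.\<close>

lemma annihilates2_global:
  assumes R: "noetherian_ring R" and M: "noetherian_module R M" and y: "y \<in> carrier R"
    and loc: "\<And>i P. i \<in> {1, 2} \<Longrightarrow> primeideal P R \<Longrightarrow> \<exists>k::nat. locally_annihilates R M r x i (carrier R - P) (y [^] k)"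
  shows "\<exists>k::nat. annihilates R M r x 2 (y [^] k)"
proof -
  obtain k :: nat where k: "\<And>m. m \<in> carrier M \<Longrightarrow> y \<odot>\<^bsub>M\<^esub> (y [^] k \<odot>\<^bsub>M\<^esub> m) = \<zero>\<^bsub>M\<^esub> \<Longrightarrow> y [^] k \<odot>\<^bsub>M\<^esub> m = \<zero>\<^bsub>M\<^esub>"
    by (rule torsion_stabilizes[OF M y]) blast
  have yk: "y [^] k \<in> carrier R" using y by simp
  define p where "p m = y [^] k \<odot>\<^bsub>M\<^esub> m" for m
  define N where "N = M\<lparr>carrier := p ` carrier M\<rparr>"
  have pM: "lin R M M p" unfolding p_def by (rule lin_homothety[OF yk])
  have sub: "submodule (p ` carrier M) R M" by (rule submodule_image[OF module_axioms module_axioms pM])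
  have N: "module R N" unfolding N_def by (rule submodule.submodule_is_module[OF sub module_axioms])
  interpret N: power_system R N r x by (intro power_system.intro power_system_axioms.intro N x_closed)
  have Ns: "smult N = smult M" "\<zero>\<^bsub>N\<^esub> = \<zero>\<^bsub>M\<^esub>" "carrier N = p ` carrier M" by (simp_all add: N_def)
  have NM: "m \<in> carrier M" if "m \<in> carrier N" for m using that submoduleE(1)[OF sub] by (auto simp: Ns)
  have p: "lin R M N p" unfolding N_def by (rule lin_restrict_cod[OF pM]) auto
  have j: "lin R N M (\<lambda>m. m)" using NM by (intro linI) (auto simp: N_def)
  \<comment> \<open>A class of \<open>y ^ k M\<close> is regarded as one of \<open>M\<close>, killed
    locally by \<open>y ^ l\<close> there and sent back by \<open>p\<close>, so the exponent grows
    by \<open>k\<close>.\<close>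
  have pow: "p (s \<odot>\<^bsub>M\<^esub> (y [^] (l::nat) \<odot>\<^bsub>M\<^esub> m)) = s \<odot>\<^bsub>N\<^esub> (y [^] (l + k) \<odot>\<^bsub>N\<^esub> m)"
    if "s \<in> carrier R" "m \<in> carrier M" for s l m
    using that y by (simp add: p_def Ns smult_comm[of "y [^] k"] pow_smult add.commute)
  have loc1: "locally_annihilates R N r x 1 (carrier R - P) (y [^] (l + k))"
    if l: "locally_annihilates R M r x 1 (carrier R - P) (y [^] l)" for P and l :: nat
  proof -
    have "\<exists>s\<in>carrier R - P. null1 R N r x n (\<lambda>i. s \<odot>\<^bsub>N\<^esub> (y [^] (l + k) \<odot>\<^bsub>N\<^esub> m i))" if m: "cocycle1 R N r x n m" for n m
    proof -
      have mM: "cocycle1 R M r x n m" by (rule N.cocycle1_map[OF module_axioms j m])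
      have mc: "m i \<in> carrier M" for i using cocycle1_closed[OF mM] by auto
      obtain s where s: "s \<in> carrier R - P" "null1 R M r x n (\<lambda>i. s \<odot>\<^bsub>M\<^esub> (y [^] l \<odot>\<^bsub>M\<^esub> m i))"
        using l mM by (auto simp: locally_annihilates_def)
      have "null1 R N r x n (\<lambda>i. p (s \<odot>\<^bsub>M\<^esub> (y [^] l \<odot>\<^bsub>M\<^esub> m i)))"
        by (rule null1_map[OF p _ s(2)]) (use s(1) y mc in auto)
      then show ?thesis using s(1) pow mc by auto
    qed
    then show ?thesis by (simp add: locally_annihilates_def)
  qed
  have loc2: "locally_annihilates R N r x 2 (carrier R - P) (y [^] (l + k))"
    if l: "locally_annihilates R M r x 2 (carrier R - P) (y [^] l)" for P and l :: nat
  proof -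
    have "\<exists>s\<in>carrier R - P. null2 R N r x n (\<lambda>v. s \<odot>\<^bsub>N\<^esub> (y [^] (l + k) \<odot>\<^bsub>N\<^esub> g v))" if g: "cocycle2 R N r x n g" for n g
    proof -
      have gM: "cocycle2 R M r x n g" by (rule N.cocycle2_map[OF j g])
      obtain s where s: "s \<in> carrier R - P" "null2 R M r x n (\<lambda>v. s \<odot>\<^bsub>M\<^esub> (y [^] l \<odot>\<^bsub>M\<^esub> g v))"
        using l gM by (auto simp: locally_annihilates_def)
      have "null2 R N r x n (\<lambda>v. p (s \<odot>\<^bsub>M\<^esub> (y [^] l \<odot>\<^bsub>M\<^esub> g v)))" by (rule null2_map[OF N p s(2)])
      also have "null2 R N r x n (\<lambda>v. p (s \<odot>\<^bsub>M\<^esub> (y [^] l \<odot>\<^bsub>M\<^esub> g v))) \<longleftrightarrow>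
          null2 R N r x n (\<lambda>v. s \<odot>\<^bsub>N\<^esub> (y [^] (l + k) \<odot>\<^bsub>N\<^esub> g v))"
        by (rule N.null2_cong) (use s(1) pow cocycle2_closed[OF gM] in auto)
      finally show ?thesis using s(1) by blast
    qed
    then show ?thesis by (simp add: locally_annihilates_def)
  qed
  have "\<exists>l::nat. annihilates R N r x 2 (y [^] l)"
  proof (rule N.annihilates2_global_regular[OF R _ y])
    show "noetherian_module R N" by (rule noetherian_image[OF M N p]) (simp add: Ns)
    show "m = \<zero>\<^bsub>N\<^esub>" if "m \<in> carrier N" "y \<odot>\<^bsub>N\<^esub> m = \<zero>\<^bsub>N\<^esub>" for m
      using that k by (auto simp: Ns p_def)
    show "\<exists>k::nat. locally_annihilates R N r x i (carrier R - P) (y [^] k)"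
      if "i \<in> {1, 2}" "primeideal P R" for i P
      using loc[OF that] that(1) loc1 loc2 by blast
  qed
  then obtain l :: nat where l: "annihilates R N r x 2 (y [^] l)" by blast
  have "null2 R M r x n (\<lambda>v. y [^] (l + k) \<odot>\<^bsub>M\<^esub> g v)" if g: "cocycle2 R M r x n g" for n g
  proof -
    have "cocycle2 R N r x n (\<lambda>v. p (g v))" by (rule cocycle2_map[OF p g])
    then have "null2 R N r x n (\<lambda>v. y [^] l \<odot>\<^bsub>N\<^esub> p (g v))" using l by (simp add: annihilates_def)
    from N.null2_map[OF module_axioms j this]
    have "null2 R M r x n (\<lambda>v. y [^] l \<odot>\<^bsub>M\<^esub> p (g v))" by (simp add: Ns)
    also have "null2 R M r x n (\<lambda>v. y [^] l \<odot>\<^bsub>M\<^esub> p (g v)) \<longleftrightarrow> null2 R M r x n (\<lambda>v. y [^] (l + k) \<odot>\<^bsub>M\<^esub> g v)"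
      by (rule null2_cong) (use y cocycle2_closed[OF g] in \<open>simp add: p_def pow_smult\<close>)
    finally show ?thesis .
  qed
  then show ?thesis by (intro exI[of _ "l + k"]) (simp add: annihilates_def)
qed

theorem annihilates_global:
  assumes R: "noetherian_ring R" and M: "noetherian_module R M" and y: "y \<in> carrier R"
    and loc: "\<And>i P. i \<le> 2 \<Longrightarrow> primeideal P R \<Longrightarrow> \<exists>k::nat. locally_annihilates R M r x i (carrier R - P) (y [^] k)"
    and i: "i \<le> 2"
  shows "\<exists>k::nat. annihilates R M r x i (y [^] k)"
proof -
  consider "i = 0" | "i = 1" | "i = 2" using i by linarith
  then show ?thesis
  proof cases
    case 1 then show ?thesis using annihilates0_global[OF R M y] loc[of 0] by simp
  next
    case 2 then show ?thesis using annihilates1_global[OF R M y] loc[of 1] by simp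
  next
    case 3
    have "\<exists>k::nat. locally_annihilates R M r x l (carrier R - P) (y [^] k)"
      if "l \<in> {1, 2}" "primeideal P R" for l P by (rule loc) (use that in auto)
    then show ?thesis unfolding 3 by (rule annihilates2_global[OF R M y])
  qed
qed

end

section \<open>Finiteness dimensions\<close>

lemma Inf_enat_gt_2_iff: "Inf {enat i | i. A i} > 2 \<longleftrightarrow> (\<forall>i\<le>2. \<not> A i)"
proof
  assume gt: "Inf {enat i | i. A i} > 2"
  show "\<forall>i\<le>2. \<not> A i"
  proof (intro allI impI notI)
    fix i assume "i \<le> 2" "A i"
    then have "Inf {enat i | i. A i} \<le> enat i" by (intro Inf_lower) auto
    also have "\<dots> \<le> 2" using \<open>i \<le> 2\<close> by (simp add: numeral_eq_enat)
    finally show False using gt by simp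
  qed
next
  assume n: "\<forall>i\<le>2. \<not> A i"
  have "3 \<le> Inf {enat i | i. A i}"
  proof (rule Inf_greatest)
    fix e assume "e \<in> {enat i | i. A i}"
    then obtain i where i: "e = enat i" "A i" by auto
    then have "\<not> i \<le> 2" using n by blast
    then have "3 \<le> i" by simp
    then show "3 \<le> e" by (simp add: i numeral_eq_enat)
  qed
  moreover have "(2::enat) < 3" by simp
  ultimately show "Inf {enat i | i. A i} > 2" by (rule less_le_trans[rotated])
qed

lemma (in power_system) local_cohomology_module:
  assumes "ideal I R"
  shows "module R (local_cohomology R I i M)"
proof -
  interpret T: cyclic_tower R "\<lambda>n. residue_module R I (Suc n)" "\<lambda>n. ideal_power R I (Suc n) +> \<one>"
    "\<lambda>n. residue_proj R I (Suc n)" M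
    by (rule residue_tower[OF assms module_axioms])
  show ?thesis
    unfolding local_cohomology_def by (rule direct_system.limit_module[OF T.Ext_system])
qed

text \<open>The annihilator of a cohomology module is an ideal, so it contains a power of
  \<open>J\<close> as soon as it contains a power of each of the finitely many generators of
  \<open>J\<close>.\<close>

lemma (in power_system) finiteness_dimension_gt_2_iff:
  assumes I: "I = Idl (x ` {..<r})" and J: "J = Idl (z ` {..<q})" and z: "\<And>j::nat. z j \<in> carrier R"
  shows "finiteness_dimension R I J M > 2 \<longleftrightarrow> (\<forall>i\<le>2. \<forall>j<q. \<exists>k::nat. annihilates R M r x i (z j [^] k))"
proof -
  have xs: "x ` {..<r} \<subseteq> carrier R" and zs: "z ` {..<q} \<subseteq> carrier R" using z by auto
  have II: "ideal I R" unfolding I by (rule genideal_ideal[OF xs])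
  have JJ: "ideal J R" unfolding J by (rule genideal_ideal[OF zs])
  have "(\<exists>k\<ge>1. ideal_smult (ideal_power R J k) (local_cohomology R I i M) = {\<zero>\<^bsub>local_cohomology R I i M\<^esub>}) \<longleftrightarrow>
      (\<forall>j<q. \<exists>k::nat. annihilates R M r x i (z j [^] k))" if i: "i \<le> 2" for i
  proof -
    let ?H = "local_cohomology R I i M"
    interpret H: module R ?H by (rule local_cohomology_module[OF II])
    let ?A = "{a \<in> carrier R. \<forall>h\<in>carrier ?H. a \<odot>\<^bsub>?H\<^esub> h = \<zero>\<^bsub>?H\<^esub>}"
    have A: "ideal ?A R"
      by (rule pred_ideal) (auto simp: H.smult_l_distr H.smult_assoc1)
    have kills: "y \<in> ?A \<longleftrightarrow> annihilates R M r x i y" if "y \<in> carrier R" for y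
      using kills_local_cohomology[OF i that I] that by blast
    have zero_iff: "ideal_smult (ideal_power R J k) ?H = {\<zero>\<^bsub>?H\<^esub>} \<longleftrightarrow> ideal_power R J k \<subseteq> ?A" for k
    proof -
      interpret Jk: ideal "ideal_power R J k" R by (rule ideal_power_ideal[OF JJ])
      show ?thesis
        unfolding ideal_smult_zero_iff[OF H.module_axioms Jk.a_subset Jk.zero_closed] using Jk.Icarr by auto
    qed
    show ?thesis
    proof
      assume "\<exists>k\<ge>1. ideal_smult (ideal_power R J k) ?H = {\<zero>\<^bsub>?H\<^esub>}"
      then obtain k where "ideal_smult (ideal_power R J k) ?H = {\<zero>\<^bsub>?H\<^esub>}" by blast
      then have k: "ideal_power R J k \<subseteq> ?A" by (rule zero_iff[THEN iffD1])
      have "annihilates R M r x i (z j [^] k)" if "j < q" for j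
      proof -
        have "z j \<in> J" using genideal_self[OF zs] that unfolding J by blast
        then have "z j [^] k \<in> ?A" by (rule subsetD[OF k power_in_ideal_power[OF JJ]])
        then show ?thesis using z by (intro kills[THEN iffD1]) auto
      qed
      then show "\<forall>j<q. \<exists>k::nat. annihilates R M r x i (z j [^] k)" by blast
    next
      assume "\<forall>j<q. \<exists>k::nat. annihilates R M r x i (z j [^] k)"
      then obtain k :: "nat \<Rightarrow> nat" where k: "\<And>j. j < q \<Longrightarrow> z j [^] k j \<in> ?A"
        unfolding kills[OF R.nat_pow_closed[OF z]] by metis
      from ideal_power_subset[OF A z k] obtain K where K: "ideal_power R (Idl (?A \<union> z ` {..<q})) K \<subseteq> ?A" ..
      have "J \<subseteq> Idl (?A \<union> z ` {..<q})"
        unfolding J by (rule subset_Idl_subset) (use zs in auto)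
      \<comment> \<open>The finiteness dimension asks for a positive exponent, and \<open>K\<close>
        might be 0.\<close>
      have "ideal_power R J (Suc K) \<subseteq> ?A"
        by (rule subset_trans[OF ideal_power_antimono[OF JJ le_SucI[OF order_refl]]
              subset_trans[OF ideal_power_mono[OF \<open>J \<subseteq> _\<close>] K]])
      then have "ideal_smult (ideal_power R J (Suc K)) ?H = {\<zero>\<^bsub>?H\<^esub>}" by (rule zero_iff[THEN iffD2])
      then show "\<exists>k\<ge>1. ideal_smult (ideal_power R J k) ?H = {\<zero>\<^bsub>?H\<^esub>}"
        by (intro exI[of _ "Suc K"]) simp
    qed
  qed
  then show ?thesis
    unfolding finiteness_dimension_def Inf_enat_gt_2_iff by blast
qed

text \<open>The sequence is continued by zero so that all its members lie in the ring, as
  \<open>power_system\<close> demands.\<close>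

lemma (in cring) finite_enumeration:
  assumes "finite A" "A \<subseteq> carrier R"
  obtains n and z :: "nat \<Rightarrow> 'a" where "\<And>j. z j \<in> carrier R" "z ` {..<n} = A"
proof -
  obtain f where f: "bij_betw f {..<card A} A"
    using ex_bij_betw_nat_finite[OF assms(1)] by (auto simp: atLeast0LessThan)
  show ?thesis
    by (rule that[of "\<lambda>j. if j < card A then f j else \<zero>" "card A"]) (use f assms(2) in \<open>auto simp: bij_betw_def\<close>)
qed

lemma (in noetherian_ring) ideal_enumeration:
  assumes "ideal I R" "cring R"
  obtains n and z :: "nat \<Rightarrow> 'a" where "\<And>j. z j \<in> carrier R" "I = Idl (z ` {..<n})"
  using finetely_gen[OF assms(1)] cring.finite_enumeration[OF assms(2)] by metis

lemma (in module) localized_at_prime: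
  assumes "primeideal P R"
  shows "localized R M (carrier R - P)"
proof (intro localized.intro localized_axioms.intro module_axioms)
  interpret P: primeideal P R by fact
  show "\<one> \<in> carrier R - P" using P.one_imp_carrier P.I_notcarr by auto
  show "s \<otimes> t \<in> carrier R - P" if "s \<in> carrier R - P" "t \<in> carrier R - P" for s t
    using that P.I_prime by auto
qed auto

text \<open>\<open>ideal_at\<close> is generated by the images of all elements of an ideal, whereas
  the criterion for the finiteness dimension speaks of finitely many generators.\<close>

lemma (in localized) genideal_extension:
  assumes A: "A \<subseteq> carrier R"
  shows "Idl\<^bsub>RS\<^esub> ((\<lambda>a. frR a \<one>) ` (Idl A)) = Idl\<^bsub>RS\<^esub> ((\<lambda>a. frR a \<one>) ` A)"
proof
  let ?f = "\<lambda>a. frR a \<one>"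
  have fA: "?f ` A \<subseteq> carrier RS" using A frR_closed by auto
  interpret E: ideal "Idl\<^bsub>RS\<^esub> (?f ` A)" RS by (rule MS.R.genideal_ideal[OF fA])
  have "ideal {a \<in> carrier R. ?f a \<in> Idl\<^bsub>RS\<^esub> (?f ` A)} R"
  proof (rule pred_ideal)
    show "?f \<zero> \<in> Idl\<^bsub>RS\<^esub> (?f ` A)" using E.zero_closed by (simp add: frR_zero[of \<one>])
    show "?f (s \<oplus> t) \<in> Idl\<^bsub>RS\<^esub> (?f ` A)"
      if "s \<in> carrier R" "t \<in> carrier R" "?f s \<in> Idl\<^bsub>RS\<^esub> (?f ` A)" "?f t \<in> Idl\<^bsub>RS\<^esub> (?f ` A)" for s t
      using E.a_closed[OF that(3,4)] that(1,2) by (simp add: frR_add)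
    show "?f (c \<otimes> s) \<in> Idl\<^bsub>RS\<^esub> (?f ` A)"
      if "c \<in> carrier R" "s \<in> carrier R" "?f s \<in> Idl\<^bsub>RS\<^esub> (?f ` A)" for c s
      using E.I_l_closed[OF that(3) frR_closed[OF that(1) one_S]] that(1,2) by (simp add: frR_mult)
  qed
  then have "Idl A \<subseteq> {a \<in> carrier R. ?f a \<in> Idl\<^bsub>RS\<^esub> (?f ` A)}"
    by (rule genideal_minimal) (use A MS.R.genideal_self[OF fA] in auto)
  then show "Idl\<^bsub>RS\<^esub> (?f ` (Idl A)) \<subseteq> Idl\<^bsub>RS\<^esub> (?f ` A)"
    by (intro MS.R.genideal_minimal[OF E.ideal_axioms]) auto
  have "?f ` (Idl A) \<subseteq> carrier RS" using ideal.Icarr[OF genideal_ideal[OF A]] frR_closed by auto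
  then show "Idl\<^bsub>RS\<^esub> (?f ` A) \<subseteq> Idl\<^bsub>RS\<^esub> (?f ` (Idl A))"
    using genideal_self[OF A] by (intro MS.R.subset_Idl_subset) auto
qed

lemma (in localized_system) annihilates_imp_locally_annihilates:
  assumes "noetherian_ring R" "annihilates RS MS r x' i (frR y \<one>)" "y \<in> carrier R" "i \<le> 2"
  shows "locally_annihilates R M r x i S y"
proof -
  consider "i = 0" | "i = 1" | "i = 2" using assms(4) by linarith
  then show ?thesis
    using local_annihilates0[OF _ assms(3)] local_annihilates1[OF _ assms(3)]
      local_annihilates2[OF assms(1) _ assms(3)] assms(2) by cases (auto simp: locally_annihilates_def)
qed

section \<open>The local-global principle\<close>

theorem corollary2p25:
  fixes R :: "('a, 'r) ring_scheme" and M :: "('a, 'm, 's) module_scheme" and I J :: "'a set"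
  assumes "cring R" and "noetherian_ring R" and "\<one>\<^bsub>R\<^esub> \<noteq> \<zero>\<^bsub>R\<^esub>"
    and "ideal I R" and "ideal J R"
    and "Module.module R M" and "finitely_generated_module R M"
  shows "(\<forall>P. primeideal P R \<longrightarrow>
            finiteness_dimension (ring_at R P) (ideal_at R P I) (ideal_at R P J) (module_at R P M) > 2)
          \<longleftrightarrow> finiteness_dimension R I J M > 2"
proof -
  note noeth = \<open>noetherian_ring R\<close>
  obtain r x where x: "\<And>i::nat. x i \<in> carrier R" and I: "I = Idl\<^bsub>R\<^esub> (x ` {..<r})"
    using noetherian_ring.ideal_enumeration[OF noeth \<open>ideal I R\<close> \<open>cring R\<close>] by metis
  obtain q z where z: "\<And>j::nat. z j \<in> carrier R" and J: "J = Idl\<^bsub>R\<^esub> (z ` {..<q})"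
    using noetherian_ring.ideal_enumeration[OF noeth \<open>ideal J R\<close> \<open>cring R\<close>] by metis
  interpret M: power_system R M r x
    by (intro power_system.intro power_system_axioms.intro \<open>Module.module R M\<close> x)
  have noethM: "noetherian_module R M"
    by (rule noetherian_finitely_generated[OF \<open>cring R\<close> noeth \<open>Module.module R M\<close> \<open>finitely_generated_module R M\<close>])
  have zk: "z j [^]\<^bsub>R\<^esub> (k::nat) \<in> carrier R" for j k using z by simp
  \<comment> \<open>The images of the fixed generators of \<open>I\<close> and \<open>J\<close>
    generate the extended ideals at every prime, so the local conditions use the same
    \<open>r\<close>, \<open>q\<close>, \<open>x\<close> and \<open>z\<close> throughout.\<close>
  have local_iff: "finiteness_dimension (ring_at R P) (ideal_at R P I) (ideal_at R P J) (module_at R P M) > 2 \<longleftrightarrow>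
      (\<forall>i\<le>2. \<forall>j<q. \<exists>k::nat. annihilates (ring_at R P) (module_at R P M) r
        (\<lambda>i. fraction R (carrier R - P) (regular_module R) (x i) \<one>\<^bsub>R\<^esub>) i
        (fraction R (carrier R - P) (regular_module R) (z j [^]\<^bsub>R\<^esub> k) \<one>\<^bsub>R\<^esub>))"
    if P: "primeideal P R" for P
  proof -
    interpret L: localized R M "carrier R - P" by (rule M.localized_at_prime[OF P])
    interpret L: localized_system R M "carrier R - P" r x by unfold_locales
    have ext: "ideal_at R P (Idl\<^bsub>R\<^esub> (w ` {..<n})) = Idl\<^bsub>L.RS\<^esub> ((\<lambda>j. L.frR (w j) \<one>\<^bsub>R\<^esub>) ` {..<n})"
      if "\<And>j. w j \<in> carrier R" for w and n :: nat
      using L.genideal_extension[of "w ` {..<n}"] that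
      by (simp add: ideal_at_def ring_at_def image_image image_subset_iff)
    show ?thesis
      using L.loc.finiteness_dimension_gt_2_iff[OF refl refl, of "\<lambda>j. L.frR (z j) \<one>\<^bsub>R\<^esub>" q] L.frR_closed[OF z L.one_S]
      by (simp add: I J ext x z L.frR_pow) (simp add: ring_at_def module_at_def)
  qed
  have "(\<forall>P. primeideal P R \<longrightarrow> (\<forall>i\<le>2. \<forall>j<q. \<exists>k::nat. annihilates (ring_at R P) (module_at R P M) r
        (\<lambda>i. fraction R (carrier R - P) (regular_module R) (x i) \<one>\<^bsub>R\<^esub>) i
        (fraction R (carrier R - P) (regular_module R) (z j [^]\<^bsub>R\<^esub> k) \<one>\<^bsub>R\<^esub>)))
      \<longleftrightarrow> (\<forall>i\<le>2. \<forall>j<q. \<exists>k::nat. annihilates R M r x i (z j [^]\<^bsub>R\<^esub> k))"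
    (is "(\<forall>P. _ \<longrightarrow> ?local P) \<longleftrightarrow> ?global")
  proof
    assume loc: "\<forall>P. primeideal P R \<longrightarrow> ?local P"
    show ?global
    proof (intro allI impI)
      fix i j :: nat assume i: "i \<le> 2" and j: "j < q"
      show "\<exists>k::nat. annihilates R M r x i (z j [^]\<^bsub>R\<^esub> k)"
      \<comment> \<open>Each generator of \<open>J\<close> is treated separately, but in all degrees
        at once: the conclusion in degree 2 draws on the local hypothesis in degree 1.\<close>
      proof (rule M.annihilates_global[OF noeth noethM z _ i])
        fix l P assume l: "l \<le> (2::nat)" and P: "primeideal P R"
        interpret L: localized R M "carrier R - P" by (rule M.localized_at_prime[OF P])
        interpret L: localized_system R M "carrier R - P" r x by unfold_locales
        have "\<exists>k::nat. annihilates L.RS L.MS r L.x' l (L.frR (z j [^]\<^bsub>R\<^esub> k) \<one>\<^bsub>R\<^esub>)"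
          using loc[rule_format, OF P l j] by (simp only: ring_at_def module_at_def)
        then show "\<exists>k::nat. locally_annihilates R M r x l (carrier R - P) (z j [^]\<^bsub>R\<^esub> k)"
          using L.annihilates_imp_locally_annihilates[OF noeth _ zk l] by blast
      qed
    qed
  next
    assume glob: ?global
    show "\<forall>P. primeideal P R \<longrightarrow> ?local P"
    proof (intro allI impI)
      fix P i j assume P: "primeideal P R" and i: "i \<le> (2::nat)" and j: "j < q"
      interpret L: localized R M "carrier R - P" by (rule M.localized_at_prime[OF P])
      interpret L: localized_system R M "carrier R - P" r x by unfold_locales
      show "\<exists>k::nat. annihilates (ring_at R P) (module_at R P M) r
        (\<lambda>i. fraction R (carrier R - P) (regular_module R) (x i) \<one>\<^bsub>R\<^esub>) i
        (fraction R (carrier R - P) (regular_module R) (z j [^]\<^bsub>R\<^esub> k) \<one>\<^bsub>R\<^esub>)"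
        unfolding ring_at_def module_at_def
        using glob i j L.annihilates_localize[OF noeth _ zk i] by blast
    qed
  qed
  then show ?thesis
    unfolding M.finiteness_dimension_gt_2_iff[OF I J z] using local_iff by blast
qed

end
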